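(* Let $d\geq2$, let $D\subset\mathbb R^d$ be an open bounded domain, and let $v\in L^\infty(\mathbb R^d)$ with $\operatorname{supp}v\subset D$ and $v\in W^{n,1}(\mathbb R^d)$ for some integer $n>d$. Let $w$ be as in the context (with $\widehat w(p)\ge c_1(1+|p|)^{-\beta}$, $\beta=d+2\nu$), let $T_1,T_2\in\mathbb R^d$ with $y=T_2-T_1\neq0$, and set $w_j(x)=w(x-T_j)$, $j=1,2$. Assume $\operatorname{supp}w_j\subset\Omega_j$, where $\Omega_j$ are open bounded domains with $\Omega_j\cap D=\varnothing$, $j=1,2$. Fix $\tau\in(0,1]$ and put $$\alpha_2=\frac{n-d}{2\bigl(n+\beta+\frac{n-d}{2}\bigr)},\quad r_2(E)=2\tau E^{\frac{\alpha_2}{n-d}},\quad \varepsilon_2(E)=E^{-\frac{\alpha_2}{2}},$$ $$u(x,E)=\int_{\mathcal B_{r_2(E)}\setminus Z^{\varepsilon_2(E)}}e^{-ipx}U_{\widehat w_1,\widehat w_2}(p,E)\,dp+\int_{\mathcal B_{r_2(E)}\cap Z^{\varepsilon_2(E)}}e^{-ipx}U^{\varepsilon_2(E)}(p,E)\,dp,\quad x\in D.$$ Then $u(\cdot,E)=v+O(E^{-\alpha_2})$ in $L^\infty(D)$ as $E\to+\infty$; more precisely, there exist constants $\rho_2\ge1$ and $A_2>0$ (independent of $x$ and $E$) such that $$|u(x,E)-v(x)|\le A_2E^{-\alpha_2},\quad x\in D,\ E^{1/2}\ge\rho_2.$$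
   Context: Fourier transform: $\widehat u(p)=(2\pi)^{-d}\int_{\mathbb R^d}e^{ipx}u(x)\,dx$. $\mathcal B_r=\{p\in\mathbb R^d:|p|\le r\}$. $W^{n,1}(\mathbb R^d)=\{u\in L^1:\|u\|_{n,1}<\infty\}$, $\|u\|_{n,1}=\max_{|J|\le n}\|\partial^{|J|}u/\partial x^J\|_{L^1(\mathbb R^d)}$. Scattering amplitude: for a potential $V\in L^\infty(\mathbb R^d)$ with bounded support and $E>0$, the scattering solutions $\psi^+(x,k)$, $k^2=E$, of $-\Delta\psi+V\psi=E\psi$ are specified by $\psi^+(x,k)=e^{ikx}+c(d,|k|)\frac{e^{i|k||x|}}{|x|^{(d-1)/2}}F(k,|k|\frac{x}{|x|})+O(|x|^{-(d+1)/2})$ as $|x|\to\infty$, $c(d,|k|)=-\pi i(-2\pi i)^{(d-1)/2}|k|^{(d-3)/2}$; $F$ on $\mathcal M_E=\{(k,l):k^2=l^2=E\}$ is the scattering amplitude of $V$. Let $f,f_1,f_2$ be the scattering amplitudes of $v$, $v+w_1$, $v+w_2$. For $p\in\mathcal B_{2\sqrt E}$: $k_E(p)=\frac p2+(E-\frac{p^2}4)^{1/2}\gamma(p)$, $l_E(p)=-\frac p2+(E-\frac{p^2}4)^{1/2}\gamma(p)$, $\gamma$ a fixed piecewise continuous vector function with $|\gamma(p)|=1$, $\gamma(p)\cdot p=0$; $f(p,E)=f(k_E(p),l_E(p))$, $f_j(p,E)=f_j(k_E(p),l_E(p))$. $\zeta(p)=\Re\widehat w_1\Im\widehat w_2-\Im\widehat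 w_1\Re\widehat w_2$ (here $\zeta(p)=\sin(py)\widehat w(p)^2$); where $\zeta(p)\ne0$, $U_{\widehat w_1,\widehat w_2}=\Re U+i\Im U$ with $\begin{pmatrix}\Re U\\ \Im U\end{pmatrix}(p,E)=\frac{1}{2\zeta(p)}\begin{pmatrix}\Im\widehat w_2&-\Im\widehat w_1\\-\Re\widehat w_2&\Re\widehat w_1\end{pmatrix}(p)\begin{pmatrix}|f_1(p,E)|^2-|f(p,E)|^2-|\widehat w_1(p)|^2\\|f_2(p,E)|^2-|f(p,E)|^2-|\widehat w_2(p)|^2\end{pmatrix}$. For $0<\varepsilon<1$: $Z^\varepsilon=\{p\in\mathbb R^d:py\in(-\varepsilon,\varepsilon)+\pi\mathbb Z\}$; for $p\in Z^\varepsilon$, $z(p)$ is the unique integer with $|py-\pi z(p)|<\varepsilon$; $p_\perp=p-(py)\frac{y}{|y|^2}$, $p^\varepsilon_\pm=p_\perp+\pi z(p)\frac{y}{|y|^2}\pm\varepsilon\frac{y}{|y|^2}$, and $U^\varepsilon(p,E)=\frac12\bigl(U_{\widehat w_1,\widehat w_2}(p^\varepsilon_-,E)+U_{\widehat w_1,\widehat w_2}(p^\varepsilon_+,E)\bigr)$ for $p\in\mathcal B_{2\sqrt E}\cap Z^\varepsilon$. The function $w$: for $\nu>0$, $r>0$ and real-valued $q\in L^\infty(\mathbb R^d)$, $q\not\equiv0$, $q(x)=0$ for $|x|>r$, $q(x)=q(-x)$, $w(x)=|x|^\nu K_\nu(|x|)\int q(x-y')q(y')\,dy'$, $K_\nu$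 the modified Bessel function of the second kind; $w$ is continuous, real, supported in $|x|\le2r$, $\widehat w$ is real and $\widehat w(p)\ge c_1(1+|p|)^{-\beta}$, $\beta=d+2\nu$, $c_1>0$. *)

theory Defs
  imports "HOL-Analysis.Analysis"
begin

definition fourier :: "('a::euclidean_space \<Rightarrow> complex) \<Rightarrow> 'a \<Rightarrow> complex" where
  "fourier u p = complex_of_real ((2 * pi) powr (- real DIM('a))) *
     integral\<^sup>L lborel (\<lambda>x. exp (\<i> * complex_of_real (p \<bullet> x)) * u x)"

definition pdiff :: "'a::euclidean_space \<Rightarrow> ('a \<Rightarrow> 'b::real_normed_vector) \<Rightarrow> 'a \<Rightarrow> 'b" where
  "pdiff b f x = vector_derivative (\<lambda>t. f (x + t *\<^sub>R b)) (at 0)"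

fun pdiffs :: "'a::euclidean_space list \<Rightarrow> ('a \<Rightarrow> 'b::real_normed_vector) \<Rightarrow> 'a \<Rightarrow> 'b" where
  "pdiffs [] f = f"
| "pdiffs (b # bs) f = pdiff b (pdiffs bs f)"

definition Ck :: "nat \<Rightarrow> ('a::euclidean_space \<Rightarrow> real) \<Rightarrow> bool" where
  "Ck k \<phi> \<longleftrightarrow> (\<forall>bs. set bs \<subseteq> Basis \<and> length bs \<le> k \<longrightarrow>
      continuous_on UNIV (pdiffs bs \<phi>) \<and>
      (length bs < k \<longrightarrow> (\<forall>b\<in>Basis. \<forall>x. (\<lambda>t. pdiffs bs \<phi> (x + t *\<^sub>R b)) differentiable (at 0))))"

definition test_fun :: "('a::euclidean_space \<Rightarrow> real) \<Rightarrow> bool" where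
  "test_fun \<phi> \<longleftrightarrow> (\<forall>k. Ck k \<phi>) \<and> bounded {x. \<phi> x \<noteq> 0}"

definition Linf :: "('a::euclidean_space \<Rightarrow> complex) \<Rightarrow> bool" where
  "Linf u \<longleftrightarrow> u \<in> borel_measurable lborel \<and> (\<exists>C. AE x in lborel. norm (u x) \<le> C)"

text \<open>u in W^{n,1}: u and all weak derivatives of order at most n are in L^1.
  A multi-index J with |J| <= n is represented by a list of basis vectors of length |J|.\<close>
definition sobolev_W1 :: "nat \<Rightarrow> ('a::euclidean_space \<Rightarrow> complex) \<Rightarrow> bool" where
  "sobolev_W1 n u \<longleftrightarrow> integrable lborel u \<and>
     (\<forall>bs. set bs \<subseteq> Basis \<and> length bs \<le> n \<longrightarrow>
        (\<exists>g. integrable lborel g \<and>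
           (\<forall>\<phi>. test_fun \<phi> \<longrightarrow>
              integral\<^sup>L lborel (\<lambda>x. g x * complex_of_real (\<phi> x)) =
              (-1) ^ length bs * integral\<^sup>L lborel (\<lambda>x. u x * complex_of_real (pdiffs bs \<phi> x)))))"

definition laplacian :: "('a::euclidean_space \<Rightarrow> real) \<Rightarrow> 'a \<Rightarrow> real" where
  "laplacian \<phi> x = (\<Sum>b\<in>Basis. pdiffs [b, b] \<phi> x)"

definition weak_schroedinger_sol :: "('a::euclidean_space \<Rightarrow> complex) \<Rightarrow> real \<Rightarrow> ('a \<Rightarrow> complex) \<Rightarrow> bool" where
  "weak_schroedinger_sol V E \<psi> \<longleftrightarrow>
     (\<forall>\<phi>. test_fun \<phi> \<longrightarrow>
        integral\<^sup>L lborel (\<lambda>x. \<psi> x * (complex_of_real (- laplacian \<phi> x)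
                                   + (V x - complex_of_real E) * complex_of_real (\<phi> x))) = 0)"

definition c_const :: "nat \<Rightarrow> real \<Rightarrow> complex" where
  "c_const d \<kappa> = - complex_of_real pi * \<i> *
      (- 2 * complex_of_real pi * \<i>) powr complex_of_real ((real d - 1) / 2) *
      complex_of_real (\<kappa> powr ((real d - 3) / 2))"

definition is_scat_amp :: "('a::euclidean_space \<Rightarrow> complex) \<Rightarrow> real \<Rightarrow> ('a \<Rightarrow> 'a \<Rightarrow> complex) \<Rightarrow> bool" where
  "is_scat_amp V E F \<longleftrightarrow>
     (\<forall>k. k \<bullet> k = E \<longrightarrow>
        (\<exists>\<psi>. continuous_on UNIV \<psi> \<and> weak_schroedinger_sol V E \<psi> \<and>
           (\<exists>C R. \<forall>x. norm x \<ge> R \<longrightarrow>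
              norm (\<psi> x - (exp (\<i> * complex_of_real (k \<bullet> x))
                  + c_const DIM('a) (norm k) * exp (\<i> * complex_of_real (norm k * norm x))
                    / complex_of_real (norm x powr ((real DIM('a) - 1) / 2))
                    * F k ((norm k / norm x) *\<^sub>R x)))
              \<le> C * norm x powr (- (real DIM('a) + 1) / 2))))"

definition piecewise_cont :: "('a::euclidean_space \<Rightarrow> 'a) \<Rightarrow> bool" where
  "piecewise_cont g \<longleftrightarrow> (\<exists>\<S>. finite \<S> \<and> \<Union>\<S> = UNIV \<and>
      (\<forall>S\<in>\<S>. S \<in> sets borel \<and> continuous_on S g))"

definition kE :: "('a::euclidean_space \<Rightarrow> 'a) \<Rightarrow> real \<Rightarrow> 'a \<Rightarrow> 'a" where
  "kE \<gamma> E p = (1/2) *\<^sub>R p + sqrt (E - (p \<bullet> p) / 4) *\<^sub>R \<gamma> p"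

definition lE :: "('a::euclidean_space \<Rightarrow> 'a) \<Rightarrow> real \<Rightarrow> 'a \<Rightarrow> 'a" where
  "lE \<gamma> E p = - (1/2) *\<^sub>R p + sqrt (E - (p \<bullet> p) / 4) *\<^sub>R \<gamma> p"

definition amp_at :: "('a::euclidean_space \<Rightarrow> 'a \<Rightarrow> complex) \<Rightarrow> ('a \<Rightarrow> 'a) \<Rightarrow> real \<Rightarrow> 'a \<Rightarrow> complex" where
  "amp_at F \<gamma> E p = F (kE \<gamma> E p) (lE \<gamma> E p)"

text \<open>U_{W1,W2}(p,E); W1, W2 are the Fourier transforms of w1, w2; F, F1, F2 the amplitudes
  of v, v+w1, v+w2.\<close>
definition U_rec :: "('a::euclidean_space \<Rightarrow> complex) \<Rightarrow> ('a \<Rightarrow> complex) \<Rightarrow>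
    ('a \<Rightarrow> 'a \<Rightarrow> complex) \<Rightarrow> ('a \<Rightarrow> 'a \<Rightarrow> complex) \<Rightarrow> ('a \<Rightarrow> 'a \<Rightarrow> complex) \<Rightarrow>
    ('a \<Rightarrow> 'a) \<Rightarrow> real \<Rightarrow> 'a \<Rightarrow> complex" where
  "U_rec W1 W2 F F1 F2 \<gamma> E p =
    (let \<zeta> = Re (W1 p) * Im (W2 p) - Im (W1 p) * Re (W2 p);
         a = (cmod (amp_at F1 \<gamma> E p))\<^sup>2 - (cmod (amp_at F \<gamma> E p))\<^sup>2 - (cmod (W1 p))\<^sup>2;
         b = (cmod (amp_at F2 \<gamma> E p))\<^sup>2 - (cmod (amp_at F \<gamma> E p))\<^sup>2 - (cmod (W2 p))\<^sup>2
     in Complex ((Im (W2 p) * a - Im (W1 p) * b) / (2 * \<zeta>))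
                ((- Re (W2 p) * a + Re (W1 p) * b) / (2 * \<zeta>)))"

definition Zset :: "'a::euclidean_space \<Rightarrow> real \<Rightarrow> 'a set" where
  "Zset y \<epsilon> = {p. \<exists>z::int. \<bar>p \<bullet> y - pi * of_int z\<bar> < \<epsilon>}"

definition zint :: "'a::euclidean_space \<Rightarrow> real \<Rightarrow> 'a \<Rightarrow> int" where
  "zint y \<epsilon> p = (THE z::int. \<bar>p \<bullet> y - pi * of_int z\<bar> < \<epsilon>)"

definition pperp :: "'a::euclidean_space \<Rightarrow> 'a \<Rightarrow> 'a" where
  "pperp y p = p - ((p \<bullet> y) / (y \<bullet> y)) *\<^sub>R y"

definition pplus :: "'a::euclidean_space \<Rightarrow> real \<Rightarrow> 'a \<Rightarrow> 'a" where
  "pplus y \<epsilon> p = pperp y p + ((pi * of_int (zint y \<epsilon> p) + \<epsilon>) / (y \<bullet> y)) *\<^sub>R y"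

definition pminus :: "'a::euclidean_space \<Rightarrow> real \<Rightarrow> 'a \<Rightarrow> 'a" where
  "pminus y \<epsilon> p = pperp y p + ((pi * of_int (zint y \<epsilon> p) - \<epsilon>) / (y \<bullet> y)) *\<^sub>R y"

definition u_rec :: "('a::euclidean_space \<Rightarrow> complex) \<Rightarrow> ('a \<Rightarrow> complex) \<Rightarrow>
    ('a \<Rightarrow> 'a \<Rightarrow> complex) \<Rightarrow> ('a \<Rightarrow> 'a \<Rightarrow> complex) \<Rightarrow> ('a \<Rightarrow> 'a \<Rightarrow> complex) \<Rightarrow>
    ('a \<Rightarrow> 'a) \<Rightarrow> 'a \<Rightarrow> real \<Rightarrow> real \<Rightarrow> real \<Rightarrow> 'a \<Rightarrow> complex" where
  "u_rec W1 W2 F F1 F2 \<gamma> y r \<epsilon> E x =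
     set_lebesgue_integral lborel (cball 0 r - Zset y \<epsilon>)
       (\<lambda>p. exp (- \<i> * complex_of_real (p \<bullet> x)) * U_rec W1 W2 F F1 F2 \<gamma> E p)
   + set_lebesgue_integral lborel (cball 0 r \<inter> Zset y \<epsilon>)
       (\<lambda>p. exp (- \<i> * complex_of_real (p \<bullet> x)) *
          ((U_rec W1 W2 F F1 F2 \<gamma> E (pminus y \<epsilon> p) + U_rec W1 W2 F F1 F2 \<gamma> E (pplus y \<epsilon> p)) / 2))"

definition besselK :: "real \<Rightarrow> real \<Rightarrow> real" where
  "besselK \<nu> z = set_lebesgue_integral lborel {0..} (\<lambda>t. exp (- z * cosh t) * cosh (\<nu> * t))"

text \<open>w(x) = |x|^nu K_nu(|x|) (q*q)(x), extended continuously at x = 0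
  (|x|^nu K_nu(|x|) -> 2^(nu-1) Gamma(nu)).\<close>
definition w_fun :: "real \<Rightarrow> ('a::euclidean_space \<Rightarrow> real) \<Rightarrow> 'a \<Rightarrow> real" where
  "w_fun \<nu> q x = (if x = 0 then 2 powr (\<nu> - 1) * Gamma \<nu> else norm x powr \<nu> * besselK \<nu> (norm x))
       * integral\<^sup>L lborel (\<lambda>y'. q (x - y') * q y')"

end

theory Submission
 imports Defs "HOL-Probability.Probability" "HOL-Complex_Analysis.Complex_Analysis" "HOL-Real_Asymp.Real_Asymp"
begin

text \<open>Write \<open>E = \<kappa>\<^sup>2\<close>. Test the Schroedinger equation of a scattering solution \<open>\<psi>\<close> with incident wave \<open>p\<close> against Gaussians
 \<open>g\<^sub>s(x - c)\<close>, which solve the heat equation in the complex time \<open>s\<close>, and let \<open>s = a + it\<close> with \<open>0 \<le> t \<le> T\<close>. As \<open>T \<rightarrow> \<infinity>\<close>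
 the outgoing wave disperses, which leaves \<open>\<psi> * g\<^sub>a = e\<^bsup>-aE\<^esup> p - i (V\<psi>) * G\<close> with \<open>G = \<integral>\<^sub>0\<^sup>T e\<^bsup>itE\<^esup> g\<^bsub>a+it\<^esub> dt\<close>.
 The Fourier transform of \<open>e\<^bsup>-|z|\<^sup>2/4\<^esup> G(z)\<close> is \<open>O(1/\<kappa>)\<close> uniformly in \<open>a\<close> and \<open>T\<close>, and the weight is undone by a superposition
 of plane waves, so \<open>G\<close> acts on \<open>L\<^sup>2\<close> of a fixed ball with norm \<open>O(1/\<kappa>)\<close>. Together with the far field of \<open>G\<close>, found
 by steepest descent, this gives, with \<open>FV\<close> for the transform of \<open>V\<close>, \<open>F(k, l) = FV(k - l) + O(1/\<kappa>)\<close>.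

 Hence \<open>|f\<^sub>j|\<^sup>2 - |f|\<^sup>2 - |Fw\<^sub>j|\<^sup>2\<close> is \<open>2 Re\<close> of \<open>Fw\<^sub>j\<close> times the conjugate of \<open>Fv\<close>, up to \<open>O(1/\<kappa>)\<close>, and solving the two
 real equations costs a factor \<open>r\<^sup>\<beta>/\<epsilon>\<close> off the strips. In a strip, the average of the boundary values is off
 by \<open>O(\<epsilon> (1 + |p|)\<^bsup>-n\<^esup>)\<close>, and the strips have relative measure \<open>O(\<epsilon>)\<close>. The tail \<open>|p| > r\<close> contributes \<open>O(r\<^bsup>d-n\<^esup>)\<close>.
 The exponents balance these three errors.\<close>

text \<open>\<open>is_scat_amp\<close> supplies only a continuous weak solution with a prescribed
  asymptotic form, so no resolvent operator is at hand; kernels in complex time stand in for it.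
  \<open>Re s = a > 0\<close> makes every integral absolutely convergent, and the order of limits is
  fixed: T tends to infinity at fixed a, and a tends to 0 afterwards. The Gaussian weight is there
  because the plain multiplier, the integral of exp(it(E - |p|^2)) over [0, T], grows like T on the
  sphere |p|^2 = E. The weight smears this singularity over a frequency window of width one, across
  which |p|^2 - E varies by about \<kappa>; hence the size 1/\<kappa>. In formulas, it turns the
  kernel at time s into a multiple of the kernel at time s/(1+s), with extra decay in t. Removing it
  costs the constant exp(rh^2), since all sources lie in a ball of radius rh. Off the energy shell
  the amplitude is arbitrary, and its measurability on the shell has to be earned: it follows from a
  Lipschitz bound in both momenta. The integrals that define u are then estimated through Borel
  modifications of their integrands.\<close>

abbreviation "mbl == borel_measurable borel"

lemmas integral_cong = Bochner_Integration.integral_cong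
 and integrable_bound = Bochner_Integration.integrable_bound
 and integrable_add = Bochner_Integration.integrable_add
 and integral_add = Bochner_Integration.integral_add
 and integral_diff = Bochner_Integration.integral_diff
 and integral_cnj = Bochner_Integration.integral_cnj
 and integrable_sum = Bochner_Integration.integrable_sum

text \<open>Cauchy's inequality on balls of half the radius turns the majorant of the integrand into
  the Lipschitz bound 2g/e for its difference quotients, so dominated convergence applies although
  nothing is assumed about derivatives.\<close>

lemma holomorphic_on_integral_parameter:
 fixes f :: "complex => 'x => complex"
 assumes holo: "\<And>x. x \<in> space M ==> (%z. f z x) holomorphic_on U"
  and meas: "\<And>z. z \<in> U ==> f z \<in> borel_measurable M"
  and bound: "\<And>z0. z0 \<in> U ==> \<exists>e>0. \<exists>g. integrable M g \<and> cball z0 e \<subseteq> U \<and>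
          (\<forall>z\<in>cball z0 e. \<forall>x\<in>space M. norm (f z x) <= g x)"
 shows "(%z. \<integral>x. f z x \<partial>M) holomorphic_on U"
proof -
 let ?A = "%x. %z. f z x"
 let ?B = "%z0 M. \<integral>x. deriv (?A x) z0 \<partial>M"
 let ?C = "%M z0 X. (%y. ((\<integral>x. f y x \<partial>M) - (\<integral>x. f z0 x \<partial>M)) / (y - z0)) \<circ> X"
 let ?D = "%Y z0 M. %n. \<integral>x. (f (Y n) x - f z0 x) / (Y n - z0) \<partial>M"
 have "(%z. \<integral>x. f z x \<partial>M) field_differentiable (at z0)" if z0: "z0 \<in> U" for z0
 proof -
  obtain e g where e: "e > 0" and g: "integrable M g" and sub: "cball z0 e \<subseteq> U"
   and bd: "\<And>z x. z \<in> cball z0 e ==> x \<in> space M ==> norm (f z x) <= g x"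
   using bound[OF z0] by metis
  have int: "integrable M (f z)" if "z \<in> cball z0 e" for z
   by (rule integrable_bound[OF g])
     (use that sub bd meas in \<open>auto intro!: AE_I2 order_trans[OF _ abs_ge_self] simp del: mem_cball\<close>)
  have dbd: "norm (f z x - f z0 x) <= (2 * g x / e) * norm (z - z0)"
   if z: "z \<in> cball z0 (e/2)" and x: "x \<in> space M" for z x
  proof (rule field_differentiable_bound[of "cball z0 (e/2)" "%z. f z x" "deriv (?A x)"])
   fix w assume w: "w \<in> cball z0 (e/2)"
   have sub2: "cball w (e/2) \<subseteq> cball z0 e"
    using w by (auto simp: subset_iff dist_norm) (smt (verit) norm_minus_commute norm_triangle_ineq4 norm_diff_triangle_less field_sum_of_halves dist_norm dist_triangle)
   have h: "?A x holomorphic_on cball w (e/2)"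
    using holo[OF x] sub sub2 by (meson holomorphic_on_subset subset_trans)
   have "norm ((deriv ^^ 1) (?A x) w) <= fact 1 * g x / (e/2)^1"
   proof (rule Cauchy_inequality)
    show "?A x holomorphic_on ball w (e/2)" using h holomorphic_on_subset ball_subset_cball by blast
    show "continuous_on (cball w (e/2)) (?A x)" using h by (rule holomorphic_on_imp_continuous_on)
    fix y assume "cmod (w - y) = e/2"
    hence "y \<in> cball w (e/2)" by (simp add: dist_norm)
    thus "cmod (f y x) <= g x" using bd sub2 x by blast
   qed (use e in auto)
   thus "norm (deriv (?A x) w) <= 2 * g x / e" by (simp add: field_simps)
   have "w \<in> ball z0 e" using w e by auto
   moreover have "?A x holomorphic_on ball z0 e"
    using holo[OF x] sub by (meson ball_subset_cball holomorphic_on_subset)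
   ultimately have "(?A x has_field_derivative deriv (?A x) w) (at w)"
    by (meson holomorphic_derivI open_ball)
   thus "(?A x has_field_derivative deriv (?A x) w) (at w within cball z0 (e/2))"
    by (rule has_field_derivative_at_within)
  qed (use z e in auto)
  have "((%z. \<integral>x. f z x \<partial>M) has_field_derivative (?B z0 M)) (at z0)"
   unfolding has_field_derivative_iff tendsto_at_iff_sequentially
  proof (intro allI impI)
   fix X :: "nat => complex" assume X: "\<forall>i. X i \<in> UNIV - {z0}" and lim: "X \<longlonglongrightarrow> z0"
   have "\<forall>\<^sub>F n in sequentially. X n \<in> ball z0 (e/2)"
    using lim e by (metis eventually_at_topological half_gt_zero topological_tendstoD open_ball centre_in_ball)
   then obtain N where N: "\<And>n. n >= N ==> X n \<in> ball z0 (e/2)" by (auto simp: eventually_sequentially)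
   \<comment> \<open>Dropping the first N terms puts every point of the sequence into the half ball,
     so that the majorant holds for all indices.\<close>
   define Y where "Y n = X (n + N)" for n
   have Y: "Y n \<in> cball z0 (e/2)" "Y n \<in> cball z0 e" "Y n \<noteq> z0" for n
    using N[of "n+N"] X e by (auto simp: Y_def)
   have Ylim: "Y \<longlonglongrightarrow> z0" unfolding Y_def using lim by (rule LIMSEQ_ignore_initial_segment)
   have z0e: "z0 \<in> cball z0 e" using e by simp
   have conv: "(%n. (f (Y n) x - f z0 x) / (Y n - z0)) \<longlonglongrightarrow> deriv (?A x) z0" if x: "x \<in> space M" for x
   proof -
    have "?A x holomorphic_on ball z0 e"
     using holo[OF x] sub by (meson ball_subset_cball holomorphic_on_subset)
    hence "(?A x has_field_derivative deriv (?A x) z0) (at z0)"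
     using e by (meson holomorphic_derivI open_ball centre_in_ball)
    hence "((%z. (f z x - f z0 x) / (z - z0)) \<longlongrightarrow> deriv (?A x) z0) (at z0)"
     by (simp add: has_field_derivative_iff)
    from this[unfolded tendsto_at_iff_sequentially, rule_format, of Y] Y(3) Ylim
    show ?thesis by (simp add: o_def)
   qed
   have mY: "(%x. (f (Y n) x - f z0 x) / (Y n - z0)) \<in> borel_measurable M" for n
    using meas[of "Y n"] meas[OF z0] Y(2)[of n] sub by auto
   have "?D Y z0 M \<longlonglongrightarrow> (?B z0 M)"
   proof (rule integral_dominated_convergence[where w="%x. 2 * g x / e"])
    show "(%x. deriv (?A x) z0) \<in> borel_measurable M"
     by (rule borel_measurable_LIMSEQ_metric[where f="%n x. (f (Y n) x - f z0 x) / (Y n - z0)"]) (use conv mY in auto)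
    show "AE x in M. cmod ((f (Y n) x - f z0 x) / (Y n - z0)) <= 2 * g x / e" for n
    proof (rule AE_I2)
     fix x assume "x \<in> space M"
     from dbd[OF Y(1) this, of n] have "cmod (f (Y n) x - f z0 x) / cmod (Y n - z0) <= 2 * g x / e"
      using Y(3)[of n] by (simp only: pos_divide_le_eq zero_less_norm_iff right_minus_eq not_False_eq_True)
     thus "cmod ((f (Y n) x - f z0 x) / (Y n - z0)) <= 2 * g x / e" by (simp only: norm_divide)
    qed
   qed (use mY conv g in auto)
   also have "?D Y z0 M
     = (%n. ((\<integral>x. f (Y n) x \<partial>M) - (\<integral>x. f z0 x \<partial>M)) / (Y n - z0))"
    using int[OF Y(2)] int[OF z0e] by (auto simp: integral_diff)
   finally have "(%n. (?C M z0 X) (n + N))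
     \<longlonglongrightarrow> (?B z0 M)"
    by (simp add: Y_def o_def)
   thus "?C M z0 X
     \<longlonglongrightarrow> (?B z0 M)"
    by (rule LIMSEQ_offset)
  qed
  thus ?thesis unfolding field_differentiable_def by blast
 qed
 thus ?thesis unfolding holomorphic_on_def using field_differentiable_at_within by blast
qed

text \<open>\<open>lborel\<close> is the image of the product of one-dimensional Lebesgue measures
  under the coordinate map, so this is Fubini for functions of product form.\<close>

lemma integral_prod_Basis:
 fixes f :: "'a::euclidean_space => real => 'b::{real_normed_field,banach,second_countable_topology}"
 assumes "\<And>b. b \<in> Basis ==> integrable lborel (f b)"
 shows "integrable lborel (%x::'a. \<Prod>b\<in>Basis. f b (x \<bullet> b))"
  and "integral\<^sup>L lborel (%x::'a. \<Prod>b\<in>Basis. f b (x \<bullet> b)) = (\<Prod>b\<in>Basis. integral\<^sup>L lborel (f b))"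
proof -
 interpret product_sigma_finite "%_::'a. lborel :: real measure" ..
 have m: "(%f. \<Sum>b\<in>Basis. f b *\<^sub>R b) \<in> measurable (\<Pi>\<^sub>M b\<in>Basis. lborel) (borel :: 'a measure)"
  by measurable
 have fm: "f b \<in> mbl" if "b \<in> Basis" for b
  using assms[OF that] by (auto dest: borel_measurable_integrable)
 have pm: "(%x::'a. \<Prod>b\<in>Basis. f b (x \<bullet> b)) \<in> mbl"
  by (intro borel_measurable_prod measurable_compose[OF _ fm]) auto
 have eq: "(\<Prod>b\<in>Basis. f b ((\<Sum>b\<in>Basis. w b *\<^sub>R b) \<bullet> b)) = (\<Prod>b\<in>Basis. f b (w b))" for w :: "'a => real"
  by (intro prod.cong refl) (simp add: inner_sum_left_Basis)
 show "integrable lborel (%x::'a. \<Prod>b\<in>Basis. f b (x \<bullet> b))"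
  unfolding lborel_eq[where 'a='a] integrable_distr_eq[OF m pm] eq
  by (rule product_integrable_prod) (use assms in auto)
 show "integral\<^sup>L lborel (%x::'a. \<Prod>b\<in>Basis. f b (x \<bullet> b)) = (\<Prod>b\<in>Basis. integral\<^sup>L lborel (f b))"
  unfolding lborel_eq[where 'a='a] integral_distr[OF m pm] eq
  by (rule product_integral_prod) (use assms in auto)
qed

section \<open>Complex Gaussian kernels\<close>

text \<open>The principal root of a point in the right half plane satisfies
  \<open>Re > |Im|\<close>, so a product of two such roots stays in the right half plane and is
  again principal. The branch matters because the dimension may be odd.\<close>

lemma csqrt_mult_Re_pos:
 assumes "Re z > 0" "Re w > 0"
 shows "csqrt (z * w) = csqrt z * csqrt w"
proof (rule csqrt_unique)
 show "(csqrt z * csqrt w)^2 = z * w" by (simp add: power_mult_distrib)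
 have z: "Re (csqrt z) > \<bar>Im (csqrt z)\<bar>" if "Re z > 0" for z
 proof -
  have "(csqrt z)^2 = z" by simp
  hence "(Re (csqrt z))^2 - (Im (csqrt z))^2 = Re z" by (metis Re_power2)
  hence "(Im (csqrt z))^2 < (Re (csqrt z))^2" using that by linarith
  hence "\<bar>Im (csqrt z)\<bar> < \<bar>Re (csqrt z)\<bar>" by (meson abs_le_square_iff linorder_not_less)
  thus ?thesis using csqrt_principal[of z] by linarith
 qed
 have "\<bar>Im (csqrt z)\<bar> * \<bar>Im (csqrt w)\<bar> < Re (csqrt z) * Re (csqrt w)"
  using z[OF assms(1)] z[OF assms(2)] by (intro mult_strict_mono; linarith)
 hence "Im (csqrt z) * Im (csqrt w) < Re (csqrt z) * Re (csqrt w)"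
  by (metis abs_ge_self abs_mult order_le_less_trans)
 thus "0 < Re (csqrt z * csqrt w) \<or> Re (csqrt z * csqrt w) = 0 \<and> 0 <= Im (csqrt z * csqrt w)"
  by (simp del: csqrt.sel)
qed

lemma Re_inverse_pos: "Re s > 0 ==> Re (inverse s) > 0"
 by (auto simp: complex_neq_0 add_pos_nonneg intro!: divide_pos_pos)

lemma integrable_gaussian_real:
 fixes c :: real
 assumes "c > 0"
 shows "integrable lborel (%t::real. \<bar>t\<bar>^k * exp (- c * t^2))"
proof -
 define sg where "sg = sqrt (1 / (2 * c))"
 have sg: "sg > 0" "sg^2 = 1 / (2 * c)" using assms by (auto simp: sg_def)
 let ?A = "%x. sqrt (2 * pi * sg^2) * (normal_density 0 sg x * \<bar>x - 0\<bar>^k)"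
 have "integrable lborel ?A"
  using sg by (intro integrable_mult_right integrable_normal_moment_abs)
 also have "?A = (%t::real. \<bar>t\<bar>^k * exp (- c * t^2))"
  using assms sg(1) by (auto simp: normal_density_def sg(2) field_simps fun_eq_iff)
 finally show ?thesis .
qed

text \<open>The characteristic function of the standard normal law, rescaled:
  \<open>c = sqrt (2 * s)\<close> turns t^2/(4s) into x^2/2.\<close>

lemma gaussian_fourier_real:
 fixes s p :: real
 assumes "s > 0"
 shows "(LBINT t. exp (- of_real (t^2) / (4 * of_real s)) * iexp (p * t))
  = of_real (sqrt (4 * pi * s)) * exp (- of_real (s * p^2) :: complex)"
proof -
 define c where "c = sqrt (2 * s)"
 have c: "c > 0" "c^2 = 2 * s" using assms by (auto simp: c_def)
 let ?G = "4 * of_real s"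
 let ?A = "%x. - of_real ((0 + c * x)^2) / ?G"
 let ?B = "LBINT t. exp (- of_real (t^2) / ?G) * iexp (p * t)"
 let ?C = "LBINT x. exp (?A x) * iexp (p * (0 + c * x))"
 let ?D = "1 / sqrt (2 * pi)"
 let ?F = "exp (- (p * c)\<^sup>2 / 2)"
 have "of_real ?F = char std_normal_distribution (p * c)"
  by (simp add: char_std_normal_distribution)
 also have "... = (LBINT x. std_normal_density x *\<^sub>R iexp (p * c * x))"
  unfolding char_def by (subst integral_density) auto
 also have "... = (LBINT x. of_real ?D * (exp (?A x) * iexp (p * (0 + c * x))))"
 proof (rule integral_cong[OF refl])
  fix x :: real
  have "c^2 * x^2 / (4 * s) = x^2 / 2" using assms by (simp add: c)
  hence e: "- complex_of_real ((0 + c * x)^2) / ?G = of_real (- x\<^sup>2 / 2)"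
   by (subst (asm) of_real_eq_iff[symmetric, where 'a=complex]) (simp add: power_mult_distrib)
  show "std_normal_density x *\<^sub>R iexp (p * c * x) = of_real ?D * (exp (?A x) * iexp (p * (0 + c * x)))"
   unfolding e exp_of_real by (simp add: std_normal_density_def scaleR_conv_of_real mult_ac)
 qed
 also have "... = of_real ?D * ?C"
  by simp
 also have "?C =
   of_real (1/c) * ?B"
  using c by (subst lborel_integral_real_affine[where c=c and t=0 and f="%t. exp (- of_real (t^2) / ?G) * iexp (p * t)"])
   (auto simp: scaleR_conv_of_real)
 finally have "?B
   = of_real (sqrt (2 * pi) * c) * of_real ?F"
  using c by (simp add: field_simps)
 also have "sqrt (2 * pi) * c = sqrt (4 * pi * s)" by (simp add: c_def real_sqrt_mult[symmetric] mult_ac)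
 also have "- (p * c)\<^sup>2 / 2 = - (s * p^2)" by (simp add: power_mult_distrib c)
 finally show ?thesis by (simp flip: exp_of_real)
qed

lemma Re_gaussian_exponent:
 fixes s :: complex
 shows "Re (- of_real y / (4 * s)) = - y * (Re s / (4 * (cmod s)^2))"
proof -
 have "- complex_of_real y / (4 * s) = of_real (- y / 4) * inverse s" by (simp add: field_simps)
 hence "Re (- complex_of_real y / (4 * s)) = - y / 4 * Re (inverse s)"
  by (metis Re_complex_of_real Im_complex_of_real times_complex.sel(1) mult_zero_left diff_zero)
 thus ?thesis unfolding inverse_complex.sel cmod_power2 by simp
qed

lemma norm_gaussian:
 fixes s :: complex
 shows "norm (exp (- of_real y / (4 * s))) = exp (- (Re s / (4 * (cmod s)^2)) * y)"
 unfolding norm_exp_eq_Re Re_gaussian_exponent by (simp add: mult.commute)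

lemma integrable_gaussian_complex:
 fixes s :: complex and p :: real
 assumes "Re s > 0"
 shows "integrable lborel (%t::real. exp (- of_real (t^2) / (4 * s)) * iexp (p * t))"
proof (rule integrable_bound)
 show "integrable lborel (%t::real. \<bar>t\<bar>^0 * exp (- (Re s / (4 * (cmod s)^2)) * t^2))"
  using assms by (intro integrable_gaussian_real divide_pos_pos mult_pos_pos zero_less_power) auto
 show "AE t in lborel. cmod (exp (- of_real (t^2) / (4 * s)) * iexp (p * t))
   <= norm (\<bar>t\<bar>^0 * exp (- (Re s / (4 * (cmod s)^2)) * t^2))"
  unfolding norm_mult norm_gaussian by simp
qed simp

text \<open>Both sides are holomorphic in s on the right half plane and agree on the positive reals,
  which accumulate at 1; analytic continuation does the rest.\<close>

lemma gaussian_fourier_complex: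
 fixes s :: complex and p :: real
 assumes "Re s > 0"
 shows "(LBINT t. exp (- of_real (t^2) / (4 * s)) * iexp (p * t))
  = csqrt (4 * of_real pi * s) * exp (- s * of_real (p^2))"
proof -
 define U where "U = {s. Re s > 0}"
 define F where "F s = (LBINT t. exp (- of_real (t^2) / (4 * s)) * iexp (p * t))" for s :: complex
 define G where "G s = csqrt (4 * of_real pi * s) * exp (- s * of_real (p^2))" for s :: complex
 have U: "open U" "connected U" unfolding U_def
  by (auto intro!: open_halfspace_Re_gt convex_connected convex_halfspace_Re_gt)
 let ?A = "%x z. exp (- complex_of_real (x^2) / (4 * z)) * iexp (p * x)"
 have FU: "F holomorphic_on U" unfolding F_def
 proof (rule holomorphic_on_integral_parameter)
  fix z0 assume "z0 \<in> U"
  hence z0: "Re z0 > 0" by (simp add: U_def)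
  define e where "e = Re z0 / 2"
  \<comment> \<open>A lower bound, on the whole ball around z0, for the rate
    \<open>Re z / (4 * (cmod z)^2)\<close> of the Gaussian; it yields one integrable majorant for
    all z in the ball.\<close>
  define rh where "rh = e / (4 * (cmod z0 + e)^2)"
  have e: "e > 0" using z0 by (simp add: e_def)
  have rh: "rh > 0" using e z0 unfolding rh_def by (intro divide_pos_pos mult_pos_pos zero_less_power add_nonneg_pos) auto
  have b: "Re z > 0 \<and> Re z / (4 * (cmod z)^2) >= rh" if "z \<in> cball z0 e" for z
  proof -
   have *: "cmod (z0 - z) <= e" using that by (simp add: dist_norm)
   have "\<bar>Re z0 - Re z\<bar> <= e" using * abs_Re_le_cmod[of "z0 - z"] by simp
   hence 1: "Re z >= e" unfolding e_def by linarith
   have "cmod z <= cmod z0 + e" using * by (metis add.commute norm_minus_commute norm_triangle_sub order_trans add_left_mono)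
   hence 2: "(cmod z)^2 <= (cmod z0 + e)^2" by (intro power_mono) auto
   have "cmod z > 0" using 1 e by auto
   thus ?thesis unfolding rh_def using 1 2 e by (auto intro!: frac_le)
  qed
  show "\<exists>e>0. \<exists>g. integrable lborel g \<and> cball z0 e \<subseteq> U \<and>
    (\<forall>z\<in>cball z0 e. \<forall>x\<in>space lborel. cmod (?A x z) <= g x)"
  proof (rule exI[of _ e], intro conjI exI[of _ "%t. \<bar>t\<bar>^0 * exp (- rh * t^2)"] ballI)
   show "integrable lborel (%t. \<bar>t\<bar>^0 * exp (- rh * t^2))" using rh by (rule integrable_gaussian_real)
   show "cball z0 e \<subseteq> U" using b by (auto simp: U_def)
   fix z and x :: real assume "z \<in> cball z0 e"
   hence "Re z / (4 * (cmod z)^2) >= rh" using b by blast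
   thus "cmod (?A x z) <= \<bar>x\<bar>^0 * exp (- rh * x^2)"
    using mult_right_mono[of rh "Re z / (4 * (cmod z)^2)" "x^2"] unfolding norm_mult norm_gaussian by simp
  qed (use e in auto)
 qed (auto simp: U_def intro!: holomorphic_intros)
 have GU: "G holomorphic_on U" unfolding G_def
  by (intro holomorphic_intros) (auto simp: U_def complex_nonpos_Reals_iff mult_le_0_iff not_le)
 have "F s - G s = 0"
 proof (rule analytic_continuation[where f="%s. F s - G s" and w=s and S=U and U="of_real ` {0<..}" and \<xi>=1])
  show "(%s. F s - G s) holomorphic_on U" using FU GU by (intro holomorphic_intros)
  have "(1::real) islimpt {0<..}" by (rule interior_limit_point) (simp add: interior_open)
  hence l: "\<exists>f. (\<forall>n::nat. f n \<in> {0<..} - {1::real}) \<and> f \<longlonglongrightarrow> 1" by (simp add: islimpt_sequential)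
  then obtain f where f: "\<And>n::nat. f n \<in> {0<..} - {1::real}" "f \<longlonglongrightarrow> 1" by blast
  show "1 islimpt complex_of_real ` {0<..}" unfolding islimpt_sequential
  proof (rule exI[of _ "%n. of_real (f n)"], intro conjI allI)
   show "complex_of_real (f n) \<in> complex_of_real ` {0<..} - {1}" for n using f(1)[of n] by auto
   show "(%n. complex_of_real (f n)) \<longlonglongrightarrow> 1" using tendsto_of_real[OF f(2), where 'a=complex] by simp
  qed
  fix z assume "z \<in> complex_of_real ` {0<..}"
  then obtain r where r: "r > 0" "z = of_real r" by auto
  have "csqrt (4 * of_real pi * of_real r) = of_real (sqrt (4 * pi * r))"
   using r csqrt_of_real[of "4 * pi * r"] by simp
  thus "F z - G z = 0" unfolding F_def G_def r(2) using gaussian_fourier_real[OF r(1), of p] by simp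
 qed (use U assms in \<open>auto simp: U_def\<close>)
 thus ?thesis by (simp add: F_def G_def)
qed

section \<open>Affine changes of variables\<close>

lemma nn_integral_lborel_affine:
 fixes f :: "'a::euclidean_space => ennreal"
 assumes [measurable]: "f \<in> mbl" and c: "c \<noteq> 0"
 shows "(\<integral>\<^sup>+x. f x \<partial>lborel) = ennreal (\<bar>c\<bar> ^ DIM('a)) * (\<integral>\<^sup>+x. f (t + c *\<^sub>R x) \<partial>lborel)"
 by (subst lborel_affine[OF c, of t]) (simp add: nn_integral_density nn_integral_distr nn_integral_cmult)

lemma integrable_lborel_affine:
 fixes f :: "'a::euclidean_space => 'b :: {banach, second_countable_topology}"
 assumes f: "integrable lborel f" and c: "c \<noteq> 0"
 shows "integrable lborel (%x. f (t + c *\<^sub>R x))"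
 using f f[THEN borel_measurable_integrable] c unfolding integrable_iff_bounded
 by (subst (asm) nn_integral_lborel_affine[where c=c and t=t]) (auto simp: ennreal_mult_less_top)

lemma integrable_lborel_affine_iff:
 fixes f :: "'a::euclidean_space => 'b :: {banach, second_countable_topology}"
 assumes c: "c \<noteq> 0"
 shows "integrable lborel (%x. f (t + c *\<^sub>R x)) \<longleftrightarrow> integrable lborel f"
 using integrable_lborel_affine[of f c t] c
  integrable_lborel_affine[of "%x. f (t + c *\<^sub>R x)" "1/c" "- (1/c) *\<^sub>R t"]
 by (auto simp: algebra_simps)

lemma integral_lborel_affine:
 fixes f :: "'a::euclidean_space => 'b :: {banach, second_countable_topology}"
 assumes c: "c \<noteq> 0"
 shows "(LBINT x. f x) = \<bar>c\<bar> ^ DIM('a) *\<^sub>R (LBINT x. f (t + c *\<^sub>R x))"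
proof (cases "integrable lborel f")
 case True
 note [measurable] = borel_measurable_integrable[OF True]
 show ?thesis using c
  by (subst lborel_affine[OF c, of t]) (simp add: integral_density integral_distr)
next
 case False
 thus ?thesis using integrable_lborel_affine_iff[OF c, of f t] by (simp add: not_integrable_integral_eq)
qed

lemma integral_lborel_translate:
 fixes f :: "'a::euclidean_space => 'b :: {banach, second_countable_topology}"
 shows "(LBINT x. f (x - t)) = (LBINT x. f x)"
 using integral_lborel_affine[of 1 f "-t"] by simp

lemma integrable_lborel_translate:
 fixes f :: "'a::euclidean_space => 'b :: {banach, second_countable_topology}"
 shows "integrable lborel (%x. f (x - t)) \<longleftrightarrow> integrable lborel f"
 using integrable_lborel_affine_iff[of 1 f "-t"] by simp

lemma integral_lborel_reflect:
 fixes f :: "'a::euclidean_space => 'b :: {banach, second_countable_topology}"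
 shows "(LBINT x. f (t - x)) = (LBINT x. f x)"
 using integral_lborel_affine[of "-1" f t] by simp

lemma integrable_lborel_reflect:
 fixes f :: "'a::euclidean_space => 'b :: {banach, second_countable_topology}"
 shows "integrable lborel (%x. f (t - x)) \<longleftrightarrow> integrable lborel f"
 using integrable_lborel_affine_iff[of "-1" f t] by simp

text \<open>The heat kernel at complex time s. Taking the d-th power of a principal root, instead of
  a power d/2, fixes the branch in odd dimensions and makes the kernel a product over the
  coordinates.\<close>

definition gk :: "complex => 'a::euclidean_space => complex" where
 "gk s x = exp (- of_real (x \<bullet> x) / (4 * s)) / csqrt (4 * of_real pi * s) ^ DIM('a)"

lemma exp_inner_prod: "exp (z * of_real (x \<bullet> y)) = (\<Prod>b\<in>Basis. exp (z * of_real ((x \<bullet> b) * (y \<bullet> b))))"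
 for z :: complex and x y :: "'a::euclidean_space"
 by (subst euclidean_inner) (simp add: exp_sum sum_distrib_left)

lemma gk_prod: "gk s x = (\<Prod>b\<in>Basis. exp (- of_real ((x \<bullet> b)^2) / (4 * s)) / csqrt (4 * of_real pi * s))"
proof -
 have "exp (- of_real (x \<bullet> x) / (4 * s)) = exp ((- 1 / (4 * s)) * of_real (x \<bullet> x))" by simp
 also have "... = (\<Prod>b\<in>Basis. exp ((- 1 / (4 * s)) * of_real ((x \<bullet> b) * (x \<bullet> b))))" by (rule exp_inner_prod)
 finally show ?thesis unfolding gk_def by (simp add: prod_dividef power2_eq_square)
qed

lemma gk_measurable [measurable]: "gk s \<in> mbl"
 unfolding gk_def by measurable

lemma continuous_on_gk [continuous_intros]:
 "continuous_on A f ==> continuous_on A (%x. gk s (f x))"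
 unfolding gk_def divide_inverse by (intro continuous_intros)

lemma norm_gk:
 fixes x :: "'a::euclidean_space"
 shows "norm (gk s x) = exp (- (Re s / (4 * (cmod s)^2)) * (x \<bullet> x)) / sqrt (4 * pi * cmod s) ^ DIM('a)"
 unfolding gk_def norm_divide norm_gaussian by (simp add: norm_power norm_csqrt norm_mult del: csqrt.sel)

lemma csqrt_4pi_nonzero: "Re s > 0 ==> csqrt (4 * of_real pi * s) \<noteq> 0"
 by (auto simp del: csqrt.sel)

lemma integrable_gk_fourier:
 fixes p :: "'a::euclidean_space"
 assumes "Re s > 0"
 shows "integrable lborel (%x. gk s x * iexp (p \<bullet> x))"
  and "(LBINT x. gk s x * iexp (p \<bullet> x)) = exp (- s * of_real (p \<bullet> p))"
proof -
 let ?B = "1 / csqrt (4 * of_real pi * s)"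
 have eq: "gk s x * iexp (p \<bullet> x) = (\<Prod>b\<in>Basis. ?B *
   (exp (- of_real ((x \<bullet> b)^2) / (4 * s)) * iexp ((p \<bullet> b) * (x \<bullet> b))))" for x :: 'a
  unfolding gk_prod exp_inner_prod prod.distrib[symmetric] by (intro prod.cong) auto
 note i = integral_prod_Basis[where 'a='a and f="%b t. ?B *
   (exp (- of_real (t^2) / (4 * s)) * iexp ((p \<bullet> b) * t))",
   OF integrable_mult_right[OF integrable_gaussian_complex[OF assms]]]
 show "integrable lborel (%x. gk s x * iexp (p \<bullet> x))"
  unfolding eq by (rule i(1))
 let ?A = "LBINT x. gk s x * iexp (p \<bullet> x)"
 let ?C = "- s * of_real (p \<bullet> p)"
 have "?A =
  (\<Prod>b\<in>Basis. LBINT t. ?B *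
   (exp (- of_real (t^2) / (4 * s)) * iexp ((p \<bullet> b) * t)))"
  unfolding eq by (rule i(2))
 also have "... = (\<Prod>b\<in>Basis. exp (- s * of_real ((p \<bullet> b)^2)))"
  unfolding integral_mult_right_zero gaussian_fourier_complex[OF assms]
  using csqrt_4pi_nonzero[OF assms] by (simp del: csqrt.sel)
 also have "... = exp ?C"
  unfolding exp_inner_prod by (simp add: power2_eq_square)
 finally show "?A = exp ?C" .
qed

lemma integrable_gk: "Re s > 0 ==> integrable lborel (gk s :: 'a::euclidean_space => complex)"
 using integrable_gk_fourier(1)[of s "0::'a"] by simp

lemma integrable_gk_translate: "Re s > 0 ==> integrable lborel (%x::'a::euclidean_space. gk s (x - c))"
 by (subst integrable_lborel_translate) (rule integrable_gk)

lemma gk_fourier_translate: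
 fixes p c :: "'a::euclidean_space"
 assumes "Re s > 0"
 shows "(LBINT x. gk s (x - c) * iexp (p \<bullet> x)) = iexp (p \<bullet> c) * exp (- s * of_real (p \<bullet> p))"
proof -
 let ?A = "LBINT x. gk s (x - c) * iexp (p \<bullet> (x - c))"
 have "(LBINT x. gk s (x - c) * iexp (p \<bullet> x))
   = (LBINT x. iexp (p \<bullet> c) * (gk s (x - c) * iexp (p \<bullet> (x - c))))"
  by (intro integral_cong refl)
   (simp add: inner_diff_right algebra_simps exp_diff)
 also have "... = iexp (p \<bullet> c) * ?A"
  by simp
 also have "?A = exp (- s * of_real (p \<bullet> p))"
  using integral_lborel_translate[of "%x. gk s x * iexp (p \<bullet> x)" c] integrable_gk_fourier(2)[OF assms, of p] by simp
 finally show ?thesis .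
qed

text \<open>A Gaussian in p is a multiple of the kernel at time 1/(4s), so the forward transform
  applies once more; \<open>csqrt_mult_Re_pos\<close> combines the two roots into 2 pi per
  dimension.\<close>

lemma gaussian_inverse_fourier:
 fixes x :: "'a::euclidean_space"
 assumes "Re s > 0"
 shows "integrable lborel (%p. iexp (x \<bullet> p) * exp (- s * of_real (p \<bullet> p)))"
  and "(LBINT p. iexp (x \<bullet> p) * exp (- s * of_real (p \<bullet> p))) = of_real (2 * pi) ^ DIM('a) * gk s x"
proof -
 define sg where "sg = inverse (4 * s)"
 have sg: "Re sg > 0" using assms unfolding sg_def by (intro Re_inverse_pos) simp
 have s0: "s \<noteq> 0" using assms by auto
 define K where "K = csqrt (4 * of_real pi * sg)"
 have K0: "K \<noteq> 0" unfolding K_def using csqrt_4pi_nonzero[OF sg] .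
 let ?C = "%p. - s * of_real (p \<bullet> p)"
 have eq: "iexp (x \<bullet> p) * exp (?C p) = K ^ DIM('a) * (gk sg p * iexp (x \<bullet> p))" for p :: 'a
  using K0 s0 unfolding gk_def K_def[symmetric] by (simp add: sg_def field_simps)
 show "integrable lborel (%p. iexp (x \<bullet> p) * exp (?C p))"
  unfolding eq by (intro integrable_mult_right integrable_gk_fourier sg)
 let ?B = "4 * of_real pi * s"
 have "K * csqrt ?B = csqrt (4 * of_real pi * sg * ?B)"
  unfolding K_def using sg assms by (intro csqrt_mult_Re_pos[symmetric]) auto
 also have "4 * of_real pi * sg * ?B = (of_real (2 * pi))^2"
  using s0 by (simp add: sg_def field_simps power2_eq_square)
 also have "csqrt ... = of_real (2 * pi)" by (rule csqrt_square) simp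
 finally have K: "K = of_real (2 * pi) / csqrt ?B"
  using csqrt_4pi_nonzero[OF assms] by (simp add: field_simps del: csqrt.sel)
 let ?A = "LBINT p. iexp (x \<bullet> p) * exp (?C p)"
 have "?A = K ^ DIM('a) * exp (- sg * of_real (x \<bullet> x))"
  unfolding eq integral_mult_right_zero integrable_gk_fourier(2)[OF sg] ..
 also have "... = of_real (2 * pi) ^ DIM('a) * gk s x"
  unfolding gk_def K power_divide using s0 by (simp add: sg_def field_simps)
 finally show "?A = of_real (2 * pi) ^ DIM('a) * gk s x" .
qed

section \<open>Product test functions and cut-offs\<close>

text \<open>A smooth function carried together with all its derivatives. Higher partial derivatives
  of products over the coordinates can then be read off by raising indices, without iterating
  derivative operators.\<close>

definition dfam :: "(nat => real => complex) => bool" where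
 "dfam H \<longleftrightarrow> (\<forall>m t. (H m has_vector_derivative H (Suc m) t) (at t))"

lemma dfamD: "dfam H ==> (H m has_vector_derivative H (Suc m) t) (at t)"
 by (simp add: dfam_def)

lemma dfam_continuous: "dfam H ==> continuous_on A (H m)"
 by (intro continuous_at_imp_continuous_on ballI) (metis dfamD has_vector_derivative_continuous)

lemma dfam_cmult_exp: "dfam (%m t. z ^ m * exp (z * of_real t))"
 unfolding dfam_def
proof (intro allI)
 fix m t
 have "((%w. z ^ m * exp (z * w)) has_field_derivative z ^ Suc m * exp (z * of_real t)) (at (of_real t))"
  by (auto intro!: derivative_eq_intros)
 thus "((%t. z ^ m * exp (z * of_real t)) has_vector_derivative z ^ Suc m * exp (z * of_real t)) (at t)"
  by (rule has_vector_derivative_real_field)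
qed

lemma dfam_entire:
 assumes "f holomorphic_on UNIV"
 shows "dfam (%m t. (deriv ^^ m) f (of_real t))"
 unfolding dfam_def
proof (intro allI)
 fix m t
 have "(deriv ^^ m) f holomorphic_on UNIV" using assms by (intro holomorphic_higher_deriv) auto
 hence "((deriv ^^ m) f has_field_derivative deriv ((deriv ^^ m) f) (of_real t)) (at (of_real t))"
  by (meson holomorphic_derivI open_UNIV UNIV_I)
 thus "((%t. (deriv ^^ m) f (of_real t)) has_vector_derivative (deriv ^^ Suc m) f (of_real t)) (at t)"
  using has_vector_derivative_real_field by fastforce
qed

lemma dfam_affine:
 assumes "dfam F"
 shows "dfam (%m t. of_real (ap ^ m) * F m (be + ap * t))"
 unfolding dfam_def
proof (intro allI)
 fix m t
 let ?A = "%t. be + ap * t"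
 let ?B = "%m. %t. of_real (ap ^ m) * F m (?A t)"
 have "((F m \<circ> (%t. be + ap * t)) has_vector_derivative ap *\<^sub>R F (Suc m) (?A t)) (at t)"
  by (rule vector_diff_chain_at) (auto intro!: dfamD[OF assms] derivative_eq_intros simp flip: has_real_derivative_iff_has_vector_derivative)
 hence "(?B m has_vector_derivative of_real (ap ^ m) * (ap *\<^sub>R F (Suc m) (?A t))) (at t)"
  unfolding o_def by (rule has_vector_derivative_mult_right)
 thus "(?B m has_vector_derivative of_real (ap ^ Suc m) * F (Suc m) (?A t)) (at t)"
  by (simp add: scaleR_conv_of_real mult_ac)
qed

text \<open>Leibniz's formula for the derivatives of a product.\<close>

definition lfam :: "(nat => real => complex) => (nat => real => complex) => nat => real => complex" where
 "lfam F G m t = (\<Sum>j\<le>m. of_nat (m choose j) * (F j t * G (m - j) t))"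

lemma dfam_lfam:
 assumes "dfam F" "dfam G"
 shows "dfam (lfam F G)"
 unfolding dfam_def
proof (intro allI)
 fix m t
 let ?a = "%j. F j t * G (Suc m - j) t"
 let ?A = "%m t. \<Sum>j\<le>m. of_nat (m choose j) * (F j t * G (Suc (m - j)) t + F (Suc j) t * G (m - j) t)"
 let ?B = "%m. \<Sum>j\<le>m. of_nat (m choose Suc j) * ?a (Suc j)"
 let ?C = "%m. \<Sum>j\<le>m. of_nat (m choose j) * ?a (Suc j)"
 have "((%t. F j t * G k t) has_vector_derivative F j t * G (Suc k) t + F (Suc j) t * G k t) (at t)" for j k
  by (intro has_vector_derivative_mult dfamD assms)
 hence "(lfam F G m has_vector_derivative (?A m t)) (at t)"
  unfolding lfam_def by (intro has_vector_derivative_sum has_vector_derivative_mult_right)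
 also have "?A m t
   = (\<Sum>j\<le>m. of_nat (m choose j) * ?a j) + ?C m"
  unfolding sum.distrib[symmetric] by (intro sum.cong refl) (simp add: Suc_diff_le algebra_simps)
 also have "(\<Sum>j\<le>m. of_nat (m choose j) * ?a j) = (\<Sum>j\<le>Suc m. of_nat (m choose j) * ?a j)" by simp
 also have "... = ?a 0 + ?B m"
  by (subst sum.atMost_Suc_shift) simp
 also have "?a 0 + ?B m + ?C m
   = ?a 0 + (\<Sum>j\<le>m. of_nat (Suc m choose Suc j) * ?a (Suc j))"
  by (simp add: sum.distrib algebra_simps)
 also have "... = lfam F G (Suc m) t"
  unfolding lfam_def sum.atMost_Suc_shift[of _ m] by simp
 finally show "(lfam F G m has_vector_derivative lfam F G (Suc m) t) (at t)" .
qed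

text \<open>A product of one-variable functions; the multi-index m says which derivative is taken in
  each coordinate, so that \<open>pdiffs\<close> merely raises m.\<close>

definition ridge :: "('a::euclidean_space => nat => real => complex) => ('a => nat) => 'a => complex" where
 "ridge H m x = (\<Prod>b\<in>Basis. H b (m b) (x \<bullet> b))"

lemma ridge_has_derivative:
 fixes H :: "'a::euclidean_space => nat => real => complex"
 assumes "\<And>b. b \<in> Basis ==> dfam (H b)" "b0 \<in> Basis"
 shows "((%t. ridge H m (x + t *\<^sub>R b0)) has_vector_derivative ridge H (m(b0 := Suc (m b0))) x) (at 0)"
proof -
 let ?P = "\<Prod>b\<in>Basis-{b0}. H b (m b) (x \<bullet> b)"
 have e: "(x + t *\<^sub>R b0) \<bullet> b = x \<bullet> b" if "b \<in> Basis - {b0}" for t b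
  using that assms(2) by (auto simp: inner_add_left inner_Basis)
 have b0: "(x + t *\<^sub>R b0) \<bullet> b0 = x \<bullet> b0 + 1 * t" for t
  using assms(2) by (simp add: inner_add_left)
 have "ridge H m (x + t *\<^sub>R b0) = H b0 (m b0) (x \<bullet> b0 + 1 * t) * ?P" for t
  unfolding ridge_def prod.remove[OF finite_Basis assms(2)] b0
  by (intro arg_cong2[where f="(*)"] refl prod.cong) (simp only: e)
 moreover have "ridge H (m(b0 := Suc (m b0))) x = H b0 (Suc (m b0)) (x \<bullet> b0 + 1 * 0) * ?P"
  unfolding ridge_def prod.remove[OF finite_Basis assms(2)]
  by (intro arg_cong2[where f="(*)"] prod.cong) simp_all
 moreover have "((%t. H b0 (m b0) (x \<bullet> b0 + 1 * t) * ?P) has_vector_derivative H b0 (Suc (m b0)) (x \<bullet> b0 + 1 * 0) * ?P) (at 0)"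
  using dfamD[OF dfam_affine[OF assms(1)[OF assms(2)], of 1 "x \<bullet> b0"], of "m b0" 0]
  by (intro has_vector_derivative_mult_left) simp
 ultimately show ?thesis by simp
qed

lemma ridge_continuous:
 assumes "\<And>b. b \<in> Basis ==> dfam (H b)"
 shows "continuous_on A (ridge H m)"
 unfolding ridge_def[abs_def]
proof (rule continuous_on_prod)
 fix b :: 'a assume "b \<in> Basis"
 from dfam_continuous[OF assms[OF this], where A=UNIV]
 show "continuous_on A (%x. H b (m b) (x \<bullet> b))"
  by (rule continuous_on_compose2) (auto intro: continuous_on_inner continuous_on_id continuous_on_const)
qed

lemma pdiffs_ridge:
 fixes H :: "'a::euclidean_space => nat => real => complex"
 assumes "\<And>b. b \<in> Basis ==> dfam (H b)" "set bs \<subseteq> Basis" "bounded_linear L"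
 shows "pdiffs bs (%x. L (ridge H m x)) = (%x. L (ridge H (%b. m b + count_list bs b) x))"
 using assms(2)
proof (induction bs)
 case (Cons b bs)
 have *: "(%c. m c + count_list (b # bs) c) = (%c. m c + count_list bs c)(b := Suc (m b + count_list bs b))"
  by auto
 show ?case unfolding pdiffs.simps Cons.IH[OF Cons.prems[unfolded list.set insert_subset, THEN conjunct2]]
  unfolding pdiff_def *
 proof (intro ext vector_derivative_at)
  fix x
  have b: "b \<in> Basis" using Cons.prems by simp
  show "((%t. L (ridge H (%b. m b + count_list bs b) (x + t *\<^sub>R b))) has_vector_derivative
    L (ridge H ((%c. m c + count_list bs c)(b := Suc (m b + count_list bs b))) x)) (at 0)"
   by (rule bounded_linear.has_vector_derivative[OF assms(3)])
     (use ridge_has_derivative[of H, OF assms(1) b] in simp)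
 qed
qed simp

text \<open>Test functions are real, whereas the products used below are complex; L will be the real
  or the imaginary part.\<close>

lemma test_fun_ridge:
 fixes H :: "'a::euclidean_space => nat => real => complex"
 assumes H: "\<And>b. b \<in> Basis ==> dfam (H b)" and L: "bounded_linear L"
  and supp: "\<And>b t. b \<in> Basis ==> \<bar>t\<bar> > R ==> H b (m b) t = 0"
 shows "test_fun (%x. L (ridge H m x))"
 unfolding test_fun_def
proof (intro conjI allI)
 let ?A = "%x. L (ridge H m x)"
 show "Ck k ?A" for k
  unfolding Ck_def
 proof (intro allI impI conjI ballI)
  fix bs :: "'a list" assume bs: "set bs \<subseteq> Basis \<and> length bs <= k"
  have pd: "pdiffs bs ?A = (%x. L (ridge H (%b. m b + count_list bs b) x))"
   by (rule pdiffs_ridge) (use H bs L in auto)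
  show "continuous_on UNIV (pdiffs bs ?A)"
   unfolding pd
   by (intro bounded_linear.continuous_on[OF L] ridge_continuous H)
  fix b x :: 'a assume b: "b \<in> Basis"
  show "(%t. pdiffs bs ?A (x + t *\<^sub>R b)) differentiable at 0"
   unfolding pd
   by (rule differentiableI_vector[OF bounded_linear.has_vector_derivative[OF L ridge_has_derivative[OF H b]]])
 qed
 have "{x. L (ridge H m x) \<noteq> 0} \<subseteq> {x. \<forall>b\<in>Basis. \<bar>x \<bullet> b\<bar> <= R}"
 proof safe
  fix x b assume "L (ridge H m x) \<noteq> 0" and b: "(b::'a) \<in> Basis"
  hence "ridge H m x \<noteq> 0" using L by (metis bounded_linear.bounded_linear linear_simps(3))
  hence "H b (m b) (x \<bullet> b) \<noteq> 0" using b unfolding ridge_def by (metis finite_Basis prod_zero)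
  thus "\<bar>x \<bullet> b\<bar> <= R" using supp[OF b] by (meson not_le)
 qed
 moreover have "bounded {x::'a. \<forall>b\<in>Basis. \<bar>x \<bullet> b\<bar> <= R}"
  unfolding bounded_iff
 proof (intro exI ballI)
  fix x :: 'a assume "x \<in> {x. \<forall>b\<in>Basis. \<bar>x \<bullet> b\<bar> <= R}"
  thus "norm x <= (\<Sum>b\<in>(Basis::'a set). R)"
   by (intro order_trans[OF norm_le_l1] sum_mono) auto
 qed
 ultimately show "bounded {x. L (ridge H m x) \<noteq> 0}" by (rule bounded_subset[rotated])
qed

text \<open>The classical flat function exp(-1/t) with a polynomial factor in 1/t, so that the class
  is closed under differentiation.\<close>

definition flatf :: "real poly => real => real" where
 "flatf P t = (if t > 0 then poly P (1/t) * exp (- (1/t)) else 0)"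

lemma poly_exp_tendsto_0: "((%u::real. poly P u * exp (- u)) \<longlongrightarrow> 0) at_top"
proof -
 have "((%u::real. \<Sum>i\<le>degree P. coeff P i * (u ^ i / exp u)) \<longlongrightarrow> (\<Sum>i\<le>degree P. coeff P i * 0)) at_top"
  by (intro tendsto_intros tendsto_power_div_exp_0)
 also have "(%u::real. \<Sum>i\<le>degree P. coeff P i * (u ^ i / exp u)) = (%u. poly P u * exp (- u))"
  unfolding poly_altdef sum_distrib_right by (intro ext sum.cong refl) (simp add: exp_minus divide_inverse)
 finally show ?thesis by simp
qed

text \<open>For t > 0 the chain rule gives the factor u^2 (P(u) - P'(u)) at u = 1/t. At 0 the right
  difference quotient is u P(u) exp(-u) with u tending to infinity, which explains
  \<open>pCons 0 P\<close>.\<close>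

lemma flatf_has_derivative:
 "(flatf P has_real_derivative flatf ([:0,0,1:] * (P - pderiv P)) t) (at t)"
proof (cases "t = 0")
 case False
 show ?thesis
 proof (cases "t > 0")
  case True
  have "((%t. poly P (1/t) * exp (- (1/t))) has_real_derivative flatf ([:0,0,1:] * (P - pderiv P)) t) (at t)"
   using True by (auto intro!: derivative_eq_intros DERIV_chain2[OF poly_DERIV] simp: flatf_def algebra_simps power2_eq_square)
  note d = this
  have "\<forall>\<^sub>F x in nhds t. flatf P x = poly P (1/x) * exp (- (1/x))"
   using eventually_nhds_in_open[of "{0<..}" t] True by (auto elim!: eventually_mono simp: flatf_def)
  from DERIV_cong_ev[OF refl this refl, THEN iffD2, OF d] show ?thesis .
 next
  case F: False
  have "\<forall>\<^sub>F x in nhds t. flatf P x = 0"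
   using eventually_nhds_in_open[of "{..<0}" t] F False by (auto elim!: eventually_mono simp: flatf_def)
  note ev = this
  have "((%t. 0) has_real_derivative flatf ([:0,0,1:] * (P - pderiv P)) t) (at t)"
   using F by (simp add: flatf_def)
  from DERIV_cong_ev[OF refl ev refl, THEN iffD2, OF this] show ?thesis .
 qed
next
 case True
 have "((%h. (flatf P h - 0) / h) \<longlongrightarrow> 0) (at 0)"
 proof (rule filterlim_split_at)
  have "((%h. (flatf P h - 0) / h) \<longlongrightarrow> 0) (at_left 0) \<longleftrightarrow> ((%h. 0::real) \<longlongrightarrow> 0) (at_left (0::real))"
   by (intro tendsto_cong) (simp add: eventually_at_filter flatf_def)
  thus "((%h. (flatf P h - 0) / h) \<longlongrightarrow> 0) (at_left 0)" by simp
  have "((%h. poly (pCons 0 P) (inverse h) * exp (- inverse h)) \<longlongrightarrow> 0) (at_right (0::real))"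
   by (rule filterlim_compose[OF poly_exp_tendsto_0 filterlim_inverse_at_top_right])
  moreover have "((%h. (flatf P h - 0) / h) \<longlongrightarrow> 0) (at_right 0) \<longleftrightarrow>
    ((%h. poly (pCons 0 P) (inverse h) * exp (- inverse h)) \<longlongrightarrow> 0) (at_right (0::real))"
   by (intro tendsto_cong) (simp add: eventually_at_filter flatf_def inverse_eq_divide)
  ultimately show "((%h. (flatf P h - 0) / h) \<longlongrightarrow> 0) (at_right 0)" by simp
 qed
 thus ?thesis unfolding True by (simp add: DERIV_def flatf_def)
qed

text \<open>The step is the normalised primitive of the bump obtained by multiplying the flat
  function with its reflection t to 1 - t.\<close>

lemma ex_smooth_step:
 obtains S :: "nat => real => complex" where "dfam S" "\<And>m t. t <= 0 ==> S m t = 0"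
  "\<And>t. t >= 1 ==> S 0 t = 1" "\<And>m t. t >= 1 ==> S (Suc m) t = 0"
  "\<And>m. \<exists>B. \<forall>t. norm (S m t) <= B"
proof -
 define Q :: "nat => real poly" where "Q m = ((%P. [:0,0,1:] * (P - pderiv P)) ^^ m) 1" for m
 define F :: "nat => real => complex" where "F m t = of_real (flatf (Q m) t)" for m t
 have F: "dfam F" unfolding dfam_def F_def
  using flatf_has_derivative by (auto intro!: has_vector_derivative_of_real simp: Q_def has_real_derivative_iff_has_vector_derivative[symmetric])
 define G where "G = lfam F (%m t. of_real ((-1) ^ m) * F m (1 + (-1) * t))"
 have G: "dfam G" unfolding G_def by (intro dfam_lfam F dfam_affine)
 have G0: "G m t = 0" if "t <= 0 \<or> t >= 1" for m t
  using that by (auto simp: G_def lfam_def F_def flatf_def)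
 define g where "g t = flatf 1 t * flatf 1 (1 - t)" for t
 have Gg: "G 0 t = of_real (g t)" for t by (simp add: G_def lfam_def F_def g_def Q_def)
 have gc: "continuous_on A g" for A
 proof -
  have "continuous_on A (flatf 1)" for A
   by (intro continuous_at_imp_continuous_on ballI DERIV_isCont[OF flatf_has_derivative])
  thus ?thesis unfolding g_def by (intro continuous_intros continuous_on_compose2[where f="%t. 1 - t" and t=UNIV]) auto
 qed
 define h where "h u = (LBINT t=0..u. g t)" for u :: real
 have hd: "(h has_real_derivative g u) (at u)" for u
 proof -
  define a b where "a = - \<bar>u\<bar> - 1" and "b = \<bar>u\<bar> + 1"
  have "((%u. LBINT y=ereal 0..ereal u. g y) has_vector_derivative (g u)) (at u within {a..b})"
   by (rule interval_integral_FTC2) (auto simp: a_def b_def gc)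
  moreover have "at u within {a..b} = at u" by (rule at_within_interior) (auto simp: a_def b_def)
  ultimately show ?thesis unfolding h_def has_real_derivative_iff_has_vector_derivative by (simp add: zero_ereal_def)
 qed
 have g0: "g t = 0" if "t <= 0 \<or> t >= 1" for t using that by (auto simp: g_def flatf_def)
 have h0: "h u = 0" if "u <= 0" for u
 proof -
  have "h u = h 0"
  proof (cases "u < 0")
   case True
   thus ?thesis by (intro DERIV_isconst_end[of u 0 h, symmetric]) (auto intro!: continuous_at_imp_continuous_on DERIV_isCont[OF hd] simp: g0 intro: hd[THEN DERIV_cong])
  qed (use that in auto)
  thus ?thesis by (simp add: h_def zero_ereal_def)
 qed
 have h1: "h u = h 1" if "u >= 1" for u
 proof (cases "u > 1")
  case True
  thus ?thesis by (intro DERIV_isconst_end[of 1 u h]) (auto intro!: continuous_at_imp_continuous_on DERIV_isCont[OF hd] simp: g0 intro: hd[THEN DERIV_cong])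
 qed (use that in auto)
 have "h 0 < h 1"
 proof (rule DERIV_pos_imp_increasing_open[of 0 1 h])
  fix x :: real assume "0 < x" "x < 1"
  thus "\<exists>y. DERIV h x :> y \<and> y > 0" using hd[of x] by (auto simp: g_def flatf_def)
 qed (auto intro!: continuous_at_imp_continuous_on DERIV_isCont[OF hd])
 hence I: "h 1 > 0" using h0[of 0] by simp
 \<comment> \<open>Index 0 is the primitive and index k + 1 the k-th derivative of the bump, both
   divided by the total mass \<open>h 1\<close>.\<close>
 define S where "S m t = (case m of 0 => of_real (h t / h 1) | Suc k => G k t / of_real (h 1))" for m t
 have S: "dfam S" unfolding dfam_def
 proof (intro allI)
  fix m t
  show "(S m has_vector_derivative S (Suc m) t) (at t)"
  proof (cases m)
   case 0
   have "((%t. complex_of_real (h t / h 1)) has_vector_derivative of_real (g t / h 1)) (at t)"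
    using I by (intro has_vector_derivative_of_real) (auto intro!: derivative_eq_intros hd simp flip: has_real_derivative_iff_has_vector_derivative)
   thus ?thesis using 0 by (simp add: S_def[abs_def] Gg)
  next
   case (Suc k)
   have "((%t. G k t / of_real (h 1)) has_vector_derivative G (Suc k) t / of_real (h 1)) (at t)"
    by (intro has_vector_derivative_divide dfamD[OF G])
   thus ?thesis using Suc by (simp add: S_def[abs_def])
  qed
 qed
 have S0: "S m t = 0" if "t <= 0" for m t using that by (auto simp: S_def h0 G0 split: nat.splits)
 have S1: "S 0 t = 1" "S (Suc m) t = 0" if "t >= 1" for m t using that I h1[OF that] by (auto simp: S_def G0)
 have "\<exists>B. \<forall>t. norm (S m t) <= B" for m
 proof -
  have "compact (S m ` {0..1})" by (intro compact_continuous_image dfam_continuous[OF S]) auto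
  then obtain B where B: "\<forall>x\<in>S m ` {0..1}. norm x <= B" using compact_imp_bounded bounded_iff by metis
  have "norm (S m t) <= max B 1" for t
  proof -
   consider "t <= 0" | "t >= 1" | "t \<in> {0..1}" by fastforce
   thus ?thesis using S0[of t m] S1[of t] B by cases (cases m; auto simp: le_max_iff_disj)+
  qed
  thus ?thesis by blast
 qed
 from that[OF S S0 S1 this] show ?thesis by blast
qed

text \<open>Each cut-off is a product of an ascending and a descending step, translated to -N - 1
  and N + 1. Only translations depend on N, hence the derivative bounds are uniform in N.\<close>

lemma ex_smooth_cutoffs:
 obtains X :: "nat => nat => real => complex" where "\<And>N. dfam (X N)"
  "\<And>N t. \<bar>t\<bar> <= real N ==> X N 0 t = 1" "\<And>N m t. \<bar>t\<bar> <= real N ==> X N (Suc m) t = 0"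
  "\<And>N m t. \<bar>t\<bar> >= real N + 1 ==> X N m t = 0"
  "\<And>m. \<exists>B. \<forall>N t. norm (X N m t) <= B"
proof -
 obtain S :: "nat => real => complex" where S: "dfam S" "\<And>m t. t <= 0 ==> S m t = 0"
  "\<And>t. t >= 1 ==> S 0 t = 1" "\<And>m t. t >= 1 ==> S (Suc m) t = 0"
  "\<And>m. \<exists>B. \<forall>t. norm (S m t) <= B" by (rule ex_smooth_step) blast
 define L R where "L N = (%m t. of_real (1 ^ m) * S m (real N + 1 + 1 * t))"
  and "R N = (%m t. of_real ((-1) ^ m) * S m (real N + 1 + (-1) * t))" for N :: nat
 define X where "X N = lfam (L N) (R N)" for N
 have 1: "dfam (X N)" for N unfolding X_def L_def R_def by (intro dfam_lfam dfam_affine S)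
 have 2: "X N 0 t = 1" if "\<bar>t\<bar> <= real N" for N t
  using that by (simp add: X_def lfam_def L_def R_def S(3))
 have 3: "X N (Suc m) t = 0" if "\<bar>t\<bar> <= real N" for N m t
  unfolding X_def lfam_def
 proof (intro sum.neutral ballI)
  fix j assume j: "j \<in> {..Suc m}"
  have "L N j t = 0 \<or> R N (Suc m - j) t = 0"
  proof (cases j)
   case 0 thus ?thesis using that by (simp add: R_def S(4))
  next
   case (Suc i) thus ?thesis using that by (simp add: L_def S(4))
  qed
  thus "of_nat (Suc m choose j) * (L N j t * R N (Suc m - j) t) = 0" by auto
 qed
 have 4: "X N m t = 0" if "\<bar>t\<bar> >= real N + 1" for N m t
  using that unfolding X_def lfam_def L_def R_def by (cases "t >= 0") (auto simp: S(2))
 have 5: "\<exists>B. \<forall>N t. norm (X N m t) <= B" for m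
 proof -
  obtain B where B: "\<And>m t. norm (S m t) <= B m" using S(5) by metis
  have "norm (X N m t) <= (\<Sum>j\<le>m. of_nat (m choose j) * (B j * B (m - j)))" for N t
   unfolding X_def lfam_def L_def R_def
   by (intro sum_norm_le) (auto simp: norm_mult norm_power intro!: mult_left_mono mult_mono B order_trans[OF norm_ge_zero B])
  thus ?thesis by blast
 qed
 from that[OF 1 2 3 4 5] show ?thesis by blast
qed

section \<open>Polar coordinates\<close>

definition polar_density :: "'a::euclidean_space itself => 'a \<times> real => real" where
 "polar_density _ = (%(z, r). indicator {0<..1} (norm z) * indicator {0<..} r * (real DIM('a) * r ^ (DIM('a) - 1)))"

lemma polar_density_nonneg: "polar_density TYPE('a::euclidean_space) w >= 0"
 by (auto simp: polar_density_def split: prod.splits split_indicator)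

lemma polar_density_measurable [measurable]:
 "polar_density TYPE('a::euclidean_space) \<in> borel_measurable (lborel \<Otimes>\<^sub>M lborel)"
 unfolding polar_density_def measurable_cong_sets[OF sets_pair_measure_cong[OF sets_lborel sets_lborel] refl]
 by measurable

lemma nn_integral_inverse_power_tail:
 fixes a :: real
 assumes a: "a > 0" and d: "d > 0"
 shows "(\<integral>\<^sup>+rh. ennreal (indicator {a..} rh * (real d * inverse (rh ^ (d + 1)))) \<partial>lborel) = ennreal (inverse (a ^ d))"
proof -
 let ?A = "%rh. - inverse (rh ^ d)"
 let ?B = "%rh. real d * inverse (rh ^ (d + 1))"
 have "(\<integral>\<^sup>+rh. ennreal (?B rh) * indicator {a..} rh \<partial>lborel) = ennreal (0 - (- inverse (a ^ d)))"
 proof (rule nn_integral_FTC_atLeast[where F="%rh. - inverse (rh ^ d)"])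
  fix x assume x: "a <= x"
  obtain k where k: "d = Suc k" using d by (cases d) auto
  show "(?A has_real_derivative real d * inverse (x ^ (d + 1))) (at x)"
   using x a unfolding k
   by (auto intro!: derivative_eq_intros simp: divide_simps power2_eq_square) (cases k; simp add: algebra_simps)
  show "0 <= real d * inverse (x ^ (d + 1))" using x a by auto
 next
  have "(?A \<longlongrightarrow> - 0) (at_top :: real filter)"
   using d by (intro tendsto_minus tendsto_inverse_0_at_top filterlim_pow_at_top filterlim_ident) auto
  thus "(?A \<longlongrightarrow> 0) (at_top :: real filter)" by simp
 qed (use a in \<open>auto\<close>)
 moreover have "ennreal (indicator {a..} rh * ?B rh) = ennreal (?B rh) * indicator {a..} rh" for rh
  by (auto split: split_indicator)
 ultimately show ?thesis by simp
qed

text \<open>Integration over the unit ball in \<open>z\<close> replaces integration over the unit sphere: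
 only the direction of \<open>z\<close> matters. After \<open>r = \<bar>z\<bar> rh\<close>, swapping the two integrals and
 substituting \<open>x = rh z\<close>, the remaining integral over \<open>rh >= \<bar>x\<bar>\<close> is elementary.\<close>

lemma nn_integral_polar:
 fixes f :: "'a::euclidean_space => ennreal"
 assumes [measurable]: "f \<in> mbl"
 shows "(\<integral>\<^sup>+x. f x \<partial>lborel) = (\<integral>\<^sup>+z. (\<integral>\<^sup>+r. f ((r / norm z) *\<^sub>R z) * ennreal (polar_density TYPE('a) (z, r)) \<partial>lborel) \<partial>lborel)"
proof -
 let ?d = "DIM('a)"
 have d: "?d > 0" by simp
 define g where "g z rh = indicator {0<..1} (norm z) * indicator {0<..} rh * (norm z ^ ?d * (real ?d * rh ^ (?d - 1)))" for z :: 'a and rh :: real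
 have [measurable]: "(%(z, rh). g z rh) \<in> borel_measurable (lborel \<Otimes>\<^sub>M lborel)"
  unfolding g_def measurable_cong_sets[OF sets_pair_measure_cong[OF sets_lborel sets_lborel] refl]
  by measurable
 let ?B = "%z. \<integral>\<^sup>+rh. f (rh *\<^sub>R z) * ennreal (g z rh) \<partial>lborel"
 let ?G = "%z. \<integral>\<^sup>+r. f ((r / norm z) *\<^sub>R z) * ennreal (polar_density TYPE('a) (z, r)) \<partial>lborel"
 let ?I = "%z rh. polar_density TYPE('a) (z, 0 + norm z * rh)"
 let ?K = "%z rh. ((0 + norm z * rh) / norm z) *\<^sub>R z"
 have 1: "?G z = ?B z" for z :: 'a
 proof (cases "z = 0")
  case True thus ?thesis by (simp add: polar_density_def g_def)
 next
  case False
  hence c: "norm z \<noteq> 0" by simp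
  have "?G z
    = ennreal (norm z) * (\<integral>\<^sup>+rh. f (?K z rh) * ennreal (?I z rh) \<partial>lborel)"
   by (subst nn_integral_real_affine[OF _ c, of _ 0]) (auto simp: polar_density_def)
  also have "... = (\<integral>\<^sup>+rh. ennreal (norm z) * (f (?K z rh) * ennreal (?I z rh)) \<partial>lborel)"
   by (subst nn_integral_cmult) (auto simp: polar_density_def)
  also have "... = ?B z"
  proof (intro nn_integral_cong)
   fix rh :: real
   have i: "(indicator {0<..} (norm z * rh) :: real) = indicator {0<..} rh"
    using c by (auto simp: indicator_def zero_less_mult_iff)
   have p: "norm z * (norm z * rh) ^ (?d - 1) = norm z ^ ?d * rh ^ (?d - 1)"
    using power_minus_mult[OF d, of "norm z"] by (simp add: power_mult_distrib mult_ac)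
   have "norm z * polar_density TYPE('a) (z, 0 + norm z * rh) = g z rh"
   proof -
    have "norm z * polar_density TYPE('a) (z, 0 + norm z * rh) = indicator {0<..1} (norm z) * indicator {0<..} rh * (real ?d * (norm z * (norm z * rh) ^ (?d - 1)))"
     unfolding polar_density_def prod.case add_0_left i by (simp only: mult_ac)
    thus ?thesis unfolding p g_def by (simp only: mult_ac)
   qed
   moreover have "polar_density TYPE('a) (z, 0 + norm z * rh) >= 0" by (rule polar_density_nonneg)
   ultimately have "ennreal (norm z) * ennreal (?I z rh) = ennreal (g z rh)"
    by (simp add: ennreal_mult[symmetric])
   thus "ennreal (norm z) * (f (?K z rh) * ennreal (?I z rh)) = f (rh *\<^sub>R z) * ennreal (g z rh)"
    using c by (simp add: mult.left_commute[of "ennreal (norm z)"])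
  qed
  finally show ?thesis .
 qed
 let ?C = "%x rh. indicator {norm x..} rh * (real ?d * inverse (rh ^ (?d + 1)))"
 let ?A = "%x rh. norm x ^ ?d * indicator (UNIV - {0}) x * ?C x rh"
 let ?D = "%rh. \<integral>\<^sup>+z. f (rh *\<^sub>R z) * ennreal (g z rh) \<partial>lborel"
 let ?F = "%x. \<integral>\<^sup>+rh. f x * ennreal (?A x rh) \<partial>lborel"
 let ?H = "%rh. \<integral>\<^sup>+x. f x * ennreal (?A x rh) \<partial>lborel"
 let ?J = "%rh x. f (rh *\<^sub>R (0 + (1/rh) *\<^sub>R x)) * ennreal (g (0 + (1/rh) *\<^sub>R x) rh)"
 let ?L = "%rh x. (1/rh) *\<^sub>R x"
 have "(\<integral>\<^sup>+z. (?B z) \<partial>lborel) = (\<integral>\<^sup>+rh. (?D rh) \<partial>lborel)"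
  by (rule lborel_pair.Fubini') measurable
 also have "... = (\<integral>\<^sup>+rh. (?H rh) \<partial>lborel)"
 proof (rule nn_integral_cong)
  fix rh :: real
  show "?D rh = ?H rh"
  proof (cases "rh > 0")
   case False
   hence z: "norm x ^ ?d * indicator (UNIV - {0}) x * ?C x rh = 0" for x :: 'a
    using zero_less_norm_iff[of x] by (cases "x = 0") (auto simp: indicator_def simp del: zero_less_norm_iff)
   show ?thesis unfolding z using False by (simp add: g_def)
  next
   case True
   have c: "1/rh \<noteq> 0" using True by simp
   have "?D rh =
    ennreal (\<bar>1/rh\<bar> ^ ?d) * (\<integral>\<^sup>+x. f (rh *\<^sub>R (0 + (1/rh) *\<^sub>R x)) * ennreal (g (0 + (1/rh) *\<^sub>R x) rh) \<partial>lborel)"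
    by (rule nn_integral_lborel_affine[OF _ c]) (auto simp: g_def)
   also have "... = (\<integral>\<^sup>+x. ennreal (\<bar>1/rh\<bar> ^ ?d) * ?J rh x \<partial>lborel)"
    by (subst nn_integral_cmult) (auto simp: g_def)
   also have "... = ?H rh"
   proof (intro nn_integral_cong)
    fix x :: 'a
    have i: "(indicator {0<..1} (norm (?L rh x)) :: real) = indicator (UNIV - {0}) x * indicator {norm x..} rh"
     using True by (auto simp: indicator_def divide_simps)
    have p: "(1/rh) ^ ?d * (norm (?L rh x) ^ ?d * rh ^ (?d - 1)) = norm x ^ ?d * inverse (rh ^ (?d + 1))"
    proof -
     obtain k where k: "?d = Suc k" using d by (cases "?d") auto
     show ?thesis unfolding k using True by (simp add: field_simps power_mult_distrib)
    qed
    have "(1/rh) ^ ?d * g (?L rh x) rh = indicator (UNIV - {0}) x * indicator {norm x..} rh * (real ?d * ((1/rh) ^ ?d * (norm (?L rh x) ^ ?d * rh ^ (?d - 1))))"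
     unfolding g_def i using True by simp
    also have "... = norm x ^ ?d * indicator (UNIV - {0}) x * ?C x rh"
     unfolding p by simp
    finally have e: "(1/rh) ^ ?d * g (?L rh x) rh = ..." .
    have "g (?L rh x) rh >= 0" by (simp add: g_def indicator_def)
    hence "ennreal (\<bar>1/rh\<bar> ^ ?d) * ennreal (g (?L rh x) rh) = ennreal (?A x rh)"
     using True unfolding e[symmetric] by (subst ennreal_mult) auto
    thus "ennreal (\<bar>1/rh\<bar> ^ ?d) * ?J rh x = f x * ennreal (?A x rh)"
     using True by (simp add: mult.left_commute)
   qed
   finally show ?thesis .
  qed
 qed
 also have "... = (\<integral>\<^sup>+x. (?F x) \<partial>lborel)"
  by (rule lborel_pair.Fubini'[symmetric]) (simp add: indicator_def, measurable)
 also have "... = (\<integral>\<^sup>+x. f x * indicator (UNIV - {0}) x \<partial>lborel)"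
 proof (intro nn_integral_cong)
  fix x :: 'a
  show "?F x = f x * indicator (UNIV - {0}) x"
  proof (cases "x = 0")
   case False
   hence x: "norm x > 0" by simp
   have "?F x
    = (\<integral>\<^sup>+rh. f x * ennreal (norm x ^ ?d) * ennreal (?C x rh) \<partial>lborel)"
    using False by (intro nn_integral_cong) (auto simp: mult.assoc ennreal_mult' split: split_indicator)
   also have "... = f x * ennreal (norm x ^ ?d) * ennreal (inverse (norm x ^ ?d))"
    by (subst nn_integral_cmult) (simp_all only: nn_integral_inverse_power_tail[OF x d], measurable)
   also have "... = f x" using x by (simp add: mult.assoc ennreal_mult[symmetric])
   finally show ?thesis using False by simp
  qed simp
 qed
 also have "... = (\<integral>\<^sup>+x. f x \<partial>lborel)"
  using AE_lborel_singleton[of "0::'a"] by (intro nn_integral_cong_AE) (auto elim: eventually_mono)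
 finally show ?thesis unfolding 1 by simp
qed

text \<open>Polar coordinates as an identity of measures, so that they also apply to Bochner
  integrals, by way of \<open>distr\<close> and \<open>density\<close>.\<close>

lemma lborel_polar:
 "lborel = distr (density (lborel \<Otimes>\<^sub>M lborel) (polar_density TYPE('a))) borel (%(z, r). (r / norm z) *\<^sub>R (z::'a::euclidean_space))"
proof (rule measure_eqI)
 fix A assume "A \<in> sets (lborel :: 'a measure)"
 hence [measurable]: "A \<in> sets borel" by simp
 have [measurable]: "(%(z::'a, r). (r / norm z) *\<^sub>R z) \<in> borel_measurable (lborel \<Otimes>\<^sub>M lborel)"
  unfolding measurable_cong_sets[OF sets_pair_measure_cong[OF sets_lborel sets_lborel] refl] by measurable
 let ?A = "density (lborel \<Otimes>\<^sub>M lborel) (polar_density TYPE('a))"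
 have "emeasure (distr ?A borel (%(z, r). (r / norm z) *\<^sub>R (z::'a))) A
  = (\<integral>\<^sup>+x. indicator A x \<partial>distr ?A borel (%(z, r). (r / norm z) *\<^sub>R (z::'a)))"
  by simp
 also have "... = (\<integral>\<^sup>+w. ennreal (polar_density TYPE('a) w) * indicator A ((%(z, r). (r / norm z) *\<^sub>R z) w) \<partial>(lborel \<Otimes>\<^sub>M lborel))"
  by (subst nn_integral_distr) (auto simp: nn_integral_density)
 also have "... = (\<integral>\<^sup>+z. (\<integral>\<^sup>+r. ennreal (polar_density TYPE('a) (z, r)) * indicator A ((r / norm z) *\<^sub>R z) \<partial>lborel) \<partial>lborel)"
  by (subst lborel.nn_integral_fst[symmetric]) auto
 also have "... = (\<integral>\<^sup>+x. indicator A x \<partial>lborel)"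
  by (subst nn_integral_polar[of "indicator A"]) (auto simp: mult.commute)
 finally show "emeasure lborel A = emeasure (distr ?A borel (%(z, r). (r / norm z) *\<^sub>R (z::'a))) A"
  by simp
qed simp

text \<open>The radial integral is estimated as a whole in each direction, so cancellation along
  rays is kept; taking absolute values at once would lose it. The factor d vol(unit ball) is the
  area of the unit sphere.\<close>

lemma norm_integral_polar_le:
 fixes f :: "'a::euclidean_space => complex"
 assumes f: "integrable lborel f"
  and B: "\<And>tt. norm tt = 1 ==> norm (LBINT r. indicator {0<..} r *\<^sub>R (r ^ (DIM('a) - 1) *\<^sub>R f (r *\<^sub>R tt))) <= B"
 shows "norm (integral\<^sup>L lborel f) <= real DIM('a) * measure lborel (cball (0::'a) 1) * B"
proof -
 let ?T = "%(z::'a, r). (r / norm z) *\<^sub>R z"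
 have [measurable]: "f \<in> mbl" using f by (auto dest: borel_measurable_integrable)
 have T [measurable]: "?T \<in> borel_measurable (lborel \<Otimes>\<^sub>M lborel)"
  unfolding measurable_cong_sets[OF sets_pair_measure_cong[OF sets_lborel sets_lborel] refl] by measurable
 obtain tt0 :: 'a where "norm tt0 = 1" using vector_choose_size[of 1] by auto
 hence B0: "B >= 0" using B norm_ge_zero order_trans by blast
 let ?A = "density (lborel \<Otimes>\<^sub>M lborel) (polar_density TYPE('a))"
 have i: "integrable (lborel \<Otimes>\<^sub>M lborel) (%w. polar_density TYPE('a) w *\<^sub>R f (?T w))"
 proof -
  have "integrable (distr ?A borel ?T) f"
   using f unfolding lborel_polar[where 'a='a, symmetric] .
  hence "integrable ?A (%w. f (?T w))"
   by (subst (asm) integrable_distr_eq) auto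
  thus ?thesis by (subst (asm) integrable_density) (auto simp: polar_density_nonneg)
 qed
 let ?B = "%z. LBINT r. polar_density TYPE('a) (z, r) *\<^sub>R f ((r / norm z) *\<^sub>R z)"
 let ?C = "%r z. r ^ (DIM('a) - 1) *\<^sub>R f (r *\<^sub>R ((1 / norm z) *\<^sub>R z))"
 let ?D = "real DIM('a) * B"
 have "integral\<^sup>L lborel f = integral\<^sup>L (distr ?A borel ?T) f"
  unfolding lborel_polar[where 'a='a, symmetric] ..
 also have "... = (\<integral>w. polar_density TYPE('a) w *\<^sub>R f (?T w) \<partial>(lborel \<Otimes>\<^sub>M lborel))"
  by (subst integral_distr) (auto simp: integral_density polar_density_nonneg)
 also have "... = (LBINT z. (?B z))"
  using lborel_pair.integral_fst'[OF i] by simp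
 also have "norm ... <= (LBINT z. indicator (cball 0 1) (z::'a) * ?D)"
 proof (rule Bochner_Integration.integral_norm_bound_integral)
  show "integrable lborel (%z. LBINT r. polar_density TYPE('a) (z, r) *\<^sub>R f ((r / norm z) *\<^sub>R z))"
   using lborel_pair.integrable_fst'[OF i] by simp
  show "integrable lborel (%z. indicator (cball 0 1) (z::'a) * ?D)"
   using emeasure_lborel_cball_finite[of "0::'a" 1] by (intro integrable_mult_left integrable_real_indicator) (auto simp: less_top)
  fix z :: 'a
  show "norm (?B z) <= indicator (cball 0 1) z * ?D"
  proof (cases "z = 0 \<or> norm z > 1")
   case True
   hence "polar_density TYPE('a) (z, r) = 0" for r by (auto simp: polar_density_def)
   thus ?thesis using B0 by simp
  next
   case False
   have "(%r. polar_density TYPE('a) (z, r) *\<^sub>R f ((r / norm z) *\<^sub>R z)) = (%r. real DIM('a) *\<^sub>R (indicator {0<..} r *\<^sub>R (?C r z)))"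
    using False by (auto simp: polar_density_def fun_eq_iff mult_ac)
   hence "norm (?B z) = real DIM('a) * norm (LBINT r. indicator {0<..} r *\<^sub>R (?C r z))"
    by (simp only: integral_scaleR_right norm_scaleR abs_of_nat)
   also have "... <= real DIM('a) * B" using False by (intro mult_left_mono B) auto
   finally show ?thesis using False by simp
  qed
 qed
 also have "... = real DIM('a) * measure lborel (cball (0::'a) 1) * B" by simp
 finally show ?thesis .
qed

lemma nn_integral_radial:
 fixes ph :: "real => ennreal"
 assumes [measurable]: "ph \<in> mbl"
 shows "(\<integral>\<^sup>+x. ph (norm (x::'a::euclidean_space)) \<partial>lborel) =
  emeasure lborel (cball (0::'a) 1) * (\<integral>\<^sup>+r. ph r * ennreal (indicator {0<..} r * (real DIM('a) * r ^ (DIM('a) - 1))) \<partial>lborel)"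
proof -
 let ?C = "%r. indicator {0<..} r * (real DIM('a) * r ^ (DIM('a) - 1))"
 let ?A = "\<integral>\<^sup>+r. ph r * ennreal (?C r) \<partial>lborel"
 let ?B = "cball 0 1 - {0}"
 let ?D = "%z r. polar_density TYPE('a) (z, r)"
 have "(\<integral>\<^sup>+x. ph (norm (x::'a)) \<partial>lborel) = (\<integral>\<^sup>+z. (\<integral>\<^sup>+r. ph (norm ((r / norm z) *\<^sub>R (z::'a))) * ennreal (?D z r) \<partial>lborel) \<partial>lborel)"
  by (rule nn_integral_polar[of "%x. ph (norm x)"]) measurable
 also have "... = (\<integral>\<^sup>+z. indicator ?B z * ?A \<partial>(lborel :: 'a measure))"
 proof (intro nn_integral_cong)
  fix z :: 'a
  show "(\<integral>\<^sup>+r. ph (norm ((r / norm z) *\<^sub>R z)) * ennreal (?D z r) \<partial>lborel) = indicator ?B z * ?A"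
  proof (cases "z \<in> cball 0 1 - {0}")
   case True
   hence "ph (norm ((r / norm z) *\<^sub>R z)) * ennreal (?D z r) = ph r * ennreal (?C r)" for r
    by (cases "r > 0") (auto simp: polar_density_def)
   thus ?thesis using True by simp
  next
   case False
   hence "polar_density TYPE('a) (z, r) = 0" for r by (auto simp: polar_density_def)
   thus ?thesis using False by simp
  qed
 qed
 also have "... = (\<integral>\<^sup>+z. indicator ?B z \<partial>(lborel :: 'a measure)) * ?A"
  by (rule nn_integral_multc) (auto intro: borel_measurable_indicator)
 also have "(\<integral>\<^sup>+z. indicator ?B z \<partial>(lborel :: 'a measure)) = emeasure lborel (cball (0::'a) 1)"
  by (subst nn_integral_indicator) (auto intro!: emeasure_Diff_null_set)
 finally show ?thesis .
qed

lemma integrable_radial: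
 fixes ph :: "real => real"
 assumes [measurable]: "ph \<in> mbl" and nn: "\<And>r. ph r >= 0"
  and i: "integrable lborel (%r. indicator {0<..} r * (r ^ (DIM('a) - 1) * ph r))"
 shows "integrable lborel (%x::'a::euclidean_space. ph (norm x))"
  and "(LBINT x. ph (norm (x::'a))) =
   real DIM('a) * measure lborel (cball (0::'a) 1) * (LBINT r. indicator {0<..} r * (r ^ (DIM('a) - 1) * ph r))"
proof -
 let ?B = "DIM('a) - 1"
 let ?I = "LBINT r. indicator {0<..} r * (r ^ ?B * ph r)"
 have I0: "?I >= 0" by (intro integral_nonneg_AE AE_I2) (auto simp: indicator_def nn)
 let ?A = "real DIM('a) * ?I"
 have "(\<integral>\<^sup>+r. ennreal (ph r) * ennreal (indicator {0<..} r * (real DIM('a) * r ^ ?B)) \<partial>lborel)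
  = (\<integral>\<^sup>+r. ennreal (real DIM('a) * (indicator {0<..} r * (r ^ ?B * ph r))) \<partial>lborel)"
  using nn by (intro nn_integral_cong) (auto simp: ennreal_mult[symmetric] mult_ac split: split_indicator)
 also have "... = ennreal (LBINT r. real DIM('a) * (indicator {0<..} r * (r ^ ?B * ph r)))"
  using i nn by (intro nn_integral_eq_integral) (auto split: split_indicator intro!: AE_I2)
 also have "... = ennreal ?A" by simp
 finally have "(\<integral>\<^sup>+x. ennreal (ph (norm (x::'a))) \<partial>lborel) = ennreal (measure lborel (cball (0::'a) 1)) * ennreal ?A"
  using nn_integral_radial[of "%r. ennreal (ph r)", where 'a='a]
   emeasure_eq_ennreal_measure[of lborel "cball (0::'a) 1"] emeasure_lborel_cball_finite[of "0::'a" 1]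
  by simp
 also have "... = ennreal (measure lborel (cball (0::'a) 1) * ?A)"
  using I0 by (subst ennreal_mult) auto
 finally have nn': "(\<integral>\<^sup>+x. ennreal (ph (norm (x::'a))) \<partial>lborel) = ennreal (measure lborel (cball (0::'a) 1) * ?A)" .
 have "has_bochner_integral lborel (%x. ph (norm (x::'a))) (measure lborel (cball (0::'a) 1) * ?A)"
  using nn I0 nn' by (intro has_bochner_integral_nn_integral) auto
 thus "integrable lborel (%x::'a. ph (norm x))"
  "(LBINT x. ph (norm (x::'a))) = real DIM('a) * measure lborel (cball (0::'a) 1) * ?I"
  by (auto simp: has_bochner_integral_iff mult_ac)
qed

section \<open>Measurability, Fubini under a product majorant, and Gaussian majorants\<close>

lemma csqrt_measurable [measurable]: "csqrt \<in> mbl"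
proof -
 have "csqrt = (%z. of_real (sqrt ((cmod z + Re z) / 2)) + \<i> * of_real ((if Im z = 0 then 1 else sgn (Im z)) * sqrt ((cmod z - Re z) / 2)))"
  by (auto simp: fun_eq_iff complex_eq_iff)
 also have "... \<in> mbl" by measurable
 finally show ?thesis .
qed

lemma gk_measurable2 [measurable (raw)]:
 assumes [measurable]: "f \<in> borel_measurable M" "g \<in> borel_measurable M"
 shows "(%w. gk (f w) (g w :: 'a::euclidean_space)) \<in> borel_measurable M"
 unfolding gk_def by measurable

lemma borel_pair_lborel [simp]:
 "borel_measurable (lborel \<Otimes>\<^sub>M lborel) = borel_measurable (borel \<Otimes>\<^sub>M borel)"
 by (intro measurable_cong_sets sets_pair_measure_cong) auto

text \<open>A majorant of product form u(x) v(y) makes the integrand integrable on the product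
  space; this is the shape in which every later exchange of integrals is justified.\<close>

lemma
 fixes f :: "'a::euclidean_space => 'b::euclidean_space => complex"
 assumes m: "(%(x, y). f x y) \<in> borel_measurable (borel \<Otimes>\<^sub>M borel)"
  and le: "\<And>x y. norm (f x y) <= u x * v y"
  and u: "integrable lborel u" and v: "integrable lborel v"
 shows Fubini_dominated: "(LBINT x. (LBINT y. f x y)) = (LBINT y. (LBINT x. f x y))"
  and Fubini_dominated_fst: "integrable lborel (%x. LBINT y. f x y)"
  and Fubini_dominated_snd: "integrable lborel (%y. LBINT x. f x y)"
proof -
 have [measurable]: "u \<in> mbl" "v \<in> mbl"
  using u v by (auto dest: borel_measurable_integrable)
 let ?A = "%(x, y). u x * v y"
 have iuv: "integrable (lborel \<Otimes>\<^sub>M lborel) ?A"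
 proof (rule lborel_pair.Fubini_integrable)
  show "?A \<in> borel_measurable (lborel \<Otimes>\<^sub>M lborel)"
   unfolding borel_pair_lborel by measurable
  show "integrable lborel (%x. LBINT y. norm (case (x, y) of (x, y) => u x * v y))"
   using u by (simp add: abs_mult integrable_mult_left integrable_abs)
  show "AE x in lborel. integrable lborel (%y. case (x, y) of (x, y) => u x * v y)"
   using v by (intro AE_I2) simp
 qed
 have i: "integrable (lborel \<Otimes>\<^sub>M lborel) (%(x, y). f x y)"
 proof (rule integrable_bound[OF iuv])
  show "(%(x, y). f x y) \<in> borel_measurable (lborel \<Otimes>\<^sub>M lborel)" unfolding borel_pair_lborel by (rule m)
 qed (auto intro!: AE_I2 order_trans[OF le abs_ge_self] simp del: abs_mult)
 show "(LBINT x. (LBINT y. f x y)) = (LBINT y. (LBINT x. f x y))"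
  using lborel_pair.Fubini_integral[OF i] by simp
 show "integrable lborel (%x. LBINT y. f x y)" using lborel_pair.integrable_fst[OF i] .
 show "integrable lborel (%y. LBINT x. f x y)" using lborel_pair.integrable_snd[OF i] .
qed

lemma integrable_bounded_support:
 fixes f :: "'a::euclidean_space => 'b::{banach, second_countable_topology}"
 assumes "f \<in> mbl" "\<And>x. norm (f x) <= B" "\<And>x. norm x > R ==> f x = 0"
 shows "integrable lborel f"
proof (rule integrableI_bounded_set[where A="cball 0 R" and B=B])
 show "emeasure lborel (cball (0::'a) R) < \<infinity>" using emeasure_lborel_cball_finite by (auto simp: less_top)
qed (use assms in auto)

lemma integrable_gaussian:
 assumes "a > 0"
 shows "integrable lborel (%x::'a::euclidean_space. exp (- a * (x \<bullet> x)))"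
proof -
 let ?A = "1 / (4 * a)"
 have "integrable lborel (%x::'a. norm (gk (of_real ?A) x))"
  using assms by (intro integrable_norm integrable_gk) simp
 hence "integrable lborel (%x::'a. norm (gk (of_real ?A) x) * sqrt (4 * pi * ?A) ^ DIM('a))"
  by (rule integrable_mult_left)
 moreover have "norm (gk (of_real ?A) x) * sqrt (4 * pi * ?A) ^ DIM('a) = exp (- a * (x \<bullet> x))" for x :: 'a
  using assms by (simp add: norm_gk norm_divide norm_mult power2_eq_square)
 ultimately show ?thesis by (simp only:)
qed

lemma mult_exp_neg_le: "y * exp (- a * y) <= (2 / a) * exp (- (a/2) * y)" if "a > 0" for a y :: real
proof -
 have "(a/2) * y <= exp ((a/2) * y)" using exp_ge_add_one_self[of "(a/2)*y"] by linarith
 hence "y <= (2/a) * exp ((a/2) * y)" using that by (simp add: field_simps)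
 hence "y * exp (- a * y) <= (2/a) * exp ((a/2) * y) * exp (- a * y)" by (rule mult_right_mono) simp
 also have "... = (2/a) * exp (- (a/2) * y)" by (simp add: mult_exp_exp algebra_simps)
 finally show ?thesis .
qed

text \<open>The value \<open>\<Delta>g\<^sub>s(x) = (\<bar>x\<bar>\<^sup>2/(4s\<^sup>2) - d/(2s)) g\<^sub>s(x) = \<partial>\<^sub>s g\<^sub>s(x)\<close>.\<close>

definition lap_gk :: "complex => 'a::euclidean_space => complex" where
 "lap_gk s x = (of_real (x \<bullet> x) / (4 * s^2) - of_nat DIM('a) / (2 * s)) * gk s x"

lemma lap_gk_measurable2 [measurable (raw)]:
 assumes [measurable]: "f \<in> borel_measurable M" "g \<in> borel_measurable M"
 shows "(%w. lap_gk (f w) (g w :: 'a::euclidean_space)) \<in> borel_measurable M"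
 unfolding lap_gk_def by measurable

lemma gk_bound:
 fixes x :: "'a::euclidean_space"
 assumes "Re s >= a" "a > 0" "cmod s <= A"
 shows "norm (gk s x) <= exp (- (a / (4 * A^2)) * (x \<bullet> x)) / sqrt (4 * pi * a) ^ DIM('a)"
proof -
 have s: "cmod s >= a" using assms complex_Re_le_cmod[of s] by linarith
 have "a / (4 * A^2) <= Re s / (4 * (cmod s)^2)"
  using assms s by (intro frac_le) (auto intro!: power_mono)
 hence "exp (- (Re s / (4 * (cmod s)^2)) * (x \<bullet> x)) <= exp (- (a / (4 * A^2)) * (x \<bullet> x))"
  unfolding mult_minus_left exp_le_cancel_iff neg_le_iff_le by (rule mult_right_mono) simp
 thus ?thesis unfolding norm_gk using s assms by (intro frac_le) (auto intro!: power_mono)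
qed

lemma lap_gk_bound:
 fixes x :: "'a::euclidean_space"
 assumes "Re s >= a" "a > 0" "cmod s <= A"
 shows "norm (lap_gk s x) <= (8 * A^2 / (4 * a ^ 3) + real DIM('a) / (2 * a)) / sqrt (4 * pi * a) ^ DIM('a) * exp (- (a / (8 * A^2)) * (x \<bullet> x))"
proof -
 have s: "cmod s >= a" using assms complex_Re_le_cmod[of s] by linarith
 have A: "A > 0" using s assms by linarith
 let ?ap = "a / (4 * A^2)" let ?y = "x \<bullet> x"
 have ap: "?ap > 0" using assms A by auto
 have "norm (of_real ?y / (4 * s^2) - of_nat DIM('a) / (2 * s)) <= ?y / (4 * (cmod s)^2) + real DIM('a) / (2 * cmod s)"
  by (rule order_trans[OF norm_triangle_ineq4]) (simp add: norm_divide norm_mult norm_power)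
 also have "... <= ?y / (4 * a^2) + real DIM('a) / (2 * a)"
  using s assms by (intro add_mono divide_left_mono mult_left_mono power_mono mult_pos_pos) auto
 finally have 1: "norm (of_real ?y / (4 * s^2) - of_nat DIM('a) / (2 * s)) <= ?y / (4 * a^2) + real DIM('a) / (2 * a)" .
 let ?A = "4 * pi * a"
 have "norm (lap_gk s x) <= (?y / (4 * a^2) + real DIM('a) / (2 * a)) * (exp (- ?ap * ?y) / sqrt ?A ^ DIM('a))"
  unfolding lap_gk_def norm_mult using assms by (intro mult_mono 1 gk_bound) (auto intro!: add_nonneg_nonneg)
 also have "... = (1 / (4 * a^2) * (?y * exp (- ?ap * ?y)) + real DIM('a) / (2 * a) * exp (- ?ap * ?y)) / sqrt ?A ^ DIM('a)"
  by (simp add: field_simps)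
 finally have 2: "norm (lap_gk s x) <= ..." .
 let ?B = "?ap/2"
 have e: "exp (- ?ap * ?y) <= exp (- ?B * ?y)"
  using mult_right_mono[of "?ap/2" "?ap" ?y] ap unfolding mult_minus_left exp_le_cancel_iff neg_le_iff_le by simp
 note 2
 also have "(1 / (4 * a^2) * (?y * exp (- ?ap * ?y)) + real DIM('a) / (2 * a) * exp (- ?ap * ?y)) / sqrt ?A ^ DIM('a)
  <= (1 / (4 * a^2) * ((2 / ?ap) * exp (- ?B * ?y)) + real DIM('a) / (2 * a) * exp (- ?B * ?y)) / sqrt ?A ^ DIM('a)"
  using ap assms by (intro divide_right_mono add_mono mult_left_mono mult_exp_neg_le e) auto
 also have "... = (8 * A^2 / (4 * a ^ 3) + real DIM('a) / (2 * a)) / sqrt ?A ^ DIM('a) * exp (- ?B * ?y)"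
  using assms A by (simp add: field_simps power3_eq_cube power2_eq_square)
 also have "?ap / 2 = a / (8 * A^2)" by simp
 finally show ?thesis .
qed

text \<open>The heat equation along a vertical line of complex times. The factor
  \<open>iexp (t * E)\<close> makes the derivative i exp(itE) times (Laplacian + E) of the kernel,
  the expression to which the Schroedinger equation applies.\<close>

lemma gk_has_vector_derivative:
 fixes x :: "'a::euclidean_space"
 assumes a: "a > 0"
 shows "((%t. iexp (t * E) * gk (of_real a + \<i> * of_real t) x) has_vector_derivative
  \<i> * iexp (t * E) * (lap_gk (of_real a + \<i> * of_real t) x + of_real E * gk (of_real a + \<i> * of_real t) x)) (at t)"
proof -
 define s where "s = of_real a + \<i> * of_real t"
 have s: "Re s > 0" using a by (simp add: s_def)
 have s0: "s \<noteq> 0" using s by auto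
 define K where "K w = csqrt (4 * of_real pi * w)" for w
 have K0: "K s \<noteq> 0" unfolding K_def by (rule csqrt_4pi_nonzero[OF s])
 have K2: "K s * K s = 4 * of_real pi * s" unfolding K_def by (simp flip: power2_eq_square)
 have np: "4 * of_real pi * s \<notin> \<real>\<^sub>\<le>\<^sub>0" using s by (auto simp: complex_nonpos_Reals_iff mult_le_0_iff not_le)
 obtain k where k: "DIM('a) = Suc k" by (metis DIM_positive Suc_pred)
 have dK: "(K has_field_derivative (4 * of_real pi / (2 * K s))) (at s)"
  unfolding K_def by (rule has_field_derivative_csqrt') (auto intro!: derivative_eq_intros np)
 let ?D = "x \<bullet> x"
 let ?A = "- of_real ?D / (4 * s)"
 let ?B = "of_real ?D / (4 * s^2)"
 have dE: "((%w. exp (- of_real ?D / (4 * w))) has_field_derivative exp ?A * ?B) (at s)"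
  using s0 by (auto intro!: derivative_eq_intros simp: power2_eq_square field_simps)
 let ?C = "of_nat (Suc k) * (4 * of_real pi / (2 * K s) * K s ^ (Suc k - Suc 0))"
 let ?G = "K s ^ Suc k * K s ^ Suc k"
 have "((%w. exp (- of_real ?D / (4 * w)) / K w ^ Suc k) has_field_derivative
   ((exp ?A * ?B) * K s ^ Suc k
    - exp ?A * ?C) / ?G) (at s)"
  using K0 by (intro DERIV_divide dE DERIV_power dK) auto
 moreover have "((exp ?A * ?B) * K s ^ Suc k
    - exp ?A * ?C) / ?G
   = lap_gk s x"
 proof -
  have e: "4 * of_real pi / (2 * K s) * K s ^ (Suc k - Suc 0) = K s ^ Suc k / (2 * s)"
  proof -
   have "4 * of_real pi = K s * K s / s" using K2 s0 by (simp add: field_simps)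
   thus ?thesis using K0 s0 by (simp add: field_simps)
  qed
  show ?thesis unfolding e lap_gk_def gk_def K_def[symmetric] k using K0 by (simp add: field_simps)
 qed
 ultimately have "(gk2 has_field_derivative lap_gk s x) (at s)" if "gk2 = (%w. gk w x)" for gk2
  unfolding that gk_def K_def[symmetric] k by simp
 hence dg: "((%w. gk w x) has_field_derivative lap_gk s x) (at s)" by blast
 let ?F = "%t. \<i> * (of_real t * of_real E)"
 have "((%z. exp (\<i> * (z * of_real E)) * gk (of_real a + \<i> * z) x) has_field_derivative
   exp (?F t) * (lap_gk s x * \<i>) + exp (?F t) * (\<i> * of_real E) * gk s x) (at (of_real t))"
 proof (rule DERIV_mult'[THEN DERIV_cong])
  show "((%z. exp (\<i> * (z * of_real E))) has_field_derivative exp (?F t) * (\<i> * of_real E)) (at (of_real t))"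
   by (auto intro!: derivative_eq_intros)
  show "((%z. gk (of_real a + \<i> * z) x) has_field_derivative lap_gk s x * \<i>) (at (of_real t))"
   by (rule DERIV_chain2[where f="%w. gk w x"]) (use dg in \<open>auto simp: s_def intro!: derivative_eq_intros\<close>)
 qed (simp add: s_def)
 from has_vector_derivative_real_field[OF this] show ?thesis
  by (simp add: s_def algebra_simps)
qed

lemma ridge_zero:
 fixes H :: "'a::euclidean_space => nat => real => complex"
 assumes supp: "\<And>b t m. b \<in> Basis ==> \<bar>t\<bar> > R ==> H b m t = 0" and x: "norm x > real DIM('a) * R"
 shows "ridge H m x = 0"
proof -
 have "\<exists>b\<in>Basis. \<bar>x \<bullet> b\<bar> > R"
 proof (rule ccontr)
  assume "\<not> ?thesis"
  hence "(\<Sum>b\<in>Basis. \<bar>x \<bullet> b\<bar>) <= (\<Sum>b\<in>(Basis::'a set). R)" by (intro sum_mono) auto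
  thus False using norm_le_l1[of x] x by simp
 qed
 thus ?thesis unfolding ridge_def using supp by (metis finite_Basis prod_zero)
qed

lemma ridge_bounded:
 fixes H :: "'a::euclidean_space => nat => real => complex"
 assumes H: "\<And>b. b \<in> Basis ==> dfam (H b)" and supp: "\<And>b t m. b \<in> Basis ==> \<bar>t\<bar> > R ==> H b m t = 0"
 obtains K where "\<And>x. norm (ridge H m x) <= K"
proof -
 have "compact (ridge H m ` cball 0 (real DIM('a) * R))"
  by (intro compact_continuous_image ridge_continuous H) auto
 then obtain K where K: "\<forall>x\<in>ridge H m ` cball 0 (real DIM('a) * R). norm x <= K"
  using compact_imp_bounded bounded_iff by metis
 have "norm (ridge H m x) <= max K 0" for x
 proof (cases "norm x <= real DIM('a) * R")
  case True thus ?thesis using K by (auto simp: le_max_iff_disj)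
 next
  case False
  hence "ridge H m x = 0" by (intro ridge_zero supp) auto
  thus ?thesis by simp
 qed
 with that show ?thesis by blast
qed

section \<open>Gaussian evolution of weak solutions\<close>

text \<open>The bound and the support condition on V are pointwise; a suitable representative of the
  potential is chosen only in the final proof.\<close>

locale weak_sol =
 fixes V ps :: "'a::euclidean_space => complex" and E CV rh B :: real
 assumes V_meas [measurable]: "V \<in> mbl"
  and V_bdd: "\<And>x. norm (V x) <= CV"
  and V_supp: "\<And>x. norm x > rh ==> V x = 0"
  and ps_cont: "continuous_on UNIV ps"
  and ps_bdd: "\<And>x. norm (ps x) <= B"
  and weak: "weak_schroedinger_sol V E ps"
begin

lemma ps_meas [measurable]: "ps \<in> mbl"
 using ps_cont by (rule borel_measurable_continuous_onI)

lemma B_nonneg: "B >= 0" using ps_bdd[of 0] norm_ge_zero order_trans by blast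

lemma CV_nonneg: "CV >= 0" using V_bdd[of 0] norm_ge_zero order_trans by blast

text \<open>The weak equation is tested with the real and the imaginary part of the product
  separately and recombined linearly; integrability of both parts is what permits this.\<close>

lemma weak_ridge:
 assumes H: "\<And>b. b \<in> Basis ==> dfam (H b)" and supp: "\<And>b t m. b \<in> Basis ==> \<bar>t\<bar> > R ==> H b m t = 0"
 shows "(LBINT x. ps x * (- (\<Sum>b\<in>Basis. ridge H ((%_. 0)(b := 2)) x) + (V x - of_real E) * ridge H (%_. 0) x)) = 0"
proof -
 let ?A = "%_. 0"
 let ?ph = "ridge H ?A"
 let ?D = "%b. ridge H (?A(b := 2))"
 let ?G = "%L x. \<Sum>b\<in>Basis. L (?D b x)"
 define I where "I L x = ps x * (of_real (- ?G L x) + (V x - of_real E) * of_real (L (?ph x)))" for L :: "complex => real" and x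
 have mr [measurable]: "ridge H m \<in> mbl" for m
  by (intro borel_measurable_continuous_onI ridge_continuous H)
 let ?C = "%K KL. \<Sum>b\<in>Basis. K (?A(b := 2)) * KL"
 let ?F = "CV + \<bar>E\<bar>"
 let ?H = "%L. %x. L (?ph x)"
 have I: "integral\<^sup>L lborel (I L) = 0 \<and> integrable lborel (I L)" if L: "bounded_linear L" for L
 proof
  have tf: "test_fun (?H L)" by (rule test_fun_ridge[OF H L supp])
  have lap: "laplacian (?H L) x = ?G L x" for x
   unfolding laplacian_def
  proof (intro sum.cong refl)
   fix b :: 'a assume b: "b \<in> Basis"
   have "(%c. 0 + count_list [b, b] c) = ?A(b := 2)" by auto
   thus "pdiffs [b, b] (?H L) x = L (?D b x)"
    using pdiffs_ridge[of H "[b, b]" L "%_. 0"] H L b by simp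
  qed
  show "integral\<^sup>L lborel (I L) = 0"
   using weak[unfolded weak_schroedinger_sol_def, rule_format, OF tf] unfolding lap I_def .
  have [measurable]: "L \<in> mbl"
   using L by (intro borel_measurable_continuous_onI linear_continuous_on)
  obtain KL where KL: "\<And>z. norm (L z) <= norm z * KL" "KL > 0" using bounded_linear.pos_bounded[OF L] by blast
  have "\<exists>K. \<forall>x. norm (ridge H m x) <= K" for m
  proof -
   obtain K where "\<And>x. norm (ridge H m x) <= K" by (rule ridge_bounded[where H=H and R=R and m=m]) (use H supp in auto)
   thus ?thesis by blast
  qed
  then obtain K where K: "\<And>m x. norm (ridge H m x) <= K m" by metis
  have LK: "\<bar>L (ridge H m x)\<bar> <= K m * KL" for m x
   using KL(1)[of "ridge H m x"] K[of m x] KL(2) by (smt (verit) mult_right_mono real_norm_def)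
  have K0: "K m >= 0" for m using K[of m 0] norm_ge_zero order_trans by blast
  show "integrable lborel (I L)"
  proof (rule integrable_bounded_support)
   show "I L \<in> mbl" unfolding I_def by measurable
   fix x
   have "norm (I L x) <= B * (?C K KL + ?F * (K ?A * KL))"
    unfolding I_def norm_mult
   proof (rule mult_mono)
    show "norm (complex_of_real (- ?G L x) + (V x - complex_of_real E) * complex_of_real (L (?ph x)))
     <= ?C K KL + ?F * (K ?A * KL)"
    proof (rule norm_triangle_mono)
     show "norm (complex_of_real (- ?G L x)) <= ?C K KL"
      unfolding norm_of_real abs_minus_cancel by (intro order_trans[OF sum_abs] sum_mono LK)
     have "norm (V x - of_real E) <= CV + \<bar>E\<bar>" using V_bdd[of x] norm_triangle_ineq4[of "V x" "of_real E"] by simp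
     thus "norm ((V x - complex_of_real E) * complex_of_real (L (?ph x))) <= ?F * (K ?A * KL)"
      unfolding norm_mult norm_of_real by (intro mult_mono LK) (auto simp: CV_nonneg)
    qed
   qed (use ps_bdd B_nonneg in auto)
   thus "norm (I L x) <= B * (?C K KL + ?F * (K ?A * KL))" .
   assume "norm x > real DIM('a) * R"
   hence "ridge H m x = 0" for m by (intro ridge_zero supp)
   thus "I L x = 0" using bounded_linear.linear[OF L] by (simp add: I_def linear_0)
  qed
 qed
 let ?B = "%x. - (\<Sum>b\<in>Basis. ?D b x) + (V x - of_real E) * ?ph x"
 have "ps x * ?B x = I Re x + \<i> * I Im x" for x
 proof -
  have "(\<Sum>b\<in>Basis. ?D b x) = of_real (\<Sum>b\<in>Basis. Re (?D b x)) + \<i> * of_real (\<Sum>b\<in>Basis. Im (?D b x))"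
   by (simp add: complex_eq_iff)
  moreover have "?ph x = of_real (Re (?ph x)) + \<i> * of_real (Im (?ph x))" by (simp add: complex_eq_iff)
  ultimately have "ps x * ?B x =
    ps x * (- (of_real (\<Sum>b\<in>Basis. Re (?D b x)) + \<i> * of_real (\<Sum>b\<in>Basis. Im (?D b x))) + (V x - of_real E) * (of_real (Re (?ph x)) + \<i> * of_real (Im (?ph x))))"
   by (simp only:)
  thus ?thesis unfolding I_def by (simp add: algebra_simps)
 qed
 hence "(LBINT x. ps x * ?B x) = integral\<^sup>L lborel (%x. I Re x + \<i> * I Im x)"
  by simp
 also have "... = 0"
  using I[OF bounded_linear_Re] I[OF bounded_linear_Im] by (subst integral_add) auto
 finally show ?thesis .
qed

end

text \<open>One coordinate factor of \<open>gk\<close>, as an entire function of z, so that its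
  derivative family comes for free from complex analysis.\<close>

definition gfun :: "complex => complex => complex => complex" where
 "gfun s c z = exp (- ((z - c)^2) / (4 * s)) / csqrt (4 * of_real pi * s)"

definition gfam :: "complex => real => nat => real => complex" where
 "gfam s c m t = (deriv ^^ m) (gfun s (of_real c)) (of_real t)"

lemma dfam_gfam: "dfam (gfam s c)"
 unfolding gfam_def[abs_def] gfun_def[abs_def] divide_inverse by (intro dfam_entire holomorphic_intros)

lemma gfun_deriv:
 assumes "s \<noteq> 0"
 shows "deriv (gfun s c) = (%z. (- (z - c) / (2 * s)) * gfun s c z)"
  and "deriv (%z. (- (z - c) / (2 * s)) * gfun s c z) = (%z. ((z - c)^2 / (4 * s^2) - 1 / (2 * s)) * gfun s c z)"
proof -
 have d: "(gfun s c has_field_derivative (- (z - c) / (2 * s)) * gfun s c z) (at z)" for z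
  unfolding gfun_def using assms by (auto intro!: derivative_eq_intros simp: power2_eq_square field_simps simp del: csqrt.sel)
 let ?A = "%z. (- (z - c) / (2 * s)) * gfun s c z"
 show "deriv (gfun s c) = ?A"
  using d by (intro ext DERIV_imp_deriv)
 have "(?A has_field_derivative ((z - c)^2 / (4 * s^2) - 1 / (2 * s)) * gfun s c z) (at z)" for z
  using assms by (auto intro!: derivative_eq_intros d simp: power2_eq_square field_simps)
 thus "deriv ?A = (%z. ((z - c)^2 / (4 * s^2) - 1 / (2 * s)) * gfun s c z)"
  by (intro ext DERIV_imp_deriv)
qed

lemma gfam_0: "gfam s c 0 t = exp (- of_real ((t - c)^2) / (4 * s)) / csqrt (4 * of_real pi * s)"
 by (simp add: gfam_def gfun_def)

lemma gfam_1: "s \<noteq> 0 ==> gfam s c (Suc 0) t = (- of_real (t - c) / (2 * s)) * gfam s c 0 t"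
 by (simp add: gfam_def gfun_deriv)

lemma gfam_2: "s \<noteq> 0 ==> gfam s c 2 t = (of_real ((t - c)^2) / (4 * s^2) - 1 / (2 * s)) * gfam s c 0 t"
 by (simp only: gfam_def numeral_2_eq_2 funpow.simps o_apply id_apply gfun_deriv not_False_eq_True of_real_diff of_real_power)

lemma integrable_gfam:
 assumes s: "Re s > 0" and m: "m <= 2"
 shows "integrable lborel (%t. norm (gfam s c m t))"
proof -
 have s0: "s \<noteq> 0" using s by auto
 let ?K = "norm (csqrt (4 * of_real pi * s))"
 define ap where "ap = Re s / (4 * (cmod s)^2)"
 have ap: "ap > 0" using s s0 by (simp add: ap_def)
 have [measurable]: "gfam s c m \<in> mbl" for m
  by (intro borel_measurable_continuous_onI dfam_continuous dfam_gfam)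
 let ?A = "%t. - ap * (- c + 1 * t)^2"
 have i: "integrable lborel (%t. \<bar>- c + 1 * t\<bar> ^ k * exp (?A t))" for k
  by (rule lborel_integrable_real_affine[OF integrable_gaussian_real[OF ap]]) simp
 have n0: "norm (gfam s c 0 t) = exp (?A t) / ?K" for t
  unfolding gfam_0 norm_divide norm_gaussian by (simp add: ap_def)
 let ?B = "1 / (2 * cmod s)"
 have n1: "norm (gfam s c (Suc 0) t) <= ?B * (\<bar>- c + 1 * t\<bar> ^ 1 * exp (?A t)) / ?K" for t
  unfolding gfam_1[OF s0] norm_mult n0 norm_divide norm_minus_cancel norm_of_real by simp
 let ?C = "1 / (4 * (cmod s)^2)"
 let ?D = "%t. \<bar>- c + 1 * t\<bar> ^ 2 * exp (?A t)"
 let ?F = "%t. \<bar>- c + 1 * t\<bar> ^ 0 * exp (?A t)"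
 have n2: "norm (gfam s c 2 t) <= ?C * ?D t / ?K + ?B * ?F t / ?K" for t
 proof -
  have "norm (of_real ((t - c)^2) / (4 * s^2) - 1 / (2 * s)) <= ?C * \<bar>- c + 1 * t\<bar> ^ 2 + ?B"
   by (rule order_trans[OF norm_triangle_ineq4]) (simp add: norm_divide norm_mult norm_power del: of_real_diff of_real_power)
  hence "norm (gfam s c 2 t) <= (?C * \<bar>- c + 1 * t\<bar> ^ 2 + ?B) * (exp (?A t) / ?K)"
   unfolding gfam_2[OF s0] norm_mult n0 by (intro mult_right_mono) auto
  also have "... = ?C * ?D t / ?K + ?B * ?F t / ?K"
   by (simp only: power_0 mult_1 distrib_right times_divide_eq_right mult.assoc add_divide_distrib)
  finally show ?thesis .
 qed
 consider "m = 0" | "m = Suc 0" | "m = 2" using m by linarith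
 thus ?thesis
 proof cases
  case 1 show ?thesis unfolding 1 n0 using i[of 0] by (intro integrable_divide) simp
 next
  case 2
  have "integrable lborel (%t. ?B * (\<bar>- c + 1 * t\<bar> ^ 1 * exp (?A t)) / ?K)"
   by (intro integrable_divide integrable_mult_right i)
  thus ?thesis unfolding 2 by (rule integrable_bound) (use n1 in \<open>auto intro!: AE_I2 order_trans[OF n1 abs_ge_self]\<close>)
 next
  case 3
  have "integrable lborel (%t. ?C * ?D t / ?K + ?B * ?F t / ?K)"
   by (intro integrable_add integrable_divide integrable_mult_right i)
  thus ?thesis unfolding 3 by (rule integrable_bound) (use n2 in \<open>auto intro!: AE_I2 order_trans[OF n2 abs_ge_self]\<close>)
 qed
qed

lemma ridge_gfam_0: "ridge (%b. gfam s (c \<bullet> b)) (%_. 0) x = gk s (x - c)"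
 unfolding ridge_def gfam_0 gk_prod by (simp add: inner_diff_left)

lemma ridge_gfam_2:
 fixes x c :: "'a::euclidean_space"
 assumes s: "s \<noteq> 0"
 shows "(\<Sum>b\<in>Basis. ridge (%b. gfam s (c \<bullet> b)) ((%_. 0)(b := 2)) x) = lap_gk s (x - c)"
proof -
 let ?A = "%b. of_real ((x \<bullet> b - c \<bullet> b)^2) / (4 * s^2) - 1 / (2 * s)"
 let ?B = "%b. gfam s (c \<bullet> b)"
 let ?C = "%_. 0"
 let ?D = "\<Sum>b\<in>Basis. (?A b)"
 have "ridge ?B (?C(b := 2)) x = ?A b * gk s (x - c)"
  if b: "b \<in> Basis" for b
 proof -
  have "ridge ?B (?C(b := 2)) x = gfam s (c \<bullet> b) 2 (x \<bullet> b) * (\<Prod>b\<in>Basis-{b}. gfam s (c \<bullet> b) 0 (x \<bullet> b))"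
   unfolding ridge_def prod.remove[OF finite_Basis b] by (intro arg_cong2[where f="(*)"] prod.cong) simp_all
  also have "... = ?A b * ridge ?B ?C x"
   unfolding gfam_2[OF s] ridge_def prod.remove[OF finite_Basis b] by (simp only: mult.assoc)
  finally show ?thesis unfolding ridge_gfam_0 .
 qed
 hence "(\<Sum>b\<in>Basis. ridge ?B (?C(b := 2)) x) = ?D * gk s (x - c)"
  by (simp add: sum_distrib_right)
 also have "?D = of_real ((x - c) \<bullet> (x - c)) / (4 * s^2) - of_nat DIM('a) / (2 * s)"
 proof -
  have "(x - c) \<bullet> (x - c) = (\<Sum>b\<in>Basis. (x \<bullet> b - c \<bullet> b)^2)"
   by (subst euclidean_inner) (simp add: inner_diff_left power2_eq_square)
  thus ?thesis by (simp only: of_real_sum sum_divide_distrib sum_subtractf) simp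
 qed
 finally show ?thesis unfolding lap_gk_def .
qed

context weak_sol
begin

text \<open>Gaussians are not compactly supported. They are multiplied by cut-offs that equal 1 on
  growing cubes; derivatives of order at most 2 stay under an integrable majorant independent of N,
  and dominated convergence removes the cut-off.\<close>

lemma weak_gk:
 assumes s: "Re s > 0"
 shows "(LBINT x. ps x * (- lap_gk s (x - c) + (V x - of_real E) * gk s (x - c))) = 0"
proof -
 have s0: "s \<noteq> 0" using s by auto
 obtain X :: "nat => nat => real => complex" where X: "\<And>N. dfam (X N)"
  "\<And>N t. \<bar>t\<bar> <= real N ==> X N 0 t = 1" "\<And>N m t. \<bar>t\<bar> <= real N ==> X N (Suc m) t = 0"
  "\<And>N m t. \<bar>t\<bar> >= real N + 1 ==> X N m t = 0"
  "\<And>m. \<exists>B. \<forall>N t. norm (X N m t) <= B" by (rule ex_smooth_cutoffs) blast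
 from X(5) obtain BX where BX: "\<And>N m t. norm (X N m t) <= BX m" by metis
 define G where "G b = gfam s (c \<bullet> b)" for b
 define H where "H N b = lfam (X N) (G b)" for N b
 have H: "dfam (H N b)" for N b unfolding H_def G_def by (intro dfam_lfam X dfam_gfam)
 have supp: "H N b m t = 0" if "\<bar>t\<bar> > real N + 1" for N b m t
  using that X(4) by (simp add: H_def lfam_def)
 have HG: "H N b m t = G b m t" if t: "\<bar>t\<bar> <= real N" for N b m t
 proof -
  have "H N b m t = (\<Sum>j\<in>{0}. of_nat (m choose j) * (X N j t * G b (m - j) t))"
   unfolding H_def lfam_def
  proof (intro sum.mono_neutral_right ballI)
   fix j assume "j \<in> {..m} - {0}"
   thus "of_nat (m choose j) * (X N j t * G b (m - j) t) = 0" using X(3)[OF t, of "j - 1"] by simp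
  qed auto
  thus ?thesis using X(2)[OF t] by simp
 qed
 have rG: "ridge (H N) m x = ridge G m x" if "norm x <= real N" for N m x
  unfolding ridge_def by (intro prod.cong refl HG order_trans[OF Basis_le_norm that])
 \<comment> \<open>Leibniz's formula with every cut-off derivative replaced by its bound, uniform in
   N. The product of these over the coordinates is the majorant \<open>W\<close>.\<close>
 define D where "D b m t = (\<Sum>j\<le>m. of_nat (m choose j) * (BX j * norm (G b (m - j) t)))" for b m t
 have D: "norm (H N b m t) <= D b m t" for N b m t
  unfolding H_def lfam_def D_def by (intro sum_norm_le) (auto simp: norm_mult intro!: mult_left_mono mult_right_mono BX)
 have Di: "integrable lborel (D b m)" if "m <= 2" for b m
  unfolding D_def[abs_def] G_def using s that
  by (intro integrable_sum integrable_mult_right integrable_gfam) auto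
 define W where "W m x = (\<Prod>b\<in>Basis. D b (m b) (x \<bullet> b))" for m and x :: 'a
 have Wi: "integrable lborel (W m)" if "\<And>b. m b <= 2" for m
  unfolding W_def by (intro integral_prod_Basis Di that)
 have rW: "norm (ridge (H N) m x) <= W m x" for N m x
  unfolding ridge_def W_def prod_norm[symmetric] by (intro prod_mono) (auto simp: D)
 have [measurable]: "ridge (H N) m \<in> mbl" for N m
  by (intro borel_measurable_continuous_onI ridge_continuous H)
 have [measurable]: "ridge G m \<in> mbl" for m
  unfolding G_def by (intro borel_measurable_continuous_onI ridge_continuous dfam_gfam)
 let ?B = "%_. 0"
 define F where "F H x = ps x * (- (\<Sum>b\<in>Basis. ridge H (?B(b := 2)) x) + (V x - of_real E) * ridge H ?B x)" for H x
 let ?A = "%x. (\<Sum>b\<in>Basis. W (?B(b := 2)) x) + (CV + \<bar>E\<bar>) * W ?B x"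
 have "(%N. integral\<^sup>L lborel (F (H N))) \<longlonglongrightarrow> integral\<^sup>L lborel (F G)"
 proof (rule integral_dominated_convergence[where w="%x. B * ?A x"])
  show "integrable lborel (%x. B * ?A x)"
   by (intro integrable_mult_right integrable_add integrable_sum Wi) auto
  show "AE x::'a in lborel. (%N. F (H N) x) \<longlonglongrightarrow> F G x"
  proof (rule AE_I2)
   fix x :: 'a
   obtain N0 :: nat where N0: "norm x <= real N0" using real_arch_simple by blast
   have "F (H N) x = F G x" if "N >= N0" for N
    using rG[of x N] N0 that unfolding F_def by simp
   thus "(%N. F (H N) x) \<longlonglongrightarrow> F G x"
    by (intro tendsto_eventually) (auto simp: eventually_sequentially)
  qed
  show "AE x::'a in lborel. norm (F (H N) x) <= B * ?A x" for N
  proof (rule AE_I2)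
   fix x
   have "norm (V x - of_real E) <= CV + \<bar>E\<bar>" using V_bdd[of x] norm_triangle_ineq4[of "V x" "of_real E"] by simp
   hence 1: "norm ((V x - of_real E) * ridge (H N) ?B x) <= (CV + \<bar>E\<bar>) * W ?B x"
    unfolding norm_mult by (intro mult_mono rW) (auto simp: CV_nonneg)
   have 2: "norm (- (\<Sum>b\<in>Basis. ridge (H N) (?B(b := 2)) x)) <= (\<Sum>b\<in>Basis. W (?B(b := 2)) x)"
    unfolding norm_minus_cancel by (intro sum_norm_le rW)
   show "norm (F (H N) x) <= B * ?A x"
    unfolding F_def norm_mult[of "ps x"] by (intro mult_mono ps_bdd norm_triangle_mono 1 2) (auto simp: B_nonneg)
  qed
 qed (auto simp: F_def[abs_def])
 moreover have "integral\<^sup>L lborel (F (H N)) = 0" for N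
  unfolding F_def by (rule weak_ridge[where R="real N + 1"]) (auto simp: H supp)
 ultimately have F0: "integral\<^sup>L lborel (F G) = 0" by (simp add: LIMSEQ_const_iff)
 have "F G x = ps x * (- lap_gk s (x - c) + (V x - of_real E) * gk s (x - c))" for x
  unfolding F_def G_def ridge_gfam_0 ridge_gfam_2[OF s0] ..
 thus ?thesis using F0 by presburger
qed

end

text \<open>Up to a factor i, the kernel of the outgoing resolvent of the negative Laplacian at
  energy E, written as a time integral of the free propagator, truncated at T and mollified at scale
  a.\<close>

definition GT :: "real => real => real => 'a::euclidean_space => complex" where
 "GT E a T x = (LBINT t. indicator {0..T} t *\<^sub>R (iexp (t * E) * gk (of_real a + \<i> * of_real t) x))"

lemma GT_measurable [measurable]: "GT E a T \<in> mbl"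
 unfolding GT_def[abs_def]
 by (rule lborel.borel_measurable_lebesgue_integral[of "%x t. indicator {0..T} t *\<^sub>R (iexp (t * E) * gk (of_real a + \<i> * of_real t) x)" borel, simplified case_prod_unfold])
   measurable

lemma gk_path_continuous:
 assumes "a > 0"
 shows "continuous_on A (%t. gk (of_real a + \<i> * of_real t) x)"
proof (intro continuous_at_imp_continuous_on ballI)
 fix t
 have "isCont (%t. iexp (t * 0) * gk (of_real a + \<i> * of_real t) x) t"
  by (rule has_vector_derivative_continuous[OF gk_has_vector_derivative[OF assms]])
 thus "isCont (%t. gk (of_real a + \<i> * of_real t) x) t" by simp
qed

lemma lap_gk_path_continuous:
 assumes "a > 0"
 shows "continuous_on A (%t. lap_gk (of_real a + \<i> * of_real t) x)"
proof -
 have "of_real a + \<i> * of_real t \<noteq> 0" for t using assms by (simp add: complex_eq_iff)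
 thus ?thesis unfolding lap_gk_def by (intro continuous_intros gk_path_continuous assms) (auto simp del: distrib_left_numeral)
qed

lemma path_bounds:
 assumes "a > 0" "t \<in> {0..T}"
 shows "Re (of_real a + \<i> * of_real t) = a" "cmod (of_real a + \<i> * of_real t) <= a + T"
 using assms norm_triangle_ineq[of "of_real a" "\<i> * of_real t"] by (auto simp: norm_mult)

context weak_sol
begin

text \<open>By \<open>weak_gk\<close>, the time derivative of exp(itE) times the integral of
  \<open>ps\<close> against the kernel equals i exp(itE) times the integral of \<open>V * ps\<close>
  against it. Integrating over [0, T] and exchanging the integrals gives the identity.\<close>

lemma evolution:
 assumes a: "a > 0" and T: "T >= 0"
 shows "iexp (T * E) * (LBINT x. ps x * gk (of_real a + \<i> * of_real T) (x - c)) - (LBINT x. ps x * gk (of_real a) (x - c))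
  = \<i> * (LBINT x. V x * ps x * GT E a T (x - c))"
proof -
 define s where "s t = of_real a + \<i> * of_real t" for t :: real
 have sR: "Re (s t) = a" for t by (simp add: s_def)
 have sC: "cmod (s t) <= a + T" if "t \<in> {0..T}" for t unfolding s_def using path_bounds(2)[OF a that] .
 have [measurable]: "s \<in> mbl" unfolding s_def[abs_def] by measurable
 define e where "e t = iexp (t * E)" for t
 have [measurable]: "e \<in> mbl" unfolding e_def[abs_def] by measurable
 have ne: "norm (e t) = 1" for t by (simp add: e_def)
 let ?C = "%t y. lap_gk (s t) y + of_real E * gk (s t) y"
 let ?H = "%y. LBINT t. indicator {0..T} t *\<^sub>R (\<i> * e t * ?C t y)"
 have FTC: "?H y = e T * gk (s T) y - gk (of_real a) y" for y :: 'a
 proof -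
  have "?H y = e T * gk (s T) y - e 0 * gk (s 0) y"
  proof (rule integral_FTC_Icc[OF T])
   fix t
   show "((%t. e t * gk (s t) y) has_vector_derivative \<i> * e t * ?C t y) (at t within {0..T})"
    unfolding e_def s_def by (rule has_vector_derivative_at_within[OF gk_has_vector_derivative[OF a]])
  next
   show "continuous_on {0..T} (%t. \<i> * e t * ?C t y)"
    unfolding s_def e_def by (intro continuous_intros lap_gk_path_continuous gk_path_continuous a)
  qed
  thus ?thesis by (simp add: e_def s_def)
 qed
 \<comment> \<open>On the segment of times, \<open>Re s = a\<close> and \<open>cmod s <= A\<close>,
   so the kernel and its Laplacian share a Gaussian majorant. Its constants depend on a and T, which
   is harmless because they serve only the exchange of integrals.\<close>
 define A where "A = a + T"
 define ap K1 K2 where "ap = a / (8 * A^2)"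
  and "K1 = (8 * A^2 / (4 * a ^ 3) + real DIM('a) / (2 * a)) / sqrt (4 * pi * a) ^ DIM('a)"
  and "K2 = 1 / sqrt (4 * pi * a) ^ DIM('a)"
 have ap: "ap > 0" using a T by (simp add: ap_def A_def)
 have K: "K1 >= 0" "K2 >= 0" using a by (auto simp: K1_def K2_def)
 let ?G = "%y. - ap * (y \<bullet> y)"
 have gb: "norm (gk (s t) y) <= K2 * exp (?G y)" if "t \<in> {0..T}" for t and y :: 'a
 proof -
  have "norm (gk (s t) y) <= exp (- (a / (4 * A^2)) * (y \<bullet> y)) / sqrt (4 * pi * a) ^ DIM('a)"
   unfolding A_def using sR sC[OF that] a by (intro gk_bound) auto
  also have "... <= exp (?G y) / sqrt (4 * pi * a) ^ DIM('a)"
  proof (rule divide_right_mono)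
   have "ap <= a / (4 * A^2)" using a by (simp add: ap_def frac_le A_def) (use T in \<open>auto intro!: divide_left_mono\<close>)
   thus "exp (- (a / (4 * A^2)) * (y \<bullet> y)) <= exp (?G y)"
    unfolding mult_minus_left exp_le_cancel_iff neg_le_iff_le by (rule mult_right_mono) simp
  qed (use a in auto)
  finally show ?thesis by (simp add: K2_def)
 qed
 have lb: "norm (lap_gk (s t) y) <= K1 * exp (?G y)" if "t \<in> {0..T}" for t and y :: 'a
  unfolding ap_def K1_def A_def using sR sC[OF that] a by (intro lap_gk_bound) auto
 let ?B = "%x. (x - c) \<bullet> (x - c)"
 define u where "u x = exp (- ap * ?B x)" for x
 have ui: "integrable lborel u"
  unfolding u_def using integrable_gaussian[OF ap, where 'a='a] by (subst integrable_lborel_translate)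
 have vi: "integrable lborel (%t::real. indicator {0..T} t :: real)" using emeasure_lborel_Icc_eq[of 0 T] by (intro integrable_real_indicator) auto
 let ?A = "%t x. lap_gk (s t) (x - c) + of_real E * gk (s t) (x - c)"
 define f where "f x t = ps x * (indicator {0..T} t *\<^sub>R (\<i> * e t * ?A t x))" for x t
 define h where "h x t = V x * ps x * (indicator {0..T} t *\<^sub>R (e t * gk (s t) (x - c)))" for x t
 let ?D = "%t. LBINT x. V x * ps x * gk (s t) (x - c)"
 let ?F = "%t. indicator {0..T} t *\<^sub>R (\<i> * e t)"
 let ?I = "%t x. gk (s t) (x - c)"
 let ?J = "borel \<Otimes>\<^sub>M borel"
 have "e T * (LBINT x. ps x * gk (s T) (x - c)) - (LBINT x. ps x * gk (of_real a) (x - c))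
   = (LBINT x. e T * (ps x * gk (s T) (x - c)) - ps x * gk (of_real a) (x - c))"
 proof -
  have "integrable lborel (%x. ps x * gk w (x - c))" if "Re w > 0" for w
  proof (rule integrable_bound)
   show "integrable lborel (%x. B * norm (gk w (x - c)))"
    by (intro integrable_mult_right integrable_norm integrable_gk_translate that)
  qed (auto simp: norm_mult B_nonneg intro!: mult_right_mono ps_bdd)
  thus ?thesis using a sR by (subst integral_diff) auto
 qed
 also have "... = (LBINT x. (LBINT t. f x t))"
  unfolding f_def integral_mult_right_zero FTC by (simp add: algebra_simps)
 also have "... = (LBINT t. (LBINT x. f x t))"
 proof (rule Fubini_dominated)
  show "(%(x, t). f x t) \<in> borel_measurable ?J" unfolding f_def by measurable
  show "norm (f x t) <= (B * (K1 + \<bar>E\<bar> * K2) * u x) * indicator {0..T} t" for x t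
  proof (cases "t \<in> {0..T}")
   case True
   have "norm (?A t x) <= K1 * u x + \<bar>E\<bar> * (K2 * u x)"
    unfolding u_def using lb[OF True] gb[OF True] by (intro norm_triangle_mono) (auto simp: norm_mult mult_left_mono)
   hence "norm (ps x) * norm (?A t x) <= B * (K1 * u x + \<bar>E\<bar> * (K2 * u x))"
    by (intro mult_mono ps_bdd) (auto simp: B_nonneg)
   moreover have "norm (f x t) = norm (ps x) * norm (?A t x)"
    using True by (simp add: f_def norm_mult ne)
   ultimately show ?thesis using True by (simp add: algebra_simps)
  qed (simp add: f_def)
 qed (intro integrable_mult_right ui vi)+
 also have "... = (LBINT t. \<i> * (LBINT x. h x t))"
 proof (intro integral_cong refl)
  fix t
  have w: "(LBINT x. ps x * ?A t x) = ?D t"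
  proof -
   have r: "Re (s t) > 0" using a sR by simp
   have 1: "integrable lborel (%x. V x * ps x * gk (s t) (x - c))"
   proof (rule integrable_bound)
    show "integrable lborel (%x. CV * B * norm (?I t x))"
     by (intro integrable_mult_right integrable_norm integrable_gk_translate r)
   qed (auto simp: norm_mult B_nonneg CV_nonneg intro!: mult_mono ps_bdd V_bdd)
   have 2: "integrable lborel (%x. ps x * ?A t x)"
   proof (rule integrable_bound)
    define C where "C = (8 * (cmod (s t))^2 / (4 * a ^ 3) + real DIM('a) / (2 * a)) / sqrt (4 * pi * a) ^ DIM('a)"
    define be where "be = a / (8 * (cmod (s t))^2)"
    have be: "be > 0" unfolding be_def using a r by (intro divide_pos_pos) auto
    show "integrable lborel (%x. B * (C * exp (- be * ?B x) + \<bar>E\<bar> * norm (?I t x)))"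
     using integrable_gaussian[OF be, where 'a='a]
     by (intro integrable_mult_right integrable_add integrable_norm integrable_gk_translate r)
       (subst integrable_lborel_translate[of "%x. exp (- be * (x \<bullet> x))"])
    have l: "norm (lap_gk (s t) (x - c)) <= C * exp (- be * ?B x)" for x
     unfolding C_def be_def using sR a by (intro lap_gk_bound) auto
    have C0: "C >= 0" using a by (simp add: C_def)
    show "AE x in lborel. norm (ps x * ?A t x) <= norm (B * (C * exp (- be * ?B x) + \<bar>E\<bar> * norm (?I t x)))"
    proof (rule AE_I2)
     fix x
     have "norm (?A t x) <= C * exp (- be * ?B x) + \<bar>E\<bar> * norm (?I t x)"
      by (intro norm_triangle_mono l) (simp add: norm_mult)
     hence "norm (ps x * ?A t x) <= B * (C * exp (- be * ?B x) + \<bar>E\<bar> * norm (?I t x))"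
      unfolding norm_mult[of "ps x"] by (intro mult_mono ps_bdd) (auto simp: B_nonneg)
     thus "norm (ps x * ?A t x) <= norm (B * (C * exp (- be * ?B x) + \<bar>E\<bar> * norm (?I t x)))"
      unfolding real_norm_def by (rule order_trans[OF _ abs_ge_self])
    qed
   qed measurable
   have "?D t - (LBINT x. ps x * ?A t x)
    = (LBINT x. V x * ps x * gk (s t) (x - c) - ps x * ?A t x)"
    by (rule integral_diff[OF 1 2, symmetric])
   also have "... = (LBINT x. ps x * (- lap_gk (s t) (x - c) + (V x - of_real E) * gk (s t) (x - c)))"
    by (intro integral_cong refl) (simp add: algebra_simps)
   also have "... = 0" by (rule weak_gk[OF r])
   finally show ?thesis by simp
  qed
  have "(LBINT x. f x t) = (LBINT x. (?F t) * (ps x * ?A t x))"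
   unfolding f_def by (intro integral_cong refl) (simp add: algebra_simps)
  also have "... = ?F t * ?D t"
   unfolding integral_mult_right_zero w ..
  also have "... = (LBINT x. (?F t) * (V x * ps x * gk (s t) (x - c)))" by simp
  also have "... = (LBINT x. \<i> * h x t)"
   unfolding h_def by (intro integral_cong refl) (simp add: algebra_simps)
  finally show "(LBINT x. f x t) = \<i> * (LBINT x. h x t)" by simp
 qed
 also have "... = \<i> * (LBINT t. (LBINT x. h x t))" by simp
 also have "(LBINT t. (LBINT x. h x t)) = (LBINT x. (LBINT t. h x t))"
 proof (rule Fubini_dominated[symmetric])
  show "(%(x, t). h x t) \<in> borel_measurable ?J" unfolding h_def by measurable
  show "norm (h x t) <= (CV * B * K2 * u x) * indicator {0..T} t" for x t
  proof (cases "t \<in> {0..T}")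
   case True
   have "norm (V x) * norm (ps x) * norm (?I t x) <= CV * B * (K2 * u x)"
    unfolding u_def by (intro mult_mono V_bdd ps_bdd gb[OF True] mult_nonneg_nonneg) (auto simp: B_nonneg CV_nonneg)
   thus ?thesis using True by (simp add: h_def norm_mult ne algebra_simps)
  qed (simp add: h_def)
 qed (intro integrable_mult_right ui vi)+
 also have "... = (LBINT x. V x * ps x * GT E a T (x - c))"
  unfolding h_def GT_def e_def s_def integral_mult_right_zero ..
 finally show ?thesis unfolding e_def s_def .
qed

end

lemma norm_integral_le_AE:
 fixes f :: "'b => 'c::{banach, second_countable_topology}"
 assumes f: "f \<in> borel_measurable M" and g: "integrable M g" and le: "AE x in M. norm (f x) <= g x"
 shows "integrable M f" and "norm (integral\<^sup>L M f) <= integral\<^sup>L M g"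
proof -
 show i: "integrable M f"
  by (rule integrable_bound[OF g f]) (use le in \<open>auto elim!: eventually_mono\<close>)
 have "norm (integral\<^sup>L M f) <= (\<integral>x. norm (f x) \<partial>M)" by (rule integral_norm_bound)
 also have "... <= integral\<^sup>L M g" by (intro integral_mono_AE integrable_norm i g le)
 finally show "norm (integral\<^sup>L M f) <= integral\<^sup>L M g" .
qed

section \<open>Dispersion of the outgoing wave\<close>

text \<open>Completing the square bounds the Gaussian by a multiple of exp(-r), which reduces the
  claim to the Gamma integral.\<close>

lemma integrable_powr_gauss:
 fixes p ap :: real
 assumes p: "p > -1" and ap: "ap > 0"
 shows "integrable lborel (%r. indicator {0<..} r * (r powr p * exp (- ap * r^2)))"
proof -
 let ?C = "%lborel. \<integral>\<^sup>+t. ennreal (indicator {0..} t * t powr p / exp t) \<partial>lborel"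
 have g: "integrable lborel (%t. indicator {0..} t * t powr p / exp t)"
 proof (rule integrableI_nonneg)
  have "?C lborel = ennreal (Gamma (p + 1))"
   using Gamma_conv_nn_integral_real[of "p + 1"] p by simp
  thus "?C lborel < \<infinity>" by simp
 qed auto
 let ?A = "1 / (4 * ap)"
 let ?B = "%r. indicator {0<..} r * (r powr p * exp (- ap * r^2))"
 let ?D = "%r. indicator {0..} r * r powr p / exp r"
 show ?thesis
 proof (rule integrable_bound)
  show "integrable lborel (%t. exp ?A * (indicator {0..} t * t powr p / exp t))"
   by (rule integrable_mult_right[OF g])
  show "AE r in lborel. norm (?B r) <= norm (exp ?A * ?D r)"
  proof (rule AE_I2)
   fix r :: real
   have "0 <= (2 * ap * r - 1)^2" by simp
   hence "r - 1 / (4 * ap) <= ap * r^2" using ap by (simp add: field_simps power2_eq_square)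
   hence "exp (- ap * r^2) <= exp ?A * exp (- r)" by (simp add: mult_exp_exp)
   hence le: "r powr p * exp (- ap * r^2) <= r powr p * (exp ?A * exp (- r))" by (rule mult_left_mono) simp
   show "norm (?B r) <= norm (exp ?A * ?D r)"
   proof (cases "r > 0")
    case True
    have "norm (?B r) = r powr p * exp (- ap * r^2)" using True by simp
    moreover have "exp ?A * ?D r = r powr p * (exp ?A * exp (- r))"
     using True by (simp add: exp_minus inverse_eq_divide)
    ultimately show ?thesis using le by (metis abs_ge_self order_trans real_norm_def)
   qed simp
  qed
 qed measurable
qed

lemma integral_powr_gauss_scale:
 fixes p ap sg :: real
 assumes sg: "sg > 0"
 shows "(LBINT r. indicator {0<..} r * (r powr p * exp (- (ap / sg^2) * r^2)))
  = sg powr (p + 1) * (LBINT r. indicator {0<..} r * (r powr p * exp (- ap * r^2)))"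
proof -
 let ?A = "%r. r powr p * exp (- ap * r^2)"
 let ?B = "%sg r. (0 + sg * r) powr p * exp (- (ap / sg^2) * (0 + sg * r)^2)"
 have "(LBINT r. indicator {0<..} r * (r powr p * exp (- (ap / sg^2) * r^2)))
   = \<bar>sg\<bar> *\<^sub>R (LBINT r. indicator {0<..} (0 + sg * r) * ?B sg r)"
  using sg by (intro lborel_integral_real_affine) auto
 also have "... = sg * (LBINT r. sg powr p * (indicator {0<..} r * ?A r))"
 proof -
  have "indicator {0<..} (0 + sg * r) * ?B sg r = sg powr p * (indicator {0<..} r * ?A r)" for r
   using sg by (cases "r > 0") (auto simp: powr_mult zero_less_mult_iff power_mult_distrib indicator_def)
  thus ?thesis using sg by (simp only: abs_of_pos real_scaleR_def)
 qed
 also have "... = sg powr (p + 1) * (LBINT r. indicator {0<..} r * ?A r)"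
  using sg by (simp add: powr_add)
 finally show ?thesis .
qed

lemma
 fixes p ap sg :: real
 assumes p: "p < real DIM('a::euclidean_space)" and ap: "ap > 0"
 shows integrable_radial_powr_gauss: "integrable lborel (%x::'a. norm x powr (- p) * exp (- ap * (norm x)^2))"
  and integral_radial_powr_gauss_scale: "sg > 0 ==> (LBINT x. norm (x::'a) powr (- p) * exp (- (ap / sg^2) * (norm x)^2))
   = sg powr (real DIM('a) - p) * (LBINT x. norm (x::'a) powr (- p) * exp (- ap * (norm x)^2))"
proof -
 have e: "indicator {0<..} r * (r ^ (DIM('a) - 1) * (r powr (- p) * exp (- ap * r^2)))
  = indicator {0<..} r * (r powr (real DIM('a) - 1 - p) * exp (- ap * r^2))" for r ap :: real
 proof (cases "r > 0")
  case True
  have "r ^ (DIM('a) - 1) = r powr (real DIM('a) - 1)" using True by (simp add: powr_realpow[symmetric] of_nat_diff)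
  moreover have "r powr (real DIM('a) - 1) * r powr (- p) = r powr (real DIM('a) - 1 - p)"
   unfolding powr_add[symmetric] by simp
  ultimately show ?thesis by (simp only: mult.assoc[symmetric])
 qed simp
 have i: "integrable lborel (%r. indicator {0<..} r * (r ^ (DIM('a) - 1) * (r powr (- p) * exp (- ap * r^2))))" if "ap > 0" for ap
  unfolding e using p that by (intro integrable_powr_gauss) auto
 have r: "integrable lborel (%x::'a. norm x powr (- p) * exp (- ap * (norm x)^2))"
  "(LBINT x. norm (x::'a) powr (- p) * exp (- ap * (norm x)^2)) = real DIM('a) * measure lborel (cball (0::'a) 1) *
   (LBINT r. indicator {0<..} r * (r powr (real DIM('a) - 1 - p) * exp (- ap * r^2)))" if "ap > 0" for ap
  using integrable_radial[of "%r. r powr (- p) * exp (- ap * r^2)", OF _ _ i[OF that]] unfolding e by auto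
 show "integrable lborel (%x::'a. norm x powr (- p) * exp (- ap * (norm x)^2))"
  by (rule r[OF ap])
 assume sg: "sg > 0"
 hence ap': "ap / sg^2 > 0" using ap by simp
 show "(LBINT x. norm (x::'a) powr (- p) * exp (- (ap / sg^2) * (norm x)^2))
   = sg powr (real DIM('a) - p) * (LBINT x. norm (x::'a) powr (- p) * exp (- ap * (norm x)^2))"
  unfolding r(2)[OF ap] r(2)[OF ap'] integral_powr_gauss_scale[OF sg] by simp
qed

lemma norm_diff_sq_ge:
 fixes x c :: "'a::real_inner"
 shows "(x - c) \<bullet> (x - c) >= (x \<bullet> x) / 2 - c \<bullet> c"
proof -
 have "0 <= (x - 2 *\<^sub>R c) \<bullet> (x - 2 *\<^sub>R c)" by simp
 also have "... = x \<bullet> x - 4 * (x \<bullet> c) + 4 * (c \<bullet> c)" by (simp add: inner_diff_left inner_diff_right inner_commute)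
 finally show ?thesis by (simp add: inner_diff_left inner_diff_right inner_commute)
qed

text \<open>Moving the centre of the Gaussian from c to 0 halves its rate and costs a constant
  factor that does not depend on t, because \<open>sg >= 1\<close> for t at least 1.\<close>

lemma norm_gk_shift_le:
 fixes x c :: "'a::euclidean_space"
 assumes a: "a > 0" and t: "t >= 1" and c: "norm c <= R1"
 defines "sg \<equiv> cmod (of_real a + \<i> * of_real t)"
 shows "exp (- (a / (4 * sg^2)) * ((x - c) \<bullet> (x - c))) <= exp (a * R1^2 / 4) * exp (- ((a/8) / sg^2) * (norm x)^2)"
proof -
 have "sg^2 = a^2 + t^2" unfolding sg_def cmod_power2 by simp
 moreover have "t^2 >= 1" using t by (simp add: one_le_power)
 ultimately have sg: "sg^2 >= 1" using zero_le_power2[of a] by linarith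
 let ?A = "4 * sg^2"
 let ?B = "(x - c) \<bullet> (x - c)"
 have "c \<bullet> c <= R1^2" using power_mono[OF c norm_ge_zero, of 2] by (simp add: power2_norm_eq_inner)
 hence "(x - c) \<bullet> (x - c) >= (norm x)^2 / 2 - R1^2" using norm_diff_sq_ge[of x c] by (simp add: power2_norm_eq_inner)
 hence "a / ?A * ((norm x)^2 / 2 - R1^2) <= a / ?A * ?B"
  using a sg by (intro mult_left_mono) auto
 moreover have "a / ?A * R1^2 <= a / 4 * R1^2"
  using a sg by (intro mult_right_mono divide_left_mono) auto
 moreover have "a / ?A * ((norm x)^2 / 2 - R1^2) = (a/8) / sg^2 * (norm x)^2 - a / ?A * R1^2"
  using sg by (simp add: right_diff_distrib)
 ultimately have "- (a / ?A) * ?B <= a * R1^2 / 4 + - ((a/8) / sg^2) * (norm x)^2" by simp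
 thus ?thesis unfolding exp_add[symmetric] by (subst exp_le_cancel_iff)
qed

text \<open>Scaling by |s|: the moment of |x|^(-(d+1)/2) against the Gaussian contributes
  |s|^(d-(d+1)/2) and the normalisation of the kernel |s|^(-d/2), together |s|^(-1/2). The
  singularity at 0 is integrable as d is at least 2.\<close>

lemma err_integral_bound:
 fixes err :: "'a::euclidean_space => complex"
 assumes dim: "DIM('a) >= 2" and a: "a > 0" and [measurable]: "err \<in> mbl"
  and err: "\<And>x. x \<noteq> 0 ==> norm (err x) <= C * norm x powr (- (real DIM('a) + 1) / 2)"
 shows "\<exists>K. \<forall>c t. norm c <= R1 \<and> t >= 1 \<longrightarrow> norm (LBINT x. err x * gk (of_real a + \<i> * of_real t) (x - c)) <= K * t powr (- 1/2)"
proof -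
 let ?d = "real DIM('a)"
 let ?A = "- ((?d + 1) / 2)"
 define J where "J = (LBINT x. norm (x::'a) powr ?A * exp (- (a/8) * (norm x)^2))"
 have J0: "J >= 0" unfolding J_def by (intro integral_nonneg_AE AE_I2) auto
 have p: "(?d + 1) / 2 < ?d" using dim by simp
 have C0: "C >= 0"
 proof -
  obtain x :: 'a where "norm x = 1" using vector_choose_size[of 1] by auto
  hence "norm (err x) <= C" using err[of x] by force
  thus ?thesis using norm_ge_zero order_trans by blast
 qed
 let ?B = "a * R1^2 / 4"
 define K where "K = C * exp ?B * J"
 let ?C = "%sg x. - ((a/8) / sg^2) * (norm x)^2"
 let ?D = "?d - (?d + 1) / 2"
 have "norm (LBINT x. err x * gk (of_real a + \<i> * of_real t) (x - c)) <= K * t powr (- 1/2)" if c: "norm c <= R1" and t: "t >= 1" for c t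
 proof -
  define s where "s = of_real a + \<i> * of_real t"
  define sg where "sg = cmod s"
  have sgt: "sg >= t" unfolding sg_def s_def using abs_Im_le_cmod[of "of_real a + \<i> * of_real t"] t by simp
  hence sg: "sg > 0" using t by linarith
  have sR: "Re s = a" by (simp add: s_def)
  have b: "norm (err x * gk s (x - c)) <= C * exp ?B / sqrt (4 * pi * sg) ^ DIM('a) * (norm x powr ?A * exp (?C sg x))" if "x \<noteq> 0" for x
  proof -
   have "norm (gk s (x - c)) <= exp ?B * exp (?C sg x) / sqrt (4 * pi * sg) ^ DIM('a)"
    unfolding norm_gk sR sg_def[symmetric] using norm_gk_shift_le[OF a t c, of x, folded s_def sg_def] sg by (intro divide_right_mono) auto
   moreover have "norm (err x) <= C * norm x powr ?A" using err[OF that] by (simp add: minus_divide_left)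
   ultimately have "norm (err x) * norm (gk s (x - c)) <= (C * norm x powr ?A) * (exp ?B * exp (?C sg x) / sqrt (4 * pi * sg) ^ DIM('a))"
    by (intro mult_mono) (auto simp: C0)
   thus ?thesis by (simp add: norm_mult field_simps)
  qed
  have "norm (LBINT x. err x * gk s (x - c)) <= (LBINT x. C * exp ?B / sqrt (4 * pi * sg) ^ DIM('a) * (norm (x::'a) powr ?A * exp (?C sg x)))"
  proof (rule norm_integral_le_AE(2))
   have i: "integrable lborel (%x::'a. norm x powr ?A * exp (?C sg x))"
    using sg a by (intro integrable_radial_powr_gauss p) auto
   show "integrable lborel (%x. C * exp ?B / sqrt (4 * pi * sg) ^ DIM('a) * (norm x powr ?A * exp (- ((a/8) / sg^2) * (norm (x::'a))^2)))"
    by (rule integrable_mult_right[OF i])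
   show "AE x in lborel. norm (err x * gk s (x - c)) <= C * exp ?B / sqrt (4 * pi * sg) ^ DIM('a) * (norm x powr ?A * exp (?C sg x))"
    using AE_lborel_singleton[of "0::'a"] by eventually_elim (rule b)
  qed measurable
  also have "... = C * exp ?B / sqrt (4 * pi * sg) ^ DIM('a) * (sg powr ?D * J)"
   unfolding integral_mult_right_zero J_def using a by (subst integral_radial_powr_gauss_scale[OF p _ sg]) auto
  also have "... <= C * exp ?B / sg powr (?d/2) * (sg powr ?D * J)"
  proof (intro mult_right_mono divide_left_mono)
   have "sg powr (?d/2) = sqrt sg ^ DIM('a)" using sg by (simp add: powr_half_sqrt[symmetric] powr_powr flip: powr_realpow)
   also have "... <= sqrt (4 * pi * sg) ^ DIM('a)"
    using sg pi_gt3 by (intro power_mono real_sqrt_le_mono) auto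
   finally show "sg powr (?d/2) <= sqrt (4 * pi * sg) ^ DIM('a)" .
  qed (use sg C0 J0 in auto)
  also have "... = K * sg powr (- 1/2)"
  proof -
   have "sg powr ?D / sg powr (?d/2) = sg powr (- 1/2)"
    by (simp add: powr_diff[symmetric] field_simps)
   moreover have "C * exp ?B / sg powr (?d/2) * (sg powr ?D * J) = K * (sg powr ?D / sg powr (?d/2))"
    by (simp add: K_def)
   ultimately show ?thesis by simp
  qed
  also have "... <= K * t powr (- 1/2)"
   using sgt t C0 J0 by (intro mult_left_mono powr_mono2') (auto simp: K_def)
  finally show ?thesis unfolding s_def .
 qed
 thus ?thesis by blast
qed

text \<open>With \<open>s = a + it\<close>, \<open>t > 0\<close>, the phase \<open>ka r + r\<^sup>2 t / (4\<bar>s\<bar>\<^sup>2)\<close> of the integrand has derivative at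
 least \<open>ka\<close>, so one integration by parts in \<open>r\<close> gains a factor \<open>\<bar>s\<bar>\<^sup>-\<^sup>1\<close>.\<close>

lemma radial_phase_bound:
 fixes ka a q R1 :: real
 assumes ka: "ka > 0" and a: "a > 0" and q: "q > 0"
 defines "W \<equiv> %p. LBINT r. indicator {0<..} r * (r powr p * exp (- (a/8) * r^2))"
 assumes t: "t >= 1" and c: "norm (c::'a::euclidean_space) <= R1" and th: "norm (tt::'a) = 1"
 defines "s \<equiv> of_real a + \<i> * of_real t"
 shows "norm (LBINT r. indicator {0<..} r *\<^sub>R (of_real (r powr q) * iexp (ka * r) * exp (- of_real ((r *\<^sub>R tt - c) \<bullet> (r *\<^sub>R tt - c)) / (4 * s))))
  <= exp (a * R1^2 / 4) / ka * (q * W (q - 1) + (R1 + 1 / ka) / 2 * W q) * cmod s powr q"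
proof -
 define sg where "sg = cmod s"
 have sgt: "sg >= t" unfolding sg_def s_def using abs_Im_le_cmod[of "of_real a + \<i> * of_real t"] t by simp
 hence sg: "sg > 0" using t by linarith
 have sR: "Re s = a" and sI: "Im s = t" by (auto simp: s_def)
 have s0: "s \<noteq> 0" using sg by (auto simp: sg_def)
 have R1: "R1 >= 0" using c norm_ge_zero order_trans by blast
 let ?J = "%r. r *\<^sub>R tt - c"
 define P where "P r = iexp (ka * r) * exp (- of_real (?J r \<bullet> (?J r)) / (4 * s))" for r
 define m where "m = tt \<bullet> c"
 have thth: "tt \<bullet> tt = 1" using th by (simp add: norm_eq_1)
 have sq: "?J r \<bullet> (?J r) = r^2 - 2 * r * m + c \<bullet> c" for r
  by (simp add: inner_diff_left inner_diff_right inner_commute m_def thth power2_eq_square algebra_simps)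
 \<comment> \<open>The logarithmic derivative of P when the centre is 0. The true one is D + m/(2s);
   the extra term is small and is left in the remainder g, so that only D, whose imaginary part is
   at least \<open>ka\<close>, is divided by.\<close>
 define D where "D r = \<i> * of_real ka - of_real r / (2 * s)" for r :: real
 have Dim: "cmod (D r) >= ka" if "r >= 0" for r
 proof -
  have "of_real r / (2 * s) = of_real (r/2) * inverse s" by (simp add: field_simps)
  hence "Im (of_real r / (2 * s)) = (r/2) * Im (inverse s)" by (metis Im_complex_of_real Re_complex_of_real add.right_neutral mult_zero_left times_complex.sel(2))
  hence "Im (D r) = ka + (r/2) * (t / (a^2 + t^2))" unfolding D_def by (simp add: sR sI)
  moreover have "(r/2) * (t / (a^2 + t^2)) >= 0" using that t by simp
  ultimately show ?thesis using abs_Im_le_cmod[of "D r"] by linarith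
 qed
 have D0: "D r \<noteq> 0" if "r >= 0" for r using Dim[OF that] ka by auto
 \<comment> \<open>Q P is the antiderivative sought: its derivative is f + g, where f is the given
   integrand and every term of g carries an extra 1/r or 1/|s|. Either one lowers the scaling
   exponent from q + 1 to q.\<close>
 define Q where "Q r = of_real (r powr q) / D r" for r
 define f where "f r = of_real (r powr q) * P r" for r
 let ?Y = "%r m. of_real (q / r) + of_real m / (2 * s) + 1 / (2 * s * D r)"
 define g where "g r = (Q r * ?Y r m) * P r" for r
 let ?A = "%r. - ((a/8) / sg^2) * r^2"
 let ?F = "a * R1^2 / 4"
 define h where "h r = exp ?F * exp (?A r)" for r
 have Pb: "norm (P r) <= h r" if "r > 0" for r
 proof -
  have "norm (P r) = exp (- (a / (4 * sg^2)) * (?J r \<bullet> (?J r)))"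
   unfolding P_def norm_mult norm_gaussian sR sg_def[symmetric] by simp
  also have "... <= exp ?F * exp (- ((a/8) / sg^2) * (norm (r *\<^sub>R tt))^2)"
   using norm_gk_shift_le[OF a t c, of "r *\<^sub>R tt"] unfolding sg_def s_def .
  also have "... = h r" using that by (simp add: h_def th)
  finally show ?thesis .
 qed
 let ?W = "%r m. D r + of_real m / (2 * s)"
 have dP: "(P has_vector_derivative (?W r m) * P r) (at r)" for r
 proof -
  have "((%z. exp (\<i> * (of_real ka * z)) * exp (- (z^2 - 2 * z * of_real m + of_real (c \<bullet> c)) / (4 * s))) has_field_derivative
   (?W r m) * (exp (\<i> * (of_real ka * of_real r)) * exp (- ((of_real r)^2 - 2 * of_real r * of_real m + of_real (c \<bullet> c)) / (4 * s)))) (at (of_real r))"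
   using s0 by (auto intro!: derivative_eq_intros simp: D_def field_simps)
  from has_vector_derivative_real_field[OF this] show ?thesis
   unfolding P_def sq by simp
 qed
 let ?U = "%r. q * r powr (q - 1)"
 let ?B = "%r. of_real (?U r) * D r + of_real (r powr q) / (2 * s)"
 let ?G = "%r. inverse (D r) * (- 1 / (2 * s)) * inverse (D r)"
 have dQ: "(Q has_vector_derivative (?B r) / (D r * D r)) (at r)" if "r > 0" for r
 proof -
  have 1: "((%r. of_real (r powr q)) has_vector_derivative complex_of_real (?U r)) (at r)"
   using that by (intro has_vector_derivative_of_real) (auto intro!: derivative_eq_intros simp flip: has_real_derivative_iff_has_vector_derivative)
  have "((%z. inverse (\<i> * of_real ka - z / (2 * s))) has_field_derivative - ?G r) (at (of_real r))"
   using s0 D0[of r] that by (auto intro!: derivative_eq_intros simp: D_def)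
  from has_vector_derivative_real_field[OF this]
  have 3: "((%r. inverse (D r)) has_vector_derivative - ?G r) (at r)"
   unfolding D_def .
  have "((%r. of_real (r powr q) * inverse (D r)) has_vector_derivative of_real (r powr q) * - ?G r + of_real (?U r) * inverse (D r)) (at r)"
   by (rule has_vector_derivative_mult[OF 1 3])
  moreover have "of_real (r powr q) * - ?G r + of_real (?U r) * inverse (D r) = ?B r / (D r * D r)"
   using D0[of r] that s0 by (simp add: field_simps)
  ultimately show ?thesis unfolding Q_def[abs_def] divide_inverse by (simp only:)
 qed
 let ?C = "%r. Q r * P r"
 have dQP: "(?C has_vector_derivative f r + g r) (at r)" if r: "r > 0" for r
 proof -
  have "(?C has_vector_derivative Q r * (?W r m * P r) + ?B r / (D r * D r) * P r) (at r)"
   by (rule has_vector_derivative_mult[OF dQ[OF r] dP])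
  moreover have "Q r * (?W r m * P r) + ?B r / (D r * D r) * P r = f r + g r"
  proof -
   have "of_real (?U r) = complex_of_real (r powr q) * of_real (q / r)" using r by (simp add: powr_diff)
   hence "?B r / (D r * D r) = Q r * (of_real (q / r) + 1 / (2 * s * D r))"
    using D0[of r] r unfolding Q_def by (simp add: add_divide_distrib distrib_left mult_ac)
   moreover have "Q r * D r = of_real (r powr q)" using D0[of r] r by (simp add: Q_def)
   ultimately show ?thesis unfolding f_def g_def by (simp add: algebra_simps)
  qed
  ultimately show ?thesis by simp
 qed
 have Qb: "norm (Q r) <= r powr q / ka" if "r > 0" for r
  unfolding Q_def norm_divide norm_of_real using Dim[of r] D0[of r] that ka by (auto intro!: divide_left_mono mult_pos_pos)
 have fb: "norm (f r) <= r powr q * h r" if "r > 0" for r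
  unfolding f_def norm_mult using Pb[OF that] by (simp add: mult_left_mono)
 let ?H = "R1 + 1 / ka"
 let ?I = "%r. r powr q * exp (?A r)"
 let ?K = "2 * sg"
 let ?N = "%r. r powr (q - 1) * exp (?A r)"
 define G where "G r = exp ?F / ka * (q * ?N r + ?H / ?K * ?I r)" for r
 let ?S = "2 * sg * ka"
 have gb: "norm (g r) <= G r" if r: "r > 0" for r
 proof -
  have "\<bar>m\<bar> <= R1" unfolding m_def using Cauchy_Schwarz_ineq2[of tt c] th c by simp
  hence "norm (of_real m / (2 * s)) <= R1 / ?K"
   unfolding norm_divide norm_mult sg_def[symmetric] using sg by (simp add: divide_right_mono)
  moreover have "norm (1 / (2 * s * D r)) <= 1 / ?S"
   unfolding norm_divide norm_mult sg_def[symmetric] using sg ka Dim[of r] r D0[of r] by (auto intro!: divide_left_mono mult_left_mono)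
  ultimately have "norm (?Y r m) <= q / r + R1 / ?K + 1 / ?S"
   using q r by (intro norm_triangle_mono) (auto simp: norm_divide)
  hence "norm (g r) <= (r powr q / ka * (q / r + R1 / ?K + 1 / ?S)) * h r"
   unfolding g_def norm_mult using Qb[OF r] Pb[OF r] q r sg R1 ka by (intro mult_mono) auto
  also have "... = exp ?F / ka * (q * ((r powr q / r) * exp (?A r)) + ?H / ?K * ?I r)"
   unfolding h_def using sg ka by (simp add: field_simps)
  also have "... = G r" using r by (simp add: G_def powr_diff)
  finally show ?thesis .
 qed
 have ap: "(a/8) / sg^2 > 0" using a sg by simp
 have i: "integrable lborel (%r. indicator {0<..} r * (r powr p * exp (?A r)))" if "p > -1" for p
  using that ap by (rule integrable_powr_gauss)
 have [measurable]: "P \<in> mbl" unfolding P_def by measurable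
 have [measurable]: "D \<in> mbl" unfolding D_def by measurable
 let ?b = "%r. indicator {0<..} r * ?I r"
 have fi: "integrable lborel (%r. indicator {0<..} r *\<^sub>R f r)"
 proof (rule norm_integral_le_AE(1))
  show "integrable lborel (%r. exp ?F * ?b r)"
   using q by (intro integrable_mult_right i) auto
  show "AE r in lborel. norm (indicator {0<..} r *\<^sub>R f r) <= exp ?F * ?b r"
   using fb by (intro AE_I2) (simp add: indicator_def h_def mult_ac)
 qed (simp add: f_def)
 let ?D = "%r. q * (indicator {0<..} r * ?N r) + ?H / ?K * ?b r"
 let ?V = "%r. indicator {0<..} r * G r"
 have Gi: "integrable lborel ?V"
 proof -
  have "?V = (%r. exp ?F / ka * ?D r)"
   by (auto simp: G_def fun_eq_iff indicator_def)
  thus ?thesis using q by (simp only:) (intro integrable_mult_right integrable_add i; simp)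
 qed
 have gae: "AE r in lborel. norm (indicator {0<..} r *\<^sub>R g r) <= indicator {0<..} r * G r"
  using gb by (intro AE_I2) (simp add: indicator_def)
 let ?Z = "%r. indicator {0<..} r *\<^sub>R g r"
 have gm: "?Z \<in> borel_measurable lborel"
  unfolding g_def Q_def by simp
 have gi: "integrable lborel ?Z"
  by (rule norm_integral_le_AE(1)[OF gm Gi gae])
 let ?L = "%r. r powr q / ka * h r"
 let ?P = "?C \<longlongrightarrow> 0"
 let ?Q = "(?C \<circ> real_of_ereal) \<longlongrightarrow> 0"
 let ?c = "?L \<longlongrightarrow> 0"
 \<comment> \<open>The boundary values of Q P vanish, at 0 because q is positive and at infinity by
   the Gaussian factor.\<close>
 have FTC: "(LBINT r=0..\<infinity>. f r + g r) = 0 - 0"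
 proof (rule interval_integral_FTC_integrable)
  show "(?C has_vector_derivative f x + g x) (at x)" if "0 < ereal x" "ereal x < \<infinity>" for x
   using dQP that by simp
  show "isCont (%r. f r + g r) x" if "0 < ereal x" "ereal x < \<infinity>" for x
  proof -
   have x: "x > 0" using that by simp
   have cP: "isCont P x" using dP by (rule has_vector_derivative_continuous)
   have cQ: "isCont Q x" using dQ[OF x] by (rule has_vector_derivative_continuous)
   have cD: "isCont D x" unfolding D_def[abs_def] using s0 by (intro continuous_intros) auto
   show ?thesis unfolding f_def g_def using x s0 D0[of x]
    by (intro continuous_intros cP cQ cD) (auto intro!: continuous_intros)
  qed
  show "set_integrable lborel (einterval 0 \<infinity>) (%r. f r + g r)"
  proof -
   have "einterval 0 \<infinity> = {0<..}" by (auto simp: einterval_def zero_ereal_def)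
   thus ?thesis using integrable_add[OF fi gi] by (simp add: set_integrable_def scaleR_add_right)
  qed
  have lim: "?c F ==> (\<forall>\<^sub>F r in F. r > 0) ==> ?P F" for F
  proof (rule Lim_null_comparison)
   assume "\<forall>\<^sub>F r in F. r > 0"
   thus "\<forall>\<^sub>F r in F. norm (Q r * P r) <= r powr q / ka * h r"
    by eventually_elim (unfold norm_mult, intro mult_mono Qb Pb, use ka in auto)
  qed
  have "(?L \<longlongrightarrow> 0 powr q / ka * h 0) (at_right 0)"
   unfolding h_def using q ka by (intro tendsto_intros tendsto_powr') (auto simp: eventually_at_filter)
  hence "?P (at_right 0)" using q by (intro lim) (auto simp: eventually_at_filter)
  thus "?Q (at_right 0)"
   unfolding zero_ereal_def by (subst ereal_tendsto_simps)
  have "?c at_top"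
  proof -
   define ap' where "ap' = (a/8) / sg^2"
   have ap': "ap' > 0" using ap by (simp add: ap'_def)
   have "((%r. r powr q * exp (- (ap' * r^2))) \<longlongrightarrow> 0) at_top"
    using ap' q by real_asymp
   hence "((%r. exp ?F / ka * (r powr q * exp (- (ap' * r^2)))) \<longlongrightarrow> 0) at_top"
    by (rule tendsto_mult_right_zero)
   thus ?thesis unfolding h_def ap'_def by (simp add: mult_ac)
  qed
  hence "?P at_top" by (intro lim eventually_gt_at_top)
  thus "?Q (at_left \<infinity>)"
   by (subst ereal_tendsto_simps)
 qed simp
 let ?M = "%f. LBINT r. indicator {0<..} r *\<^sub>R f r"
 let ?X = "LBINT r. indicator {0<..} r * G r"
 let ?a = "LBINT r. indicator {0<..} r *\<^sub>R g r"
 have "(LBINT r=0..\<infinity>. f r + g r) = (LBINT r. indicator {0<..} r *\<^sub>R f r + indicator {0<..} r *\<^sub>R g r)"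
  unfolding interval_lebesgue_integral_0_infty set_lebesgue_integral_def by (simp add: scaleR_add_right)
 also have "... = ?M f + ?a"
  by (rule integral_add[OF fi gi])
 finally have "?M f = - ?a"
  using FTC by (simp add: eq_neg_iff_add_eq_0)
 hence "norm (?M f) <= ?X"
  using norm_integral_le_AE(2)[OF gm Gi gae] by simp
 also have "... = exp ?F / ka * (q * (sg powr (q - 1 + 1) * W (q - 1)) + ?H / ?K * (sg powr (q + 1) * W q))"
 proof -
  have "?X = (LBINT r. exp ?F / ka * ?D r)"
   by (intro integral_cong) (auto simp: G_def indicator_def)
  also have "... = exp ?F / ka * (q * (LBINT r. indicator {0<..} r * ?N r) + ?H / ?K * (LBINT r. indicator {0<..} r * ?I r))"
  proof -
   have i1: "integrable lborel (%r. indicator {0<..} r * ?N r)"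
    and i2: "integrable lborel (%r. indicator {0<..} r * ?I r)" using q by (intro i; simp)+
   show ?thesis
    by (subst integral_mult_right_zero, subst integral_add[OF integrable_mult_right[OF i1] integrable_mult_right[OF i2]])
     (simp only: integral_mult_right_zero)
  qed
  finally show ?thesis unfolding W_def integral_powr_gauss_scale[OF sg] .
 qed
 also have "... = exp ?F / ka * (q * W (q - 1) + ?H / 2 * W q) * sg powr q"
  using sg ka by (simp add: powr_add field_simps)
 finally show ?thesis unfolding f_def P_def sg_def by (simp add: mult.assoc)
qed

text \<open>The field is split into a pure spherical wave \<open>L\<close>, extended to all x, and
  an error of order |x|^(-(d+1)/2). Absolute values suffice for the error. The wave is larger by a
  factor |x| and needs the oscillation along rays; the gain of 1/|s| from
  \<open>radial_phase_bound\<close> brings it to |s|^(q-d/2) = |s|^(-1/2) as well.\<close>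

lemma outgoing_decay:
 fixes ph F1 :: "'a::euclidean_space => complex"
 assumes dim: "DIM('a) >= 2" and ka: "ka > 0" and a: "a > 0"
  and cont: "continuous_on UNIV ph" and bdd: "\<And>x. norm (ph x) <= B"
  and asym: "\<And>x. norm x >= R ==> norm (ph x - iexp (ka * norm x) / of_real (norm x powr ((real DIM('a) - 1) / 2)) * F1 ((1 / norm x) *\<^sub>R x))
   <= C * norm x powr (- (real DIM('a) + 1) / 2)"
 shows "\<exists>K. \<forall>c t. norm c <= R1 \<and> t >= 1 \<longrightarrow> norm (LBINT x. ph x * gk (of_real a + \<i> * of_real t) (x - c)) <= K * t powr (- 1/2)"
proof -
 let ?d = "real DIM('a)"
 define q where "q = (?d - 1) / 2"
 have q: "q > 0" "q - (?d + 1) / 2 = -1" "?d - 1 - q = q" "q - ?d / 2 = - 1/2" using dim by (auto simp: q_def field_simps)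
 have [measurable]: "ph \<in> mbl" using cont by (rule borel_measurable_continuous_onI)
 have B0: "B >= 0" using bdd[of 0] norm_ge_zero order_trans by blast
 let ?B = "%x. (1 / norm x) *\<^sub>R x"
 define A where "A x = (if x = 0 then 0 else F1 (?B x))" for x
 let ?A = "- (?d + 1) / 2"
 let ?C = "%u x. ph (u *\<^sub>R x) - iexp (ka * u) / of_real (u powr q) * F1 x"
 have asym': "norm (?C u x) <= C * u powr ?A"
  if "u >= R" "u > 0" "norm x = 1" for u x
  using asym[of "u *\<^sub>R x"] that by (simp add: q_def)
 let ?M = "%u. - \<i> * of_real (ka * u)"
 let ?I = "%u x. of_real (u powr q) * exp (?M u) * ph (u *\<^sub>R x) - F1 x"
 have dev: "norm (?I u x) <= C / u"
  if u: "u >= R" "u > 0" "norm x = 1" for u x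
 proof -
  have "of_real (u powr q) * exp (?M u) * ph (u *\<^sub>R x) - F1 x =
    of_real (u powr q) * exp (?M u) * ?C u x"
   using u by (simp add: field_simps exp_minus)
  hence "norm (?I u x) = u powr q * norm (?C u x)"
   by (simp add: norm_mult)
  also have "... <= u powr q * (C * u powr ?A)" using asym'[OF u] by (rule mult_left_mono) simp
  also have "... = C * (u powr q * u powr ?A)" by simp
  also have "u powr q * u powr ?A = u powr (q - (?d + 1) / 2)" unfolding powr_add[symmetric] by (rule arg_cong[where f="%e. u powr e"]) (simp add: field_simps)
  also have "C * u powr (q - (?d + 1) / 2) = C / u" unfolding q(2) using u by (simp add: powr_neg_one)
  finally show ?thesis .
 qed
 let ?D = "%n. - \<i> * of_real (ka * real n)"
 let ?P = "%n x. real n *\<^sub>R (?B x)"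
 let ?K = "%n x. of_real (real n powr q) * exp (?D n) * ph (?P n x) - F1 (?B x)"
 \<comment> \<open>No regularity of F1 is given. The profile is Borel as the pointwise limit of
   rescaled values of the continuous field on spheres of radius n.\<close>
 have [measurable]: "A \<in> mbl"
 proof (rule borel_measurable_LIMSEQ_metric)
  fix n :: nat
  show "(%x. if x = 0 then 0 else of_real (real n powr q) * exp (?D n) * ph (?P n x)) \<in> mbl"
   by measurable
 next
  fix x :: 'a
  show "(%n. if x = 0 then 0 else of_real (real n powr q) * exp (?D n) * ph (?P n x)) \<longlonglongrightarrow> A x"
  proof (cases "x = 0")
   case False
   obtain N :: nat where N: "real N >= max R 1" using real_arch_simple by blast
   have "(%n. of_real (real n powr q) * exp (?D n) * ph (?P n x) - F1 (?B x)) \<longlonglongrightarrow> 0"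
   proof (rule Lim_null_comparison)
    show "\<forall>\<^sub>F n in sequentially. norm (?K n x) <= C / real n"
    proof (rule eventually_sequentiallyI[of N])
     fix n assume "N <= n"
     hence "real n >= R" "real n > 0" using N by auto
     thus "norm (?K n x) <= C / real n"
      using False by (intro dev) auto
    qed
   qed (rule lim_const_over_n)
   thus ?thesis using False by (simp add: A_def LIM_zero_iff)
  qed (simp add: A_def)
 qed
 define U where "U = max R 1"
 have U: "U >= R" "U >= 1" by (auto simp: U_def)
 \<comment> \<open>A bound for the angular profile, read off from the asymptotics at the single
   radius U.\<close>
 define CF where "CF = U powr q * B + \<bar>C\<bar> / U"
 let ?N = "- \<i> * of_real (ka * U)"
 have F1b: "norm (F1 x) <= CF" if x: "norm x = 1" for x
 proof -
  have "norm (F1 x) <= norm (of_real (U powr q) * exp ?N * ph (U *\<^sub>R x)) + norm (of_real (U powr q) * exp ?N * ph (U *\<^sub>R x) - F1 x)"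
   by (metis norm_triangle_sub norm_minus_commute)
  also have "... <= U powr q * B + C / U" using U x
   by (intro add_mono dev) (auto simp: norm_mult bdd mult_left_mono)
  also have "... <= CF" unfolding CF_def using U by (intro add_mono divide_right_mono) auto
  finally show ?thesis .
 qed
 have CF0: "CF >= 0" using U B0 by (simp add: CF_def)
 define L where "L x = iexp (ka * norm x) * of_real (norm x powr (- q)) * A x" for x
 have [measurable]: "L \<in> mbl" unfolding L_def by measurable
 have Ab: "norm (A x) <= CF" for x using F1b[of "(1 / norm x) *\<^sub>R x"] CF0 by (cases "x = 0") (auto simp: A_def)
 have Lb: "norm (L x) <= CF * norm x powr (- q)" for x
  using Ab[of x] by (simp add: L_def norm_mult mult.commute mult_right_mono)
 define err where "err x = ph x - L x" for x
 have [measurable]: "err \<in> mbl" unfolding err_def by measurable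
 let ?H = "(?d + 1) / 2"
 \<comment> \<open>The second entry covers |x| below R, where no asymptotics are available: there a
   bounded field and a wave of size CF |x|^(-q) are both dominated by a multiple of
   |x|^(-(d+1)/2).\<close>
 define C' where "C' = max (\<bar>C\<bar>) (B * U powr ?H + CF * U)"
 have errb: "norm (err x) <= C' * norm x powr ?A" if x: "x \<noteq> 0" for x
 proof (cases "norm x >= R")
  case True
  have "L x = iexp (ka * norm x) / of_real (norm x powr q) * F1 (?B x)"
   using x by (simp add: L_def A_def powr_minus divide_inverse)
  hence "norm (err x) <= C * norm x powr ?A"
   using asym[OF True] unfolding err_def q_def by (simp only:)
  also have "... <= C' * norm x powr ?A" by (intro mult_right_mono) (auto simp: C'_def)
  finally show ?thesis .
 next
  case False
  hence xU: "norm x <= U" using U by linarith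
  have "norm (err x) <= B + CF * norm x powr (- q)" unfolding err_def
   by (rule order_trans[OF norm_triangle_ineq4 add_mono[OF bdd Lb]])
  also have "... = (B * norm x powr ?H + CF * norm x) * norm x powr ?A"
  proof -
   have "norm x powr ?H * norm x powr ?A = 1"
   proof -
    have "norm x powr ?H * norm x powr ?A = norm x powr 0"
     unfolding powr_add[symmetric] by (rule arg_cong[where f="%e. norm x powr e"]) (simp add: field_simps)
    thus ?thesis using x by simp
   qed
   moreover have "norm x * norm x powr ?A = norm x powr (- q)"
   proof -
    have "norm x * norm x powr ?A = norm x powr 1 * norm x powr ?A" using x by simp
    also have "... = norm x powr (- q)" unfolding powr_add[symmetric] by (rule arg_cong[where f="%e. norm x powr e"]) (simp add: q_def field_simps)
    finally show ?thesis .
   qed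
   ultimately show ?thesis by (simp add: distrib_right mult.assoc)
  qed
  also have "... <= C' * norm x powr ?A"
  proof (rule mult_right_mono)
   have "B * norm x powr ?H + CF * norm x <= B * U powr ?H + CF * U"
    using xU B0 CF0 by (intro add_mono mult_left_mono powr_mono2) auto
   thus "B * norm x powr ?H + CF * norm x <= C'" by (simp add: C'_def)
  qed simp
  finally show ?thesis .
 qed
 obtain K1 where K1: "\<And>c t. norm c <= R1 ==> t >= 1 ==> norm (LBINT x. err x * gk (of_real a + \<i> * of_real t) (x - c)) <= K1 * t powr (- 1/2)"
  using err_integral_bound[OF dim a, of err C' R1] errb by auto
 define W where "W p = (LBINT r. indicator {0<..} r * (r powr p * exp (- (a/8) * r^2)))" for p :: real
 let ?L = "a * R1^2 / 4"
 define KW where "KW = exp ?L / ka * (q * W (q - 1) + (R1 + 1 / ka) / 2 * W q)"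
 define K2 where "K2 = ?d * measure lborel (cball (0::'a) 1) * (CF * KW)"
 have W0: "W p >= 0" for p unfolding W_def by (intro integral_nonneg_AE AE_I2) auto
 let ?J = "DIM('a) - 1"
 let ?F = "%tt s c. LBINT r. indicator {0<..} r *\<^sub>R (r ^ ?J *\<^sub>R (L (r *\<^sub>R tt) * gk s (r *\<^sub>R tt - c)))"
 let ?G = "%sg x. - ((a/8) / sg^2) * (norm x)^2"
 have "norm (LBINT x. ph x * gk (of_real a + \<i> * of_real t) (x - c)) <= (K1 + K2) * t powr (- 1/2)" if c: "norm c <= R1" and t: "t >= 1" for c t
 proof -
  define s where "s = of_real a + \<i> * of_real t"
  define sg where "sg = cmod s"
  have sgt: "sg >= t" unfolding sg_def s_def using abs_Im_le_cmod[of "of_real a + \<i> * of_real t"] t by simp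
  hence sg: "sg > 0" using t by linarith
  have sR: "Re s = a" by (simp add: s_def)
  have R1: "R1 >= 0" using c norm_ge_zero order_trans by blast
  have KW0: "KW >= 0" using R1 ka q W0 by (simp add: KW_def)
  have iL: "integrable lborel (%x. L x * gk s (x - c))"
  proof (rule norm_integral_le_AE(1))
   have "integrable lborel (%x::'a. norm x powr (- q) * exp (?G sg x))"
    using sg a by (intro integrable_radial_powr_gauss) (auto simp: q_def)
   thus "integrable lborel (%x::'a. CF * exp ?L / sqrt (4 * pi * sg) ^ DIM('a) * (norm x powr (- q) * exp (?G sg x)))"
    by (rule integrable_mult_right)
   show "AE x::'a in lborel. norm (L x * gk s (x - c)) <= CF * exp ?L / sqrt (4 * pi * sg) ^ DIM('a) * (norm x powr (- q) * exp (?G sg x))"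
   proof (rule AE_I2)
    fix x :: 'a
    have "norm (gk s (x - c)) <= exp ?L * exp (?G sg x) / sqrt (4 * pi * sg) ^ DIM('a)"
     unfolding norm_gk sR sg_def[symmetric] using norm_gk_shift_le[OF a t c, of x, folded s_def sg_def] sg by (intro divide_right_mono) auto
    hence "norm (L x) * norm (gk s (x - c)) <= (CF * norm x powr (- q)) * (exp ?L * exp (?G sg x) / sqrt (4 * pi * sg) ^ DIM('a))"
     using CF0 by (intro mult_mono Lb) auto
    thus "norm (L x * gk s (x - c)) <= CF * exp ?L / sqrt (4 * pi * sg) ^ DIM('a) * (norm x powr (- q) * exp (?G sg x))"
     by (simp add: norm_mult field_simps)
   qed
  qed measurable
  have iph: "integrable lborel (%x. ph x * gk s (x - c))"
  proof (rule norm_integral_le_AE(1))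
   show "integrable lborel (%x. B * norm (gk s (x - c)))"
    using a sR by (intro integrable_mult_right integrable_norm integrable_gk_translate) auto
  qed (auto simp: norm_mult intro!: mult_right_mono bdd)
  have "(LBINT x. ph x * gk s (x - c)) = (LBINT x. L x * gk s (x - c)) + (LBINT x. err x * gk s (x - c))"
   using integral_diff[OF iph iL] by (simp add: err_def left_diff_distrib)
  moreover have "norm (LBINT x. L x * gk s (x - c)) <= K2 * t powr (- 1/2)"
  proof -
   have "norm (LBINT x. L x * gk s (x - c)) <= ?d * measure lborel (cball (0::'a) 1) * (CF / sqrt (4 * pi * sg) ^ DIM('a) * (KW * sg powr q))"
   proof (rule norm_integral_polar_le[OF iL])
    fix tt :: 'a assume th: "norm tt = 1"
    let ?g = "%r. indicator {0<..} r *\<^sub>R (of_real (r powr q) * iexp (ka * r) * exp (- of_real ((r *\<^sub>R tt - c) \<bullet> (r *\<^sub>R tt - c)) / (4 * s)))"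
    have "?F tt s c
     = (LBINT r. (F1 tt / csqrt (4 * of_real pi * s) ^ DIM('a)) * ?g r)"
    proof (intro integral_cong refl)
     fix r :: real
     show "indicator {0<..} r *\<^sub>R (r ^ ?J *\<^sub>R (L (r *\<^sub>R tt) * gk s (r *\<^sub>R tt - c))) = (F1 tt / csqrt (4 * of_real pi * s) ^ DIM('a)) * ?g r"
     proof (cases "r > 0")
      case True
      have "r ^ ?J = r powr (?d - 1)" using True by (simp add: powr_realpow[symmetric] of_nat_diff)
      moreover have "r powr (?d - 1) * r powr (- q) = r powr q"
       unfolding powr_add[symmetric] using q(3) by (intro arg_cong[where f="%e. r powr e"]) simp
      ultimately have "r ^ ?J * r powr (- q) = r powr q" by (simp only:)
      hence rr: "complex_of_real (r ^ ?J) * of_real (r powr (- q)) = of_real (r powr q)" by (simp only: of_real_mult[symmetric])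
      have "tt \<noteq> 0" using th by auto
      hence "L (r *\<^sub>R tt) = iexp (ka * r) * of_real (r powr (- q)) * F1 tt" using True th by (simp add: L_def A_def)
      hence "r ^ ?J *\<^sub>R (L (r *\<^sub>R tt) * gk s (r *\<^sub>R tt - c)) = (complex_of_real (r ^ ?J) * of_real (r powr (- q))) * iexp (ka * r) * F1 tt * gk s (r *\<^sub>R tt - c)"
       by (simp only: scaleR_conv_of_real mult_ac)
      thus ?thesis unfolding rr gk_def using True by (simp add: mult_ac)
     qed simp
    qed
    also have "norm ... = norm (F1 tt) / sqrt (4 * pi * sg) ^ DIM('a) * norm (LBINT r. ?g r)"
     unfolding integral_mult_right_zero norm_mult norm_divide norm_power norm_csqrt sg_def by simp
    also have "... <= CF / sqrt (4 * pi * sg) ^ DIM('a) * (KW * sg powr q)"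
     using radial_phase_bound[OF ka a q(1) t c th] F1b[OF th] CF0 sg unfolding KW_def W_def sg_def s_def
     by (intro mult_mono divide_right_mono) auto
    finally show "norm (?F tt s c) <= CF / sqrt (4 * pi * sg) ^ DIM('a) * (KW * sg powr q)" .
   qed
   also have "... <= ?d * measure lborel (cball (0::'a) 1) * (CF / sg powr (?d/2) * (KW * sg powr q))"
   proof (intro mult_left_mono mult_right_mono divide_left_mono)
    have "sg powr (?d/2) = sqrt sg ^ DIM('a)" using sg by (simp add: powr_half_sqrt[symmetric] powr_powr flip: powr_realpow)
    also have "... <= sqrt (4 * pi * sg) ^ DIM('a)"
     using sg pi_gt3 by (intro power_mono real_sqrt_le_mono) auto
    finally show "sg powr (?d/2) <= sqrt (4 * pi * sg) ^ DIM('a)" .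
   qed (use sg CF0 KW0 in auto)
   also have "... = K2 * (sg powr q / sg powr (?d/2))" by (simp add: K2_def)
   also have "sg powr q / sg powr (?d/2) = sg powr (- 1/2)" unfolding powr_diff[symmetric] q(4) ..
   also have "K2 * sg powr (- 1/2) <= K2 * t powr (- 1/2)"
    using sgt t CF0 KW0 by (intro mult_left_mono powr_mono2') (auto simp: K2_def)
   finally show ?thesis .
  qed
  ultimately show ?thesis using K1[OF c t] unfolding s_def[symmetric] distrib_right
   by (smt (verit) norm_triangle_ineq)
 qed
 thus ?thesis by blast
qed

text \<open>One integration by parts against exp(itE). The majorant g of the derivative is kept as a
  function, since the application uses a Gaussian for small t and a multiple of t^(-2) for large
  t.\<close>

lemma oscillatory_by_parts:
 fixes w w' :: "real => complex"
 assumes ab: "ap <= be" and E: "E > 0"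
  and dw: "\<And>t. t \<in> {ap..be} ==> (w has_vector_derivative w' t) (at t)"
  and cw': "continuous_on {ap..be} w'"
  and g: "integrable lborel (%t. indicator {ap..be} t * g t)"
  and le: "\<And>t. t \<in> {ap..be} ==> norm (w' t) <= g t"
 shows "norm (LBINT t. indicator {ap..be} t *\<^sub>R (iexp (t * E) * w t))
  <= (norm (w ap) + norm (w be) + (LBINT t. indicator {ap..be} t * g t)) / E"
proof -
 let ?e = "%t. iexp (t * E)"
 have cw: "continuous_on {ap..be} w"
  using dw by (meson continuous_at_imp_continuous_on has_vector_derivative_continuous)
 have de: "(?e has_vector_derivative \<i> * of_real E * ?e t) (at t)" for t
 proof -
  have "((%z. exp (\<i> * (z * of_real E))) has_field_derivative \<i> * of_real E * exp (\<i> * (of_real t * of_real E))) (at (of_real t))"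
   by (auto intro!: derivative_eq_intros)
  from has_vector_derivative_real_field[OF this] show ?thesis by simp
 qed
 have b: "integrable lborel (%t. indicator {ap..be} t *\<^sub>R f t)"
  if "continuous_on {ap..be} f" for f :: "real => complex"
  using borel_integrable_atLeastAtMost'[OF that] by (simp add: set_integrable_def)
 have i1: "integrable lborel (%t. indicator {ap..be} t *\<^sub>R (?e t * w t))"
  by (rule b) (intro continuous_intros cw)
 have i2: "integrable lborel (%t. indicator {ap..be} t *\<^sub>R (?e t * w' t))"
  by (rule b) (intro continuous_intros cw')
 let ?A = "LBINT t. indicator {ap..be} t *\<^sub>R (?e t * w' t)"
 let ?B = "LBINT t. indicator {ap..be} t *\<^sub>R (?e t * w t)"
 have "(LBINT t. indicator {ap..be} t *\<^sub>R (?e t * w' t + \<i> * of_real E * ?e t * w t)) = ?e be * w be - ?e ap * w ap"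
 proof (rule integral_FTC_Icc[OF ab])
  fix t assume "ap <= t" "t <= be"
  thus "((%t. ?e t * w t) has_vector_derivative ?e t * w' t + \<i> * of_real E * ?e t * w t) (at t within {ap..be})"
   by (intro has_vector_derivative_at_within[OF has_vector_derivative_mult[OF de dw]]) simp
 qed (intro continuous_intros cw cw')
 also have "(%t. indicator {ap..be} t *\<^sub>R (?e t * w' t + \<i> * of_real E * ?e t * w t)) =
  (%t. \<i> * of_real E * (indicator {ap..be} t *\<^sub>R (?e t * w t)) + indicator {ap..be} t *\<^sub>R (?e t * w' t))"
  by (auto simp: fun_eq_iff algebra_simps)
 also have "integral\<^sup>L lborel ... = \<i> * of_real E * ?B + ?A"
  by (subst integral_add[OF integrable_mult_right[OF i1] i2]) (simp only: integral_mult_right_zero)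
 finally have eq: "\<i> * of_real E * ?B = ?e be * w be - ?e ap * w ap - ?A"
  by (simp add: algebra_simps)
 let ?C = "LBINT t. indicator {ap..be} t * g t"
 have "norm ?A <= ?C"
  by (rule norm_integral_le_AE(2)[OF _ g]) (use i2 le in \<open>auto simp: indicator_def norm_mult intro!: AE_I2\<close>)
 hence "norm (\<i> * of_real E * ?B) <= norm (w be) + norm (w ap) + ?C"
  unfolding eq by (intro order_trans[OF norm_triangle_ineq4] add_mono) (auto simp: norm_mult)
 thus ?thesis using E by (simp add: norm_mult field_simps)
qed

lemma integral_gauss_real:
 fixes c :: real
 assumes "c > 0"
 shows "integrable lborel (%t::real. exp (- c * t^2))" and "(LBINT t. exp (- c * t^2)) = sqrt (pi / c)"
proof -
 show "integrable lborel (%t::real. exp (- c * t^2))" using integrable_gaussian_real[OF assms, of 0] by simp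
 have s: "1 / (4 * c) > 0" using assms by simp
 have "of_real (LBINT t. exp (- c * t^2)) = (LBINT t. complex_of_real (exp (- c * t^2)))" by simp
 also have "... = (LBINT t. exp (- of_real (t^2) / (4 * of_real (1 / (4 * c)))) * iexp (0 * t))"
  using assms by (intro integral_cong refl) (simp add: field_simps flip: exp_of_real)
 also have "... = of_real (sqrt (pi / c))" unfolding gaussian_fourier_real[OF s] by simp
 finally show "(LBINT t. exp (- c * t^2)) = sqrt (pi / c)" using of_real_eq_iff by blast
qed

text \<open>The rate p/5 comes from t^2/(4 + t^2) >= t^2/5 for t at most 1, and 4 is a bound for
  sqrt(5 pi).\<close>

lemma integral_gauss_unit_le:
 assumes p: "p > 0"
 shows "(LBINT t. indicator {0..T} t * exp (- (p/5) * t^2)) <= 4 / sqrt p"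
  and "integrable lborel (%t. indicator {0..T} t * exp (- (p/5) * t^2) :: real)"
proof -
 have c: "p / 5 > 0" using p by simp
 show i: "integrable lborel (%t. indicator {0..T} t * exp (- (p/5) * t^2) :: real)"
  by (rule integrable_bound[OF integral_gauss_real(1)[OF c]]) (auto simp: indicator_def)
 let ?A = "LBINT t. indicator {0..T} t * exp (- (p/5) * t^2)"
 have "?A <= (LBINT t. exp (- (p/5) * t^2))"
  by (intro integral_mono i integral_gauss_real(1)[OF c]) (auto simp: indicator_def)
 also have "... = sqrt (5 * pi) / sqrt p" unfolding integral_gauss_real(2)[OF c] by (simp add: real_sqrt_divide mult.commute)
 also have "... <= 4 / sqrt p"
 proof (rule divide_right_mono)
  have "5 * pi <= 4^2" using pi_less_4 pi_approx by (simp add: power2_eq_square)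
  thus "sqrt (5 * pi) <= 4" by (intro real_le_lsqrt) auto
 qed (use p in auto)
 finally show "?A <= 4 / sqrt p" .
qed

section \<open>The multiplier of the truncated resolvent\<close>

text \<open>With h = 1 + a and p in the role of |p|^2, the Fourier multiplier at time t of the
  kernel \<open>gk (a + it)\<close> weighted by exp(-|z|^2/4); see
  \<open>gk_weighted\<close>.\<close>

definition mw :: "nat => real => real => real => complex" where
 "mw d h p t = exp (- of_real p * (1 - 1 / (of_real h + \<i> * of_real t))) / csqrt (of_real h + \<i> * of_real t) ^ d"

lemma mw_derivative:
 assumes h: "h > 0" and d: "d > 0"
 defines "u \<equiv> %t. of_real h + \<i> * of_real t :: complex"
 shows "(mw d h p has_vector_derivative - \<i> * (of_nat d / (2 * u t) + of_real p / (u t)^2) * mw d h p t) (at t)"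
proof -
 obtain k where k: "d = Suc k" using d by (cases d) auto
 have Re: "Re (u t) > 0" using h by (simp add: u_def)
 have u0: "u t \<noteq> 0" using Re by auto
 have np: "u t \<notin> \<real>\<^sub>\<le>\<^sub>0" using Re by (auto simp: complex_nonpos_Reals_iff)
 let ?K = "csqrt (u t)"
 have K0: "?K \<noteq> 0" using u0 by (simp del: csqrt.sel)
 have K2: "?K * ?K = u t" by (simp flip: power2_eq_square del: csqrt.sel)
 let ?C = "%t. - of_real p * (1 - 1 / u t)"
 let ?D = "Suc k - Suc 0"
 let ?A = "%t. (exp (?C t) * (- of_real p / (u t)^2)) * ?K ^ Suc k - exp (?C t) * (of_nat (Suc k) * (1 / (2 * ?K) * ?K ^ ?D))"
 let ?B = "%t. of_nat d / (2 * u t) + of_real p / (u t)^2"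
 have "((%z. exp (- of_real p * (1 - 1 / z)) / csqrt z ^ Suc k) has_field_derivative
  (?A t) / (?K ^ Suc k * ?K ^ Suc k)) (at (u t))"
  using K0 u0 np by (intro DERIV_divide DERIV_power has_field_derivative_csqrt') (auto intro!: derivative_eq_intros simp: power2_eq_square field_simps simp del: csqrt.sel)
 moreover have "?A t / (?K ^ Suc k * ?K ^ Suc k)
  = - ?B t * (exp (?C t) / ?K ^ Suc k)"
 proof -
  have "1 / (2 * ?K) * ?K ^ ?D = ?K ^ Suc k / (2 * u t)"
  proof -
   have "1 / (2 * K) * K ^ ?D = K ^ Suc k / (2 * (K * K))" if "K \<noteq> 0" for K :: complex
    using that by (simp add: field_simps)
   from this[OF K0] show ?thesis unfolding K2 .
  qed
  moreover have "((X * (- P / U2)) * Z - X * (N * (Z / Y))) / (Z * Z) = - (N / Y + P / U2) * (X / Z)" if "Z \<noteq> 0" for X Z P N Y U2 :: complex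
   using that by (simp add: field_simps)
  ultimately show ?thesis unfolding k using K0 by simp
 qed
 ultimately have 1: "((%z. exp (- of_real p * (1 - 1 / z)) / csqrt z ^ d) has_field_derivative - ?B t * (exp (?C t) / ?K ^ Suc k)) (at (u t))"
  unfolding k by simp
 have "((%z. exp (- of_real p * (1 - 1 / (of_real h + \<i> * z))) / csqrt (of_real h + \<i> * z) ^ d) has_field_derivative - ?B t * (exp (?C t) / ?K ^ Suc k) * \<i>) (at (of_real t))"
  by (rule DERIV_chain2[where f="%z. exp (- of_real p * (1 - 1 / z)) / csqrt z ^ d"]) (use 1 in \<open>auto simp: u_def intro!: derivative_eq_intros\<close>)
 from has_vector_derivative_real_field[OF this]
 have "(mw d h p has_vector_derivative - ?B t * mw d h p t * \<i>) (at t)"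
  unfolding mw_def[abs_def] u_def k .
 thus ?thesis by (rule back_subst[where P="%D. (mw d h p has_vector_derivative D) (at t)"]) (simp add: algebra_simps)
qed

lemma mw_measurable [measurable]: "mw d h p \<in> mbl"
 unfolding mw_def[abs_def] by measurable

lemma Re_one_minus_inverse:
 assumes h: "h >= 1"
 shows "Re (1 - 1 / (of_real h + \<i> * of_real t)) = (h^2 - h + t^2) / (h^2 + t^2)"
proof -
 have "h^2 + t^2 > 0" using h by (intro add_pos_nonneg) auto
 moreover have "Re (1 - 1 / (of_real h + \<i> * of_real t)) = 1 - h / (h^2 + t^2)"
  by (simp add: Re_divide)
 moreover have "1 - h / D = (D - h) / D" if "D > 0" for D :: real using that by (simp add: field_simps)
 ultimately show ?thesis by (simp add: algebra_simps)
qed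

text \<open>For h between 1 and 2 the exponent has real part at least p t^2/(4 + t^2). In dimension
  at least 2 the denominator is at least |h + it|, which supplies the factor \<open>max 1 t\<close>
  uniformly in a.\<close>

lemma mw_norm_le:
 assumes h: "1 <= h" "h <= 2" and p: "p >= 0" and t: "t >= 0" and d: "d >= 2"
 shows "norm (mw d h p t) <= exp (- p * (t^2 / (4 + t^2))) / max 1 t"
proof -
 let ?u = "of_real h + \<i> * of_real t :: complex"
 have hh: "h^2 >= h" using h by (simp add: power2_eq_square)
 have h4: "h^2 <= 4" using power_mono[of h 2 2] h by simp
 have hp: "h^2 + t^2 > 0" using h by (intro add_pos_nonneg) auto
 have "t^2 / (4 + t^2) <= (h^2 - h + t^2) / (h^2 + t^2)"
  using hh h4 hp by (intro frac_le) auto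
 hence "p * (t^2 / (4 + t^2)) <= p * Re (1 - 1 / ?u)"
  unfolding Re_one_minus_inverse[OF h(1)] using p by (rule mult_left_mono)
 hence 1: "norm (exp (- of_real p * (1 - 1 / ?u))) <= exp (- p * (t^2 / (4 + t^2)))"
  by (simp add: norm_exp_eq_Re del: minus_complex.sel)
 have m: "max 1 t <= cmod ?u"
  using abs_Re_le_cmod[of ?u] abs_Im_le_cmod[of ?u] h t by simp
 have "max 1 t <= sqrt (cmod ?u) ^ 2" using m by simp
 also have "... <= sqrt (cmod ?u) ^ d" using m d by (intro power_increasing) auto
 finally have 2: "max 1 t <= norm (csqrt ?u ^ d)" by (simp add: norm_power norm_csqrt del: csqrt.sel)
 show ?thesis unfolding mw_def norm_divide using 1 2 by (intro frac_le) auto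
qed

lemma mw_derivative_norm_le:
 assumes h: "1 <= h" "h <= 2" and p: "p >= 0" and t: "t >= 0" and d: "d >= 2"
 defines "u \<equiv> of_real h + \<i> * of_real t :: complex"
 shows "norm (- \<i> * (of_nat d / (2 * u) + of_real p / u^2) * mw d h p t) <= (real d / 2 + p) * exp (- p * (t^2 / (4 + t^2))) / (max 1 t)^2"
proof -
 have m: "max 1 t <= cmod u"
  using abs_Re_le_cmod[of u] abs_Im_le_cmod[of u] h t by (simp add: u_def)
 have u1: "cmod u >= 1" using m by simp
 let ?A = "of_nat d / (2 * u) + of_real p / u^2"
 have "norm ?A <= real d / 2 / max 1 t + p / max 1 t"
 proof (rule norm_triangle_mono)
  show "norm (of_nat d / (2 * u)) <= real d / 2 / max 1 t"
   unfolding norm_divide norm_mult using m u1 by (simp only: norm_of_nat norm_numeral divide_divide_eq_left, intro divide_left_mono mult_left_mono mult_pos_pos) (auto simp: max_def)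
  have "max 1 t <= (cmod u)^2" using m u1 mult_mono[of 1 "cmod u" "max 1 t" "cmod u"] by (simp add: power2_eq_square)
  thus "norm (of_real p / u^2) <= p / max 1 t" unfolding norm_divide norm_power norm_of_real abs_of_nonneg[OF p] using p u1
   by (intro divide_left_mono mult_pos_pos) (auto simp: max_def)
 qed
 hence "norm (- \<i> * ?A * mw d h p t) <= (real d / 2 / max 1 t + p / max 1 t) * (exp (- p * (t^2 / (4 + t^2))) / max 1 t)"
  unfolding norm_mult using mw_norm_le[OF h p t d] p by (intro mult_mono) (auto simp: norm_mult)
 also have "... = (real d / 2 + p) * exp (- p * (t^2 / (4 + t^2))) / (max 1 t)^2"
 proof -
  have "(A / M + P / M) * (e / M) = (A + P) * e / M^2" for A M P e :: real
   by (simp add: power2_eq_square add_divide_distrib[symmetric])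
  thus ?thesis .
 qed
 finally show ?thesis .
qed

lemma integral_inverse_square_le:
 fixes T :: real
 assumes T: "T >= 1"
 shows "integrable lborel (%t. indicator {1..T} t * (K / t^2))" and "K >= 0 ==> (LBINT t. indicator {1..T} t * (K / t^2)) <= K"
proof -
 have d: "((%t. - inverse t) has_real_derivative inverse t ^ 2) (at t)" if "1 <= t" "t <= T" for t :: real
  using that by (auto intro!: derivative_eq_intros simp: power2_eq_square)
 have c: "isCont (%t::real. inverse t ^ 2) t" if "1 <= t" "t <= T" for t
  using that by (intro continuous_intros) auto
 let ?A = "%t. indicator {1..T} t * (K / t^2)"
 have "has_bochner_integral lborel (%t::real. inverse t ^ 2 * indicator {1..T} t) (- inverse T - - inverse 1)"
  by (rule has_bochner_integral_FTC_Icc_real[OF T d c])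
 hence "has_bochner_integral lborel (%t::real. K * (inverse t ^ 2 * indicator {1..T} t)) (K * (1 - inverse T))"
  using has_bochner_integral_mult_right by force
 moreover have "(%t::real. K * (inverse t ^ 2 * indicator {1..T} t)) = ?A"
  by (auto simp: fun_eq_iff divide_inverse power_inverse)
 ultimately have "has_bochner_integral lborel ?A (K * (1 - inverse T))" by simp
 thus "integrable lborel ?A" "K >= 0 ==> (LBINT t. indicator {1..T} t * (K / t^2)) <= K"
  using T by (auto simp: has_bochner_integral_iff mult_le_cancel_left1 not_less intro!: mult_left_le)
qed

lemma mw_derivative_continuous:
 assumes "h > 0" "d > 0"
 shows "continuous_on A (%t. - \<i> * (of_nat d / (2 * (of_real h + \<i> * of_real t)) + of_real p / (of_real h + \<i> * of_real t)^2) * mw d h p t)"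
proof -
 have "continuous_on A (mw d h p)"
  by (intro continuous_at_imp_continuous_on ballI has_vector_derivative_continuous[OF mw_derivative] assms)
 moreover have "of_real h + \<i> * of_real t \<noteq> 0" for t using assms by (simp add: complex_eq_iff)
 ultimately show ?thesis
  by (intro continuous_intros) (auto simp del: distrib_left_numeral)
qed

text \<open>The interval is split at t = 1. Beyond 1 the derivative of the multiplier is O(t^(-2))
  uniformly in p, and integration by parts gives O(1/E). Below 1 the two mechanisms of the case
  split are needed; the worst case is p near E, where both give E^(-1/2). The two parts contribute 6
  + d/2 and 7 + d/2.\<close>

lemma multiplier_bound:
 assumes h: "1 <= h" "h <= 2" and p: "p >= 0" and d: "d >= 2" and E: "E >= 1" and T: "T >= 0"
 shows "norm (LBINT t. indicator {0..T} t *\<^sub>R (iexp (t * E) * mw d h p t)) <= (13 + real d) / sqrt E"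
proof -
 define w' where "w' t = - \<i> * (of_nat d / (2 * (of_real h + \<i> * of_real t)) + of_real p / (of_real h + \<i> * of_real t)^2) * mw d h p t" for t
 have dw: "(mw d h p has_vector_derivative w' t) (at t)" for t
  unfolding w'_def using h d by (intro mw_derivative) auto
 have cw': "continuous_on A w'" for A unfolding w'_def using h d by (intro mw_derivative_continuous) auto
 have cw: "continuous_on A (mw d h p)" for A
  by (intro continuous_at_imp_continuous_on ballI has_vector_derivative_continuous[OF dw])
 let ?C = "%t. - p * (t^2 / (4 + t^2))"
 have w1: "norm (mw d h p t) <= 1" if "t >= 0" for t
 proof -
  have "norm (mw d h p t) <= exp (?C t) / max 1 t" by (rule mw_norm_le[OF h p that d])
  also have "... <= 1 / 1" using p by (intro frac_le) auto
  finally show ?thesis by simp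
 qed
 have sE: "sqrt E >= 1" "sqrt E > 0" using E by auto
 have E2: "1 / E <= 1 / sqrt E" using E sE by (simp add: divide_simps) (metis mult_right_mono real_sqrt_mult_self sE(1) mult_1 order_trans abs_of_pos less_le_trans zero_less_one sE(2) less_imp_le)
 define e where "e t = iexp (t * E)" for t
 have ne: "norm (e t) = 1" for t by (simp add: e_def)
 have [measurable]: "e \<in> mbl" unfolding e_def[abs_def] by measurable
 define T1 where "T1 = min T 1"
 have T1: "0 <= T1" "T1 <= 1" using T by (auto simp: T1_def)
 have q: "t^2 / 5 <= t^2 / (4 + t^2)" if "t \<in> {0..T1}" for t
  using that T1 power_le_one[of t 2] by (intro divide_left_mono mult_pos_pos add_pos_nonneg) auto
 let ?F = "%t. - (p/5) * t^2"
 have ex: "exp (?C t) <= exp (?F t)" if "t \<in> {0..T1}" for t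
  using mult_left_mono[OF q[OF that] p] by simp
 have gi: "integrable lborel (%t. indicator {0..T1} t * (K * exp (?F t)))" for K :: real
 proof -
  have "set_integrable lborel {0..T1} (%t. K * exp (?F t))"
   by (intro borel_integrable_atLeastAtMost' continuous_intros)
  thus ?thesis by (simp add: set_integrable_def)
 qed
 let ?A = "LBINT t. indicator {0..T1} t * (1 * exp (?F t))"
 let ?G = "%d. real d / 2 + p"
 let ?B = "%d. LBINT t. indicator {0..T1} t * (?G d * exp (?F t))"
 let ?D = "%t d h. e t * mw d h p t"
 let ?H = "%d h. LBINT t. indicator {0..T1} t *\<^sub>R (?D t d h)"
 let ?J = "1 / sqrt E"
 let ?K = "%t d. norm (w' t) <= ?G d * exp (?C t) / (max 1 t)^2"
 \<comment> \<open>If p is at least E, the Gaussian decay in t alone gives 4/sqrt(p). If p is below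
   E, integration by parts gains 1/E, while the derivative integrates to d/2 plus p times
   O(1/sqrt(p)), which is at most O(sqrt(E)).\<close>
 have A: "norm (?H d h) <= (6 + real d / 2) / sqrt E"
 proof (cases "p >= E")
  case True
  hence p0: "p > 0" using E by simp
  have "norm (?H d h) <= (LBINT t. indicator {0..T1} t * exp (?F t))"
  proof (rule norm_integral_le_AE(2)[OF _ integral_gauss_unit_le(2)[OF p0]])
   show "AE t in lborel. norm (indicator {0..T1} t *\<^sub>R (?D t d h)) <= indicator {0..T1} t * exp (?F t)"
   proof (rule AE_I2)
    fix t
    show "norm (indicator {0..T1} t *\<^sub>R (?D t d h)) <= indicator {0..T1} t * exp (?F t)"
    proof (cases "t \<in> {0..T1}")
     case t: True
     have "norm (mw d h p t) <= exp (?C t) / max 1 t" using t by (intro mw_norm_le[OF h p _ d]) auto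
     also have "... <= exp (?F t) / 1" by (intro frac_le ex t) auto
     finally show ?thesis using t by (simp add: norm_mult ne)
    qed simp
   qed
  qed simp
  also have "... <= 4 / sqrt p" by (rule integral_gauss_unit_le(1)[OF p0])
  also have "... <= 4 / sqrt E" using True sE by (intro divide_left_mono) auto
  also have "... <= (6 + real d / 2) / sqrt E" using sE by (intro divide_right_mono) auto
  finally show ?thesis .
 next
  case False
  have I: "?B d <= real d / 2 + 4 * sqrt E"
  proof -
   have i1: "?A <= 1"
   proof -
    have "?A <= (LBINT t. indicator {0..T1} t)"
    proof (rule integral_mono[OF gi])
     show "integrable lborel (indicator {0..T1} :: real => real)"
      using emeasure_lborel_Icc_eq[of 0 T1] by (intro integrable_real_indicator) auto
    qed (use p in \<open>auto simp: indicator_def\<close>)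
    also have "... <= 1" using T1 by simp
    finally show ?thesis .
   qed
   have i2: "p * ?A <= 4 * sqrt E"
   proof (cases "p = 0")
    case True thus ?thesis using E by simp
   next
    case p0: False
    hence p0: "p > 0" using p by simp
    have "p * ?A <= p * (4 / sqrt p)"
     using integral_gauss_unit_le(1)[OF p0, of T1] p by (intro mult_left_mono) auto
    also have "... = 4 * (p / sqrt p)" by simp
    also have "p / sqrt p = sqrt p" using p by (rule real_div_sqrt)
    also have "4 * sqrt p <= 4 * sqrt E" using False by simp
    finally show ?thesis .
   qed
   have "(%t. indicator {0..T1} t * (?G d * exp (?F t))) = (%t. (?G d) * (indicator {0..T1} t * (1 * exp (?F t))))"
    by (auto simp: fun_eq_iff)
   hence "?B d = ?G d * ?A"
    by (simp only: integral_mult_right_zero)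
   also have "... = real d / 2 * ?A + p * ?A"
    by (rule distrib_right)
   also have "... <= real d / 2 * 1 + 4 * sqrt E" by (intro add_mono mult_left_mono i1 i2) auto
   finally show ?thesis by simp
  qed
  have "norm (?H d h) <= (norm (mw d h p 0) + norm (mw d h p T1) + ?B d) / E"
   unfolding e_def
  proof (rule oscillatory_by_parts[OF T1(1) _ dw cw' gi])
   fix t assume t: "t \<in> {0..T1}"
   have "?K t d"
    unfolding w'_def using t by (intro mw_derivative_norm_le[OF h p _ d]) auto
   also have "... <= ?G d * exp (?F t) / 1"
    using p t T1 by (intro frac_le mult_left_mono ex t) (auto simp: max_def)
   finally show "norm (w' t) <= ?G d * exp (?F t)" by simp
  qed (use E in auto)
  also have "... <= (1 + 1 + (real d / 2 + 4 * sqrt E)) / E"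
   using E T1 by (intro divide_right_mono add_mono w1 I) auto
  also have "... = (2 + real d / 2) * (1 / E) + 4 * (sqrt E / E)" by (simp add: add_divide_distrib distrib_right)
  also have "sqrt E / E = 1 / sqrt E" using E by (simp add: real_div_sqrt divide_simps)
  also have "(2 + real d / 2) * (1 / E) + 4 * ?J <= (2 + real d / 2) * ?J + 4 * ?J"
   by (intro add_mono mult_left_mono E2) auto
  also have "... = (6 + real d / 2) / sqrt E" by (simp add: add_divide_distrib[symmetric] distrib_right[symmetric])
  finally show ?thesis .
 qed
 let ?I = "%d h. LBINT t. indicator {1..T} t *\<^sub>R (?D t d h)"
 show ?thesis
 proof (cases "T <= 1")
  case True
  hence "norm (LBINT t. indicator {0..T} t *\<^sub>R (?D t d h)) <= (6 + real d / 2) / sqrt E" using A by (simp add: T1_def)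
  also have "... <= (13 + real d) / sqrt E" using sE by (intro divide_right_mono) auto
  finally show ?thesis unfolding e_def .
 next
  case False
  hence T1e: "T1 = 1" and T1le: "1 <= T" by (auto simp: T1_def)
  have i: "integrable lborel (%t. indicator {ap..be} t *\<^sub>R (?D t d h))" for ap be
  proof -
   have "continuous_on {ap..be} (%t. e t * mw d h p t)" unfolding e_def by (intro continuous_intros cw)
   from borel_integrable_atLeastAtMost'[OF this] show ?thesis by (simp add: set_integrable_def)
  qed
  have B: "norm (?I d h) <= (7 + real d / 2) / sqrt E"
  proof -
   have "norm (?I d h) <= (norm (mw d h p 1) + norm (mw d h p T) + (LBINT t. indicator {1..T} t * ((real d / 2 + 5) / t^2))) / E"
    unfolding e_def
   proof (rule oscillatory_by_parts[OF T1le _ dw cw' integral_inverse_square_le(1)[OF T1le]])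
    fix t assume t: "t \<in> {1..T}"
    hence t1: "t >= 1" by simp
    have "(4 + t^2) <= 5 * t^2" using t1 one_le_power[of t 2] by simp
    moreover have "4 + t^2 > 0" by (intro add_pos_nonneg) auto
    ultimately have "1 / 5 <= t^2 / (4 + t^2)" by (simp add: pos_le_divide_eq)
    hence "p * (1/5) <= p * (t^2 / (4 + t^2))" using p by (rule mult_left_mono)
    hence x: "exp (?C t) <= exp (- (p/5))" by simp
    \<comment> \<open>For t at least 1 the multiplier decays like exp(-p/5), which absorbs the
      factor p of its derivative.\<close>
    have "p/5 <= exp (p/5)" using exp_ge_add_one_self[of "p/5"] by linarith
    hence "p * exp (- (p/5)) <= 5" by (simp add: exp_minus divide_simps)
    moreover have "real d / 2 * exp (- (p/5)) <= real d / 2 * 1" using p by (intro mult_left_mono) auto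
    ultimately have y: "?G d * exp (- (p/5)) <= real d / 2 + 5" by (simp add: distrib_right)
    have "?K t d"
     unfolding w'_def using t by (intro mw_derivative_norm_le[OF h p _ d]) auto
    also have "max 1 t = t" using t1 by simp
    also have "?G d * exp (?C t) / t^2 <= ?G d * exp (- (p/5)) / t^2"
     using p x by (intro divide_right_mono mult_left_mono) auto
    also have "... <= (real d / 2 + 5) / t^2" by (intro divide_right_mono y) auto
    finally show "norm (w' t) <= (real d / 2 + 5) / t^2" .
   qed (use E in auto)
   also have "... <= (1 + 1 + (real d / 2 + 5)) / E"
    using E T1le by (intro divide_right_mono add_mono w1 integral_inverse_square_le(2)) auto
   also have "... = (7 + real d / 2) * (1 / E)" by simp
   also have "... <= (7 + real d / 2) * ?J" by (intro mult_left_mono E2) auto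
   finally show ?thesis by simp
  qed
  have "(LBINT t. indicator {0..T} t *\<^sub>R (?D t d h)) = (LBINT t. indicator {0..1} t *\<^sub>R (?D t d h) + indicator {1..T} t *\<^sub>R (?D t d h))"
  proof (rule integral_cong_AE)
   show "AE t in lborel. indicator {0..T} t *\<^sub>R (?D t d h) = indicator {0..1} t *\<^sub>R (?D t d h) + indicator {1..T} t *\<^sub>R (?D t d h)"
    using AE_lborel_singleton[of "1::real"] by eventually_elim (use T1le in \<open>auto simp: indicator_def\<close>)
  qed auto
  also have "... = (LBINT t. indicator {0..1} t *\<^sub>R (?D t d h)) + ?I d h"
   by (rule integral_add[OF i i])
  also have "norm ... <= (6 + real d / 2) / sqrt E + (7 + real d / 2) / sqrt E"
   by (rule norm_triangle_mono[OF A[unfolded T1e] B])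
  also have "... = (13 + real d) / sqrt E" by (simp add: add_divide_distrib[symmetric])
  finally show ?thesis unfolding e_def .
 qed
qed

text \<open>The multiplier of the weighted, truncated resolvent kernel, as a function of |p|^2; the
  type argument carries the dimension.\<close>

definition kT :: "'a::euclidean_space itself => real => real => real => real => complex" where
 "kT _ E a T p = (LBINT t. indicator {0..T} t *\<^sub>R (iexp (t * E) * mw DIM('a) (1 + a) p t))"

lemma mw_measurable2 [measurable (raw)]:
 assumes [measurable]: "f \<in> borel_measurable M" "g \<in> borel_measurable M"
 shows "(%w. mw d h (f w) (g w)) \<in> borel_measurable M"
 unfolding mw_def by measurable

lemma kT_measurable [measurable]: "kT TYPE('a::euclidean_space) E a T \<in> mbl"
 unfolding kT_def[abs_def]
 by (rule lborel.borel_measurable_lebesgue_integral[of "%p t. indicator {0..T} t *\<^sub>R (iexp (t * E) * mw DIM('a) (1 + a) p t)" borel, simplified case_prod_unfold])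
   measurable

text \<open>Multiplying Gaussians adds inverse times: 1/s' = 1 + 1/s, hence s' = s/(1+s) = 1 -
  1/(1+s). The ratio of the two normalisations is the root of 1 + s.\<close>

lemma gk_weighted:
 fixes x :: "'a::euclidean_space"
 assumes s: "Re s > 0"
 shows "exp (- of_real (x \<bullet> x) / 4) * gk s x = gk (1 - 1 / (1 + s)) x / csqrt (1 + s) ^ DIM('a)"
  and "Re (1 - 1 / (1 + s)) > 0"
proof -
 have s0: "s \<noteq> 0" using s by auto
 have s1: "1 + s \<noteq> 0" using s by (auto simp: complex_eq_iff)
 define s' where "s' = 1 - 1 / (1 + s)"
 have s': "s' = s / (1 + s)" using s1 by (simp add: s'_def field_simps)
 have "inverse s' = 1 + inverse s" unfolding s' using s0 s1 by (simp add: field_simps)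
 hence "Re (inverse s') > 0" using Re_inverse_pos[OF s] by simp
 from Re_inverse_pos[OF this] have R: "Re s' > 0" by simp
 show "Re (1 - 1 / (1 + s)) > 0" using R unfolding s'_def .
 have s'0: "s' \<noteq> 0" using R by auto
 have "csqrt (4 * of_real pi * s) = csqrt (4 * of_real pi * s' * (1 + s))" unfolding s' using s1 by simp
 also have "... = csqrt (4 * of_real pi * s') * csqrt (1 + s)"
  using R s by (intro csqrt_mult_Re_pos) auto
 finally have c: "csqrt (4 * of_real pi * s) = csqrt (4 * of_real pi * s') * csqrt (1 + s)" .
 let ?A = "x \<bullet> x"
 let ?B = "- of_real ?A / 4"
 have "- of_real ?A / 4 + - of_real ?A / (4 * s) = - of_real ?A / (4 * s')"
  unfolding s' using s0 s1 by (simp add: field_simps)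
 hence e: "exp ?B * exp (- of_real ?A / (4 * s)) = exp (- of_real ?A / (4 * s'))"
  by (simp only: exp_add[symmetric])
 have "exp ?B * gk s x = gk s' x / csqrt (1 + s) ^ DIM('a)"
  unfolding gk_def c power_mult_distrib e[symmetric] by (simp only: times_divide_eq_right divide_divide_eq_left)
 thus "exp ?B * gk s x = gk (1 - 1 / (1 + s)) x / csqrt (1 + s) ^ DIM('a)" by (simp only: s'_def)
qed

text \<open>Decay in p at fixed a and T. The rate degenerates as a tends to 0 or T to infinity, so
  this serves integrability and not the estimates.\<close>

lemma mw_norm_gauss:
 assumes a: "a > 0" and p: "p >= 0" and t: "t \<in> {0..T}"
 shows "norm (mw d (1 + a) p t) <= exp (- (((1+a)^2 - (1+a)) / ((1+a)^2 + T^2)) * p)"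
proof -
 let ?u = "of_real (1 + a) + \<i> * of_real t :: complex" let ?h = "1 + a"
 have h1: "?h >= 1" using a by simp
 have hh: "?h^2 - ?h >= 0" using a by (simp add: power2_eq_square algebra_simps)
 have tT: "t^2 <= T^2" using t by (intro power_mono) auto
 have pos: "?h^2 + t^2 > 0" "?h^2 + T^2 > 0" using a by (auto intro!: add_pos_nonneg)
 have "(?h^2 - ?h) / (?h^2 + T^2) <= (?h^2 - ?h + t^2) / (?h^2 + t^2)"
  using hh tT pos by (intro frac_le) auto
 hence "(?h^2 - ?h) / (?h^2 + T^2) * p <= p * Re (1 - 1 / ?u)"
  unfolding Re_one_minus_inverse[OF h1] using p by (subst mult.commute, intro mult_left_mono) auto
 hence 1: "norm (exp (- of_real p * (1 - 1 / ?u))) <= exp (- ((?h^2 - ?h) / (?h^2 + T^2)) * p)"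
  by (simp add: norm_exp_eq_Re del: minus_complex.sel)
 have "1 <= cmod ?u" using abs_Re_le_cmod[of ?u] a by simp
 hence "1 <= norm (csqrt ?u ^ d)" by (simp add: norm_power norm_csqrt del: csqrt.sel)
 hence "norm (mw d (1 + a) p t) <= exp (- ((?h^2 - ?h) / (?h^2 + T^2)) * p) / 1"
  unfolding mw_def norm_divide using 1 by (intro frac_le) auto
 thus ?thesis by simp
qed

lemma kT_integrable:
 assumes a: "a > 0"
 shows "integrable lborel (%p::'a::euclidean_space. kT TYPE('a) E a T (p \<bullet> p))"
proof -
 define ep where "ep = ((1+a)^2 - (1+a)) / ((1+a)^2 + T^2)"
 have "(1+a)^2 - (1+a) > 0" using a by (simp add: power2_eq_square algebra_simps add_pos_pos)
 hence ep: "ep > 0" unfolding ep_def using a by (auto intro!: divide_pos_pos add_pos_nonneg)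
 have vi: "integrable lborel (%t::real. indicator {0..T} t :: real)" using emeasure_lborel_Icc_eq[of 0 T] by (intro integrable_real_indicator) auto
 let ?A = "%t p. iexp (t * E) * mw DIM('a) (1 + a) (p \<bullet> p) t"
 show ?thesis unfolding kT_def
 proof (rule Fubini_dominated_fst[OF _ _ integrable_gaussian[OF ep] vi])
  show "(%(p :: 'a, t). indicator {0..T} t *\<^sub>R (?A t p)) \<in> borel_measurable (borel \<Otimes>\<^sub>M (borel :: real measure))"
   by measurable
  show "norm (indicator {0..T} t *\<^sub>R (?A t p)) <= exp (- ep * (p \<bullet> p)) * indicator {0..T} t" for p :: 'a and t
   using mw_norm_gauss[OF a, of "p \<bullet> p" t T "DIM('a)"] by (cases "t \<in> {0..T}") (auto simp: norm_mult ep_def)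
 qed
qed

text \<open>For each t the weighted kernel is again a Gaussian, represented by Fourier inversion
  through \<open>mw\<close>; the Gaussian decay of \<open>mw\<close> in p allows the t-integral to
  be taken inside.\<close>

lemma GT_fourier:
 fixes z :: "'a::euclidean_space"
 assumes a: "a > 0"
 shows "exp (- of_real (z \<bullet> z) / 4) * GT E a T z
  = (1 / of_real (2 * pi) ^ DIM('a)) * (LBINT p. iexp (z \<bullet> p) * kT TYPE('a) E a T (p \<bullet> p))"
proof -
 define ep where "ep = ((1+a)^2 - (1+a)) / ((1+a)^2 + T^2)"
 have "(1+a)^2 - (1+a) > 0" using a by (simp add: power2_eq_square algebra_simps add_pos_pos)
 hence ep: "ep > 0" unfolding ep_def using a by (auto intro!: divide_pos_pos add_pos_nonneg)
 have vi: "integrable lborel (%t::real. indicator {0..T} t :: real)" using emeasure_lborel_Icc_eq[of 0 T] by (intro integrable_real_indicator) auto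
 let ?e = "%t. iexp (t * E)"
 let ?B = "1 / of_real (2 * pi) ^ DIM('a)"
 let ?C = "- of_real (z \<bullet> z) / 4"
 let ?D = "%p. p \<bullet> p"
 let ?G = "%p. z \<bullet> p"
 have g: "exp ?C * gk (of_real a + \<i> * of_real t) z
   = ?B * (LBINT p. iexp (?G p) * mw DIM('a) (1 + a) (?D p) t)" for t
 proof -
  let ?s = "of_real a + \<i> * of_real t :: complex"
  have s: "Re ?s > 0" using a by simp
  have "exp ?C * gk ?s z = gk (1 - 1 / (1 + ?s)) z / csqrt (1 + ?s) ^ DIM('a)"
   by (rule gk_weighted(1)[OF s])
  also have "gk (1 - 1 / (1 + ?s)) z = ?B * (LBINT p. iexp (?G p) * exp (- (1 - 1 / (1 + ?s)) * of_real (?D p)))"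
   unfolding gaussian_inverse_fourier(2)[OF gk_weighted(2)[OF s]] by simp
  also have "?B * (LBINT p. iexp (?G p) * exp (- (1 - 1 / (1 + ?s)) * of_real (?D p))) / csqrt (1 + ?s) ^ DIM('a)
   = ?B * (LBINT p. (iexp (?G p) * exp (- (1 - 1 / (1 + ?s)) * of_real (?D p))) / csqrt (1 + ?s) ^ DIM('a))"
   by (simp del: csqrt.sel)
  also have "(%p::'a. (iexp (?G p) * exp (- (1 - 1 / (1 + ?s)) * of_real (?D p))) / csqrt (1 + ?s) ^ DIM('a)) = (%p. iexp (?G p) * mw DIM('a) (1 + a) (?D p) t)"
  proof (rule ext)
   fix p :: 'a
   have u: "1 + ?s = of_real (1 + a) + \<i> * of_real t" by simp
   show "(iexp (?G p) * exp (- (1 - 1 / (1 + ?s)) * of_real (?D p))) / csqrt (1 + ?s) ^ DIM('a) = iexp (?G p) * mw DIM('a) (1 + a) (?D p) t"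
    unfolding mw_def u by (simp only: times_divide_eq_right mult_minus_left mult.commute[of "of_real (?D p)"])
  qed
  finally show ?thesis .
 qed
 let ?A = "%t p. ?e t * (iexp (?G p) * mw DIM('a) (1 + a) (?D p) t)"
 let ?F = "%t. LBINT p. indicator {0..T} t *\<^sub>R (?A t p)"
 have "exp ?C * GT E a T z = (LBINT t. indicator {0..T} t *\<^sub>R (?e t * (exp ?C * gk (of_real a + \<i> * of_real t) z)))"
  unfolding GT_def integral_mult_right_zero[symmetric] by (intro integral_cong refl) (simp add: mult_ac)
 also have "... = (LBINT t. ?B * ?F t)"
  unfolding g by (intro integral_cong refl) simp
 also have "... = ?B * (LBINT t. (?F t))"
  by (rule integral_mult_right_zero)
 also have "(LBINT t. (?F t))
   = (LBINT p. (LBINT t. indicator {0..T} t *\<^sub>R (?A t p)))"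
 proof (rule Fubini_dominated[OF _ _ vi integrable_gaussian[OF ep]])
  show "(%(t, p). indicator {0..T} t *\<^sub>R (?A t p)) \<in> borel_measurable (borel \<Otimes>\<^sub>M (borel :: 'a measure))"
   by measurable
  show "norm (indicator {0..T} t *\<^sub>R (?A t p)) <= indicator {0..T} t * exp (- ep * ?D p)" for p :: 'a and t
   using mw_norm_gauss[OF a, of "p \<bullet> p" t T "DIM('a)"] by (cases "t \<in> {0..T}") (auto simp: norm_mult ep_def)
 qed
 also have "... = (LBINT p. iexp (?G p) * kT TYPE('a) E a T (?D p))"
  unfolding kT_def integral_mult_right_zero[symmetric] by (intro integral_cong refl) (simp add: mult_ac)
 finally show ?thesis .
qed

section \<open>The high-energy resolvent bound\<close>

text \<open>Sources and test functions live in this class; it is closed under multiplication by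
  functions bounded on the ball, which keeps later integrability trivial.\<close>

definition bcs :: "real => ('a::euclidean_space => complex) => bool" where
 "bcs rh h \<longleftrightarrow> h \<in> mbl \<and> (\<exists>B. \<forall>x. norm (h x) <= B) \<and> (\<forall>x. norm x > rh \<longrightarrow> h x = 0)"

lemma bcs_measurable: "bcs rh h ==> h \<in> mbl" by (simp add: bcs_def)

lemma bcsE:
 assumes "bcs rh h"
 obtains B where "B >= 0" "\<And>x. norm (h x) <= B" "\<And>x. norm x > rh ==> h x = 0"
 using assms unfolding bcs_def by (metis norm_ge_zero order_trans)

lemma bcs_integrable: "bcs rh h ==> integrable lborel h"
 by (auto simp: bcs_def intro: integrable_bounded_support)

lemma bcs_mult:
 assumes "bcs rh h" and [measurable]: "f \<in> mbl" and "\<And>x. norm x <= rh ==> norm (f x) <= K"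
 shows "bcs rh (%x. h x * f x)"
proof -
 obtain B where B: "B >= 0" "\<And>x. norm (h x) <= B" "\<And>x. norm x > rh ==> h x = 0" using assms(1) by (rule bcsE) blast
 have [measurable]: "h \<in> mbl" using assms(1) by (rule bcs_measurable)
 have "norm (h x * f x) <= B * \<bar>K\<bar>" for x
 proof (cases "norm x <= rh")
  case True
  thus ?thesis unfolding norm_mult using B assms(3)[OF True] by (intro mult_mono) auto
 next
  case False thus ?thesis using B by simp
 qed
 moreover have "(%x. h x * f x) \<in> mbl" by measurable
 ultimately show ?thesis unfolding bcs_def using B(3) by auto
qed

lemma bcs_norm2_integrable:
 assumes "bcs rh h"
 shows "integrable lborel (%x. (norm (h x))^2)"
proof -
 obtain B where B: "B >= 0" "\<And>x. norm (h x) <= B" "\<And>x. norm x > rh ==> h x = 0" using assms by (rule bcsE) blast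
 have [measurable]: "h \<in> mbl" using assms by (rule bcs_measurable)
 show ?thesis
  by (rule integrable_bounded_support[where B="B^2" and R=rh]) (auto simp: B intro!: power_mono)
qed

definition FT :: "('a::euclidean_space => complex) => 'a => complex" where
 "FT h p = (LBINT x. iexp (p \<bullet> x) * h x)"

lemma FT_measurable [measurable]:
 assumes [measurable]: "h \<in> mbl"
 shows "FT h \<in> mbl"
 unfolding FT_def[abs_def]
 by (rule lborel.borel_measurable_lebesgue_integral[of "%p x. iexp (p \<bullet> x) * h x" borel, simplified case_prod_unfold]) measurable

lemma FT_bounded:
 assumes "integrable lborel h"
 shows "norm (FT h p) <= (LBINT x. norm (h x))"
 unfolding FT_def by (rule order_trans[OF integral_norm_bound]) (simp add: norm_mult)

definition L2sq :: "('a::euclidean_space => complex) => real" where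
 "L2sq h = (LBINT x. (norm (h x))^2)"

lemma L2sq_nonneg: "L2sq h >= 0"
 unfolding L2sq_def by (intro integral_nonneg_AE AE_I2) auto

lemma gk_real:
 fixes x :: "'a::euclidean_space"
 assumes "et > 0"
 shows "gk (of_real et) x = of_real (norm (gk (of_real et) x))"
  and "(LBINT x. norm (gk (of_real et) (x::'a))) = 1"
proof -
 let ?A = "of_real et"
 have 1: "gk ?A x = of_real (norm (gk ?A x))" for x :: 'a
 proof -
  have "csqrt (4 * of_real pi * of_real et) = of_real (sqrt (4 * pi * et))"
   using assms csqrt_of_real[of "4 * pi * et"] by simp
  thus ?thesis unfolding norm_gk using assms by (simp add: gk_def power2_eq_square exp_of_real[symmetric])
 qed
 show "gk ?A x = of_real (norm (gk ?A x))" by (rule 1)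
 have "of_real (LBINT x. norm (gk ?A (x::'a))) = (LBINT x. complex_of_real (norm (gk ?A (x::'a))))" by simp
 also have "... = (LBINT x. gk ?A (x::'a))" by (simp only: 1[symmetric])
 also have "... = 1" using integrable_gk_fourier(2)[of "of_real et" "0::'a"] assms by simp
 finally show "(LBINT x. norm (gk ?A (x::'a))) = 1" using of_real_eq_1_iff by blast
qed

lemma FT_cnj: "cnj (FT h p) = FT (%x. cnj (h x)) (- p)"
proof -
 have "cnj (FT h p) = (LBINT x. cnj (iexp (p \<bullet> x) * h x))" unfolding FT_def by (rule integral_cnj[symmetric])
 thus ?thesis unfolding FT_def by (simp add: exp_cnj)
qed

lemma cnj_borel_measurable [measurable]: "cnj \<in> mbl"
 by (intro borel_measurable_continuous_onI continuous_intros)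

lemma bcs_cnj: "bcs rh h ==> bcs rh (%x. cnj (h x))"
proof -
 note cnj_borel_measurable
 thus "bcs rh h ==> bcs rh (%x. cnj (h x))" unfolding bcs_def by (auto intro: measurable_compose)
qed

lemma FT_swap:
 fixes m :: "'a::euclidean_space => complex"
 assumes h: "bcs rh h" and m: "integrable lborel m"
 shows "(LBINT p. m p * FT h p) = (LBINT x. h x * (LBINT p. m p * iexp (p \<bullet> x)))"
proof -
 have [measurable]: "h \<in> mbl" using h by (rule bcs_measurable)
 have [measurable]: "m \<in> mbl" using m by (auto dest: borel_measurable_integrable)
 have "(LBINT p. m p * FT h p) = (LBINT p. (LBINT x. m p * (iexp (p \<bullet> x) * h x)))"
  unfolding FT_def by simp
 also have "... = (LBINT x. (LBINT p. m p * (iexp (p \<bullet> x) * h x)))"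
  by (rule Fubini_dominated[where u="%p. norm (m p)" and v="%x. norm (h x)"])
    (use m bcs_integrable[OF h] in \<open>auto simp: norm_mult\<close>)
 also have "... = (LBINT x. h x * (LBINT p. m p * iexp (p \<bullet> x)))"
  unfolding integral_mult_right_zero[symmetric] by (intro integral_cong refl) (simp add: mult_ac)
 finally show ?thesis .
qed

text \<open>The Gaussian regularises the p-integral, which becomes (2 pi)^d times the integral of
  h(x) cnj(h(y)) against a probability density in x - y. Such a form is at most the squared L2
  norm.\<close>

lemma FT_gaussian_energy:
 fixes h :: "'a::euclidean_space => complex"
 assumes h: "bcs rh h" and et: "et > 0"
 shows "integrable lborel (%p. exp (- et * (p \<bullet> p)) * (norm (FT h p))^2)"
  and "(LBINT p. exp (- et * (p \<bullet> p)) * (norm (FT h p))^2) <= (2 * pi) ^ DIM('a) * L2sq h"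
proof -
 have [measurable]: "h \<in> mbl" using h by (rule bcs_measurable)
 have ih: "integrable lborel h" using h by (rule bcs_integrable)
 obtain B where B: "B >= 0" "\<And>x. norm (h x) <= B" "\<And>x. norm x > rh ==> h x = 0" using h by (rule bcsE) blast
 define M where "M = (LBINT x. norm (h x))"
 have M: "norm (FT h p) <= M" for p unfolding M_def by (rule FT_bounded[OF ih])
 let ?B = "%p. - et * (p \<bullet> p)"
 have gi: "integrable lborel (%p::'a. exp (?B p))" using et by (rule integrable_gaussian)
 show "integrable lborel (%p. exp (?B p) * (norm (FT h p))^2)"
 proof (rule integrable_bound)
  show "integrable lborel (%p::'a. exp (?B p) * M^2)" using gi by (rule integrable_mult_left)
 qed (auto intro!: mult_left_mono power_mono M)
 let ?A = "%p. - of_real et * of_real (p \<bullet> p)"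
 define m where "m p = exp (?A p) * cnj (FT h p)" for p :: 'a
 have nm: "norm (exp (- complex_of_real et * of_real (p \<bullet> p))) = exp (?B p)" for p :: 'a
  by (subst norm_exp_eq_Re) simp
 have mi: "integrable lborel m"
 proof (rule integrable_bound)
  show "integrable lborel (%p::'a. exp (?B p) * M)" using gi by (rule integrable_mult_left)
  have [measurable]: "(%p. FT (%x. cnj (h x)) (- p)) \<in> mbl"
   by (rule measurable_compose[where N=borel and f=uminus]) (auto intro!: FT_measurable measurable_compose[OF _ cnj_borel_measurable])
  show "m \<in> borel_measurable lborel" unfolding m_def FT_cnj by measurable
 next
  have "M >= 0" using M[of 0] norm_ge_zero order_trans by blast
  thus "AE p in lborel. norm (m p) <= norm (exp (?B p) * M)"
   by (intro AE_I2) (auto simp: m_def norm_mult nm intro!: mult_left_mono M)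
 qed
 let ?K = "of_real et"
 let ?G = "%z::'a. norm (gk ?K z)"
 have s: "Re (complex_of_real et) > 0" using et by simp
 let ?C = "%x. LBINT y. cnj (h y) * of_real (?G (x - y))"
 let ?H = "%x y. LBINT p. exp (?A p) * iexp (- p \<bullet> x) * iexp (p \<bullet> y)"
 have inner: "(LBINT p. m p * iexp (p \<bullet> x)) = of_real (2 * pi) ^ DIM('a) * ?C x" for x
 proof -
  have i2: "integrable lborel (%p. exp (?A p) * iexp (- p \<bullet> x))"
  proof (rule integrable_bound[OF gi])
   show "AE p in lborel. norm (exp (?A p) * iexp (- p \<bullet> x)) <= norm (exp (?B p))"
    unfolding norm_mult nm by simp
  qed measurable
  have "(LBINT p. m p * iexp (p \<bullet> x)) = (LBINT p. m (- p) * iexp (- p \<bullet> x))"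
   using integral_lborel_reflect[of "%p. m p * iexp (p \<bullet> x)" 0] by simp
  also have "... = (LBINT p. (exp (?A p) * iexp (- p \<bullet> x)) * FT (%y. cnj (h y)) p)"
   by (simp add: m_def FT_cnj mult_ac)
  also have "... = (LBINT y. cnj (h y) * ?H x y)"
   by (rule FT_swap[OF bcs_cnj[OF h] i2])
  also have "... = (LBINT y. cnj (h y) * (of_real (2 * pi) ^ DIM('a) * of_real (?G (x - y))))"
  proof (intro integral_cong refl)
   fix y
   have e: "exp (?A p) * iexp (- p \<bullet> x) * iexp (p \<bullet> y) = iexp ((y - x) \<bullet> p) * exp (?A p)" for p
    by (simp add: mult_exp_exp inner_diff_left inner_diff_right inner_commute algebra_simps)
   have "?H x y = of_real (2 * pi) ^ DIM('a) * gk ?K (y - x)"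
    unfolding e by (rule gaussian_inverse_fourier(2)[OF s])
   also have "gk ?K (y - x) = gk ?K (x - y)"
   proof -
    have "(y - x) \<bullet> (y - x) = (x - y) \<bullet> (x - y)" by (simp add: inner_diff_left inner_diff_right inner_commute)
    thus ?thesis unfolding gk_def by (simp only:)
   qed
   also have "... = of_real (?G (x - y))" by (rule gk_real(1)[OF et])
   finally show "cnj (h y) * ?H x y = cnj (h y) * (of_real (2 * pi) ^ DIM('a) * of_real (?G (x - y)))"
    by (simp only:)
  qed
  also have "... = of_real (2 * pi) ^ DIM('a) * ?C x"
   unfolding integral_mult_right_zero[symmetric] by (intro integral_cong refl) (simp only: mult_ac)
  finally show ?thesis .
 qed
 let ?D = "LBINT p. exp (?B p) * (norm (FT h p))^2"
 let ?J = "LBINT x. h x * ?C x"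
 have "complex_of_real ?D = (LBINT p. complex_of_real (exp (?B p) * (norm (FT h p))^2))"
  by (rule integral_complex_of_real[symmetric])
 also have "... = (LBINT p. m p * FT h p)"
  by (intro integral_cong refl)
    (simp add: m_def complex_norm_square[unfolded of_real_power] exp_of_real[symmetric] mult_ac)
 also have "... = (LBINT x. h x * (of_real (2 * pi) ^ DIM('a) * ?C x))"
  unfolding FT_swap[OF h mi] inner ..
 also have "... = of_real (2 * pi) ^ DIM('a) * ?J"
  unfolding integral_mult_right_zero[symmetric] by (simp only: mult.left_commute)
 finally have eq: "complex_of_real ?D = of_real (2 * pi) ^ DIM('a) * ?J" .
 have Gi: "integrable lborel ?G" by (intro integrable_norm integrable_gk s)
 have n2: "integrable lborel (%x. (norm (h x))^2)" by (rule bcs_norm2_integrable[OF h])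
 let ?F = "%x z. h x * (cnj (h (x - z)) * of_real (?G z))"
 have vi: "integrable lborel (%z. B * ?G z)" using Gi by simp
 have ui: "integrable lborel (%x. norm (h x))" using ih by simp
 have dom: "norm (?F x z) <= norm (h x) * (B * ?G z)" for x z
  unfolding norm_mult by (intro mult_left_mono mult_mono) (auto simp: B)
 have dm: "(%(x, z). ?F x z) \<in> borel_measurable (borel \<Otimes>\<^sub>M borel)" by measurable
 let ?I = "%x z. (norm (h x))^2 + (norm (h (x - z)))^2"
 \<comment> \<open>The product of |h(x)| and |h(x - z)| is at most half the sum of their squares,
   and both squares have the same integral by translation invariance.\<close>
 have Ib: "norm (LBINT x. ?F x z) <= L2sq h * ?G z" for z
 proof -
  have hz: "integrable lborel (%x. (norm (h (x - z)))^2)" "(LBINT x. (norm (h (x - z)))^2) = L2sq h"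
   using n2 integrable_lborel_translate[of "%x. (norm (h x))^2" z] integral_lborel_translate[of "%x. (norm (h x))^2" z] by (auto simp: L2sq_def)
  have "norm (LBINT x. ?F x z) <= (LBINT x. ?G z / 2 * ?I x z)"
  proof (rule norm_integral_le_AE(2))
   show "AE x in lborel. norm (?F x z) <= ?G z / 2 * ?I x z"
   proof (rule AE_I2)
    fix x
    have "?G z * (2 * norm (h x) * norm (h (x - z))) <= ?G z * ?I x z"
     by (intro mult_left_mono sum_squares_bound) simp
    thus "norm (?F x z) <= ?G z / 2 * ?I x z" by (simp add: norm_mult mult_ac)
   qed
  qed (use n2 hz in auto)
  also have "... = L2sq h * ?G z" using n2 hz by (simp add: L2sq_def)
  finally show ?thesis .
 qed
 have "?J = (LBINT x. LBINT z. ?F x z)"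
  using integral_lborel_reflect[of "%z. cnj (h (x - z)) * of_real (?G z)" x for x] by simp
 also have "... = (LBINT z. LBINT x. ?F x z)" by (rule Fubini_dominated[OF dm dom ui vi])
 also have "norm ... <= (LBINT z. L2sq h * ?G z)"
  using Ib by (intro norm_integral_le_AE(2) integrable_mult_right Gi borel_measurable_integrable Fubini_dominated_snd[OF dm dom ui vi]) auto
 also have "... = L2sq h" using gk_real(2)[OF et, where 'a='a] by simp
 finally have fin: "norm ?J <= L2sq h" .
 have "\<bar>LBINT p. exp (?B p) * (norm (FT h p))^2\<bar> = norm (complex_of_real ?D)" by simp
 also have "... <= (2 * pi) ^ DIM('a) * L2sq h" unfolding eq norm_mult norm_power
  using fin by (intro mult_mono) auto
 finally show "?D <= (2 * pi) ^ DIM('a) * L2sq h" by simp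
qed

text \<open>Fatou's lemma as the Gaussian regularisation is removed; this is the inequality half of
  Plancherel's theorem.\<close>

lemma bessel:
 fixes h :: "'a::euclidean_space => complex"
 assumes h: "bcs rh h"
 shows "integrable lborel (%p. (norm (FT h p))^2)" and "L2sq (FT h) <= (2 * pi) ^ DIM('a) * L2sq h"
proof -
 have [measurable]: "h \<in> mbl" using h by (rule bcs_measurable)
 define et where "et n = 1 / real (Suc n)" for n
 have et: "et n > 0" for n by (simp add: et_def)
 let ?C = "(2 * pi) ^ DIM('a) * L2sq h"
 have C0: "?C >= 0" using L2sq_nonneg[of h] by simp
 have et0: "et \<longlonglongrightarrow> 0" unfolding et_def using LIMSEQ_inverse_real_of_nat by (simp add: inverse_eq_divide)
 let ?D = "%p. norm (FT h p)"
 let ?A = "%et n p. exp (- et n * (p \<bullet> p)) * ?D p^2"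
 let ?B = "\<integral>\<^sup>+p. ennreal (?D p^2) \<partial>lborel"
 have "?B = (\<integral>\<^sup>+p. liminf (%n. ennreal (?A et n p)) \<partial>lborel)"
 proof (intro nn_integral_cong)
  fix p :: 'a
  have "(%n. exp (- et n * (p \<bullet> p)) * ?D p^2) \<longlonglongrightarrow> exp (- 0 * (p \<bullet> p)) * ?D p^2"
   by (intro tendsto_intros et0)
  hence "(%n. ennreal (?A et n p)) \<longlonglongrightarrow> ennreal (?D p^2)"
   by (intro tendsto_ennrealI) simp
  thus "ennreal (?D p^2) = liminf (%n. ennreal (?A et n p))"
   by (rule lim_imp_Liminf[symmetric, rotated]) simp
 qed
 also have "... <= liminf (%n. \<integral>\<^sup>+p. ennreal (?A et n p) \<partial>lborel)"
  by (rule nn_integral_liminf) measurable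
 also have "... <= liminf (%n::nat. ennreal ?C)"
 proof (rule Liminf_mono, rule always_eventually, rule allI)
  fix n
  have "(\<integral>\<^sup>+p. ennreal (?A et n p) \<partial>lborel) = ennreal (LBINT p. exp (- et n * (p \<bullet> p)) * ?D p^2)"
   by (rule nn_integral_eq_integral[OF FT_gaussian_energy(1)[OF h et]]) simp
  also have "... <= ennreal ?C" by (intro ennreal_leI FT_gaussian_energy(2)[OF h et])
  finally show "(\<integral>\<^sup>+p. ennreal (?A et n p) \<partial>lborel) <= ennreal ?C" .
 qed
 also have "... = ennreal ?C" by (simp add: Liminf_const)
 finally have le: "?B <= ennreal ?C" .
 show i: "integrable lborel (%p. (?D p)^2)"
  by (rule integrableI_nonneg) (use le in \<open>auto intro: order_le_less_trans\<close>)
 have "ennreal (L2sq (FT h)) <= ennreal ?C"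
  unfolding L2sq_def[of "FT h"] using le nn_integral_eq_integral[OF i] by simp
 thus "L2sq (FT h) <= ?C" by (rule iffD1[OF ennreal_le_iff[OF C0]])
qed

text \<open>On the Fourier side the form is an integral of both transforms against a multiplier of
  size O(1/sqrt(E)). Products are split by the arithmetic mean; the geometric mean is recovered
  later by rescaling one of the functions.\<close>

lemma GT_bilinear_weighted:
 fixes h g :: "'a::euclidean_space => complex"
 assumes dim: "DIM('a) >= 2" and a: "0 < a" "a <= 1" and T: "T >= 0" and E: "E >= 1"
  and h: "bcs rh h" and g: "bcs rh g"
 shows "norm (LBINT x. h x * (LBINT y. g y * (exp (- of_real ((x - y) \<bullet> (x - y)) / 4) * GT E a T (x - y))))
  <= (13 + real DIM('a)) / sqrt E * ((L2sq h + L2sq g) / 2)"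
proof -
 have [measurable]: "h \<in> mbl" "g \<in> mbl" using h g by (auto dest: bcs_measurable)
 define k where "k p = kT TYPE('a) E a T (p \<bullet> p)" for p :: 'a
 have ki: "integrable lborel k" unfolding k_def using a by (intro kT_integrable) auto
 have km [measurable]: "k \<in> mbl" unfolding k_def by measurable
 define S where "S = (13 + real DIM('a)) / sqrt E"
 have S0: "S >= 0" using E by (simp add: S_def)
 have kb: "norm (k p) <= S" for p
  unfolding k_def kT_def S_def using a dim E T by (intro multiplier_bound) auto
 let ?c = "1 / of_real (2 * pi) ^ DIM('a) :: complex"
 let ?C = "%x y. - of_real ((x - y) \<bullet> (x - y)) / 4"
 let ?F = "%x y. LBINT p. (iexp (x \<bullet> - p) * k (- p)) * iexp (p \<bullet> y)"
 let ?J = "%p. k p * FT g (- p)"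
 let ?G = "%x. LBINT p. (?J p) * iexp (p \<bullet> x)"
 let ?I = "%x. LBINT p. (iexp (x \<bullet> - p) * k (- p)) * FT g p"
 have inner: "(LBINT y. g y * (exp (?C x y) * GT E a T (x - y)))
   = ?c * ?G x" for x
 proof -
  have i: "integrable lborel (%p. iexp (x \<bullet> - p) * k (- p))"
  proof (rule integrable_bound)
   show "integrable lborel (%p. k (0 - p))" using ki by (subst integrable_lborel_reflect)
  qed (auto simp: norm_mult)
  have "(LBINT y. g y * (exp (?C x y) * GT E a T (x - y)))
   = (LBINT y. ?c * (g y * ?F x y))"
  proof (intro integral_cong refl)
   fix y
   have "(LBINT p. iexp ((x - y) \<bullet> p) * k p) = (LBINT p. iexp ((x - y) \<bullet> (0 - p)) * k (0 - p))"
    by (rule integral_lborel_reflect[symmetric])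
   also have "... = ?F x y"
    by (intro integral_cong refl) (simp add: mult_exp_exp inner_diff_left inner_commute algebra_simps exp_diff)
   finally show "g y * (exp (?C x y) * GT E a T (x - y)) = ?c * (g y * ?F x y)"
    unfolding GT_fourier[OF a(1)] k_def by (simp only: mult_ac)
  qed
  also have "... = ?c * ?I x"
   unfolding FT_swap[OF g i] by simp
  also have "?I x = (LBINT p. (iexp (x \<bullet> - (0 - p)) * k (- (0 - p))) * FT g (0 - p))"
   by (rule integral_lborel_reflect[symmetric])
  also have "... = ?G x"
   by (simp add: inner_commute mult_ac)
  finally show ?thesis .
 qed
 have Fg: "integrable lborel (%p. (norm (FT g (- p)))^2)" "(LBINT p. (norm (FT g (- p)))^2) = L2sq (FT g)"
  using integrable_lborel_reflect[of "%p. (norm (FT g p))^2" 0] integral_lborel_reflect[of "%p. (norm (FT g p))^2" 0] bessel(1)[OF g]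
  by (auto simp: L2sq_def)
 have Fgm [measurable]: "(%p. FT g (- p)) \<in> mbl"
  by (rule measurable_compose[where N=borel and f=uminus]) auto
 have ig: "integrable lborel (%p. k p * FT g (- p))"
 proof (rule norm_integral_le_AE(1))
  show "integrable lborel (%p. norm (k p) * (LBINT x. norm (g x)))" by (intro integrable_mult_left integrable_norm ki)
  show "AE p in lborel. norm (?J p) <= norm (k p) * (LBINT x. norm (g x))"
   unfolding norm_mult by (intro AE_I2 mult_left_mono FT_bounded bcs_integrable[OF g]) auto
 qed measurable
 let ?B = "LBINT p. (?J p) * FT h p"
 let ?H = "%E a T. LBINT x. h x * (LBINT y. g y * (exp (?C x y) * GT E a T (x - y)))"
 have "?H E a T
  = (LBINT x. ?c * (h x * ?G x))"
  unfolding inner by (simp only: mult.left_commute)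
 also have "... = ?c * ?B"
  unfolding FT_swap[OF h ig] by simp
 finally have eq: "?H E a T = ?c * ?B" .
 let ?A = "%p. (norm (FT g (- p)))^2 + (norm (FT h p))^2"
 let ?D = "(2 * pi) ^ DIM('a) * L2sq g + (2 * pi) ^ DIM('a) * L2sq h"
 have "norm ?B <= (LBINT p. S / 2 * ?A p)"
 proof (rule norm_integral_le_AE(2))
  show "integrable lborel (%p. S / 2 * ?A p)"
   by (intro integrable_mult_right integrable_add Fg bessel(1)[OF h])
  show "AE p in lborel. norm (?J p * FT h p) <= S / 2 * ?A p"
  proof (rule AE_I2)
   fix p
   have "0 <= (norm (FT g (- p)) - norm (FT h p))^2" by simp
   hence "norm (FT g (- p)) * norm (FT h p) <= ?A p / 2" by (simp add: power2_eq_square algebra_simps)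
   hence "norm (k p) * (norm (FT g (- p)) * norm (FT h p)) <= S * (?A p / 2)"
    using S0 by (intro mult_mono kb) auto
   thus "norm (?J p * FT h p) <= S / 2 * ?A p"
    by (simp add: norm_mult mult.assoc)
  qed
 qed measurable
 also have "... = S / 2 * (L2sq (FT g) + L2sq (FT h))"
  by (subst integral_mult_right_zero, subst integral_add[OF Fg(1) bessel(1)[OF h]]) (simp only: Fg(2) L2sq_def)
 also have "... <= S / 2 * ?D"
  using S0 by (intro mult_left_mono add_mono bessel(2)[OF h] bessel(2)[OF g]) auto
 finally have "norm ?B <= S / 2 * ?D" .
 hence "norm ?c * norm ?B <= norm ?c * (S / 2 * ?D)"
  by (rule mult_left_mono) simp
 also have "... = S * ((L2sq h + L2sq g) / 2)"
 proof -
  have "norm ?c = 1 / (2 * pi) ^ DIM('a)" by (simp add: norm_divide norm_power norm_mult)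
  moreover have "1 / P * (S / 2 * (P * u + P * v)) = S * ((v + u) / 2)" if "P > 0" for P u v :: real
   using that by (simp add: field_simps)
  ultimately show ?thesis by simp
 qed
 finally show ?thesis unfolding eq norm_mult S_def .
qed

lemma L2sq_mono:
 assumes "bcs rh h" "bcs rh g" "\<And>x. norm (h x) <= K * norm (g x)"
 shows "L2sq h <= K^2 * L2sq g"
proof -
 have "L2sq h <= (LBINT x. K^2 * (norm (g x))^2)" unfolding L2sq_def
  using assms(3) by (intro integral_mono bcs_norm2_integrable[OF assms(1)] integrable_mult_right bcs_norm2_integrable[OF assms(2)]) (auto simp: power_mult_distrib[symmetric] intro!: power_mono)
 thus ?thesis by (simp add: L2sq_def)
qed

lemma GT_norm_bound:
 assumes a: "a > 0" and T: "T >= 0"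
 shows "norm (GT E a T (x :: 'a::euclidean_space)) <= T / sqrt (4 * pi * a) ^ DIM('a)"
proof -
 let ?C = "4 * pi * a"
 let ?A = "1 / sqrt ?C ^ DIM('a)"
 let ?D = "%t. of_real a + \<i> * of_real t"
 let ?B = "%t. indicator {0..T} t *\<^sub>R (iexp (t * E) * gk (?D t) x)"
 have "norm (GT E a T x) <= (LBINT t. indicator {0..T} t *\<^sub>R ?A)"
  unfolding GT_def
 proof (rule norm_integral_le_AE(2))
  show "integrable lborel (%t. indicator {0..T} t *\<^sub>R ?A)"
   by (intro borel_integrable_atLeastAtMost' [unfolded set_integrable_def] continuous_intros)
  show "AE t in lborel. norm (?B t) <= indicator {0..T} t *\<^sub>R ?A"
  proof (rule AE_I2)
   fix t
   have "norm (gk (?D t) x) <= 1 / sqrt ?C ^ DIM('a)" if "t \<in> {0..T}"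
   proof -
    have "norm (gk (?D t) x) <= exp (- (a / (4 * (a + T)^2)) * (x \<bullet> x)) / sqrt ?C ^ DIM('a)"
     using path_bounds[OF a that] a by (intro gk_bound) auto
    also have "... <= 1 / sqrt ?C ^ DIM('a)" using a by (intro divide_right_mono) auto
    finally show ?thesis .
   qed
   thus "norm (?B t) <= indicator {0..T} t *\<^sub>R ?A"
    by (simp add: indicator_def norm_mult)
  qed
 qed measurable
 also have "... = T / sqrt ?C ^ DIM('a)" using T by (simp add: measure_def)
 finally show ?thesis .
qed

text \<open>By the parallelogram identity the inverse weight exp(|x-y|^2/4) equals exp(|x|^2/2)
  exp(|y|^2/2) exp(-|x+y|^2/4). The first two factors are absorbed into h and g at the cost of
  exp(rh^2). The last one is a superposition of the plane waves exp(iq(x+y)), which split into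
  unimodular factors of x and of y, so the weighted bound applies for each q.\<close>

lemma GT_bilinear:
 fixes h g :: "'a::euclidean_space => complex"
 assumes dim: "DIM('a) >= 2" and a: "0 < a" "a <= 1" and T: "T >= 0" and E: "E >= 1"
  and h: "bcs rh h" and g: "bcs rh g"
 shows "norm (LBINT x. h x * (LBINT y. g y * GT E a T (x - y)))
  <= (13 + real DIM('a)) * exp (rh^2) / sqrt E * ((L2sq h + L2sq g) / 2)"
proof -
 have [measurable]: "h \<in> mbl" "g \<in> mbl" using h g by (auto dest: bcs_measurable)
 define w :: "'a => complex" where "w x = of_real (exp (x \<bullet> x / 2))" for x
 have [measurable]: "w \<in> mbl" unfolding w_def[abs_def] by measurable
 define W :: "'a => complex" where "W z = exp (- of_real (z \<bullet> z) / 4) * GT E a T z" for z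
 have [measurable]: "W \<in> mbl" unfolding W_def[abs_def] by measurable
 define M where "M = T / sqrt (4 * pi * a) ^ DIM('a)"
 have M0: "M >= 0" using a T by (simp add: M_def)
 have WM: "norm (W z) <= M" for z
 proof -
  have "norm (W z) <= 1 * M" unfolding W_def norm_mult M_def
   by (intro mult_mono GT_norm_bound a T) auto
  thus ?thesis by simp
 qed
 define c :: complex where "c = csqrt (4 * of_real pi) ^ DIM('a) / of_real (2 * pi) ^ DIM('a)"
 let ?G = "%q::'a. exp (- (1 * (q \<bullet> q)))"
 have Gi: "integrable lborel ?G" using integrable_gaussian[of 1, where 'a='a] by simp
 have gauss: "c * (LBINT q. iexp (z \<bullet> q) * of_real (?G q)) = exp (- of_real (z \<bullet> z) / 4)" for z :: 'a
  using gaussian_inverse_fourier(2)[of 1 z] csqrt_4pi_nonzero[of 1]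
  by (simp add: c_def gk_def exp_of_real[symmetric] del: csqrt.sel)
 let ?K = "LBINT q. ?G q"
 \<comment> \<open>The superposition has total mass 1, so averaging over q loses nothing.\<close>
 have cG: "norm c * ?K = 1"
 proof -
  have "norm (c * of_real ?K) = 1" using gauss[of 0] by simp
  thus ?thesis by (simp add: norm_mult)
 qed
 let ?B = "%x q. w x * iexp (q \<bullet> x)"
 define h' g' where "h' q x = h x * ?B x q" and "g' q x = g x * ?B x q" for q x
 let ?I = "%f q. %x. f x * ?B x q"
 have b: "bcs rh (?I f q)" "L2sq (?I f q) <= exp (rh^2) * L2sq f"
  if f: "bcs rh f" for f q
 proof -
  have wb: "norm (?B x q) <= exp (rh^2 / 2)" if "norm x <= rh" for x
   using power_mono[OF that norm_ge_zero, of 2] by (simp add: w_def norm_mult power2_norm_eq_inner)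
  show b: "bcs rh (?I f q)" by (rule bcs_mult[OF f _ wb]) auto
  obtain B where B: "\<And>x. norm x > rh ==> f x = 0" using f by (rule bcsE) blast
  have "norm (f x * ?B x q) <= exp (rh^2 / 2) * norm (f x)" for x
   using B[of x] mult_left_mono[OF wb[of x], of "norm (f x)"] by (cases "norm x <= rh") (simp_all add: norm_mult mult.commute)
  from L2sq_mono[OF b f this] show "L2sq (?I f q) <= exp (rh^2) * L2sq f"
   by (simp flip: exp_double)
 qed
 have hi: "integrable lborel (%x. norm (f x * w x))" if "bcs rh f" for f
  using bcs_integrable[OF b(1)[OF that, of 0]] by simp
 define N where "N = (LBINT y. norm (g y * w y))"
 define J where "J q x = (LBINT y. g' q y * W (x - y))" for q x
 let ?L = "borel \<Otimes>\<^sub>M borel"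
 let ?J = "?L"
 have [measurable]: "(%(x, q). J q x) \<in> borel_measurable ?J"
  unfolding J_def[abs_def] g'_def split_beta
  by (rule lborel.borel_measurable_lebesgue_integral[of "%p y. g y * (w y * iexp (snd p \<bullet> y)) * W (fst p - y)" "?L", simplified case_prod_unfold]) measurable
 have g'M: "norm (g' q y * W (x - y)) <= norm (g y * w y) * M" for q x y
  unfolding g'_def norm_mult using WM M0 by (auto intro!: mult_mono)
 have JN: "norm (J q x) <= N * M" for q x
 proof -
  have "norm (J q x) <= (LBINT y. norm (g y * w y) * M)" unfolding J_def
   by (rule norm_integral_le_AE(2)) (use g'M hi[OF g] in \<open>auto simp: g'_def\<close>)
  thus ?thesis by (simp add: N_def)
 qed
 let ?A = "%q x. of_real (?G q) * iexp (q \<bullet> x)"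
 let ?C = "%y x. w y * (exp (- of_real ((x + y) \<bullet> (x + y)) / 4) * exp (- of_real ((x - y) \<bullet> (x - y)) / 4))"
 let ?D = "%y x. y \<bullet> y / 2 + (- ((x + y) \<bullet> (x + y)) / 4 + - ((x - y) \<bullet> (x - y)) / 4)"
 let ?H = "%x. LBINT y. g y * GT E a T (x - y)"
 have eq: "h x * ?H x = (LBINT q. c * (of_real (?G q) * (h' q x * J q x)))" for x
 proof -
  \<comment> \<open>The parallelogram identity; it is inserted as a factor 1 in front of the
    unweighted kernel.\<close>
  have one: "w x * ?C y x = 1" for y
  proof -
   have "w x * ?C y x
    = exp (of_real (x \<bullet> x / 2 + ?D y x))"
    by (simp only: w_def exp_of_real[symmetric] exp_add of_real_add of_real_divide of_real_minus of_real_numeral)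
   also have "x \<bullet> x / 2 + ?D y x = 0"
    by (simp add: inner_simps inner_commute field_simps)
   finally show ?thesis by simp
  qed
  have "?H x = (LBINT y. LBINT q. w x * c * ?A q x * (g' q y * W (x - y)))"
  proof (rule integral_cong[OF refl])
   fix y
   have "g y * GT E a T (x - y) = w x * (g y * w y * W (x - y)) * (c * (LBINT q. iexp ((x + y) \<bullet> q) * of_real (?G q)))"
    using arg_cong[OF one[of y], of "%u. u * (g y * GT E a T (x - y))"] unfolding gauss W_def by (simp only: mult_ac mult_1_left mult_1_right)
   also have "... = (LBINT q. w x * (g y * w y * W (x - y)) * (c * (iexp ((x + y) \<bullet> q) * of_real (?G q))))"
    by (simp only: integral_mult_right_zero)
   also have "... = (LBINT q. w x * c * ?A q x * (g' q y * W (x - y)))"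
    unfolding g'_def by (intro integral_cong refl) (simp add: inner_simps inner_commute distrib_left exp_add mult_ac)
   finally show "g y * GT E a T (x - y) = (LBINT q. w x * c * ?A q x * (g' q y * W (x - y)))" .
  qed
  also have "... = (LBINT q. LBINT y. w x * c * ?A q x * (g' q y * W (x - y)))"
  proof (rule Fubini_dominated[where u="%y. norm (g y * w y) * M" and v="%q. norm (w x * c) * ?G q"])
   show "norm (w x * c * ?A q x * (g' q y * W (x - y))) <= norm (g y * w y) * M * (norm (w x * c) * ?G q)" for y q
    using mult_right_mono[OF g'M, of "norm (w x * c) * ?G q" q y x] by (simp add: norm_mult mult_ac)
  qed (use hi[OF g] Gi in \<open>auto simp: g'_def split_beta\<close>)
  also have "... = (LBINT q. w x * c * ?A q x * J q x)" by (simp only: integral_mult_right_zero J_def)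
  finally have "h x * ?H x = (LBINT q. h x * (w x * c * ?A q x * J q x))"
   by (simp only: integral_mult_right_zero)
  thus ?thesis by (simp only: h'_def mult_ac)
 qed
 let ?F = "%x q. c * (of_real (?G q) * (h' q x * J q x))"
 have dm: "(%(x, q). ?F x q) \<in> borel_measurable ?J" unfolding h'_def by measurable
 have ui: "integrable lborel (%x. norm (h x * w x))" by (rule hi[OF h])
 have vi: "integrable lborel (%q. N * M * (norm c * ?G q))" using Gi by simp
 have dom: "norm (?F x q) <= norm (h x * w x) * (N * M * (norm c * ?G q))" for x q
  using mult_left_mono[OF JN, of "norm (h x * w x) * (norm c * ?G q)" q x] by (simp add: h'_def norm_mult mult_ac)
 define C where "C = (13 + real DIM('a)) / sqrt E"
 have C0: "C >= 0" using E by (simp add: C_def)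
 let ?N = "C * (exp (rh^2) * ((L2sq h + L2sq g) / 2))"
 have Fb: "norm (LBINT x. ?F x q) <= norm c * ?G q * ?N" for q
 proof -
  have "norm (LBINT x. h' q x * J q x) <= C * ((L2sq (h' q) + L2sq (g' q)) / 2)"
   unfolding J_def W_def C_def using b(1)[OF h] b(1)[OF g]
   by (intro GT_bilinear_weighted[OF dim a T E]) (auto simp: h'_def[abs_def] g'_def[abs_def])
  also have "... <= ?N" using b(2)[OF h, of q] b(2)[OF g, of q] C0
   by (intro mult_left_mono) (auto simp: h'_def[abs_def] g'_def[abs_def] distrib_left)
  finally have "norm c * ?G q * norm (LBINT x. h' q x * J q x) <= norm c * ?G q * ?N" by (rule mult_left_mono) simp
  thus ?thesis by (simp only: integral_mult_right_zero norm_mult norm_of_real abs_exp_cancel mult.assoc)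
 qed
 have "(LBINT x. h x * ?H x) = (LBINT q. LBINT x. ?F x q)"
  unfolding eq by (rule Fubini_dominated[OF dm dom ui vi])
 also have "norm ... <= (LBINT q. norm c * ?G q * ?N)"
  using Fb Gi by (intro norm_integral_le_AE(2) borel_measurable_integrable Fubini_dominated_snd[OF dm dom ui vi]) auto
 also have "... = norm c * ?K * ?N" by simp
 finally show ?thesis unfolding cG by (simp add: C_def mult_ac)
qed

section \<open>The far field of the resolvent kernel\<close>

text \<open>The integrand of \<open>GT\<close> after scaling: s is the complex time in units of the
  travel time |x|/(2 ka), and l = ka |x|/2 is the large parameter.\<close>

definition cph :: "nat => real => complex => complex" where
 "cph d l s = exp (of_real l * (s - 1 / s)) / csqrt (4 * of_real pi * s) ^ d"

lemma slit_cph: "- (complex_of_real ` {..0}) = - \<real>\<^sub>\<le>\<^sub>0"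
 by (auto simp: nonpos_Reals_def)

lemma slit_4pi: "4 * of_real pi * s \<notin> \<real>\<^sub>\<le>\<^sub>0 \<and> s \<noteq> 0" if "s \<in> - \<real>\<^sub>\<le>\<^sub>0" for s :: complex
proof -
 have "of_real (4 * pi) * s \<notin> \<real>\<^sub>\<le>\<^sub>0"
  using that by (simp add: complex_nonpos_Reals_iff mult_le_0_iff zero_le_mult_iff not_le)
 thus ?thesis using that by auto
qed

lemma cph_holomorphic: "cph d l holomorphic_on - \<real>\<^sub>\<le>\<^sub>0"
 unfolding cph_def[abs_def] using slit_4pi by (intro holomorphic_intros) auto

text \<open>The slit plane is star-shaped, so a primitive exists there and the deformation of the
  contour becomes a comparison of end points.\<close>

lemma cph_primitive: "\<exists>G. \<forall>s\<in>- \<real>\<^sub>\<le>\<^sub>0. (G has_field_derivative cph d l s) (at s)"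
proof -
 have "open (- \<real>\<^sub>\<le>\<^sub>0 :: complex set)" by (simp add: open_Compl)
 thus ?thesis
  using cph_holomorphic holomorphic_starlike_primitive[of "- \<real>\<^sub>\<le>\<^sub>0" "cph d l" "{}"] starlike_slotted_complex_plane_left
  by (auto simp: slit_cph[symmetric] holomorphic_on_imp_continuous_on holomorphic_on_open field_differentiable_def intro: field_differentiable_at_within)
qed

lemma cph_path:
 assumes "c <= e" and m: "\<And>t. t \<in> {c..e} ==> m t \<in> - \<real>\<^sub>\<le>\<^sub>0" and m': "\<And>t. (m has_vector_derivative z) (at t)"
  and G: "\<forall>s\<in>- \<real>\<^sub>\<le>\<^sub>0. (G has_field_derivative cph d l s) (at s)"
 shows "(LBINT t. indicator {c..e} t *\<^sub>R (z * cph d l (m t))) = G (m e) - G (m c)"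
proof (rule integral_FTC_Icc[OF assms(1)])
 fix t assume t: "c <= t" "t <= e"
 have "((%t. G (m t)) has_vector_derivative z * cph d l (m t)) (at t)"
  using field_vector_diff_chain_at[OF m'] G m[of t] t by (auto simp: o_def)
 thus "((%t. G (m t)) has_vector_derivative z * cph d l (m t)) (at t within {c..e})" by (rule has_vector_derivative_at_within)
next
 have "continuous_on {c..e} m" using m' by (intro continuous_at_imp_continuous_on ballI has_vector_derivative_continuous)
 thus "continuous_on {c..e} (%t. z * cph d l (m t))"
  using m by (intro continuous_intros continuous_on_compose2[OF holomorphic_on_imp_continuous_on[OF cph_holomorphic]]) auto
qed

text \<open>The line $\sigma = \alpha + iu$ is deformed through $1$ and along $1 + (-1+i)\tau$, which is a
 path of steepest descent at the saddle point $\sigma = i$ of $\sigma - 1/\sigma$.\<close>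

lemma cph_contour:
 assumes "0 < ap" "ap <= 1" "S >= 2"
 shows "(LBINT u. indicator {0..S} u *\<^sub>R (\<i> * cph d l (of_real ap + \<i> * of_real u))) =
   (LBINT s. indicator {ap..1} s *\<^sub>R (1 * cph d l (of_real s)))
  + (LBINT t. indicator {0..1/2} t *\<^sub>R ((\<i> - 1) * cph d l (1 + (\<i> - 1) * of_real t)))
  + (LBINT t. indicator {1/2..S} t *\<^sub>R ((\<i> - 1) * cph d l (1 + (\<i> - 1) * of_real t)))
  + (LBINT x. indicator {1-S..ap} x *\<^sub>R (1 * cph d l (of_real x + \<i> * of_real S)))"
proof -
 obtain G where G: "\<forall>s\<in>- \<real>\<^sub>\<le>\<^sub>0. (G has_field_derivative cph d l s) (at s)" using cph_primitive by blast
 have "((%u. of_real ap + \<i> * of_real u) has_vector_derivative \<i>) (at u)" for u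
  by (auto intro!: derivative_eq_intros)
 note p = cph_path[OF _ _ this G, of 0 S]
 have d2: "((%s. of_real s :: complex) has_vector_derivative 1) (at u)" for u by (auto intro!: derivative_eq_intros)
 have "((%t. 1 + (\<i> - 1) * of_real t) has_vector_derivative (\<i> - 1)) (at u)" for u by (auto intro!: derivative_eq_intros)
 note p3 = cph_path[OF _ _ this G]
 have "((%x. of_real x + \<i> * of_real S) has_vector_derivative 1) (at u)" for u by (auto intro!: derivative_eq_intros)
 note p4 = cph_path[OF _ _ this G, of "1 - S" ap]
 have eq: "1 + (\<i> - 1) * of_real S = of_real (1 - S) + \<i> * of_real S" by (simp add: algebra_simps)
 show ?thesis
  using assms p cph_path[OF _ _ d2 G, of ap 1] p3[of 0 "1/2"] p3[of "1/2" S] p4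
  by (simp add: complex_nonpos_Reals_iff eq del: mult_1)
qed

lemma norm_cph: "norm (cph d l s) = exp (l * Re s * (1 - 1 / (cmod s)^2)) / sqrt (4 * pi * cmod s) ^ d"
proof -
 have "Re (1 / s) = Re s / (cmod s)^2" by (simp add: Re_divide cmod_power2)
 hence "Re (of_real l * (s - 1 / s)) = l * Re s * (1 - 1 / (cmod s)^2)"
  by (simp only: times_complex.sel Re_complex_of_real Im_complex_of_real minus_complex.sel) (simp add: algebra_simps)
 moreover have "cmod (csqrt (4 * of_real pi * s)) = sqrt (4 * pi * cmod s)" by (simp add: norm_csqrt norm_mult del: csqrt.sel)
 ultimately show ?thesis unfolding cph_def by (simp add: norm_divide norm_power del: csqrt.sel)
qed

lemma norm_cph_le:
 assumes "(cmod s)^2 >= 1/2" "l * Re s * (1 - 1 / (cmod s)^2) <= m"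
 shows "norm (cph d l s) <= exp m"
proof -
 have "cmod s >= 1/2" using assms(1) by (intro power2_le_imp_le[of "1/2"]) (auto simp: power2_eq_square)
 hence "1 <= 4 * pi * cmod s" using pi_ge_two mult_mono[of 2 "4*pi" "1/2" "cmod s"] by simp
 hence "1 <= sqrt (4 * pi * cmod s) ^ d" by (simp add: one_le_power)
 hence "norm (cph d l s) <= exp (l * Re s * (1 - 1 / (cmod s)^2)) / 1" unfolding norm_cph by (intro divide_left_mono) auto
 also have "... <= exp m" using assms(2) by simp
 finally show ?thesis .
qed

lemma norm_integral_exp_le:
 assumes "m > 0" "c <= e" "\<And>t. t \<in> {c..e} ==> norm (f t) <= K * exp (m * (t - e))" "K >= 0" and [measurable]: "f \<in> mbl"
 shows "norm (LBINT t. indicator {c..e} t *\<^sub>R (f t :: complex)) <= K / m"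
proof -
 let ?A = "LBINT t. indicator {c..e} t *\<^sub>R (K * exp (m * (t - e)))"
 have FTC: "?A = K / m * exp (m * (e - e)) - K / m * exp (m * (c - e))"
  using assms by (intro integral_FTC_Icc) (auto intro!: derivative_eq_intros continuous_intros simp: has_real_derivative_iff_has_vector_derivative[symmetric])
 have "norm (LBINT t. indicator {c..e} t *\<^sub>R f t) <= ?A"
  using assms(3) by (intro norm_integral_le_AE(2) borel_integrable_atLeastAtMost' [unfolded set_integrable_def] continuous_intros AE_I2) (auto simp: indicator_def)
 also have "... <= K / m" unfolding FTC using assms by simp
 finally show ?thesis .
qed

lemma norm_integral_exp_le':
 assumes "m > 0" "c <= e" "\<And>t. t \<in> {c..e} ==> norm (f t) <= K * exp (- m * (t - c))" "K >= 0" and [measurable]: "f \<in> mbl"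
 shows "norm (LBINT t. indicator {c..e} t *\<^sub>R (f t :: complex)) <= K / m"
proof -
 have "(LBINT t. indicator {c..e} t *\<^sub>R f t) = (LBINT t. indicator {c..e} (-t) *\<^sub>R f (-t))"
  using lborel_integral_real_affine[of "-1" "%t. indicator {c..e} t *\<^sub>R f t" 0] by simp
 also have "... = (LBINT t. indicator {-e..-c} t *\<^sub>R f (-t))" by (intro integral_cong) (auto simp: indicator_def)
 also have "norm ... <= K / m"
  using assms(3)[of "- t" for t] assms by (intro norm_integral_exp_le) (auto simp: algebra_simps)
 finally show ?thesis .
qed

lemma integrable_exp_neg_abs: "integrable lborel (%x::real. exp (- \<bar>x\<bar>))"
proof -
 have "integrable lborel (%x::real. exp (- x) * indicator {0..} x)"
  using nn_intergal_power_times_exp_Ici[of 0] by (intro integrableI_bounded) (auto simp: abs_mult ennreal_mult' ennreal_indicator)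
 from integrable_add[OF this lborel_integrable_real_affine[OF this, of "-1" 0]]
 show ?thesis by (rule integrable_bound) (auto simp: indicator_def)
qed

lemma cph_measurable [measurable]: "cph d l \<in> mbl"
 unfolding cph_def[abs_def] by measurable

lemma power_le_fact_exp:
 fixes x :: real
 assumes "x >= 0"
 shows "x ^ n <= fact n * exp x"
proof -
 have "x ^ n /\<^sub>R fact n <= exp x"
  unfolding exp_def using sum_le_suminf[OF summable_exp_generic, of "{n}" x] assms by simp
 thus ?thesis by (simp add: field_simps)
qed

lemma integral_dominated_convergence_at_top_seq:
 fixes f :: "nat => 'b => 'c::{banach, second_countable_topology}"
 assumes w: "integrable M w" and g: "g \<in> borel_measurable M" and f: "eventually (%n. f n \<in> borel_measurable M) sequentially"
  and b: "eventually (%n. \<forall>x. norm (f n x) <= w x) sequentially" and lim: "AE x in M. (%n. f n x) \<longlonglongrightarrow> g x"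
 shows "(%n. integral\<^sup>L M (f n)) \<longlonglongrightarrow> integral\<^sup>L M g"
proof -
 obtain N where N: "\<And>n. n >= N ==> f n \<in> borel_measurable M" "\<And>n x. n >= N ==> norm (f n x) <= w x"
  using eventually_conj[OF f b] unfolding eventually_sequentially by blast
 have "(%n. integral\<^sup>L M (f (n + N))) \<longlonglongrightarrow> integral\<^sup>L M g"
  using lim by (intro integral_dominated_convergence[OF g _ w] N(1)) (auto simp: N(2) intro: LIMSEQ_ignore_initial_segment[of "%n. f n x" for x] elim!: eventually_mono)
 thus ?thesis by (rule LIMSEQ_offset)
qed

text \<open>The prefactor removes the size l^(-1/2) and the phase 2l of the value at the saddle. The
  piece through the saddle converges to a Gaussian integral; the other three pieces of the contour
  are O(1/l) and vanish against sqrt(l).\<close>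

lemma cph_limit:
 assumes l: "filterlim l at_top sequentially" and al: "\<And>n. ap n > 0" "\<And>n. ap n * l n <= A" and S: "\<And>n. S n >= 2"
 shows "(%n. of_real (sqrt (l n)) * exp (- 2 * \<i> * of_real (l n)) *
    (LBINT u. indicator {0..S n} u *\<^sub>R (\<i> * cph d (l n) (of_real (ap n) + \<i> * of_real u))))
   \<longlonglongrightarrow> (\<i> - 1) * of_real (sqrt (pi / 2)) / csqrt (4 * of_real pi * \<i>) ^ d"
proof -
 define \<Phi> where "\<Phi> n x = of_real (sqrt (l n)) * exp (- 2 * \<i> * of_real (l n)) * (x :: complex)" for n x
 define I1 where "I1 n = (LBINT s. indicator {ap n..1} s *\<^sub>R (1 * cph d (l n) (of_real s)))" for n
 let ?F = "%t. 1 + (\<i> - 1) * of_real t"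
 define I2 where "I2 n = (LBINT t. indicator {0..1/2} t *\<^sub>R ((\<i> - 1) * cph d (l n) (?F t)))" for n
 define I3 where "I3 n = (LBINT t. indicator {1/2..S n} t *\<^sub>R ((\<i> - 1) * cph d (l n) (?F t)))" for n
 let ?I = "%x n. of_real x + \<i> * of_real (S n)"
 define I4 where "I4 n = (LBINT x. indicator {1-S n..ap n} x *\<^sub>R (1 * cph d (l n) (?I x n)))" for n
 have l2: "eventually (%n. l n >= 2 \<and> l n >= A) sequentially" using filterlim_at_top_ge[THEN iffD1, OF l, rule_format, of 0 "max 2 A"] by (auto elim: eventually_mono)
 have al1: "ap n <= 1" if "l n >= 2 \<and> l n >= A" for n
  using that al(2)[of n] mult_strict_right_mono[of 1 "ap n" "l n"] by (smt (verit))
 have small: "(%n. \<Phi> n (I n)) \<longlonglongrightarrow> 0" if b: "\<And>n. l n >= 2 \<and> l n >= A ==> norm (I n) <= K / (l n)" for I K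
 proof (rule Lim_null_comparison)
  show "eventually (%n. norm (\<Phi> n (I n)) <= sqrt (l n) * (K / l n)) sequentially"
   using l2
  proof eventually_elim
   case (elim n)
   have "norm (\<Phi> n (I n)) = sqrt (l n) * norm (I n)" using elim by (simp add: \<Phi>_def norm_mult)
   also have "... <= sqrt (l n) * (K / l n)" using b[OF elim] elim by (intro mult_left_mono) auto
   finally show ?case .
  qed
  have "((%x. sqrt x * (K / x)) \<longlongrightarrow> 0) at_top" by real_asymp
  thus "(%n. sqrt (l n) * (K / l n)) \<longlonglongrightarrow> 0" using l by (rule filterlim_compose)
 qed
 let ?H = "%l n. l n >= 2 \<and> l n >= A"
 let ?L = "fact d * exp 1"
 have b1: "norm (I1 n) <= 2 * ?L / l n" if n: "?H l n" for n
 proof -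
  \<comment> \<open>Near 0 the denominator behaves badly. One unit of the parameter l is set aside,
    and its factor exp(s - 1/s) absorbs s^(-d) through the bound s^(-d) <= d! exp(1/s).\<close>
  have "norm (1 * cph d (l n) (of_real s)) <= ?L * exp ((l n - 1) * (s - 1))" if s: "s \<in> {ap n..1}" for s
  proof -
   have s0: "s > 0" "s <= 1" using s al(1)[of n] by auto
   have e: "1 / s + s >= 2" using s0 sum_squares_bound[of 1 s] by (auto simp: field_simps power2_eq_square)
   have "s^2 <= 4 * pi * s" using s0 pi_ge_two mult_mono[of s "4 * pi" s s] by (simp add: power2_eq_square)
   hence "s <= sqrt (4 * pi * s)" using s0 by (intro real_le_rsqrt)
   hence "s ^ d <= sqrt (4 * pi * s) ^ d" using s0 by (intro power_mono) auto
   hence "norm (cph d (l n) (of_real s)) <= exp (l n * s * (1 - 1 / s^2)) / s ^ d"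
    unfolding norm_cph using s0 by (intro divide_mono) auto
   also have "l n * s * (1 - 1 / s^2) = (l n - 1) * (s - 1/s) + (s - 1/s)" using s0 by (simp add: field_simps power2_eq_square)
   also have "exp ... / s ^ d <= exp ((l n - 1) * (s - 1) + (s - 1/s)) * (fact d * exp (1 / s))"
   proof -
    have "1 / s ^ d <= fact d * exp (1/s)" using power_le_fact_exp[of "1/s" d] s0 by (simp add: power_one_over)
    have "(l n - 1) * (s - 1/s) <= (l n - 1) * (2 * (s - 1))" using e n by (intro mult_left_mono) auto
    moreover have "(l n - 1) * (2 * (s - 1)) <= (l n - 1) * (s - 1)" using s0 n by (intro mult_left_mono) auto
    ultimately have "(l n - 1) * (s - 1/s) + (s - 1/s) <= (l n - 1) * (s - 1) + (s - 1/s)" by linarith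
    hence "exp ((l n - 1) * (s - 1/s) + (s - 1/s)) * (1 / s ^ d) <= exp ((l n - 1) * (s - 1) + (s - 1/s)) * (fact d * exp (1 / s))"
     using \<open>1 / s ^ d <= _\<close> s0 by (intro mult_mono) auto
    thus ?thesis by simp
   qed
   also have "... = fact d * exp (s + (l n - 1) * (s - 1))" by (simp add: exp_add[symmetric] field_simps)
   also have "... <= fact d * exp (1 + (l n - 1) * (s - 1))" using s0 by simp
   finally show ?thesis by (simp add: exp_add mult_ac)
  qed
  hence "norm (I1 n) <= ?L / (l n - 1)"
   unfolding I1_def using n al1 by (intro norm_integral_exp_le) auto
  also have "... <= ?L / (l n / 2)" using n by (intro divide_left_mono) auto
  finally show ?thesis by (simp add: mult.commute)
 qed
 have cm: "(cmod (?F t))^2 = 1 - 2 * t + 2 * t^2" for t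
  unfolding cmod_power2 by (simp add: power2_eq_square algebra_simps)
 have cm2: "1 - 2 * t + 2 * t^2 >= 1/2" for t :: real
 proof -
  have "1 - 2 * t + 2 * t^2 - 1/2 = 2 * (t - 1/2)^2" by (simp add: power2_eq_square algebra_simps)
  thus ?thesis by (smt (verit) zero_le_power2)
 qed
 have ni: "norm (\<i> - 1) <= 2" using norm_triangle_ineq4[of \<i> 1] by simp
 let ?J = "%t. 1 - 2 * t + 2 * t^2"
 have re: "l * Re (?F t) * (1 - 1 / ?J t) = - l * (2 * t * (1 - t)^2 / ?J t)" for l t :: real
  using cm2[of t] by (simp add: field_simps power2_eq_square)
 have b2: "norm (I2 n) <= 4 / l n" if n: "?H l n" for n
 proof -
  have "norm ((\<i> - 1) * cph d (l n) (?F t)) <= 2 * exp (- (l n / 2) * (t - 0))" if t: "t \<in> {0..1/2}" for t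
  proof -
   have "t/2 * ?J t <= t/2 * 1" using t by (intro mult_left_mono) (auto simp: power2_eq_square mult_left_le)
   moreover have "2 * t * (1/2)^2 <= 2 * t * (1 - t)^2" using t by (intro mult_left_mono power_mono) auto
   ultimately have "t/2 * ?J t <= 2 * t * (1 - t)^2" by (simp add: power2_eq_square)
   hence "t/2 <= 2 * t * (1 - t)^2 / ?J t" using cm2[of t] by (subst pos_le_divide_eq) auto
   hence "l n * (t/2) <= l n * (2 * t * (1 - t)^2 / ?J t)" using n by (intro mult_left_mono) auto
   hence "norm (cph d (l n) (?F t)) <= exp (- (l n / 2) * (t - 0))"
    by (intro norm_cph_le, unfold re cm) (use cm2[of t] in \<open>simp_all only: mult_minus_left diff_0_right neg_le_iff_le times_divide_eq_right times_divide_eq_left\<close>)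
   thus ?thesis using ni unfolding norm_mult by (intro mult_mono) auto
  qed
  from norm_integral_exp_le'[OF _ _ this] show ?thesis unfolding I2_def using n by auto
 qed
 have b4: "norm (I4 n) <= 2 * exp A / l n" if n: "?H l n" for n
 proof -
  \<comment> \<open>On the top edge |s| is at least 2, so the exponent is l x m with m between 1/2
    and 1. To the left of 0 it decays; between 0 and \<open>ap\<close> it is controlled by the bound
    A for \<open>ap * l\<close>.\<close>
  have "norm (1 * cph d (l n) (?I x n)) <= exp A * exp (l n / 2 * (x - ap n))" if x: "x \<in> {1 - S n..ap n}" for x
  proof -
   define A' where "A' = ap n * l n"
   define c where "c = cmod (?I x n)"
   have "(S n)^2 >= 2^2" using S[of n] by (intro power_mono) auto
   hence c: "c^2 >= 4" unfolding c_def cmod_power2 by (simp add: add_increasing)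
   define m where "m = 1 - 1 / c^2"
   have "1 / c^2 <= 1/4" using c by (intro divide_left_mono) auto
   hence m: "1/2 <= m" "m <= 1" by (auto simp: m_def)
   have e: "A' + l n / 2 * (x - ap n) = A' / 2 + l n * x / 2" unfolding A'_def by (simp add: field_simps)
   have "l n * x * m <= A' + l n / 2 * (x - ap n)"
   proof (cases "x >= 0")
    case True
    have "l n * x * m <= l n * x * 1" using True n m by (intro mult_left_mono) auto
    moreover have "l n * x <= l n * ap n" using x n by (intro mult_left_mono) auto
    ultimately have "l n * x * m <= A' / 2 + l n * x / 2" by (simp add: mult.commute A'_def)
    thus ?thesis unfolding e .
   next
    case False
    have "l n * x * m <= l n * x * (1/2)" using False n m by (intro mult_left_mono_neg) (auto simp: mult_nonneg_nonpos)
    moreover have "A' >= 0" using al(1)[of n] n by (auto simp: A'_def)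
    ultimately have "l n * x * m <= A' / 2 + l n * x / 2" by simp
    thus ?thesis unfolding e .
   qed
   hence "l n * x * m <= A + l n / 2 * (x - ap n)" using al(2)[of n] by (simp add: A'_def)
   hence "norm (cph d (l n) (?I x n)) <= exp (A + l n / 2 * (x - ap n))"
    using c by (intro norm_cph_le) (auto simp: c_def m_def)
   thus ?thesis by (simp add: exp_add)
  qed
  hence "norm (I4 n) <= exp A / (l n / 2)" unfolding I4_def using n S[of n] al(1)[of n] by (intro norm_integral_exp_le) auto
  thus ?thesis by (simp add: mult.commute)
 qed
 \<comment> \<open>The path meets the saddle i at t = 1; the natural variable there is w = sqrt(l)
   (t - 1).\<close>
 define sg where "sg n w = \<i> + (\<i> - 1) * of_real (w / sqrt (l n))" for n w
 have [measurable]: "sg n \<in> mbl" for n unfolding sg_def[abs_def] by measurable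
 let ?B = "%w n. - 2 * \<i> * of_real (w^2) / sg n w"
 let ?D = "%n w. 4 * of_real pi * sg n w"
 let ?N = "%w n. exp (?B w n) / csqrt (?D n w) ^ d"
 define H where "H n w = indicator {1/2..S n} (1 + w / sqrt (l n)) *\<^sub>R ((\<i> - 1) * ?N w n)" for n w
 let ?G = "%n c l. LBINT w. indicator {1/2..S n} (1 + c * w) *\<^sub>R ((\<i> - 1) * cph d (l n) (1 + (\<i> - 1) * of_real (1 + c * w)))"
 have I3: "\<Phi> n (I3 n) = (LBINT w. H n w)" if n: "?H l n" for n
 proof -
  have l0: "l n > 0" using n by auto
  define c where "c = 1 / sqrt (l n)"
  have c: "c > 0" "sqrt (l n) * c = 1" "c^2 * l n = 1" using l0 by (auto simp: c_def power2_eq_square field_simps)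
  have "I3 n = c *\<^sub>R (?G n c l)"
   unfolding I3_def using c by (subst lborel_integral_real_affine[of c _ 1]) auto
  hence "\<Phi> n (I3 n) = exp (- 2 * \<i> * of_real (l n)) * ?G n c l"
   using c(2) by (simp add: \<Phi>_def scaleR_conv_of_real mult_ac flip: of_real_mult)
  also have "... = (LBINT w. H n w)"
   unfolding integral_mult_right_zero[symmetric]
  proof (rule integral_cong[OF refl])
   fix w :: real
   have s: "1 + (\<i> - 1) * of_real (1 + c * w) = sg n w" by (simp add: sg_def c_def algebra_simps)
   have nz: "sg n w \<noteq> 0" unfolding s[symmetric] using cm[of "1 + c * w"] cm2[of "1 + c * w"] by (metis norm_zero zero_power2 not_one_le_zero half_gt_zero_iff zero_less_one not_le)
   have "(sg n w - \<i>)^2 = - 2 * \<i> * of_real (c^2 * w^2)"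
   proof -
    have si: "sg n w - \<i> = (\<i> - 1) * of_real (c * w)" by (simp add: sg_def c_def)
    show ?thesis unfolding si by (simp add: power2_eq_square algebra_simps)
   qed
   hence "of_real (l n) * (sg n w - \<i>)^2 = - 2 * \<i> * of_real (c^2 * l n * w^2)" by simp
   \<comment> \<open>The identity l(s - 1/s) - 2il = l(s - i)^2/s is exact, not a Taylor expansion,
     and (i - 1)^2 = -2i makes the numerator quadratic in w.\<close>
   hence "- 2 * \<i> * of_real (w^2) / sg n w = of_real (l n) * (sg n w - \<i>)^2 / sg n w" by (simp add: c(3))
   also have "... = - 2 * \<i> * of_real (l n) + of_real (l n) * (sg n w - 1 / sg n w)" using nz by (simp add: field_simps power2_eq_square)
   finally have fin: "- 2 * \<i> * of_real (w^2) / sg n w = - 2 * \<i> * of_real (l n) + of_real (l n) * (sg n w - 1 / sg n w)" .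
   have cw: "w / sqrt (l n) = c * w" by (simp add: c_def)
   show "exp (- 2 * \<i> * of_real (l n)) * (indicator {1/2..S n} (1 + c * w) *\<^sub>R ((\<i> - 1) * cph d (l n) (1 + (\<i> - 1) * of_real (1 + c * w)))) = H n w"
    unfolding s H_def cph_def fin cw exp_add mult_scaleR_right by (rule arg_cong[where f="scaleR _"]) (simp add: divide_inverse mult_ac del: csqrt.sel)
  qed
  finally show ?thesis .
 qed
 let ?C = "4 * of_real pi * \<i>"
 let ?A = "%w. exp (- 2 * \<i> * of_real (w^2) / \<i>) / csqrt ?C ^ d"
 let ?M = "sqrt (pi / 2)"
 let ?P = "LBINT w. (\<i> - 1) * ?A w"
 have "(%n. LBINT w. H n w) \<longlonglongrightarrow> ?P"
 proof (rule integral_dominated_convergence_at_top_seq)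
  show "integrable lborel (%w::real. 2 * exp 1 * exp (- \<bar>w\<bar>))" by (intro integrable_mult_right integrable_exp_neg_abs)
  show "(%w. (\<i> - 1) * ?A w) \<in> borel_measurable lborel" by measurable
  show "eventually (%n. H n \<in> borel_measurable lborel) sequentially" unfolding H_def[abs_def] by (intro always_eventually allI) measurable
  show "eventually (%n. \<forall>w. norm (H n w) <= 2 * exp 1 * exp (- \<bar>w\<bar>)) sequentially"
   using l2
  proof (eventually_elim, intro allI)
   fix n w
   assume n: "?H l n"
   \<comment> \<open>For the majorant: the real part of the exponent is -2 w^2 (1 + dl)/q, where q
     is at most 2 (1 + dl)(1 + |dl|) and |dl| at most |w|. It is therefore at most -w^2/(1 + |w|),
     which is at most 1 - |w|.\<close>
   define dl where "dl = w / sqrt (l n)"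
   show "norm (H n w) <= 2 * exp 1 * exp (- \<bar>w\<bar>)"
   proof (cases "1 + dl \<in> {1/2..S n}")
    case True
    hence d: "dl >= - 1/2" by auto
    have s: "sg n w = 1 + (\<i> - 1) * of_real (1 + dl)" by (simp add: sg_def dl_def algebra_simps)
    define q where "q = 1 + 2 * dl + 2 * dl^2"
    have q: "(cmod (sg n w))^2 = q" "q >= 1/2"
     using cm[of "1 + dl"] cm2[of "1 + dl"] by (auto simp: s q_def power2_eq_square algebra_simps)
    have "Re (?B w n) = - 2 * w^2 * Im (sg n w) / q"
     by (simp add: Re_divide q(1)[symmetric] cmod_power2)
    also have "Im (sg n w) = 1 + dl" by (simp add: s)
    finally have R: "Re (?B w n) = - (w^2 * (2 * (1 + dl) / q))" by simp
    have "q <= 2 * (1 + dl) * (1 + \<bar>dl\<bar>)"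
    proof (cases "dl >= 0")
     case False
     have "dl * dl <= (- dl) * (1/2)" using False d mult_left_mono[of "- dl" "1/2" "- dl"] by simp
     moreover have "(- dl) * (1/2) <= 1/4" using d by simp
     ultimately show ?thesis using False by (simp add: q_def power2_eq_square algebra_simps)
    qed (simp add: q_def power2_eq_square algebra_simps)
    hence "1 / (1 + \<bar>dl\<bar>) <= 2 * (1 + dl) / q" using q(2) by (simp add: field_simps)
    moreover have "1 / (1 + \<bar>w\<bar>) <= 1 / (1 + \<bar>dl\<bar>)"
    proof -
     have "\<bar>w\<bar> / sqrt (l n) <= \<bar>w\<bar> / 1" using n by (intro divide_left_mono) auto
     thus ?thesis using n by (intro divide_left_mono) (auto simp: dl_def abs_divide intro!: mult_pos_pos add_pos_nonneg)
    qed
    ultimately have "w^2 * (1 / (1 + \<bar>w\<bar>)) <= w^2 * (2 * (1 + dl) / q)" by (intro mult_left_mono) auto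
    moreover have "\<bar>w\<bar> - 1 <= w^2 * (1 / (1 + \<bar>w\<bar>))"
     by (simp add: field_simps) (simp add: abs_mult[symmetric] power2_eq_square algebra_simps)
    ultimately have 1: "norm (exp (?B w n)) <= exp (1 - \<bar>w\<bar>)" unfolding norm_exp_eq_Re R by simp
    have "norm (sg n w) >= 1/2" using q by (intro power2_le_imp_le[of "1/2"]) (auto simp: power2_eq_square)
    hence "1 <= 4 * pi * norm (sg n w)" using pi_ge_two mult_mono[of 2 "4*pi" "1/2" "norm (sg n w)"] by simp
    hence "1 <= norm (csqrt (?D n w) ^ d)" by (simp add: norm_power norm_csqrt norm_mult one_le_power del: csqrt.sel)
    hence "norm (exp (?B w n)) / norm (csqrt (?D n w) ^ d) <= exp (1 - \<bar>w\<bar>) / 1"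
     using 1 by (intro frac_le) auto
    hence "norm (\<i> - 1) * (norm (exp (?B w n)) / norm (csqrt (?D n w) ^ d)) <= 2 * (exp (1 - \<bar>w\<bar>) / 1)"
     using ni by (intro mult_mono) auto
    thus ?thesis using True unfolding H_def dl_def by (simp add: norm_mult norm_divide exp_diff exp_minus field_simps del: csqrt.sel)
   qed (simp add: H_def dl_def)
  qed
  show "AE w in lborel. (%n. H n w) \<longlonglongrightarrow> (\<i> - 1) * ?A w"
  proof (rule AE_I2)
   fix w :: real
   have "((%x. w / sqrt x) \<longlongrightarrow> 0) at_top" by real_asymp
   hence w0: "(%n. w / sqrt (l n)) \<longlonglongrightarrow> 0" using l by (rule filterlim_compose)
   hence "(%n. sg n w) \<longlonglongrightarrow> \<i> + (\<i> - 1) * of_real 0" unfolding sg_def by (intro tendsto_intros)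
   hence s: "(%n. sg n w) \<longlonglongrightarrow> \<i>" by simp
   have "of_real (4 * pi) * \<i> \<notin> \<real>\<^sub>\<le>\<^sub>0" by (simp add: complex_nonpos_Reals_iff)
   hence "isCont csqrt ?C" by (intro continuous_at_csqrt) simp
   hence "(%n. csqrt (?D n w)) \<longlonglongrightarrow> csqrt ?C"
    by (rule isCont_tendsto_compose) (intro tendsto_intros s)
   hence "(%n. (\<i> - 1) * ?N w n) \<longlonglongrightarrow>
     (\<i> - 1) * ?A w"
    by (intro tendsto_intros s) (auto simp del: csqrt.sel)
   moreover have "eventually (%n. \<bar>w / sqrt (l n)\<bar> < 1/2) sequentially"
    using tendstoD[OF w0, of "1/2"] by (auto simp: dist_norm)
   hence "eventually (%n. (\<i> - 1) * ?N w n = H n w) sequentially"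
   proof eventually_elim
    case (elim n)
    hence "1 + w / sqrt (l n) \<in> {1/2..S n}" using S[of n] unfolding atLeastAtMost_iff by linarith
    thus ?case unfolding H_def by simp
   qed
   ultimately show "(%n. H n w) \<longlonglongrightarrow> (\<i> - 1) * ?A w"
    by (rule Lim_transform_eventually)
  qed
 qed
 also have "?P = (LBINT w. of_real (exp (- 2 * w^2)) * ((\<i> - 1) / csqrt ?C ^ d))"
  by (intro integral_cong) (auto simp: field_simps exp_of_real[symmetric] simp del: csqrt.sel)
 also have "... = (\<i> - 1) * of_real ?M / csqrt ?C ^ d"
  unfolding integral_mult_left_zero integral_of_real using integral_gauss_real(2)[of 2] by simp
 finally have L3: "(%n. \<Phi> n (I3 n)) \<longlonglongrightarrow> (\<i> - 1) * of_real ?M / csqrt ?C ^ d"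
  by (rule Lim_transform_eventually) (use l2 in \<open>auto elim!: eventually_mono simp: I3\<close>)
 let ?K = "%I1 I3. %n. \<Phi> n (I1 n) + \<Phi> n (I2 n) + \<Phi> n (I3 n) + \<Phi> n (I4 n)"
 have "?K I1 I3 \<longlonglongrightarrow> 0 + 0 + (\<i> - 1) * of_real ?M / csqrt ?C ^ d + 0"
  by (intro tendsto_add L3 small[OF b1] small[OF b2] small[OF b4])
 hence "?K I1 I3 \<longlonglongrightarrow> (\<i> - 1) * of_real ?M / csqrt ?C ^ d"
  by simp
 thus ?thesis
  by (rule Lim_transform_eventually)
    (use l2 in eventually_elim, simp add: cph_contour[OF al(1) al1 S] I1_def I2_def I3_def I4_def \<Phi>_def algebra_simps del: mult_1 csqrt.sel)
qed

section \<open>From the model integral to the asymptotics of the kernel\<close>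

lemma csqrt_of_real_times:
 assumes "b > 0"
 shows "csqrt (of_real b * z) = of_real (sqrt b) * csqrt z"
proof (rule csqrt_unique)
 let ?A = "of_real (sqrt b) * csqrt z"
 show "?A^2 = of_real b * z" using assms by (simp add: power_mult_distrib flip: of_real_power del: csqrt.sel)
 show "0 < Re ?A \<or> Re ?A = 0 \<and> 0 <= Im ?A"
  using csqrt_principal[of z] assms by (auto simp del: csqrt.sel)
qed

text \<open>The substitution t = b u, where b is the travel time over the distance |x| at group
  velocity 2 ka; the saddle then sits at u = 1 for every x.\<close>

lemma GT_eq_cph:
 fixes x :: "'a::euclidean_space"
 assumes ka: "ka > 0" and x: "x \<noteq> 0"
 defines "b \<equiv> norm x / (2 * ka)"
 shows "\<i> * GT (ka^2) a T x = of_real (exp (- a * ka^2) * (b / sqrt b ^ DIM('a))) *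
   (LBINT u. indicator {0..T/b} u *\<^sub>R (\<i> * cph DIM('a) (ka * norm x / 2) (of_real (a / b) + \<i> * of_real u)))"
proof -
 have b: "b > 0" using assms by simp
 let ?A = "%b u. (b * u) * ka^2"
 let ?B = "%b u. \<i> * cph DIM('a) (ka * norm x / 2) (of_real (a / b) + \<i> * of_real u)"
 let ?C = "- a * ka^2"
 let ?D = "%b u. \<i> * iexp (?A b u) * gk (of_real a + \<i> * of_real (b * u)) x"
 let ?F = "x \<bullet> x"
 have "?D b u =
   of_real (exp ?C / sqrt b ^ DIM('a)) * ?B b u" for u
 proof -
  define s where "s = of_real (a / b) + \<i> * of_real u"
  have s: "of_real a + \<i> * of_real (b * u) = of_real b * s" using b by (simp add: s_def algebra_simps)
  have cs: "csqrt (4 * of_real pi * (of_real b * s)) = of_real (sqrt b) * csqrt (4 * of_real pi * s)"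
   using csqrt_of_real_times[OF b, of "4 * of_real pi * s"] by (simp add: mult_ac del: csqrt.sel)
  define l where "l = ka * norm x / 2"
  have l: "l = ka^2 * b" "x \<bullet> x = 4 * (l * b)" using ka by (auto simp: b_def l_def dot_square_norm power2_eq_square)
  have s2: "of_real l * s = of_real (a * ka^2) + \<i> * of_real (?A b u)" using b by (simp add: s_def l(1) field_simps)
  have "- of_real ?F / (4 * (of_real b * s)) = - of_real l / s" using b by (simp add: l(2) del: mult_minus_left)
  hence "\<i> * of_real (?A b u) + - of_real ?F / (4 * (of_real b * s)) = of_real ?C + of_real l * (s - 1 / s)"
   unfolding right_diff_distrib s2 by simp
  hence "iexp (?A b u) * exp (- of_real ?F / (4 * (of_real b * s))) = exp (of_real ?C) * exp (of_real l * (s - 1 / s))"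
   unfolding exp_add[symmetric] by simp
  note e = this
  have "\<i> * iexp (?A b u) * gk (of_real b * s) x =
    \<i> * (iexp (?A b u) * exp (- of_real ?F / (4 * (of_real b * s)))) / (of_real (sqrt b) * csqrt (4 * of_real pi * s)) ^ DIM('a)"
   unfolding gk_def cs by simp
  thus ?thesis unfolding s_def[symmetric] s cph_def l_def[symmetric] e
   by (simp add: power_mult_distrib del: csqrt.sel flip: exp_of_real)
 qed
 note eq = this
 have ind: "indicator {0..T} (b * u) = (indicator {0..T / b} u :: real)" for u
  using b by (auto simp: indicator_def field_simps zero_le_mult_iff)
 have "\<i> * GT (ka^2) a T x = (LBINT t. indicator {0..T} t *\<^sub>R (\<i> * iexp (t * ka^2) * gk (of_real a + \<i> * of_real t) x))"
  unfolding GT_def integral_mult_right_zero[symmetric] by (simp add: mult.assoc)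
 also have "... = b *\<^sub>R (LBINT u. indicator {0..T} (b * u) *\<^sub>R (?D b u))"
  using b by (subst lborel_integral_real_affine[of b _ 0]) auto
 also have "... = b *\<^sub>R (of_real (exp ?C / sqrt b ^ DIM('a)) * (LBINT u. indicator {0..T / b} u *\<^sub>R (?B b u)))"
  unfolding eq ind integral_mult_right_zero[symmetric] by simp
 finally show ?thesis by (simp add: scaleR_conv_of_real)
qed

text \<open>T is at least twice the travel time, so the scaled interval passes the saddle and ends
  beyond 2, as \<open>cph_limit\<close> requires. Boundedness of a bounds the product
  \<open>ap * l\<close>, which equals a ka^2.\<close>

lemma GT_limit:
 fixes x :: "nat => 'a::euclidean_space"
 assumes ka: "ka > 0" and a: "\<And>n. a n > 0" "a \<longlonglongrightarrow> 0" and x: "filterlim (%n. norm (x n)) at_top sequentially" "\<And>n. x n \<noteq> 0"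
  and T: "\<And>n. T n >= norm (x n) / ka"
 shows "(%n. of_real (norm (x n) powr ((real DIM('a) - 1) / 2)) * exp (- \<i> * of_real (ka * norm (x n))) * GT (ka^2) (a n) (T n) (x n))
  \<longlonglongrightarrow> \<i> * c_const DIM('a) ka / of_real ((2 * pi) ^ DIM('a))"
proof -
 let ?d = "real DIM('a)"
 define l where "l n = ka * norm (x n) / 2" for n
 let ?J = "2 * ka"
 define b where "b n = norm (x n) / ?J" for n
 let ?K = "?d / 2 - 1"
 define C where "C = sqrt (2 / ka) * ?J powr ?K"
 have b: "b n > 0" for n using x(2) ka by (simp add: b_def)
 have l: "filterlim l at_top sequentially"
  unfolding l_def by (rule filterlim_compose[OF _ x(1)]) (use ka in real_asymp)
 obtain M where M: "\<And>n. \<bar>a n\<bar> <= M" using convergent_imp_Bseq[OF convergentI[OF a(2)]] by (auto simp: Bseq_def)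
 let ?C = "%n b a. LBINT u. indicator {0..T n / b n} u *\<^sub>R (\<i> * cph DIM('a) (l n) (of_real (a n / b n) + \<i> * of_real u))"
 let ?F = "4 * of_real pi * \<i>"
 have lim: "(%n. of_real (sqrt (l n)) * exp (- 2 * \<i> * of_real (l n)) *
    (?C n b a))
   \<longlonglongrightarrow> (\<i> - 1) * of_real (sqrt (pi / 2)) / csqrt ?F ^ DIM('a)"
 proof (rule cph_limit[OF l])
  show "a n / b n > 0" for n using a b by simp
  show "a n / b n * l n <= M * ka^2" for n
  proof -
   have "a n / b n * l n = a n * ka^2" using x(2)[of n] ka by (simp add: b_def l_def power2_eq_square field_simps)
   also have "... <= M * ka^2" using M[of n] a(1)[of n] by (intro mult_right_mono) auto
   finally show ?thesis .
  qed
  show "2 <= T n / b n" for n using T[of n] b[of n] ka by (simp add: field_simps b_def)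
 qed
 let ?D = "(?d - 1) / 2"
 let ?G = "%b n. b n / sqrt (b n) ^ DIM('a)"
 let ?H = "ka^2"
 let ?L = "1 - ?d / 2"
 have eq: "of_real (norm (x n) powr ?D) * exp (- \<i> * of_real (ka * norm (x n))) * GT ?H (a n) (T n) (x n)
   = - \<i> * of_real (exp (- a n * ka^2) * C) * (of_real (sqrt (l n)) * exp (- 2 * \<i> * of_real (l n)) *
    (?C n b a))" (is "?A * ?B * _ = _ * (_ * ?B' * ?I)") for n
 proof -
  have r: "norm (x n) > 0" using x(2) by simp
  have "GT ?H (a n) (T n) (x n) = - \<i> * (\<i> * GT ?H (a n) (T n) (x n))" by simp
  hence G: "GT ?H (a n) (T n) (x n) = - \<i> * of_real (exp (- a n * ka^2) * ?G b n) * ?I"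
   unfolding GT_eq_cph[OF ka x(2)] b_def l_def by (simp add: mult_ac)
  have "sqrt (b n) ^ DIM('a) = b n powr (?d / 2)" using b[of n] by (simp add: powr_half_sqrt[symmetric] powr_powr flip: powr_realpow)
  hence "b n / sqrt (b n) ^ DIM('a) = b n powr ?L" using b[of n] by (simp add: powr_diff)
  also have "... = norm (x n) powr ?L * ?J powr ?K"
   unfolding b_def using r ka by (simp add: powr_divide divide_powr_uminus)
  finally have "norm (x n) powr ?D * ?G b n = (norm (x n) powr ?D * norm (x n) powr ?L) * ?J powr ?K" by simp
  also have "norm (x n) powr ?D * norm (x n) powr ?L = norm (x n) powr (1/2)"
   unfolding powr_add[symmetric] by (rule arg_cong[where f="%e. norm (x n) powr e"]) (simp add: field_simps)
  also have "... = sqrt (2 / ka) * sqrt (l n)" using r ka by (simp add: l_def powr_half_sqrt real_sqrt_mult[symmetric])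
  finally have "norm (x n) powr ?D * ?G b n = C * sqrt (l n)" by (simp add: C_def mult_ac)
  hence "?A * of_real (?G b n) = of_real C * of_real (sqrt (l n))" unfolding of_real_mult[symmetric] by (rule arg_cong)
  moreover have "?B = ?B'" by (simp add: l_def)
  moreover have "?A * ?B * GT ?H (a n) (T n) (x n) = - \<i> * of_real (exp (- a n * ka^2)) * (?A * of_real (?G b n)) * ?B * ?I"
   unfolding G of_real_mult by (simp only: mult_ac)
  ultimately show ?thesis by (simp only: mult_ac of_real_mult)
 qed
 \<comment> \<open>Every root and power is written as the exponential of a principal logarithm;
   matching the constant with \<open>c_const\<close> then reduces to a linear identity between
   exponents, with all branches settled.\<close>
 have e1: "\<i> - 1 = - exp (of_real (ln 2 / 2) - \<i> * of_real (pi / 4))"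
  by (simp add: complex_eq_iff Re_exp Im_exp cos_45 sin_45 ln_sqrt[symmetric] power2_eq_square)
 have "Ln (of_real (4 * pi) * \<i>) = of_real (ln (4 * pi)) + \<i> * of_real pi / 2" using Ln_of_real[of "4 * pi"] by (subst Ln_times_of_real) auto
 hence e2: "csqrt ?F = exp ((of_real (ln (4 * pi)) + \<i> * of_real pi / 2) / 2)" by (subst csqrt_exp_Ln) auto
 have "Ln (of_real (2 * pi) * (- \<i>)) = of_real (ln (2 * pi)) - \<i> * of_real pi / 2" using Ln_of_real[of "2 * pi"] by (subst Ln_times_of_real) (auto simp: Ln_minus_ii)
 hence e3: "(- 2 * of_real pi * \<i>) powr of_real ?D = exp (of_real ?D * (of_real (ln (2 * pi)) - \<i> * of_real pi / 2))"
  by (simp add: powr_def mult_ac)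
 let ?M = "exp (- 0 * ka^2) * C"
 let ?N = "- \<i> * of_real (pi / 2)"
 have key: "- \<i> * of_real ?M * ((\<i> - 1) * of_real (sqrt (pi / 2)) / csqrt ?F ^ DIM('a)) =
   \<i> * c_const DIM('a) ka / of_real ((2 * pi) ^ DIM('a))"
 proof -
  define L M N where "L = ln (2::real)" and "M = ln pi" and "N = ln ka"
  have LM: "ln (4 * pi) = 2 * L + M" "ln (2 * pi) = L + M"
   using ln_mult[of 2 2] by (auto simp: ln_mult L_def M_def)
  have C: "C * sqrt (pi / 2) = exp ((L - N) / 2 + (L + N) * ?K + (M - L) / 2)"
   using ka by (simp add: C_def powr_half_sqrt[symmetric] powr_def exp_add L_def M_def N_def ln_div ln_mult mult_ac)
  have P: "(2 * pi) ^ DIM('a) = exp (?d * (L + M))" unfolding LM(2)[symmetric] by (simp add: exp_of_nat_mult)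
  have Q: "pi * ka powr ((?d - 3) / 2) = exp (M + (?d - 3) / 2 * N)" using ka by (simp add: powr_def exp_add M_def N_def)
  have i: "- \<i> = exp ?N" by (simp add: exp_minus exp_of_real complex_eq_iff Re_exp Im_exp)
  have "(of_real (C * sqrt (pi / 2)) * exp (of_real (L / 2) - \<i> * of_real (pi / 4))) / csqrt ?F ^ DIM('a)
   = exp ?N * exp (of_real ?D * (of_real (L + M) - \<i> * of_real pi / 2)) * of_real (pi * ka powr ((?d - 3) / 2)) / of_real ((2 * pi) ^ DIM('a))"
   unfolding C P Q e2 LM exp_of_nat_mult[symmetric] exp_of_real[symmetric] exp_add[symmetric] exp_diff[symmetric]
   by (rule arg_cong[where f=exp]) (simp add: complex_eq_iff field_simps)
  thus ?thesis unfolding i[symmetric] e1 c_const_def e3 LM(2) L_def[symmetric] of_real_mult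
   by (simp add: field_simps del: csqrt.sel)
 qed
 have "(%n. - \<i> * of_real (exp (- a n * ka^2) * C)) \<longlonglongrightarrow> - \<i> * of_real ?M" by (intro tendsto_intros a(2))
 from tendsto_mult[OF this lim] show ?thesis unfolding eq key .
qed

text \<open>A sequence of violations would have |x| tending to infinity, and
  \<open>a * norm x <= 1\<close> would force a to 0; then \<open>GT_limit\<close> makes the
  allegedly unbounded sequence convergent. No explicit constant is needed because \<kappa> is fixed
  here.\<close>

lemma GT_bound:
 assumes ka: "ka > 0"
 shows "\<exists>K r0. r0 > 0 \<and> (\<forall>(x::'a::euclidean_space) a T. norm x >= r0 \<and> 0 < a \<and> a * norm x <= 1 \<and> T >= norm x / ka \<longrightarrow>
  norm x powr ((real DIM('a) - 1) / 2) * norm (GT (ka^2) a T x) <= K)"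
proof (rule ccontr)
 assume N: "\<not> ?thesis"
 let ?A = "(real DIM('a) - 1) / 2"
 have "\<exists>x a T. norm (x::'a) >= real n + 1 \<and> 0 < a \<and> a * norm x <= 1 \<and> T >= norm x / ka \<and>
  norm x powr ?A * norm (GT (ka^2) a T x) > real n" for n
 proof -
  have "0 < real n + 1" by simp
  with N show ?thesis by (auto simp: not_le)
 qed
 then obtain x :: "nat => 'a" and a T where H: "\<And>n. norm (x n) >= real n + 1" "\<And>n. 0 < a n" "\<And>n. a n * norm (x n) <= 1" "\<And>n. T n >= norm (x n) / ka"
  and big: "\<And>n. norm (x n) powr ?A * norm (GT (ka^2) (a n) (T n) (x n)) > real n" by metis
 have x0: "x n \<noteq> 0" for n using H(1)[of n] by auto
 have x: "filterlim (%n. norm (x n)) at_top sequentially"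
  by (rule filterlim_at_top_mono[of "%n. real n + 1"]) (real_asymp, use H(1) in auto)
 have "a n <= 1 / norm (x n)" for n using H(3)[of n] x0[of n] by (simp add: field_simps)
 moreover have "1 / norm (x n) <= 1 / (real n + 1)" for n using H(1)[of n] by (intro divide_left_mono) (auto intro!: mult_pos_pos)
 ultimately have "a n <= 1 / (real n + 1)" for n by (meson order_trans)
 moreover have "(%n. 1 / (real n + 1)) \<longlonglongrightarrow> 0" by real_asymp
 ultimately have "a \<longlonglongrightarrow> 0" using H(2) by (intro tendsto_sandwich[of "%_. 0" a sequentially "%n. 1 / (real n + 1)"]) (auto intro!: always_eventually less_imp_le)
 from convergent_imp_Bseq[OF convergentI[OF GT_limit[OF ka H(2) this x x0 H(4)]]]
 obtain K where "\<And>n. norm (x n) powr ?A * norm (GT (ka^2) (a n) (T n) (x n)) <= K"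
  by (auto simp: Bseq_def norm_mult)
 with big have "real n < K" for n by (meson less_le_trans)
 thus False using reals_Archimedean2[of K] by (meson not_less_iff_gr_or_eq)
qed

text \<open>Seen from a far point R tt, the distance to x is R - tt.x + o(1), so each source point
  contributes the common limit with the phase exp(-i ka tt.x). \<open>GT_bound\<close> dominates the
  integrand on the support of g.\<close>

lemma GT_far_field:
 fixes g :: "'a::euclidean_space => complex"
 assumes ka: "ka > 0" and g: "bcs rh g" and rh: "rh >= 0" and tt: "norm tt = 1"
  and R: "filterlim R at_top sequentially" and a: "\<And>n. 0 < a n" "\<And>n. a n * (R n + rh) <= 1"
  and T: "\<And>n. T n >= (R n + rh) / ka"
 shows "(%n. of_real (R n powr ((real DIM('a) - 1) / 2)) * exp (- \<i> * of_real (ka * R n)) * (LBINT x. g x * GT (ka^2) (a n) (T n) (x - R n *\<^sub>R tt)))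
  \<longlonglongrightarrow> \<i> * c_const DIM('a) ka / of_real ((2 * pi) ^ DIM('a)) * (LBINT x. g x * exp (- \<i> * of_real (ka * (tt \<bullet> x))))"
proof -
 define q where "q = (real DIM('a) - 1) / 2"
 have q: "q >= 0" by (simp add: q_def DIM_ge_Suc0[simplified])
 have [measurable]: "g \<in> mbl" using g by (rule bcs_measurable)
 have gi: "integrable lborel g" using g by (rule bcs_integrable)
 let ?G = "ka^2"
 obtain K r0 where r0: "r0 > 0" and K: "\<And>(x::'a) a T. norm x >= r0 ==> 0 < a ==> a * norm x <= 1 ==> T >= norm x / ka ==>
  norm x powr q * norm (GT ?G a T x) <= K" unfolding q_def using GT_bound[OF ka, where 'a='a] by blast
 obtain n0 where n0: "\<And>n. n >= n0 ==> R n >= 2 * rh + 2 * r0 + 1"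
  using R unfolding filterlim_at_top eventually_sequentially by meson
 let ?A = "%x n tt. x - R n *\<^sub>R tt"
 have lo: "norm (?A x n tt) >= R n / 2" "norm (?A x n tt) >= r0" "norm (?A x n tt) <= R n + rh" "R n > 0"
  if "norm x <= rh" "n >= n0" for n x
 proof -
  have R0: "R n > 0" using n0[OF that(2)] rh r0 by linarith
  hence N: "norm (R n *\<^sub>R tt) = R n" by (simp add: tt)
  show "norm (?A x n tt) >= R n / 2" "norm (?A x n tt) >= r0" "norm (?A x n tt) <= R n + rh" "R n > 0"
   using norm_triangle_ineq3[of x "R n *\<^sub>R tt"] norm_triangle_ineq4[of x "R n *\<^sub>R tt"] n0[OF that(2)] that(1) r0 rh R0 unfolding N by linarith+
 qed
 have aT: "a n * norm (?A x n tt) <= 1" "T n >= norm (?A x n tt) / ka" if "norm x <= rh" "n >= n0" for n x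
 proof -
  have "a n * norm (?A x n tt) <= a n * (R n + rh)" using lo(3)[OF that] a(1)[of n] by (intro mult_left_mono) auto
  thus "a n * norm (?A x n tt) <= 1" using a(2)[of n] by linarith
  have "norm (?A x n tt) / ka <= (R n + rh) / ka" using lo(3)[OF that] ka by (intro divide_right_mono) auto
  thus "T n >= norm (?A x n tt) / ka" using T[of n] by linarith
 qed
 let ?B = "%x n tt. g x * GT ?G (a n) (T n) (?A x n tt)"
 let ?C = "%n. - \<i> * of_real (ka * R n)"
 have bd: "norm (of_real (R n powr q) * exp (?C n) * ?B x n tt) <= 2 powr q * K * norm (g x)"
  if n: "n >= n0" for n x
 proof (cases "norm x <= rh")
  case False
  thus ?thesis using g by (auto simp: bcs_def)
 next
  case True
  let ?r = "norm (?A x n tt)"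
  have "R n powr q <= (2 * ?r) powr q" using lo[OF True n] q by (intro powr_mono2) auto
  hence "R n powr q <= 2 powr q * ?r powr q" by (simp add: powr_mult)
  hence "R n powr q * norm (GT ?G (a n) (T n) (?A x n tt)) <= 2 powr q * (?r powr q * norm (GT ?G (a n) (T n) (?A x n tt)))"
   using mult_right_mono by (fastforce simp: mult.assoc[symmetric])
  also have "... <= 2 powr q * K" using K[OF lo(2)[OF True n] a(1) aT[OF True n]] by (intro mult_left_mono) auto
  finally have "R n powr q * norm (GT ?G (a n) (T n) (?A x n tt)) * norm (g x) <= 2 powr q * K * norm (g x)" by (rule mult_right_mono) simp
  thus ?thesis by (simp add: norm_mult mult_ac)
 qed
 let ?J = "%tt x. tt \<bullet> x"
 let ?D = "%x tt. g x * exp (- \<i> * of_real (ka * ?J tt x))"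
 let ?F = "%r s n. - \<i> * of_real (ka * r (s n))"
 let ?H = "(2 * pi) ^ DIM('a)"
 let ?I = "%r s n. ka * (r (s n) - R (s n))"
 let ?K = "%s n r. (R (s n) / r (s n)) powr q"
 have pt: "(%n. of_real (R n powr q) * exp (?C n) * ?B x n tt)
   \<longlonglongrightarrow> \<i> * c_const DIM('a) ka / of_real ?H * ?D x tt" for x
 proof (cases "norm x <= rh")
  case False
  thus ?thesis using g by (auto simp: bcs_def)
 next
  case True
  define r where "r n = norm (?A x n tt)" for n
  define s where "s n = n + n0" for n
  have s: "s n >= n0" for n by (simp add: s_def)
  have Rs: "filterlim (%n. R (s n)) at_top sequentially" unfolding s_def by (rule filterlim_compose[OF R filterlim_add_const_nat_at_top])
  have R0: "R (s n) > 0" "r (s n) > 0" for n using lo(2,4)[OF True s, of n] r0 unfolding r_def by linarith+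
  have "filterlim (%n. R (s n) / 2) at_top sequentially" by (rule filterlim_compose[OF _ Rs]) real_asymp
  hence rs: "filterlim (%n. r (s n)) at_top sequentially"
   by (rule filterlim_at_top_mono) (use lo(1)[OF True s] in \<open>auto simp: r_def\<close>)
  have r2: "(r (s n))^2 = (norm x)^2 - 2 * R (s n) * ?J tt x + (R (s n))^2" for n
   unfolding r_def power2_norm_eq_inner using tt
   by (simp add: inner_diff_left inner_diff_right inner_commute norm_eq_1 power2_eq_square algebra_simps)
  have "((%t. (norm x)^2 / t^2 - 2 * ?J tt x / t + 1) \<longlongrightarrow> 1) at_top" by real_asymp
  from filterlim_compose[OF this Rs]
  have "(%n. (norm x)^2 / (R (s n))^2 - 2 * ?J tt x / R (s n) + 1) \<longlonglongrightarrow> 1" .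
  moreover have "(norm x)^2 / (R (s n))^2 - 2 * ?J tt x / R (s n) + 1 = (r (s n) / R (s n))^2" for n
   unfolding power_divide r2 using R0(1)[of n] by (simp add: field_simps power2_eq_square)
  ultimately have "(%n. sqrt ((r (s n) / R (s n))^2)) \<longlonglongrightarrow> sqrt 1" by (intro tendsto_real_sqrt) simp
  hence ratio: "(%n. r (s n) / R (s n)) \<longlonglongrightarrow> 1" using R0 by (simp add: less_imp_le)
  have "(%n. R (s n) / r (s n)) \<longlonglongrightarrow> 1" using tendsto_inverse[OF ratio] by (simp add: field_simps)
  hence "(%n. (R (s n) / r (s n)) powr q) \<longlonglongrightarrow> 1 powr q" by (intro tendsto_intros) auto
  hence pw: "(%n. of_real (?K s n r) :: complex) \<longlonglongrightarrow> 1" using tendsto_of_real[of _ 1] by fastforce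
  have "((%t. (norm x)^2 / t - 2 * ?J tt x) \<longlongrightarrow> - 2 * ?J tt x) at_top" by real_asymp
  from filterlim_compose[OF this Rs]
  have "(%n. ((norm x)^2 / R (s n) - 2 * ?J tt x) / (r (s n) / R (s n) + 1)) \<longlonglongrightarrow> (- 2 * ?J tt x) / (1 + 1)"
   by (intro tendsto_divide tendsto_add ratio tendsto_const) auto
  moreover have "((norm x)^2 / R (s n) - 2 * ?J tt x) / (r (s n) / R (s n) + 1) = r (s n) - R (s n)" for n
  proof -
   have "((norm x)^2 / R (s n) - 2 * ?J tt x) = ((r (s n))^2 - (R (s n))^2) / R (s n)" unfolding r2 using R0(1)[of n] by (simp add: field_simps power2_eq_square)
   also have "... = (r (s n) - R (s n)) * (r (s n) / R (s n) + 1)" using R0(1)[of n] by (simp add: field_simps power2_eq_square)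
   moreover have "r (s n) / R (s n) + 1 > 0" using R0[of n] by (intro add_pos_pos) auto
   ultimately show ?thesis by simp
  qed
  \<comment> \<open>From r^2 - R^2 divided by r + R; the phase needs the difference of the distances
    itself, and not merely that their ratio tends to 1.\<close>
  ultimately have dr: "(%n. r (s n) - R (s n)) \<longlonglongrightarrow> - ?J tt x" by simp
  hence ex: "(%n. iexp (?I r s n)) \<longlonglongrightarrow> iexp (ka * (- ?J tt x))"
   by (intro tendsto_intros)
  have a0: "(%n. a (s n)) \<longlonglongrightarrow> 0"
  proof (rule tendsto_sandwich[of "%_. 0" _ _ "%n. 1 / R (s n)"])
   have "((%t::real. 1 / t) \<longlongrightarrow> 0) at_top" by real_asymp
   from filterlim_compose[OF this Rs] show "(%n. 1 / R (s n)) \<longlonglongrightarrow> 0" .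
   show "\<forall>\<^sub>F n in sequentially. a (s n) <= 1 / R (s n)"
   proof (intro always_eventually allI)
    fix n
    have "a (s n) * R (s n) <= a (s n) * (R (s n) + rh)" using a(1)[of "s n"] rh by (intro mult_left_mono) auto
    thus "a (s n) <= 1 / R (s n)" using a(2)[of "s n"] R0(1)[of n] by (simp add: field_simps)
   qed
  qed (use a(1) in \<open>auto intro!: always_eventually less_imp_le\<close>)
  have "(%n. of_real (r (s n) powr q) * exp (?F r s n) * GT ?G (a (s n)) (T (s n)) (x - R (s n) *\<^sub>R tt))
    \<longlonglongrightarrow> \<i> * c_const DIM('a) ka / of_real ?H"
   unfolding r_def q_def
   by (rule GT_limit[OF ka a(1) a0 rs[unfolded r_def]]) (use R0(2) aT(2)[OF True s] in \<open>auto simp: r_def\<close>)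
  from tendsto_mult[OF tendsto_mult[OF pw ex] tendsto_mult[OF this tendsto_const[of "g x"]]]
  have tl: "(%n. of_real (?K s n r) * iexp (?I r s n) *
    (of_real (r (s n) powr q) * exp (?F r s n) * GT ?G (a (s n)) (T (s n)) (x - R (s n) *\<^sub>R tt) * g x))
    \<longlonglongrightarrow> \<i> * c_const DIM('a) ka / of_real ?H * ?D x tt"
   by (simp add: mult_ac)
  have eqG: "of_real (?K s n r) * iexp (?I r s n) *
    (of_real (r (s n) powr q) * exp (?F r s n) * G * g x) = of_real (R (s n) powr q) * exp (- \<i> * of_real (ka * R (s n))) * (g x * G)" for n G
  proof -
   have "(R (s n) / r (s n)) powr q * r (s n) powr q = R (s n) powr q" using R0[of n] by (simp add: powr_divide)
   hence 1: "complex_of_real (?K s n r) * of_real (r (s n) powr q) = of_real (R (s n) powr q)" by (metis of_real_mult)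
   have 2: "iexp (?I r s n) * exp (?F r s n) = exp (- \<i> * of_real (ka * R (s n)))"
    unfolding exp_add[symmetric] by (rule arg_cong[where f=exp]) (simp add: algebra_simps)
   show ?thesis unfolding 1[symmetric] 2[symmetric] by (simp only: mult_ac)
  qed
  show ?thesis by (rule LIMSEQ_offset[where k=n0]) (rule tl[unfolded eqG, unfolded s_def])
 qed
 have "(%n. LBINT x. of_real (R n powr q) * exp (?C n) * ?B x n tt)
  \<longlonglongrightarrow> (LBINT x. \<i> * c_const DIM('a) ka / of_real ?H * ?D x tt)"
 proof (rule integral_dominated_convergence_at_top_seq)
  show "integrable lborel (%x. 2 powr q * K * norm (g x))" using gi by (intro integrable_mult_right integrable_norm)
  show "\<forall>\<^sub>F n in sequentially. \<forall>x. norm (of_real (R n powr q) * exp (?C n) * ?B x n tt) <= 2 powr q * K * norm (g x)"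
   using bd unfolding eventually_sequentially by blast
  show "\<forall>\<^sub>F n in sequentially. (%x. of_real (R n powr q) * exp (?C n) * ?B x n tt) \<in> borel_measurable lborel"
   by (intro always_eventually allI) measurable
 qed (measurable, use pt in auto)
 thus ?thesis unfolding integral_mult_right_zero q_def .
qed

section \<open>Gaussian mollification of bounded continuous fields\<close>

lemma gk_translate_bound:
 fixes ps :: "'a::euclidean_space => complex"
 assumes [measurable]: "ps \<in> mbl" and b: "\<And>x. norm (ps x) <= B" and a: "a > 0"
 shows "integrable lborel (%x. ps x * gk (of_real a) (x - c))" "norm (LBINT x. ps x * gk (of_real a) (x - c)) <= B"
proof -
 have i: "integrable lborel (%x. B * norm (gk (of_real a) (x - c)))"
  using a by (intro integrable_mult_right integrable_norm integrable_gk_translate) simp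
 have le: "AE x in lborel. norm (ps x * gk (of_real a) (x - c)) <= B * norm (gk (of_real a) (x - c))"
  using b by (auto simp: norm_mult intro!: mult_right_mono)
 show "integrable lborel (%x. ps x * gk (of_real a) (x - c))" by (rule norm_integral_le_AE(1)[OF _ i le]) measurable
 let ?A = "LBINT x. ps x * gk (of_real a) (x - c)"
 have "norm ?A <= (LBINT x. B * norm (gk (of_real a) (x - c)))"
  by (rule norm_integral_le_AE(2)[OF _ i le]) measurable
 also have "... = B" using gk_real(2)[OF a, where 'a='a] integral_lborel_translate[of "%x. norm (gk (of_real a) x)" c] by simp
 finally show "norm ?A <= B" .
qed

text \<open>Scaling x by sqrt(a) turns the integral into an average of \<open>ps\<close> near z
  against the fixed kernel \<open>gk 1\<close>, whose integral is 1.\<close>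

lemma gk_approx:
 fixes ps :: "'a::euclidean_space => complex"
 assumes c: "continuous_on UNIV ps" and b: "\<And>x. norm (ps x) <= B" and a: "\<And>n. a n > 0" "a \<longlonglongrightarrow> 0"
 shows "(%n. LBINT x. ps x * gk (of_real (a n)) (x - z)) \<longlonglongrightarrow> ps z"
proof -
 have [measurable]: "ps \<in> mbl" using c by (rule borel_measurable_continuous_onI)
 have i1: "integrable lborel (%x::'a. gk 1 x)" by (rule integrable_gk) simp
 let ?A = "%n x. z + sqrt (a n) *\<^sub>R x"
 let ?B = "%n x. sqrt (a n) *\<^sub>R x"
 let ?C = "%n. LBINT x. ps x * gk (of_real (a n)) (x - z)"
 have eq: "?C n = (LBINT x. ps (?A n x) * gk 1 x)" for n
 proof -
  have s: "sqrt (a n) > 0" using a by simp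
  have cs: "csqrt (4 * of_real pi * of_real (a n)) = of_real (sqrt (a n)) * csqrt (4 * of_real pi)"
   using csqrt_of_real_times[OF a(1), of n "4 * of_real pi"] by (simp add: mult_ac del: csqrt.sel)
  have e: "?B n x \<bullet> (?B n x) = a n * (x \<bullet> x)" for x :: 'a using a(1)[of n] by simp
  have g: "of_real (sqrt (a n) ^ DIM('a)) * gk (of_real (a n)) (?B n x) = gk 1 x" for x :: 'a
   using a(1)[of n] s unfolding gk_def e cs power_mult_distrib by (simp del: csqrt.sel flip: of_real_mult) simp
  have "?C n = sqrt (a n) ^ DIM('a) *\<^sub>R (LBINT x. ps (?A n x) * gk (of_real (a n)) (?B n x))"
   using s by (subst integral_lborel_affine[of "sqrt (a n)" _ z]) auto
  also have "... = (LBINT x. ps (?A n x) * (of_real (sqrt (a n) ^ DIM('a)) * gk (of_real (a n)) (?B n x)))"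
   unfolding scaleR_conv_of_real integral_mult_right_zero[symmetric] by (simp only: mult_ac)
  finally show ?thesis unfolding g .
 qed
 have "(%n. LBINT x. ps (?A n x) * gk 1 x) \<longlonglongrightarrow> (LBINT x. ps z * gk 1 (x::'a))"
 proof (rule integral_dominated_convergence[where w="%x. B * norm (gk 1 (x::'a))"])
  show "AE x in lborel. (%n. ps (?A n x) * gk 1 x) \<longlonglongrightarrow> ps z * gk 1 x"
  proof (intro AE_I2 tendsto_mult tendsto_const)
   fix x
   have "(%n. z + sqrt (a n) *\<^sub>R x) \<longlonglongrightarrow> z + sqrt 0 *\<^sub>R x" by (intro tendsto_intros a(2))
   hence "(%n. z + sqrt (a n) *\<^sub>R x) \<longlonglongrightarrow> z" by simp
   thus "(%n. ps (?A n x)) \<longlonglongrightarrow> ps z" using c by (intro isCont_tendsto_compose[where g=ps]) (auto simp: continuous_on_eq_continuous_at)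
  qed
 qed (use i1 b in \<open>auto simp: norm_mult intro!: mult_right_mono\<close>)
 also have "(LBINT x. ps z * gk 1 (x::'a)) = ps z" using integrable_gk_fourier(2)[of 1 "0::'a"] by simp
 finally show ?thesis unfolding eq .
qed

lemma GT_even: "GT E a T (- x) = GT E a T x"
 by (simp add: GT_def gk_def)

section \<open>The Duhamel representation\<close>

text \<open>The Duhamel representation of a field \<open>ps\<close> with incident part \<open>p\<close> and source \<open>g\<close>,
 smoothed at scale \<open>a\<close> and up to an error that vanishes as the evolution time \<open>T\<close> grows.\<close>

definition duhamel :: "real => ('a::euclidean_space => complex) => ('a => complex) => ('a => complex) => bool" where
 "duhamel ka p ps g \<longleftrightarrow> (\<forall>a R. a > 0 \<longrightarrow> (\<exists>K. \<forall>c T. norm c <= R \<and> T >= 1 \<longrightarrow>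
   norm (of_real (exp (- a * ka^2)) * p c - (LBINT x. ps x * gk (of_real a) (x - c)) - \<i> * (LBINT x. g x * GT (ka^2) a T (x - c)))
    <= K * T powr (- 1/2)))"

lemma GT_mult_integrable:
 assumes "a > 0" "T >= 0" "bcs rh g"
 shows "integrable lborel (%x. g x * GT E a T (x - c))"
 using assms GT_norm_bound[OF assms(1,2)] by (intro bcs_integrable[OF bcs_mult[OF assms(3)]]) auto

text \<open>Linearity of the representation. It lets two fields with different incident waves be
  compared as one field whose incident part is small.\<close>

lemma duhamel_diff:
 assumes D: "duhamel ka p ps g" "duhamel ka p' ps' g'"
  and g: "bcs rh g" "bcs rh g'" and m: "ps \<in> mbl" "ps' \<in> mbl"
  and b: "\<And>x. norm (ps x) <= B" "\<And>x. norm (ps' x) <= B'"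
 shows "duhamel ka (%x. p x - p' x) (%x. ps x - ps' x) (%x. g x - g' x)"
 unfolding duhamel_def
proof (intro allI impI)
 fix a R :: real
 assume a: "a > 0"
 define X where "X p ps g c T = of_real (exp (- a * ka^2)) * p c - (LBINT x. ps x * gk (of_real a) (x - c)) - \<i> * (LBINT x. g x * GT (ka^2) a T (x - c))"
  for p ps g :: "'a => complex" and c T
 obtain K K' where K: "\<And>c T. norm c <= R \<and> T >= 1 ==> norm (X p ps g c T) <= K * T powr (- 1/2)"
  "\<And>c T. norm c <= R \<and> T >= 1 ==> norm (X p' ps' g' c T) <= K' * T powr (- 1/2)"
  using D a unfolding duhamel_def X_def by meson
 have "norm (X (%x. p x - p' x) (%x. ps x - ps' x) (%x. g x - g' x) c T) <= (K + K') * T powr (- 1/2)" if "norm c <= R \<and> T >= 1" for c T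
 proof -
  have "X (%x. p x - p' x) (%x. ps x - ps' x) (%x. g x - g' x) c T = X p ps g c T - X p' ps' g' c T"
   unfolding X_def using that a gk_translate_bound(1)[OF m(1) b(1) a] gk_translate_bound(1)[OF m(2) b(2) a] GT_mult_integrable[OF a _ g(1)] GT_mult_integrable[OF a _ g(2)]
   by (simp add: left_diff_distrib algebra_simps)
  thus ?thesis using norm_triangle_ineq4[of "X p ps g c T" "X p' ps' g' c T"] K[OF that] by (simp add: distrib_right)
 qed
 thus "\<exists>K. \<forall>c T. norm c <= R \<and> 1 <= T \<longrightarrow> norm (of_real (exp (- a * ka^2)) * (p c - p' c) - (LBINT x. (ps x - ps' x) * gk (of_real a) (x - c))
   - \<i> * (LBINT x. (g x - g' x) * GT (ka^2) a T (x - c))) <= K * T powr (- 1/2)" unfolding X_def by blast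
qed

text \<open>Duality: the scattered part is paired with a test function h in the ball, the error is
  removed by letting T and then a go to their limits, and \<open>GT_bilinear\<close> bounds what
  remains uniformly in both.\<close>

lemma duhamel_L2:
 fixes g :: "'a::euclidean_space => complex"
 assumes dim: "DIM('a) >= 2" and ka: "ka >= 1" and D: "duhamel ka p ps g" and g: "bcs rh g"
  and p: "continuous_on UNIV p" "\<And>x. norm (p x) <= P" and ps: "continuous_on UNIV ps" "\<And>x. norm (ps x) <= B"
 defines "A \<equiv> (13 + real DIM('a)) * exp (rh^2)"
 shows "L2sq (%x. indicator (cball 0 rh) x *\<^sub>R (p x - ps x)) <= (A / ka)^2 * L2sq g"
proof -
 have [measurable]: "g \<in> mbl" using g by (rule bcs_measurable)
 have [measurable]: "p \<in> mbl" "ps \<in> mbl" using p ps by (auto intro: borel_measurable_continuous_onI)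
 define psa where "psa a c = (LBINT x. ps x * gk (of_real a) (x - c))" for a c
 have [measurable]: "psa a \<in> mbl" for a unfolding psa_def[abs_def]
  by (rule lborel.borel_measurable_lebesgue_integral[of "%c x. ps x * gk (of_real a) (x - c)" borel, simplified case_prod_unfold]) measurable
 have psab: "norm (psa a c) <= B" if "a > 0" for a c unfolding psa_def by (rule gk_translate_bound(2)[OF _ ps(2) that]) measurable
 let ?A = "%a c. of_real (exp (- a * ka^2)) * p c - psa a c"
 have P0: "norm (?A a c) <= P + B" if "a > 0" for a c
 proof -
  have "exp (- a * ka^2) * norm (p c) <= 1 * P" using that p(2)[of c] by (intro mult_mono) auto
  thus ?thesis using norm_triangle_ineq4[of "of_real (exp (- a * ka^2)) * p c" "psa a c"] psab[OF that, of c] by (simp add: norm_mult)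
 qed
 let ?C = "%h. (L2sq h + L2sq g) / 2"
 let ?G = "%h a. LBINT c. h c * ?A a c"
 \<comment> \<open>At fixed a: the bilinear bound does not depend on T, while the Duhamel error
   decays as T grows.\<close>
 have s1: "norm (?G h a) <= A / ka * ?C h"
  if a: "a > 0" "a <= 1" and h: "bcs rh h" for a h
 proof -
  have [measurable]: "h \<in> mbl" using h by (rule bcs_measurable)
  define G where "G T c = (LBINT x. g x * GT (ka^2) a T (x - c))" for T c
  have [measurable]: "G T \<in> mbl" for T unfolding G_def[abs_def]
   by (rule lborel.borel_measurable_lebesgue_integral[of "%c x. g x * GT (ka^2) a T (x - c)" borel, simplified case_prod_unfold]) measurable
  define e where "e T c = of_real (exp (- a * ka^2)) * p c - psa a c - \<i> * G T c" for T c
  have [measurable]: "e T \<in> mbl" for T unfolding e_def[abs_def] by measurable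
  obtain K where K: "\<And>c T. norm c <= rh ==> T >= 1 ==> norm (e T c) <= K * T powr (- 1/2)"
   using D a(1) unfolding duhamel_def e_def psa_def G_def by meson
  have bound: "norm (?G h a) <= K * T powr (- 1/2) * (LBINT c. norm (h c)) + A / ka * ?C h"
   if T: "T >= 1" for T
  proof -
   have i1: "integrable lborel (%c. h c * ?A a c)"
    by (rule bcs_integrable[OF bcs_mult[OF h _ P0[OF a(1)]]]) measurable
   have i2: "integrable lborel (%c. h c * e T c)"
    by (rule bcs_integrable[OF bcs_mult[OF h _ K[OF _ T]]]) auto
   have "norm (LBINT c. h c * e T c) <= (LBINT c. K * T powr (- 1/2) * norm (h c))"
   proof (rule norm_integral_le_AE(2))
    show "AE c in lborel. norm (h c * e T c) <= K * T powr (- 1/2) * norm (h c)"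
    proof (rule AE_I2)
     fix c show "norm (h c * e T c) <= K * T powr (- 1/2) * norm (h c)"
      using K[OF _ T, of c] h by (cases "norm c <= rh") (auto simp: norm_mult mult.commute bcs_def intro!: mult_left_mono)
    qed
   qed (use bcs_integrable[OF h] in auto)
   moreover have "?G h a = (LBINT c. h c * e T c) + \<i> * (LBINT c. h c * G T c)"
   proof -
    have "?G h a - (LBINT c. h c * e T c) = (LBINT c. \<i> * (h c * G T c))"
     unfolding integral_diff[OF i1 i2, symmetric] by (simp add: e_def algebra_simps)
    thus ?thesis by (simp add: algebra_simps)
   qed
   moreover have "norm (LBINT c. h c * G T c) <= A / ka * ?C h"
   proof -
    have "G T c = (LBINT x. g x * GT (ka^2) a T (c - x))" for c
     unfolding G_def by (rule integral_cong[OF refl]) (metis GT_even minus_diff_eq)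
    thus ?thesis using GT_bilinear[OF dim a _ _ h g, of T "ka^2"] T ka unfolding A_def by simp
   qed
   ultimately show ?thesis
    using norm_triangle_ineq[of "LBINT c. h c * e T c" "\<i> * (LBINT c. h c * G T c)"] by (simp add: norm_mult)
  qed
  have "((%T. K * T powr (- 1/2) * I + Q) \<longlongrightarrow> Q) at_top" for K I Q :: real by real_asymp
  from this[of K "LBINT c. norm (h c)"] show ?thesis by (rule tendsto_lowerbound) (use bound in \<open>auto intro: eventually_mono[OF eventually_ge_at_top[of 1]] simp del: times_divide_eq_right\<close>)
 qed
 let ?B = "%a n c. of_real (exp (- a n * ka^2)) * p c - psa (a n) c"
 let ?D = "%c. p c - ps c"
 \<comment> \<open>The previous bound is uniform in a, so a may tend to 0, which removes the
   mollification.\<close>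
 have s2: "norm (LBINT c. h c * ?D c) <= A / ka * ?C h" if h: "bcs rh h" for h
 proof -
  have [measurable]: "h \<in> mbl" using h by (rule bcs_measurable)
  define a where "a n = 1 / (real n + 1)" for n
  have a: "a n > 0" "a n <= 1" for n by (auto simp: a_def)
  have a0: "a \<longlonglongrightarrow> 0" unfolding a_def by real_asymp
  have "(%n. LBINT c. h c * ?B a n c) \<longlonglongrightarrow> (LBINT c. h c * ?D c)"
  proof (rule integral_dominated_convergence[where w="%c. norm (h c) * (P + B)"])
   show "AE c in lborel. (%n. h c * ?B a n c) \<longlonglongrightarrow> h c * ?D c"
   proof (rule AE_I2)
    fix c
    have "(%n. h c * ?B a n c) \<longlonglongrightarrow> h c * (of_real (exp (- 0 * ka^2)) * p c - ps c)"
     unfolding psa_def by (intro tendsto_intros a0 gk_approx[OF ps a(1) a0])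
    thus "(%n. h c * ?B a n c) \<longlonglongrightarrow> h c * ?D c" by simp
   qed
   show "AE c in lborel. norm (h c * ?B a n c) <= norm (h c) * (P + B)" for n
    unfolding norm_mult by (intro AE_I2 mult_left_mono P0 a) auto
  qed (use bcs_integrable[OF h] in auto)
  from tendsto_norm[OF this] show ?thesis by (rule LIMSEQ_le_const2) (use s1[OF a h] in auto)
 qed
 define u where "u x = indicator (cball 0 rh) x *\<^sub>R (p x - ps x)" for x
 have PB: "norm (p x - ps x) <= P + B" for x using norm_triangle_ineq4[of "p x" "ps x"] p(2)[of x] ps(2)[of x] by linarith
 have u: "bcs rh u" unfolding bcs_def u_def using PB order_trans[OF norm_ge_zero PB]
  by (auto simp: indicator_def intro!: exI[of _ "P + B"])
 have A: "A > 0" unfolding A_def by (intro mult_pos_pos) auto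
 \<comment> \<open>The scale at which the arithmetic mean loses nothing: testing with h = mu cnj(u)
   leaves half of mu^2 \<open>L2sq u\<close> on the right, which is absorbed by the left.\<close>
 define mu where "mu = ka / A"
 have mu: "mu > 0" using A ka by (simp add: mu_def)
 define h where "h x = of_real mu * cnj (u x)" for x
 have h: "bcs rh h" using bcs_mult[OF bcs_cnj[OF u], of "%_. of_real mu" mu] mu unfolding h_def by (simp add: mult.commute)
 have Lh: "L2sq h = mu^2 * L2sq u" unfolding L2sq_def h_def by (simp add: norm_mult power_mult_distrib)
 let ?F = "(mu^2 * L2sq u + L2sq g) / 2"
 let ?H = "mu * L2sq u"
 have "(LBINT c. h c * ?D c) = (LBINT c. of_real (mu * (norm (u c))^2))"
 proof (rule integral_cong[OF refl])
  fix c
  have "cnj (u c) * ?D c = cnj (u c) * u c" by (simp add: u_def indicator_def)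
  thus "h c * ?D c = of_real (mu * (norm (u c))^2)" unfolding h_def by (simp add: complex_norm_square mult_ac del: of_real_power)
 qed
 also have "... = of_real ?H" by (simp add: L2sq_def del: of_real_power of_real_mult)
 finally have "norm (complex_of_real ?H) <= A / ka * ?C h" using s2[OF h] by simp
 moreover have "A / ka = 1 / mu" by (simp add: mu_def)
 ultimately have "mu * L2sq u <= (1 / mu) * ?F" unfolding Lh norm_of_real by (metis abs_ge_self order_trans)
 hence "mu * ?H <= mu * ((1 / mu) * ?F)" using mu by (intro mult_left_mono) auto
 hence "mu^2 * L2sq u <= L2sq g" using mu by (simp add: power2_eq_square)
 hence "L2sq u <= (1 / mu)^2 * L2sq g" using mu by (simp add: field_simps)
 thus ?thesis unfolding u_def[abs_def] mu_def by simp
qed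

text \<open>The mollification parameter is chosen first, then T large depending on it, because the
  constant K of the error depends on a.\<close>

lemma duhamel_approx:
 assumes D: "duhamel ka p ps g" and ps: "continuous_on UNIV ps" "\<And>x. norm (ps x) <= B" and et: "et > 0" and M: "M > 0"
 shows "\<exists>a T. 0 < a \<and> a * M <= 1 \<and> T >= N \<and> norm (p c - ps c - \<i> * (LBINT x. g x * GT (ka^2) a T (x - c))) < et"
proof -
 define a where "a n = 1 / (M * (real n + 1))" for n
 have a: "a n > 0" "a n * M <= 1" for n using M by (auto simp: a_def)
 have a0: "a \<longlonglongrightarrow> 0" unfolding a_def using M by real_asymp
 let ?A = "%a n. LBINT x. ps x * gk (of_real (a n)) (x - c)"
 let ?C = "%a n. exp (- a n * ka^2)"
 have "(%n. of_real (?C a n) * p c - ?A a n) \<longlonglongrightarrow> of_real (exp (- 0 * ka^2)) * p c - ps c"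
  by (intro tendsto_intros a0 gk_approx[OF ps a(1) a0])
 from tendstoD[OF this, of "et/2"] et obtain n where n: "norm (of_real (?C a n) * p c - ?A a n - (p c - ps c)) < et / 2"
  by (auto simp: dist_norm eventually_sequentially)
 let ?B = "%a n T. LBINT x. g x * GT (ka^2) (a n) T (x - c)"
 obtain K where K: "\<And>T. T >= 1 ==> norm (of_real (?C a n) * p c - ?A a n - \<i> * ?B a n T) <= K * T powr (- 1/2)"
  using D a(1)[of n] unfolding duhamel_def by (meson order_refl)
 have "((%T. K * T powr (- 1/2)) \<longlongrightarrow> 0) at_top" by real_asymp
 hence "eventually (%T. K * T powr (- 1/2) < et / 2) at_top" using et by (intro order_tendstoD) auto
 then obtain T0 where "\<And>T. T >= T0 ==> K * T powr (- 1/2) < et / 2" unfolding eventually_at_top_linorder by blast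
 hence T: "K * T powr (- 1/2) < et / 2" "T >= 1" "T >= N" if "T = max T0 (max 1 N)" for T using that by auto
 define T where "T = max T0 (max 1 N)"
 note T = T[OF T_def]
 have "norm (p c - ps c - \<i> * ?B a n T) < et"
  using norm_triangle_ineq4[of "of_real (?C a n) * p c - ?A a n - \<i> * ?B a n T"
   "of_real (?C a n) * p c - ?A a n - (p c - ps c)"] n K[OF T(2)] T(1)
  by (simp add: algebra_simps)
 thus ?thesis using a T by blast
qed

text \<open>At each radius R the parameters are chosen so that the Duhamel error is below R^(-q)/R,
  small even after rescaling by R^q. The other requirements on a and T are the hypotheses of
  \<open>GT_far_field\<close>.\<close>

lemma duhamel_far:
 fixes g :: "'a::euclidean_space => complex"
 assumes ka: "ka > 0" and D: "duhamel ka p ps g" and g: "bcs rh g" and rh: "rh >= 0" and ps: "continuous_on UNIV ps" "\<And>x. norm (ps x) <= B" and tt: "norm tt = 1"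
 shows "(%n. of_real ((real n + 1) powr ((real DIM('a) - 1) / 2)) * exp (- \<i> * of_real (ka * (real n + 1))) * (ps ((real n + 1) *\<^sub>R tt) - p ((real n + 1) *\<^sub>R tt)))
  \<longlonglongrightarrow> c_const DIM('a) ka / of_real ((2 * pi) ^ DIM('a)) * (LBINT x. g x * exp (- \<i> * of_real (ka * (tt \<bullet> x))))"
proof -
 define q where "q = (real DIM('a) - 1) / 2"
 define R where "R n = real n + 1" for n
 have R: "R n > 0" for n by (simp add: R_def)
 let ?A = "%R n. R n *\<^sub>R tt"
 let ?B = "%x R n. x - R n *\<^sub>R tt"
 let ?C = "ka^2"
 define W where "W n a T \<longleftrightarrow> norm (p (?A R n) - ps (?A R n) - \<i> * (LBINT x. g x * GT ?C a T (?B x R n))) < R n powr (- q) / R n" for n a T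
 have "\<exists>a T. 0 < a \<and> a * (R n + rh) <= 1 \<and> T >= (R n + rh) / ka \<and> W n a T" for n
  unfolding W_def using R[of n] rh by (intro duhamel_approx[OF D ps]) auto
 then obtain a T where aT: "\<And>n. 0 < a n" "\<And>n. a n * (R n + rh) <= 1" "\<And>n. T n >= (R n + rh) / ka"
  and e: "\<And>n. W n (a n) (T n)" by metis
 note e = e[unfolded W_def]
 define z where "z n = of_real (R n powr q) * exp (- \<i> * of_real (ka * R n))" for n
 have z: "norm (z n) = R n powr q" for n by (simp add: z_def norm_mult)
 have 1: "(%n. z n * (p (?A R n) - ps (?A R n) - \<i> * (LBINT x. g x * GT ?C (a n) (T n) (?B x R n)))) \<longlonglongrightarrow> 0"
 proof (rule Lim_null_comparison)
  show "eventually (%n. norm (z n * (p (?A R n) - ps (?A R n) - \<i> * (LBINT x. g x * GT ?C (a n) (T n) (?B x R n)))) <= 1 / R n) sequentially"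
  proof (intro always_eventually allI)
   fix n
   have "R n powr q * norm (p (?A R n) - ps (?A R n) - \<i> * (LBINT x. g x * GT ?C (a n) (T n) (?B x R n))) <= R n powr q * (R n powr (- q) / R n)"
    using e[of n] by (intro mult_left_mono) auto
   also have "... = 1 / R n" using R[of n] by (simp add: powr_minus)
   finally show "norm (z n * (p (?A R n) - ps (?A R n) - \<i> * (LBINT x. g x * GT ?C (a n) (T n) (?B x R n)))) <= 1 / R n"
    by (simp only: norm_mult[of "z n"] z)
  qed
  show "(%n. 1 / R n) \<longlonglongrightarrow> 0" unfolding R_def by real_asymp
 qed
 let ?D = "(2 * pi) ^ DIM('a)"
 have "filterlim R at_top sequentially" unfolding R_def by real_asymp
 from GT_far_field[OF ka g rh tt this aT]
 have 2: "(%n. z n * (LBINT x. g x * GT ?C (a n) (T n) (?B x R n)))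
  \<longlonglongrightarrow> \<i> * c_const DIM('a) ka / of_real ?D * (LBINT x. g x * exp (- \<i> * of_real (ka * (tt \<bullet> x))))"
  unfolding z_def q_def .
 have eq: "- (z n * (p (?A R n) - ps (?A R n) - \<i> * I)) - \<i> * (z n * I) = z n * (ps (?A R n) - p (?A R n))" for n I by (simp add: algebra_simps)
 have ii: "\<i> * (\<i> * x) = - x" for x by (simp add: mult.assoc[symmetric])
 have cJ: "- 0 - \<i> * (\<i> * c_const DIM('a) ka / of_real ?D * J) = c_const DIM('a) ka / of_real ?D * J" for J by (simp add: mult.assoc ii)
 from tendsto_diff[OF tendsto_minus[OF 1] tendsto_mult_left[OF 2, of \<i>]] show ?thesis
  unfolding eq cJ unfolding z_def R_def q_def .
qed

text \<open>Boundedness combines compactness near the origin with the asymptotics outside. The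
  representation combines \<open>evolution\<close>, the explicit evolution of the plane wave and the
  dispersion of the rest. The formula for F compares two descriptions of the same far field and
  cancels the nonzero constant \<open>c_const\<close>.\<close>

lemma scat_duhamel:
 fixes V ps F :: "'a::euclidean_space => complex"
 assumes dim: "DIM('a) >= 2" and V: "V \<in> mbl" "\<And>x. norm (V x) <= CV" "\<And>x. norm x > rh ==> V x = 0" and rh: "rh >= 0"
  and k: "norm k = ka" "ka > 0" and ps: "continuous_on UNIV ps" and weak: "weak_schroedinger_sol V (ka^2) ps"
  and asym: "\<And>x. norm x >= R ==> norm (ps x - (iexp (k \<bullet> x) + c_const DIM('a) ka * iexp (ka * norm x)
    / of_real (norm x powr ((real DIM('a) - 1) / 2)) * F ((ka / norm x) *\<^sub>R x))) <= C * norm x powr (- (real DIM('a) + 1) / 2)"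
 shows "\<exists>B. \<forall>x. norm (ps x) <= B"
  and "duhamel ka (%x. iexp (k \<bullet> x)) ps (%x. V x * ps x)"
  and "norm l = ka ==> F l = (LBINT x. V x * ps x * exp (- \<i> * of_real (l \<bullet> x))) / of_real ((2 * pi) ^ DIM('a))"
proof -
 define q where "q = (real DIM('a) - 1) / 2"
 define p where "p x = iexp (k \<bullet> x)" for x :: 'a
 have pc: "continuous_on UNIV p" unfolding p_def by (intro continuous_intros)
 have np: "norm (p x) = 1" for x by (simp add: p_def)
 let ?H = "real DIM('a) + 1"
 have q: "q > 0" "q + 1 = ?H / 2" using dim by (auto simp: q_def field_simps)
 define A where "A tt = c_const DIM('a) ka * F (ka *\<^sub>R tt)" for tt
 define ph where "ph x = ps x - p x" for x
 have ph: "continuous_on UNIV ph" unfolding ph_def by (intro continuous_intros ps pc)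
 let ?A = "- ?H / 2"
 let ?D = "%x. (1 / norm x) *\<^sub>R x"
 have as: "norm (ph x - iexp (ka * norm x) / of_real (norm x powr q) * A (?D x)) <= C * norm x powr ?A"
  if "norm x >= R" for x using asym[OF that] by (simp add: ph_def A_def q_def p_def algebra_simps)
 define R0 where "R0 = max R 1"
 have R0: "R0 >= R" "R0 >= 1" by (auto simp: R0_def)
 have "bounded (ph ` cball 0 R0)" by (intro compact_imp_bounded compact_continuous_image continuous_on_subset[OF ph]) auto
 then obtain M where M: "\<And>x. norm x <= R0 ==> norm (ph x) <= M" by (force simp: bounded_iff)
 have C0: "C >= 0"
 proof -
  obtain b :: 'a where "b \<in> Basis" using nonempty_Basis by blast
  hence "0 <= C * R0 powr ?A" using order_trans[OF norm_ge_zero as[of "R0 *\<^sub>R b"]] R0 by simp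
  thus ?thesis using R0 by (simp add: zero_le_mult_iff)
 qed
 have Ab: "norm (A tt) <= (M + C) * R0 powr q" if "norm tt = 1" for tt
 proof -
  have "norm (iexp (ka * R0) / of_real (R0 powr q) * A tt) <= norm (ph (R0 *\<^sub>R tt)) + C * R0 powr ?A"
   using as[of "R0 *\<^sub>R tt"] norm_triangle_ineq2[of "iexp (ka * R0) / of_real (R0 powr q) * A tt" "ph (R0 *\<^sub>R tt)"] R0 that by (simp add: norm_minus_commute)
  also have "... <= M + C * 1" using R0 that C0 powr_mono[of "- ?H / 2" 0 R0] by (intro add_mono M mult_left_mono) auto
  finally show ?thesis using R0 by (simp add: norm_mult norm_divide field_simps)
 qed
 let ?I = "%x. iexp (ka * norm x) / of_real (norm x powr q) * A (?D x)"
 have B: "norm (ph x) <= max M ((M + C) * R0 powr q + C)" for x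
 proof (cases "norm x <= R0")
  case True thus ?thesis using M by (simp add: le_max_iff_disj)
 next
  case False
  hence x: "norm x > 1" "norm x >= R" using R0 by auto
  have "norm (?I x) = norm (A (?D x)) / norm x powr q" by (simp add: norm_mult norm_divide)
  also have "... <= norm (A (?D x)) / 1" using x q ge_one_powr_ge_zero[of "norm x" q] by (intro divide_left_mono) auto
  also have "... <= (M + C) * R0 powr q" using x Ab[of "(1 / norm x) *\<^sub>R x"] by (cases "x = 0") auto
  finally have "norm (?I x) <= (M + C) * R0 powr q" .
  moreover have "C * norm x powr ?A <= C * 1" using x C0 powr_mono[of "- ?H / 2" 0 "norm x"] by (intro mult_left_mono) (auto split: if_splits)
  ultimately show ?thesis using as[OF x(2)] norm_triangle_ineq2[of "ph x" "iexp (ka * norm x) / of_real (norm x powr q) * A (?D x)"] by simp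
 qed
 define B where "B = max M ((M + C) * R0 powr q + C) + 1"
 have psb: "norm (ps x) <= B" for x
  using B[of x] norm_triangle_ineq[of "ph x" "p x"] np[of x] by (simp add: ph_def B_def)
 thus "\<exists>B. \<forall>x. norm (ps x) <= B" by blast
 interpret weak_sol V ps "ka^2" CV rh B
  by unfold_locales (use V ps psb weak in auto)
 have [measurable]: "p \<in> mbl" using pc by (rule borel_measurable_continuous_onI)
 let ?J = "ka^2"
 let ?K = "%a. exp (- a * ka^2)"
 let ?B = "%a c T. of_real (?K a) * p c - (LBINT x. ps x * gk (of_real a) (x - c)) - \<i> * (LBINT x. V x * ps x * GT ?J a T (x - c))"
 let ?G = "%x. V x * ps x"
 let ?M = "%s c. LBINT x. ps x * gk s (x - c)"
 have D: "duhamel ka p ps ?G"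
  unfolding duhamel_def
 proof (intro allI impI)
  fix a R1 :: real
  assume a: "a > 0"
  obtain K where K: "\<And>c t. norm c <= R1 ==> t >= 1 ==> norm (LBINT x. ph x * gk (of_real a + \<i> * of_real t) (x - c)) <= K * t powr (- 1/2)"
   using outgoing_decay[where R=R and ?R1.0=R1, OF dim k(2) a ph B as[unfolded q_def]] by blast
  have "norm (?B a c T) <= K * T powr (- 1/2)"
   if c: "norm c <= R1" and T: "T >= 1" for c T
  proof -
   define s where "s = of_real a + \<i> * of_real T"
   have s: "Re s > 0" using a by (simp add: s_def)
   note gi = integrable_gk_translate[OF s, of c]
   have i1: "integrable lborel (%x. p x * gk s (x - c))"
    by (rule integrable_bound[OF integrable_norm[OF gi]]) (auto simp: norm_mult np)
   have i2: "integrable lborel (%x. ph x * gk s (x - c))"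
   proof (rule norm_integral_le_AE(1))
    show "integrable lborel (%x. (B + 1) * norm (gk s (x - c)))" by (intro integrable_mult_right integrable_norm gi)
    show "AE x in lborel. norm (ph x * gk s (x - c)) <= (B + 1) * norm (gk s (x - c))"
     unfolding norm_mult by (intro AE_I2 mult_right_mono order_trans[OF B]) (auto simp: B_def)
   qed (simp add: ph_def)
   have "?M s c = (LBINT x. p x * gk s (x - c)) + (LBINT x. ph x * gk s (x - c))"
    unfolding integral_add[OF i1 i2, symmetric] by (simp add: ph_def algebra_simps)
   also have "(LBINT x. p x * gk s (x - c)) = p c * exp (- s * of_real ?J)"
    using gk_fourier_translate[OF s, of c k] k by (simp add: p_def mult.commute dot_square_norm)
   finally have pss: "?M s c = p c * exp (- s * of_real ?J) + (LBINT x. ph x * gk s (x - c))" .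
   \<comment> \<open>The plane wave lies on the energy shell, so its evolution merely undoes the
     factor exp(iTE) and no T-dependence is left.\<close>
   have "iexp (T * ka^2) * exp (- s * of_real ?J) = of_real (?K a)"
    unfolding exp_add[symmetric] exp_of_real[symmetric] by (rule arg_cong[where f=exp]) (simp add: s_def algebra_simps)
   hence "iexp (T * ka^2) * ?M s c = of_real (?K a) * p c + iexp (T * ka^2) * (LBINT x. ph x * gk s (x - c))"
    unfolding pss distrib_left by (simp add: mult.left_commute[of _ "p c"] mult.commute[of "p c"])
   hence "of_real (?K a) * p c - (LBINT x. ps x * gk (of_real a) (x - c)) - \<i> * (LBINT x. V x * ps x * GT ?J a T (x - c))
    = - (iexp (T * ka^2) * (LBINT x. ph x * gk s (x - c)))"
    using evolution[OF a, of T c] T unfolding s_def by (simp add: algebra_simps)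
   thus ?thesis using K[OF c T] by (simp add: norm_mult s_def)
  qed
  thus "\<exists>K. \<forall>c T. norm c <= R1 \<and> 1 <= T \<longrightarrow> norm (?B a c T) <= K * T powr (- 1/2)" by blast
 qed
 thus "duhamel ka (%x. iexp (k \<bullet> x)) ps ?G" unfolding p_def .
 assume l: "norm l = ka"
 define tt where "tt = (1 / ka) *\<^sub>R l"
 have tt: "norm tt = 1" "l = ka *\<^sub>R tt" using l k by (auto simp: tt_def)
 have g: "bcs rh ?G" using V psb by (intro bcs_mult[where K=B]) (auto simp: bcs_def)
 define z where "z n = of_real ((real n + 1) powr q) * exp (- \<i> * of_real (ka * (real n + 1)))" for n
 let ?L = "(2 * pi) ^ DIM('a)"
 have L1: "(%n. z n * ph ((real n + 1) *\<^sub>R tt)) \<longlonglongrightarrow> c_const DIM('a) ka / of_real ?L * (LBINT x. V x * ps x * exp (- \<i> * of_real (ka * (tt \<bullet> x))))"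
  using duhamel_far[OF k(2) D g rh ps psb tt(1)] unfolding z_def q_def ph_def .
 let ?C = "%ph r tt. ph (r *\<^sub>R tt) - iexp (ka * r) / of_real (r powr q) * A tt"
 let ?F = "LBINT x. V x * ps x * exp (- \<i> * of_real (l \<bullet> x))"
 \<comment> \<open>The prescribed asymptotics identify the same rescaled limit as A; uniqueness of
   limits then equates it with the integral over the source.\<close>
 have "(%n. z n * ph ((real n + 1) *\<^sub>R tt) - A tt) \<longlonglongrightarrow> 0"
 proof (rule Lim_null_comparison)
  show "(%n. C / (real n + 1)) \<longlonglongrightarrow> 0" by real_asymp
  show "eventually (%n. norm (z n * ph ((real n + 1) *\<^sub>R tt) - A tt) <= C / (real n + 1)) sequentially"
   using eventually_ge_at_top[of "nat \<lceil>R\<rceil>"]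
  proof eventually_elim
   case (elim n)
   define r where "r = real n + 1"
   have r: "r > 0" "r >= R" using elim by (auto simp: r_def)
   have "norm (r *\<^sub>R tt) = r" using tt r by simp
   with as[of "r *\<^sub>R tt"] r have "norm (?C ph r tt) <= C * r powr ?A" by simp
   hence "norm (z n) * norm (?C ph r tt) <= norm (z n) * (C * r powr ?A)" by (rule mult_left_mono) simp
   moreover have "z n * ?C ph r tt = z n * ph (r *\<^sub>R tt) - A tt"
   proof -
    have "z n = of_real (r powr q) * exp (- \<i> * of_real (ka * r))" by (simp only: z_def r_def)
    hence "z n * (iexp (ka * r) / of_real (r powr q)) = 1" using r by (simp add: exp_minus)
    thus ?thesis unfolding right_diff_distrib mult.assoc[symmetric] by simp
   qed
   moreover have "norm (z n) * (C * r powr ?A) = C / r"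
   proof -
    have "r powr q * r powr ?A = r powr (- 1)" unfolding powr_add[symmetric] by (rule arg_cong[where f="%e. r powr e"]) (simp add: q_def field_simps)
    moreover have "norm (z n) = r powr q" by (simp add: z_def r_def norm_mult)
    ultimately show ?thesis using r by (simp only: mult.left_commute[of _ C]) (simp add: powr_neg_one)
   qed
   ultimately show ?case by (simp add: norm_mult[symmetric] r_def)
  qed
 qed
 hence "(%n. z n * ph ((real n + 1) *\<^sub>R tt)) \<longlonglongrightarrow> A tt" by (simp add: LIM_zero_iff)
 from LIMSEQ_unique[OF this L1]
 have "A tt = c_const DIM('a) ka / of_real ?L * ?F" by (simp add: tt(2))
 moreover have "c_const DIM('a) ka \<noteq> 0" using k by (simp add: c_const_def powr_def)
 ultimately show "F l = ?F / of_real ?L"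
  unfolding A_def tt(2)[symmetric] by (simp add: field_simps)
qed

section \<open>Elementary L1 and L2 estimates in a fixed ball\<close>

lemma norm_exp_i_diff_le: "norm (iexp a - iexp b) <= \<bar>a - b\<bar>"
proof -
 have "iexp b * iexp (a - b) = iexp a"
  unfolding exp_add[symmetric] by (rule arg_cong[where f=exp]) (simp add: algebra_simps)
 hence "iexp a - iexp b = iexp b * (iexp (a - b) - 1)"
  by (simp only: right_diff_distrib mult_1_right)
 hence "norm (iexp a - iexp b) = 2 * \<bar>sin ((a - b) / 2)\<bar>" by (simp only: norm_mult dist_exp_i_1) simp
 also have "... <= 2 * \<bar>(a - b) / 2\<bar>" by (intro mult_left_mono abs_sin_x_le_abs_x) auto
 finally show ?thesis by simp
qed

lemma bcs_add:
 assumes "bcs rh g" "bcs rh h"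
 shows "bcs rh (%x. g x + h x)"
proof -
 obtain B B' where B: "\<And>x. norm (g x) <= B" "\<And>x. norm (h x) <= B'" using assms unfolding bcs_def by blast
 have "norm (g x + h x) <= B + B'" for x by (rule order_trans[OF norm_triangle_ineq add_mono[OF B]])
 thus ?thesis using assms unfolding bcs_def by (intro conjI exI[of _ "B + B'"]) auto
qed

lemma integrable_indicator_ball: "integrable lborel (indicator (cball (0::'a::euclidean_space) rh) :: 'a => real)"
 using emeasure_lborel_cball_finite[of "0::'a" rh] by (intro integrable_real_indicator) (auto simp: less_top)

lemma L2sq_add:
 assumes "bcs rh g" "bcs rh h"
 shows "L2sq (%x. g x + h x) <= 2 * L2sq g + 2 * L2sq h"
proof -
 have "(norm (g x + h x))^2 <= 2 * (norm (g x))^2 + 2 * (norm (h x))^2" for x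
  using power_mono[OF norm_triangle_ineq[of "g x" "h x"], of 2] sum_squares_bound[of "norm (g x)" "norm (h x)"] by (simp add: power2_sum)
 hence "L2sq (%x. g x + h x) <= (LBINT x. 2 * (norm (g x))^2 + 2 * (norm (h x))^2)" unfolding L2sq_def
  by (intro integral_mono bcs_norm2_integrable[OF bcs_add[OF assms]] integrable_add integrable_mult_right bcs_norm2_integrable[OF assms(1)] bcs_norm2_integrable[OF assms(2)])
 thus ?thesis using bcs_norm2_integrable[OF assms(1)] bcs_norm2_integrable[OF assms(2)] by (simp add: L2sq_def)
qed

lemma bcs_ball: "bcs rh (%x::'a::euclidean_space. indicator (cball 0 rh) x *\<^sub>R f x)"
 if "f \<in> mbl" "\<And>x. norm x <= rh ==> norm (f x) <= B"
 unfolding bcs_def using that by (intro conjI exI[of _ "max B 0"]) (auto simp: indicator_def le_max_iff_disj)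

lemma L2sq_ball_le:
 fixes f :: "'a::euclidean_space => complex"
 assumes [measurable]: "f \<in> mbl" and f: "\<And>x. norm x <= rh ==> norm (f x) <= B"
 shows "L2sq (%x. indicator (cball 0 rh) x *\<^sub>R f x) <= B^2 * measure lborel (cball (0::'a) rh)"
proof -
 have "L2sq (%x. indicator (cball 0 rh) x *\<^sub>R f x) <= (LBINT x. B^2 * indicator (cball (0::'a) rh) x)"
  unfolding L2sq_def
 proof (rule integral_mono[OF bcs_norm2_integrable[OF bcs_ball[OF assms]]])
  show "integrable lborel (%x::'a. B^2 * indicator (cball 0 rh) x)" by (intro integrable_mult_right integrable_indicator_ball)
 qed (use f in \<open>auto simp: indicator_def intro!: power_mono\<close>)
 thus ?thesis by simp
qed

text \<open>Pointwise |h| <= mu + |h|^2/mu on the ball. The free parameter mu plays the part of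
  Cauchy-Schwarz: the caller balances the two terms.\<close>

lemma L1_le_L2:
 fixes h :: "'a::euclidean_space => complex"
 assumes h: "bcs rh h" and mu: "mu > 0"
 shows "(LBINT x. norm (h x)) <= mu * measure lborel (cball (0::'a) rh) + L2sq h / mu"
proof -
 let ?A = "cball 0 rh"
 have i: "integrable lborel (%x::'a. mu * indicator ?A x)" by (intro integrable_mult_right integrable_indicator_ball)
 have i2: "integrable lborel (%x. (norm (h x))^2 / mu)" using bcs_norm2_integrable[OF h] by simp
 have "(LBINT x. norm (h x)) <= (LBINT x. mu * indicator ?A x + (norm (h x))^2 / mu)"
 proof (intro integral_mono integrable_add i i2 integrable_norm bcs_integrable[OF h])
  fix x
  have "2 * mu * norm (h x) <= mu^2 + (norm (h x))^2" using sum_squares_bound[of mu "norm (h x)"] .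
  moreover have "mu * norm (h x) >= 0" using mu by simp
  ultimately have "mu * norm (h x) <= mu^2 + (norm (h x))^2" by linarith
  hence "norm (h x) <= mu + (norm (h x))^2 / mu" using mu by (simp add: field_simps power2_eq_square)
  thus "norm (h x) <= mu * indicator ?A x + (norm (h x))^2 / mu"
   using h by (cases "norm x <= rh") (auto simp: bcs_def)
 qed
 also have "... = mu * measure lborel (cball (0::'a) rh) + L2sq h / mu"
  using i i2 by (subst integral_add) (auto simp: L2sq_def)
 finally show ?thesis .
qed

section \<open>The amplitude at high energy\<close>

text \<open>The condition relating \<open>ka\<close> to CV says that the L2 bound for one scattering
  step, (13 + d) exp(rh^2) CV / ka, is at most 1/2.\<close>

locale scatterer =
 fixes V :: "'a::euclidean_space => complex" and F :: "'a => 'a => complex" and CV rh ka :: real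
 assumes dim: "DIM('a) >= 2" and V_meas [measurable]: "V \<in> mbl"
  and V_bdd: "\<And>x. norm (V x) <= CV" and V_supp: "\<And>x. norm x > rh ==> V x = 0" and rh: "rh >= 0" and ka1: "ka >= 1"
  and ka: "4 * ((13 + real DIM('a)) * exp (rh^2) * CV)^2 <= ka^2"
  and amp: "is_scat_amp V (ka^2) F"
begin

definition "bvol = measure lborel (cball (0::'a) rh)"

lemma bvol: "bcs rh h ==> mu > 0 ==> (LBINT x. norm (h (x::'a))) <= mu * bvol + L2sq h / mu"
 "f \<in> mbl ==> (\<And>x::'a. norm x <= rh ==> norm (f x) <= B) ==> L2sq (%x. indicator (cball 0 rh) x *\<^sub>R f x) <= B^2 * bvol"
 "bvol >= 0"
 unfolding bvol_def by (rule L1_le_L2 L2sq_ball_le measure_nonneg; assumption)+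

definition "A = (13 + real DIM('a)) * exp (rh^2)"

definition "on_ball f x = indicator (cball (0::'a) rh) x *\<^sub>R (f x :: complex)"

definition "pw k x = iexp (k \<bullet> (x::'a))"

lemma CV0: "CV >= 0" using V_bdd[of 0] norm_ge_zero order_trans by blast

lemma V_mult_bcs: "f \<in> mbl ==> (\<And>x. norm x <= rh ==> norm (f x) <= B) ==> bcs rh (%x. V x * f x)"
 using V_bdd V_supp by (intro bcs_mult[where K=B]) (auto simp: bcs_def)

lemma bcs_on_ball: "f \<in> mbl ==> (\<And>x. norm x <= rh ==> norm (f x) <= B) ==> bcs rh (on_ball f)"
 unfolding on_ball_def[abs_def] by (rule bcs_ball)

lemma V_mult_le: "norm (V x * f x) <= CV * norm (on_ball f x)"
 using V_bdd[of x] V_supp[of x] by (cases "norm x <= rh") (auto simp: on_ball_def norm_mult intro!: mult_right_mono)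

text \<open>At high energy the Born series contracts.\<close>

lemma field_bound:
 assumes D: "duhamel ka p ps (%x. V x * ps x)" and p: "continuous_on UNIV p" "\<And>x. norm (p x) <= P"
  and ps: "continuous_on UNIV ps" "\<And>x. norm (ps x) <= B"
 shows "L2sq (on_ball ps) <= 4 * L2sq (on_ball p)"
  and "L2sq (on_ball (%x. p x - ps x)) <= (A * CV / ka)^2 * (4 * L2sq (on_ball p))"
proof -
 have [measurable]: "p \<in> mbl" "ps \<in> mbl" using p ps by (auto intro: borel_measurable_continuous_onI)
 let ?C = "%x. V x * ps x"
 have g: "bcs rh ?C" using ps(2) by (rule V_mult_bcs[rotated]) measurable
 let ?B = "on_ball ps"
 have b: "bcs rh ?B" "bcs rh (on_ball p)" using ps(2) p(2) by (auto intro!: bcs_on_ball)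
 have PB: "norm (p x - ps x) <= P + B" for x using norm_triangle_ineq4[of "p x" "ps x"] p(2)[of x] ps(2)[of x] by linarith
 let ?A = "%x. p x - ps x"
 let ?F = "on_ball ?A"
 have u: "bcs rh ?F" by (rule bcs_on_ball[OF _ PB]) measurable
 let ?D = "A * CV / ka"
 have "L2sq ?F <= (A / ka)^2 * L2sq ?C"
  using duhamel_L2[OF dim ka1 D g p ps] unfolding on_ball_def[abs_def] A_def .
 also have "L2sq ?C <= CV^2 * L2sq ?B" by (rule L2sq_mono[OF g b(1) V_mult_le])
 finally have 1: "L2sq ?F <= ?D^2 * L2sq ?B"
  unfolding power_mult_distrib power_divide using mult_left_mono[of _ _ "A^2 / ka^2"] by fastforce
 have small: "?D^2 <= 1/4" using ka ka1 unfolding A_def[symmetric] by (simp add: power_divide field_simps)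
 let ?G = "%x. (- 1) * on_ball ?A x"
 have "on_ball ps = (%x. on_ball p x + (- 1) * on_ball ?A x)" by (simp add: on_ball_def fun_eq_iff indicator_def)
 hence "L2sq ?B <= 2 * L2sq (on_ball p) + 2 * L2sq ?G"
  using L2sq_add[OF b(2) bcs_mult[OF u, of "%_. - 1" 1]] by (simp add: mult.commute)
 also have "L2sq ?G = L2sq ?F" by (simp add: L2sq_def)
 finally have "L2sq ?B <= 2 * L2sq (on_ball p) + 2 * ((1/4) * L2sq ?B)"
  using 1 mult_right_mono[OF small L2sq_nonneg[of "on_ball ps"]] by linarith
 thus 2: "L2sq ?B <= 4 * L2sq (on_ball p)" by simp
 show "L2sq ?F <= ?D^2 * (4 * L2sq (on_ball p))"
  using 1 mult_left_mono[OF 2, of "?D^2"] by simp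
qed

lemma V_integral_le:
 assumes f: "bcs rh (on_ball f)" and [measurable]: "f \<in> mbl" "z \<in> mbl" and z: "\<And>x. norm (z x) <= 1" and mu: "mu > 0"
 shows "norm (LBINT x. V x * f x * z x) <= CV * (mu * bvol + L2sq (on_ball f) / mu)"
proof -
 have "norm (LBINT x. V x * f x * z x) <= (LBINT x. CV * norm (on_ball f x))"
 proof (rule norm_integral_le_AE(2))
  show "AE x in lborel. norm (V x * f x * z x) <= CV * norm (on_ball f x)"
   using mult_mono[OF V_mult_le z] CV0 by (auto simp: norm_mult)
 qed (use bcs_integrable[OF f] in auto)
 also have "... <= CV * (mu * bvol + L2sq (on_ball f) / mu)" using bvol(1)[OF f mu] CV0 by (simp add: mult_left_mono)
 finally show ?thesis .
qed

text \<open>One constant for three estimates in \<open>amp_approx\<close>: the Born error uses the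
  first two terms, the change of the incident momentum the first and third, the change of the
  outgoing momentum the fourth.\<close>

definition "amp_const = (CV + CV * (4 * (A * CV)^2) + 4 * CV * rh^2 + 5 * CV * rh) * bvol + 1"

text \<open>A field is chosen once for each incident momentum, so that fields for different momenta
  can be compared.\<close>

lemma fields:
 obtains ps where "\<And>k. norm k = ka ==> continuous_on UNIV (ps k)" "\<And>k. norm k = ka ==> \<exists>B. \<forall>x. norm (ps k x) <= B"
  "\<And>k. norm k = ka ==> duhamel ka (pw k) (ps k) (%x. V x * ps k x)"
  "\<And>k l. norm k = ka ==> norm l = ka ==> F k l = (LBINT x. V x * ps k x * pw (- l) x) / of_real ((2 * pi) ^ DIM('a))"
proof -
 define Q where "Q k ps \<longleftrightarrow> continuous_on UNIV ps \<and> (\<exists>B. \<forall>x. norm (ps x) <= B) \<and> duhamel ka (pw k) ps (%x. V x * ps x) \<and>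
   (\<forall>l. norm l = ka \<longrightarrow> F k l = (LBINT x. V x * ps x * pw (- l) x) / of_real ((2 * pi) ^ DIM('a)))" for k ps
 have "\<exists>ps. Q k ps" if k: "norm k = ka" for k
 proof -
  have "k \<bullet> k = ka^2" using k by (simp add: dot_square_norm)
  then obtain ps C R where ps: "continuous_on UNIV ps" "weak_schroedinger_sol V (ka^2) ps"
   and as: "\<And>x. norm x >= R ==> norm (ps x - (iexp (k \<bullet> x) + c_const DIM('a) ka * iexp (ka * norm x)
    / of_real (norm x powr ((real DIM('a) - 1) / 2)) * F k ((ka / norm x) *\<^sub>R x))) <= C * norm x powr (- (real DIM('a) + 1) / 2)"
   using amp[unfolded is_scat_amp_def, rule_format, of k] k by auto
  have ka0: "ka > 0" using ka1 by simp
  note S = scat_duhamel[where F="F k" and R=R, OF dim V_meas V_bdd V_supp rh k ka0 ps as]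
  have "Q k ps" unfolding Q_def pw_def[abs_def] using ps(1) S by simp
  thus ?thesis by blast
 qed
 hence Qs: "Q k (SOME ps. Q k ps)" if "norm k = ka" for k using someI_ex[of "Q k"] that by blast
 define s where "s k = (SOME ps. Q k ps)" for k
 note Qs = Qs[folded s_def, unfolded Q_def]
 show ?thesis by (rule that[of s]) (use Qs in blast)+
qed

lemma pw_props: "continuous_on UNIV (pw k)" "norm (pw k x) = 1" "pw k \<in> mbl"
 unfolding pw_def[abs_def] by (auto intro!: continuous_intros borel_measurable_continuous_onI)

text \<open>Inside the ball the field differs from the plane wave by O(1/ka) in L2, which is the
  Born approximation. The second claim, Lipschitz dependence on both momenta, later yields
  measurability of the amplitude on the shell; it rests on \<open>duhamel_diff\<close> applied to
  two incident waves.\<close>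

lemma amp_approx:
 assumes k: "norm k = ka" and l: "norm l = ka"
 shows "norm (F k l - fourier V (k - l)) <= amp_const / ka"
  and "norm k' = ka ==> norm l' = ka ==> norm (F k l - F k' l') <= amp_const * (norm (k - k') + norm (l - l'))"
proof -
 let ?H = "(2 * pi) ^ DIM('a)"
 obtain ps where ps: "\<And>k. norm k = ka ==> continuous_on UNIV (ps k)" "\<And>k. norm k = ka ==> \<exists>B. \<forall>x. norm (ps k x) <= B"
  "\<And>k. norm k = ka ==> duhamel ka (pw k) (ps k) (%x. V x * ps k x)"
  "\<And>k l. norm k = ka ==> norm l = ka ==> F k l = (LBINT x. V x * ps k x * pw (- l) x) / of_real ?H" using fields by blast
 have psm: "ps k \<in> mbl" if "norm k = ka" for k using ps(1)[OF that] by (rule borel_measurable_continuous_onI)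
 note [measurable] = pw_props(3)
 have ka0: "ka > 0" using ka1 by simp
 have d1: "norm (z / of_real ?H) <= norm z" for z :: complex
 proof -
  have "1 <= (2 * pi) ^ DIM('a)" using pi_ge_two by (intro one_le_power) linarith
  hence "norm z / (2 * pi) ^ DIM('a) <= norm z / 1" by (intro divide_left_mono) auto
  thus ?thesis by (simp add: norm_divide norm_mult norm_power)
 qed
 have Lp: "L2sq (on_ball (pw k)) <= bvol" for k
  using bvol(2)[of "pw k" 1] pw_props unfolding on_ball_def[abs_def] by simp
 have LV: "integrable lborel (%x. V x * f x)" if "f \<in> mbl" "\<And>x. norm x <= rh ==> norm (f x) <= B" for f B
  by (rule bcs_integrable[OF V_mult_bcs[OF that]])
 obtain B where B: "\<And>x. norm (ps k x) <= B" using ps(2)[OF k] by blast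
 note [measurable] = psm[OF k]
 have PB: "norm (pw k x - ps k x) <= 1 + B" for x using norm_triangle_ineq4[of "pw k x" "ps k x"] pw_props(2)[of k x] B[of x] by linarith
 let ?F = "A * CV / ka"
 let ?L = "%k ps. on_ball (%x. pw k x - ps k x)"
 have fb: "L2sq (on_ball (ps k)) <= 4 * bvol" "L2sq (?L k ps) <= ?F^2 * (4 * bvol)"
 proof -
  note f = field_bound[OF ps(3)[OF k] pw_props(1) _ ps(1)[OF k] B, of 1]
  have L: "4 * L2sq (on_ball (pw k)) <= 4 * bvol" using Lp[of k] by simp
  show "L2sq (on_ball (ps k)) <= 4 * bvol" using f(1) L by (simp add: pw_props)
  have "?F^2 * (4 * L2sq (on_ball (pw k))) <= ?F^2 * (4 * bvol)" by (rule mult_left_mono[OF L]) simp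
  thus "L2sq (?L k ps) <= ?F^2 * (4 * bvol)"
   by (rule order_trans[OF f(2), rotated]) (simp add: pw_props)
 qed
 note vol0 = bvol(3)
 let ?D = "%k ps l. LBINT x. V x * (pw k x - ps k x) * pw (- l) x"
 let ?I = "1 / ka"
 show "norm (F k l - fourier V (k - l)) <= amp_const / ka"
 proof -
  have "fourier V (k - l) = (LBINT x. V x * pw k x * pw (- l) x) / of_real ?H"
  proof -
   have e: "iexp ((k - l) \<bullet> x) * V x = V x * pw k x * pw (- l) x" for x
    by (simp add: pw_def inner_diff_left mult_exp_exp right_diff_distrib)
   show ?thesis unfolding fourier_def e by (simp add: powr_minus powr_realpow divide_inverse mult.commute)
  qed
  moreover have "(LBINT x. V x * ps k x * pw (- l) x) - (LBINT x. V x * pw k x * pw (- l) x) = - ?D k ps l"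
  proof -
   have "integrable lborel (%x. V x * (ps k x * pw (- l) x))" "integrable lborel (%x. V x * (pw k x * pw (- l) x))"
    by (rule LV[where B=B], measurable, simp add: norm_mult pw_props B, rule LV[where B=1], measurable, simp add: norm_mult pw_props)
   thus ?thesis by (simp add: algebra_simps)
  qed
  ultimately have "F k l - fourier V (k - l) = - ?D k ps l / of_real ?H"
   unfolding ps(4)[OF k l] by (simp add: diff_divide_distrib[symmetric])
  hence "norm (F k l - fourier V (k - l)) <= norm (?D k ps l)"
   using d1[of "- ?D k ps l"] by simp
  \<comment> \<open>The choice mu = 1/ka balances the two terms, since the squared L2 norm is
    O(1/ka^2).\<close>
  also have "... <= CV * (?I * bvol + L2sq (?L k ps) / ?I)"
   using ka0 pw_props(2) by (intro V_integral_le bcs_on_ball[OF _ PB]) auto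
  also have "... <= CV * (?I * bvol + ?F^2 * (4 * bvol) / ?I)"
   using fb(2) ka0 CV0 by (intro mult_left_mono add_left_mono divide_right_mono) auto
  also have "... = ((CV + CV * (4 * (A * CV)^2)) * bvol) / ka" using ka0 by (simp add: field_simps power2_eq_square)
  also have "... <= amp_const / ka" unfolding amp_const_def using ka0 CV0 rh vol0 by (intro divide_right_mono) (auto simp: distrib_right)
  finally show ?thesis .
 qed
 assume k': "norm k' = ka" and l': "norm l' = ka"
 obtain B' where B': "\<And>x. norm (ps k' x) <= B'" using ps(2)[OF k'] by blast
 note [measurable] = psm[OF k']
 let ?d = "%x. ps k x - ps k' x"
 have BB: "norm (?d x) <= B + B'" for x using norm_triangle_ineq4[of "ps k x" "ps k' x"] B[of x] B'[of x] by linarith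
 let ?B = "LBINT x. V x * ?d x * pw (- l') x"
 let ?G = "%k. %x. pw k x - pw k' x"
 let ?K = "1 + 4 * rh^2"
 \<comment> \<open>The difference of the fields has incident part \<open>pw k - pw k'\<close>, of
   size rh |k - k'| in the ball; here mu = |k - k'| is the balancing choice.\<close>
 have T1: "norm ?B <= CV * ?K * bvol * norm (k - k')"
 proof (cases "k = k'")
  case False
  hence n: "norm (k - k') > 0" by simp
  have "duhamel ka (?G k) ?d (%x. V x * ps k x - V x * ps k' x)"
   using B B' by (intro duhamel_diff[OF ps(3)[OF k] ps(3)[OF k'] V_mult_bcs V_mult_bcs, of B B']) auto
  hence D: "duhamel ka (?G k) ?d (%x. V x * ?d x)" by (simp add: right_diff_distrib)
  have "norm (pw k x - pw k' x) <= 2" for x using norm_triangle_ineq4[of "pw k x" "pw k' x"] pw_props(2) by simp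
  hence "L2sq (on_ball ?d) <= 4 * L2sq (on_ball (?G k))"
   using BB by (intro field_bound(1)[OF D]) (intro continuous_intros pw_props ps k k' | assumption)+
  also have "L2sq (on_ball (?G k)) <= (rh * norm (k - k'))^2 * bvol"
   unfolding on_ball_def[abs_def]
  proof (rule bvol(2))
   fix x :: 'a assume x: "norm x <= rh"
   have "norm (pw k x - pw k' x) <= \<bar>(k - k') \<bullet> x\<bar>" unfolding pw_def using norm_exp_i_diff_le by (simp add: inner_diff_left)
   also have "... <= norm (k - k') * norm x" by (rule Cauchy_Schwarz_ineq2)
   also have "... <= norm (k - k') * rh" using x by (intro mult_left_mono) auto
   finally show "norm (pw k x - pw k' x) <= rh * norm (k - k')" by (simp add: mult.commute)
  qed measurable
  finally have L: "L2sq (on_ball ?d) <= 4 * ((rh * norm (k - k'))^2 * bvol)" by simp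
  have "norm ?B <= CV * (norm (k - k') * bvol + L2sq (on_ball ?d) / norm (k - k'))"
   using n pw_props(2) by (intro V_integral_le bcs_on_ball[OF _ BB]) auto
  also have "... <= CV * (norm (k - k') * bvol + 4 * ((rh * norm (k - k'))^2 * bvol) / norm (k - k'))"
   using L n CV0 by (intro mult_left_mono add_left_mono divide_right_mono) auto
  also have "... = CV * ?K * bvol * norm (k - k')" using n by (simp add: field_simps power2_eq_square)
  finally show ?thesis .
 qed simp
 let ?A = "%l x. pw (- l) x - pw (- l') x"
 let ?C = "%l. CV * (rh * norm (l - l'))"
 let ?J = "%ps k l. LBINT x. V x * ps k x * ?A l x"
 have T2: "norm (?J ps k l) <= 5 * CV * rh * bvol * norm (l - l')"
 proof (cases "l = l'")
  case False
  hence n: "norm (l - l') > 0" by simp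
  have bps: "bcs rh (on_ball (ps k))" by (rule bcs_on_ball[OF _ B]) measurable
  have "norm (?J ps k l) <= (LBINT x. (?C l) * norm (on_ball (ps k) x))"
  proof (rule norm_integral_le_AE(2))
   show "AE x in lborel. norm (V x * ps k x * ?A l x) <= ?C l * norm (on_ball (ps k) x)"
   proof (rule AE_I2)
    fix x
    show "norm (V x * ps k x * ?A l x) <= ?C l * norm (on_ball (ps k) x)"
    proof (cases "norm x <= rh")
     case True
     have "norm (?A l x) <= \<bar>(l - l') \<bullet> x\<bar>" unfolding pw_def using norm_exp_i_diff_le[of "- l \<bullet> x" "- l' \<bullet> x"] by (simp add: inner_diff_left abs_minus_commute)
     also have "... <= norm (l - l') * norm x" by (rule Cauchy_Schwarz_ineq2)
     also have "... <= norm (l - l') * rh" using True by (intro mult_left_mono) auto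
     finally have "norm (V x * ps k x) * norm (?A l x) <= (CV * norm (on_ball (ps k) x)) * (norm (l - l') * rh)"
      using V_mult_le[of x "ps k"] CV0 by (intro mult_mono) auto
     thus ?thesis by (simp add: norm_mult mult_ac)
    qed (simp add: V_supp on_ball_def)
   qed
  qed (use bcs_integrable[OF bps] in auto)
  also have "... = ?C l * (LBINT x. norm (on_ball (ps k) x))" by simp
  also have "... <= ?C l * (1 * bvol + 4 * bvol / 1)"
   using bvol(1)[OF bps, of 1] fb(1) CV0 rh by (intro mult_left_mono) auto
  finally show ?thesis by (simp add: mult_ac)
 qed simp
 have "(LBINT x. V x * ps k x * pw (- l) x) - (LBINT x. V x * ps k' x * pw (- l') x)
   = ?B + ?J ps k l"
 proof -
  have "integrable lborel (%x. V x * (ps k x * pw (- l) x))" "integrable lborel (%x. V x * (ps k x * pw (- l') x))"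
   by (rule LV[where B=B], measurable, simp add: norm_mult pw_props B)+
  moreover have "integrable lborel (%x. V x * (ps k' x * pw (- l') x))"
   by (rule LV[where B=B'], measurable, simp add: norm_mult pw_props B')
  ultimately show ?thesis by (simp add: algebra_simps)
 qed
 hence "norm (F k l - F k' l') <= norm (?B + ?J ps k l)"
  unfolding ps(4)[OF k l] ps(4)[OF k' l'] diff_divide_distrib[symmetric] by (metis d1)
 also have "... <= CV * ?K * bvol * norm (k - k') + 5 * CV * rh * bvol * norm (l - l')"
  by (rule order_trans[OF norm_triangle_ineq add_mono[OF T1 T2]])
 also have "... <= amp_const * norm (k - k') + amp_const * norm (l - l')"
  unfolding amp_const_def using CV0 rh vol0 by (intro add_mono mult_right_mono) (auto simp: algebra_simps)
 finally show "norm (F k l - F k' l') <= amp_const * (norm (k - k') + norm (l - l'))" by (simp add: distrib_left)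
qed

end

section \<open>Fourier decay and inversion\<close>

lemma FT_lipschitz:
 assumes g: "integrable lborel g" and s: "\<And>x. norm x > S ==> g x = 0"
 shows "norm (FT g q - FT g p) <= S * norm (q - p) * (LBINT x. norm (g x))"
proof -
 have [measurable]: "g \<in> mbl" using g by (auto dest: borel_measurable_integrable)
 have i: "integrable lborel (%x. iexp (p \<bullet> x) * g x)" for p
  by (rule integrable_bound[OF g]) (auto simp: norm_mult)
 let ?A = "%x p. iexp (q \<bullet> x) - iexp (p \<bullet> x)"
 have "FT g q - FT g p = (LBINT x. (?A x p) * g x)"
  unfolding FT_def integral_diff[OF i i, symmetric] left_diff_distrib ..
 also have "norm ... <= (LBINT x. S * norm (q - p) * norm (g x))"
 proof (rule norm_integral_le_AE(2))
  show "AE x in lborel. norm (?A x p * g x) <= S * norm (q - p) * norm (g x)"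
  proof (rule AE_I2)
   fix x
   show "norm (?A x p * g x) <= S * norm (q - p) * norm (g x)"
   proof (cases "norm x <= S")
    case True
    have "norm (?A x p) <= \<bar>(q - p) \<bullet> x\<bar>" using norm_exp_i_diff_le by (simp add: inner_diff_left)
    also have "... <= norm (q - p) * norm x" by (rule Cauchy_Schwarz_ineq2)
    also have "... <= S * norm (q - p)" using True by (simp add: mult.commute mult_right_mono)
    finally show ?thesis unfolding norm_mult by (rule mult_right_mono) simp
   qed (use s in auto)
  qed
 qed (use g in auto)
 finally show ?thesis by simp
qed

text \<open>The weak derivative is tested with a plane wave times a cut-off that equals 1 on the
  support of v. On that support n derivatives in direction b produce the factor (i p.b)^n.\<close>

lemma weak_deriv_fourier:
 fixes v :: "'a::euclidean_space => complex"
 assumes sob: "sobolev_W1 n v" and s: "\<And>x. norm x > R ==> v x = 0" and b: "b \<in> Basis"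
 shows "\<exists>h S. integrable lborel h \<and> (\<forall>x. norm x > S \<longrightarrow> h x = 0) \<and> (\<forall>p. (\<i> * of_real (p \<bullet> b)) ^ n * FT v p = FT h p)"
proof -
 have vi: "integrable lborel v" using sob by (simp add: sobolev_W1_def)
 hence [measurable]: "v \<in> mbl" by (auto dest: borel_measurable_integrable)
 let ?D = "replicate n b"
 obtain g where g: "integrable lborel g" and wd: "\<And>ph. test_fun ph ==> (LBINT x. g x * of_real (ph x)) = (-1) ^ n * (LBINT x. v x * of_real (pdiffs ?D ph x))"
  using sob[unfolded sobolev_W1_def, THEN conjunct2, rule_format, of "replicate n b"] b by (cases n) (auto simp: set_replicate_conv_if simp del: replicate_Suc)
 have [measurable]: "g \<in> mbl" using g by (auto dest: borel_measurable_integrable)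
 obtain X :: "nat => nat => real => complex" where X: "\<And>N. dfam (X N)" "\<And>N t. \<bar>t\<bar> <= real N ==> X N 0 t = 1"
  "\<And>N m t. \<bar>t\<bar> <= real N ==> X N (Suc m) t = 0" "\<And>N m t. \<bar>t\<bar> >= real N + 1 ==> X N m t = 0" by (rule ex_smooth_cutoffs) blast
 define N where "N = nat \<lceil>R\<rceil>"
 have N: "R <= real N" by (simp add: N_def real_nat_ceiling_ge)
 define e where "e p c m t = (\<i> * of_real (p \<bullet> c)) ^ m * exp (\<i> * of_real (p \<bullet> c) * of_real t)" for p c :: 'a and m t
 define H where "H p c = lfam (X N) (e p c)" for p c
 have H: "dfam (H p c)" for p c unfolding H_def e_def by (intro dfam_lfam X dfam_cmult_exp)
 have Hs: "H p c m t = 0" if "\<bar>t\<bar> > real N + 1" for p c m t using that X(4)[of N t] by (simp add: H_def lfam_def)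
 have He: "H p c m t = e p c m t" if t: "\<bar>t\<bar> <= real N" for p c m t
 proof -
  have "(\<Sum>j\<le>m. of_nat (m choose j) * (X N j t * e p c (m - j) t)) = (\<Sum>j\<le>m. if j = 0 then e p c m t else 0)"
   using X(2,3)[OF t] by (intro sum.cong) (auto simp: gr0_conv_Suc)
  thus ?thesis by (simp add: H_def lfam_def)
 qed
 have rb': "set ?D \<subseteq> Basis" using b by (cases n) (auto simp: set_replicate_conv_if simp del: replicate_Suc)
 have cl: "count_list ?D c = (if c = b then n else 0)" for c by (induction n) auto
 \<comment> \<open>The weak derivative g is not known to vanish far out. The product g ch is
   compactly supported and satisfies the same identity, because the derivatives of the cut-off
   vanish where v lives; compact support is what makes its transform Lipschitz.\<close>
 define ch where "ch = ridge (%_. X N) (%_::'a. 0)"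
 have pe: "(\<Prod>c\<in>Basis. exp (\<i> * of_real (p \<bullet> c) * of_real (x \<bullet> c))) = iexp (p \<bullet> x)" for p x :: 'a
  unfolding exp_sum[OF finite_Basis, symmetric] euclidean_inner[of p x] by (simp add: sum_distrib_left mult.assoc)
 let ?C = "%_. 0"
 have r0: "ridge (H p) ?C x = ch x * iexp (p \<bullet> x)" for p x
  unfolding pe[symmetric] ch_def ridge_def by (simp add: H_def lfam_def e_def prod.distrib)
 let ?A = "%c. 0 + count_list ?D c"
 let ?B = "%p. \<i> * of_real (p \<bullet> b)"
 have rn: "v x * ridge (H p) ?A x = ?B p ^ n * (iexp (p \<bullet> x) * v x)" for p x
 proof (cases "norm x <= R")
  case True
  have "\<bar>x \<bullet> c\<bar> <= real N" if "c \<in> Basis" for c using Basis_le_norm[OF that, of x] True N by linarith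
  hence "ridge (H p) ?A x = (\<Prod>c\<in>Basis. (if c = b then (?B p) ^ n else 1) * exp (\<i> * of_real (p \<bullet> c) * of_real (x \<bullet> c)))"
   unfolding ridge_def by (intro prod.cong) (auto simp: He e_def cl)
  thus ?thesis using b by (simp add: prod.distrib pe prod.delta)
 qed (simp add: s)
 have rb: "\<exists>K. \<forall>x. norm (ridge (H p) m x) <= K" for p m
  by (rule ridge_bounded[where H="H p" and R="real N + 1" and m=m]) (use H Hs in auto)
 have mr [measurable]: "ridge (H p) m \<in> mbl" for p m by (intro borel_measurable_continuous_onI ridge_continuous H)
 have cx: "(LBINT x. f x * h x) = (LBINT x. f x * of_real (Re (h x))) + \<i> * (LBINT x. f x * of_real (Im (h x)))"
  if fi: "integrable lborel f" and [measurable]: "h \<in> mbl" and hb: "\<exists>K. \<forall>x. norm (h x) <= K" for f h :: "'a => complex"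
 proof -
  note [measurable] = borel_measurable_integrable[OF fi, simplified]
  obtain K where K: "\<And>x. norm (h x) <= K" using hb by blast
  have i: "integrable lborel (%x. f x * of_real (L (h x)))" if L: "L = Re \<or> L = Im" for L
  proof (rule norm_integral_le_AE(1)[where g="%x. K * norm (f x)"])
   have "\<bar>L (h x)\<bar> <= K" for x using K[of x] abs_Re_le_cmod[of "h x"] abs_Im_le_cmod[of "h x"] L by fastforce
   thus "AE x in lborel. norm (f x * of_real (L (h x))) <= K * norm (f x)" by (auto simp: norm_mult mult.commute[of K] intro!: mult_left_mono)
  qed (use fi L in auto)
  have "(LBINT x. f x * h x) = (LBINT x. f x * of_real (Re (h x)) + \<i> * (f x * of_real (Im (h x))))"
   by (intro integral_cong) (auto simp: complex_eq_iff algebra_simps)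
  thus ?thesis using i by simp
 qed
 let ?F = "%x. (-1) ^ n * (g x * ch x)"
 have main: "?B p ^ n * FT v p = FT ?F p" for p
 proof -
  have L: "(LBINT x. g x * of_real (L (ridge (H p) ?C x))) = (-1) ^ n * (LBINT x. v x * of_real (L (ridge (H p) ?A x)))"
   if "bounded_linear L" for L :: "complex => real"
   using wd[OF test_fun_ridge[where H="H p" and m="%_. 0" and R="real N + 1", OF H that Hs]] unfolding pdiffs_ridge[of "H p" "replicate n b" L "%_. 0", OF H rb' that] .
  have "(LBINT x. g x * ridge (H p) ?C x) = (-1) ^ n * (LBINT x. v x * ridge (H p) ?A x)"
   unfolding cx[OF g mr rb] cx[OF vi mr rb] L[OF bounded_linear_Re] L[OF bounded_linear_Im] by (simp add: algebra_simps)
  also have "... = (-1) ^ n * (?B p ^ n * FT v p)" unfolding rn FT_def by simp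
  finally have "(-1) ^ n * (LBINT x. g x * ridge (H p) ?C x) = ?B p ^ n * FT v p"
   by (simp add: mult.assoc[symmetric] power_mult_distrib[symmetric])
  thus ?thesis unfolding r0 FT_def integral_mult_right_zero[symmetric] by (simp add: mult_ac)
 qed
 have "ch = ridge (H 0) ?C" using r0[of 0] by auto
 then obtain K where K: "\<And>x. norm (ch x) <= K" and [measurable]: "ch \<in> mbl" using rb by (metis mr)
 have "integrable lborel ?F"
 proof (rule norm_integral_le_AE(1)[where g="%x. K * norm (g x)"])
  show "AE x in lborel. norm ((-1) ^ n * (g x * ch x)) <= K * norm (g x)" using K by (auto simp: norm_mult norm_power mult.commute[of K] intro!: mult_left_mono)
 qed (use g in auto)
 moreover have "ch x = 0" if x: "norm x > real DIM('a) * (real N + 1)" for x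
 proof -
  have "\<exists>c\<in>Basis. \<bar>x \<bullet> c\<bar> >= real N + 1"
  proof (rule ccontr)
   assume "\<not> ?thesis"
   hence "(\<Sum>c\<in>Basis. \<bar>x \<bullet> c\<bar>) <= (\<Sum>c\<in>(Basis::'a set). real N + 1)" by (intro sum_mono) auto
   thus False using x norm_le_l1[of x] by simp
  qed
  thus ?thesis unfolding ch_def ridge_def using X(4) by (intro prod_zero) auto
 qed
 ultimately show ?thesis using main by (intro exI[of _ "%x. (-1) ^ n * (g x * ch x)"] exI[of _ "real DIM('a) * (real N + 1)"]) auto
qed

lemma norm_power_diff_le:
 fixes a b :: complex
 assumes "norm a <= M" "norm b <= M" "M >= 1"
 shows "norm (a ^ n - b ^ n) <= real n * norm (a - b) * M ^ n"
proof (induction n)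
 case (Suc n)
 have "a ^ Suc n - b ^ Suc n = a * (a ^ n - b ^ n) + (a - b) * b ^ n" by (simp add: algebra_simps)
 hence "norm (a ^ Suc n - b ^ Suc n) <= norm a * norm (a ^ n - b ^ n) + norm (a - b) * norm b ^ n"
  by (metis norm_triangle_ineq norm_mult norm_power)
 also have "... <= M * (real n * norm (a - b) * M ^ n) + norm (a - b) * M ^ Suc n"
  using assms Suc by (intro add_mono mult_mono mult_left_mono order_trans[OF power_mono power_increasing[of n "Suc n" M]]) auto
 finally show ?case by (simp add: algebra_simps)
qed simp

text \<open>Some coordinate of p is at least |p|/d in modulus, so decay in each single coordinate
  gives decay in |p|.\<close>

lemma decay_from_coordinates:
 fixes p :: "'a::euclidean_space"
 assumes 0: "D <= C0" and 1: "\<And>b. b \<in> Basis ==> \<bar>p \<bullet> b\<bar> ^ n * D <= C1" and D: "D >= 0"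
 shows "(1 + norm p) ^ n * D <= 2 ^ n * (C0 + real DIM('a) ^ n * C1)"
proof -
 obtain b where b: "b \<in> Basis" "norm p <= real DIM('a) * \<bar>p \<bullet> b\<bar>"
 proof (rule ccontr)
  assume "\<not> thesis"
  hence H: "\<And>b. b \<in> Basis ==> \<bar>p \<bullet> b\<bar> < norm p / real DIM('a)" using that by (fastforce simp: field_simps not_le)
  have "(\<Sum>b\<in>Basis. \<bar>p \<bullet> b\<bar>) < (\<Sum>b\<in>(Basis::'a set). norm p / real DIM('a))" using H by (intro sum_strict_mono) auto
  thus False using norm_le_l1[of p] by simp
 qed
 define x where "x = real DIM('a) * \<bar>p \<bullet> b\<bar>"
 have x: "0 <= x" "norm p <= x" using b by (auto simp: x_def)
 have "(1 + norm p) ^ n <= (2 * max 1 x) ^ n" using x by (intro power_mono) auto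
 also have "... <= 2 ^ n * (1 + x ^ n)" using x by (auto simp: power_mult_distrib max_def)
 finally have "(1 + norm p) ^ n * D <= 2 ^ n * (1 + x ^ n) * D" using D by (rule mult_right_mono)
 also have "... = 2 ^ n * (D + real DIM('a) ^ n * (\<bar>p \<bullet> b\<bar> ^ n * D))" by (simp add: x_def power_mult_distrib algebra_simps)
 also have "... <= 2 ^ n * (C0 + real DIM('a) ^ n * C1)" using 0 1[OF b(1)] by (intro mult_left_mono add_mono) auto
 finally show ?thesis .
qed

lemma fourier_eq_FT: "fourier v p = of_real ((2 * pi) powr - real DIM('a)) * FT v (p :: 'a::euclidean_space)"
 by (simp add: fourier_def FT_def)

lemma norm_fourier_le: "norm (fourier v p - fourier v q) <= norm (FT v p - FT v (q :: 'a::euclidean_space))" "norm (fourier v p) <= norm (FT v p)"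
proof -
 have "(2 * pi) powr - real DIM('a) <= 1" using powr_mono[of "- real DIM('a)" 0 "2 * pi"] pi_ge_two by (auto split: if_splits)
 thus "norm (fourier v p - fourier v q) <= norm (FT v p - FT v q)" "norm (fourier v p) <= norm (FT v p)"
  unfolding fourier_eq_FT right_diff_distrib[symmetric] norm_mult by (auto intro!: mult_left_le_one_le)
qed

text \<open>The second estimate, Lipschitz with the same decay, is needed in the strips, where the
  transform at p is replaced by its values at the two boundary points.\<close>

lemma fourier_decay:
 fixes v :: "'a::euclidean_space => complex"
 assumes sob: "sobolev_W1 n v" and s: "\<And>x. norm x > R ==> v x = 0"
 shows "\<exists>C\<ge>0. \<forall>p. (1 + norm p) ^ n * norm (fourier v p) <= C \<and>
  (\<forall>q. norm (q - p) <= 1 \<longrightarrow> (1 + norm p) ^ n * norm (fourier v q - fourier v p) <= C * norm (q - p))"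
proof -
 have vi: "integrable lborel v" using sob by (simp add: sobolev_W1_def)
 obtain h S where h: "\<And>b. b \<in> Basis ==> integrable lborel (h b)" "\<And>b x. b \<in> Basis ==> norm x > S b ==> h b x = 0"
  "\<And>b p. b \<in> Basis ==> (\<i> * of_real (p \<bullet> b)) ^ n * FT v p = FT (h b) p"
  using weak_deriv_fourier[OF sob s] by metis
 let ?A = "%b. LBINT x. norm (h b x)"
 define K where "K = (\<Sum>b\<in>Basis. (1 + \<bar>S b\<bar>) * ?A b)"
 have hK: "(1 + \<bar>S b\<bar>) * ?A b <= K" if "b \<in> Basis" for b
  unfolding K_def by (rule member_le_sum[OF that]) auto
 let ?B = "%b q p. FT (h b) q - FT (h b) p"
 have K: "norm (FT (h b) p) <= K" "norm (?B b q p) <= K * norm (q - p)" if b: "b \<in> Basis" for b p q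
 proof -
  have I: "?A b >= 0" by simp
  show "norm (FT (h b) p) <= K" using FT_bounded[OF h(1)[OF b], of p] hK[OF b] mult_right_mono[OF _ I, of 1 "1 + \<bar>S b\<bar>"] by simp
  have "norm (?B b q p) <= S b * norm (q - p) * ?A b" using FT_lipschitz[OF h(1,2)[OF b]] .
  also have "... <= ((1 + \<bar>S b\<bar>) * norm (q - p)) * ?A b" using I by (intro mult_right_mono) auto
  also have "... <= K * norm (q - p)" using mult_right_mono[OF hK[OF b], of "norm (q - p)"] by (simp add: mult_ac)
  finally show "norm (?B b q p) <= K * norm (q - p)" .
 qed
 have K0: "K >= 0" unfolding K_def by (intro sum_nonneg mult_nonneg_nonneg) auto
 define I where "I = (LBINT x. norm (v x))"
 have I0: "I >= 0" by (simp add: I_def)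
 define C1 where "C1 = 2 ^ n * (I + real DIM('a) ^ n * K)"
 have C1: "(1 + norm p) ^ n * norm (FT v p) <= C1" for p
  unfolding C1_def
 proof (rule decay_from_coordinates)
  show "norm (FT v p) <= I" unfolding I_def by (rule FT_bounded[OF vi])
  show "\<bar>p \<bullet> b\<bar> ^ n * norm (FT v p) <= K" if "b \<in> Basis" for b
   using K(1)[OF that, of p] unfolding h(3)[OF that, symmetric] by (simp add: norm_mult norm_power)
 qed simp
 have C10: "C1 >= 0" unfolding C1_def using I0 K0 by simp
 define C2 where "C2 = 2 ^ n * (\<bar>R\<bar> * I + real DIM('a) ^ n * (K + real n * 2 ^ n * C1))"
 let ?C = "%q p. FT v q - FT v p"
 have C2: "(1 + norm p) ^ n * norm (?C q p) <= C2 * norm (q - p)" if q: "norm (q - p) <= 1" for p q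
 proof -
  have "(1 + norm p) ^ n * norm (?C q p) <= 2 ^ n * (\<bar>R\<bar> * norm (q - p) * I + real DIM('a) ^ n * ((K + real n * 2 ^ n * C1) * norm (q - p)))"
  proof (rule decay_from_coordinates)
   have "norm (?C q p) <= R * norm (q - p) * I" unfolding I_def by (rule FT_lipschitz[OF vi s])
   also have "... <= \<bar>R\<bar> * norm (q - p) * I" using I0 by (intro mult_right_mono) auto
   finally show "norm (?C q p) <= \<bar>R\<bar> * norm (q - p) * I" .
   fix b :: 'a assume b: "b \<in> Basis"
   define qb pb where "qb = \<i> * of_real (q \<bullet> b)" and "pb = \<i> * of_real (p \<bullet> b)"
   define M where "M = 2 * (1 + norm q)"
   have "\<bar>q \<bullet> b\<bar> <= norm q" "\<bar>p \<bullet> b\<bar> <= norm p" "\<bar>(q - p) \<bullet> b\<bar> <= norm (q - p)" using Basis_le_norm[OF b] by auto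
   moreover have "norm p <= norm q + 1" using q norm_triangle_ineq2[of p q] by (simp add: norm_minus_commute)
   ultimately have nb: "norm qb <= M" "norm pb <= M" "M >= 1" "norm (qb - pb) <= norm (q - p)"
    by (auto simp: qb_def pb_def M_def norm_mult inner_diff_left right_diff_distrib[symmetric] simp flip: of_real_diff)
   \<comment> \<open>The difference of the n-th powers is O(|q - p| (1 + |q|)^n), and its growth is
     compensated by the decay of the transform at q.\<close>
   have "pb ^ n * ?C q p = ?B b q p - (qb ^ n - pb ^ n) * FT v q"
    unfolding h(3)[OF b, symmetric] qb_def pb_def by (simp add: algebra_simps)
   hence "norm (pb ^ n * ?C q p) <= norm (?B b q p) + norm (qb ^ n - pb ^ n) * norm (FT v q)"
    by (metis norm_triangle_ineq4 norm_mult)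
   also have "... <= K * norm (q - p) + (real n * norm (q - p) * M ^ n) * norm (FT v q)"
    using nb by (intro add_mono K b mult_right_mono order_trans[OF norm_power_diff_le[OF nb(1-3)]] mult_left_mono) auto
   also have "(real n * norm (q - p) * M ^ n) * norm (FT v q) = (real n * norm (q - p) * 2 ^ n) * ((1 + norm q) ^ n * norm (FT v q))" by (simp only: M_def power_mult_distrib mult_ac)
   also have "... <= (real n * norm (q - p) * 2 ^ n) * C1" by (intro mult_left_mono C1) auto
   finally show "\<bar>p \<bullet> b\<bar> ^ n * norm (?C q p) <= (K + real n * 2 ^ n * C1) * norm (q - p)"
    unfolding norm_mult norm_power by (simp add: norm_mult pb_def distrib_left mult_ac)
  qed simp
  thus ?thesis by (simp add: C2_def algebra_simps)
 qed
 have "(1 + norm p) ^ n * norm (fourier v p) <= max C1 C2" for p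
  by (rule order_trans[OF mult_left_mono[OF norm_fourier_le(2)]]) (use C1[of p] in auto)
 moreover have "(1 + norm p) ^ n * norm (fourier v q - fourier v p) <= max C1 C2 * norm (q - p)" if "norm (q - p) <= 1" for p q
  using order_trans[OF mult_left_mono[OF norm_fourier_le(1)] C2[OF that]] mult_right_mono[of C2 "max C1 C2" "norm (q - p)"] by force
 ultimately show ?thesis using C10 by (intro exI[of _ "max C1 C2"]) auto
qed

section \<open>Power tails and Fourier inversion\<close>

lemma nn_integral_power_tail:
 assumes r: "r > 0" and m: "m > 0"
 shows "(\<integral>\<^sup>+p. ennreal (indicator {r..} (norm (p::'a::euclidean_space)) / norm p ^ (DIM('a) + m)) \<partial>lborel)
  = ennreal (measure lborel (cball (0::'a) 1) * (real DIM('a) / real m) / r ^ m)"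
proof -
 let ?F = "DIM('a) + m"
 have e: "t ^ ?F = t ^ (DIM('a) - 1) * t ^ (m + 1)" for t :: real
  unfolding power_add[symmetric] using DIM_positive[where 'a='a] by (intro arg_cong[where f="power t"]) simp
 let ?C = "%t. indicator {0<..} t * (real DIM('a) * t ^ (DIM('a) - 1))"
 let ?A = "\<integral>\<^sup>+t. ennreal (indicator {r..} t / t ^ ?F) * ennreal (?C t) \<partial>lborel"
 let ?B = "real DIM('a) / real m"
 let ?D = "%t. indicator {r..} t * (real m * inverse (t ^ (m + 1)))"
 have "(\<integral>\<^sup>+p. ennreal (indicator {r..} (norm (p::'a)) / norm p ^ ?F) \<partial>lborel)
  = emeasure lborel (cball (0::'a) 1) * ?A"
  by (rule nn_integral_radial) measurable
 also have "?A
  = (\<integral>\<^sup>+t. ennreal ?B * ennreal (?D t) \<partial>lborel)"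
 proof (rule nn_integral_cong)
  fix t :: real
  show "ennreal (indicator {r..} t / t ^ ?F) * ennreal (?C t)
   = ennreal ?B * ennreal (?D t)"
   using r m unfolding e by (cases "t >= r") (auto simp: ennreal_mult'[symmetric] divide_inverse intro!: arg_cong[where f=ennreal])
 qed
 also have "... = ennreal ?B * ennreal (inverse (r ^ m))"
  by (subst nn_integral_cmult, measurable, simp only: nn_integral_inverse_power_tail[OF r m])
 also have "emeasure lborel (cball (0::'a) 1) = ennreal (measure lborel (cball (0::'a) 1))"
  using emeasure_lborel_cball_finite[of "0::'a" 1] by (simp add: emeasure_eq_ennreal_measure)
 finally show ?thesis using r by (simp add: ennreal_mult'[symmetric] mult.assoc divide_inverse)
qed

lemma integrable_power_decay:
 assumes m: "m > 0"
 shows "integrable lborel (%p::'a::euclidean_space. 1 / (1 + norm p) ^ (DIM('a) + m))"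
  and "r > 0 ==> (LBINT p. indicator (- cball (0::'a) r) p * (1 / (1 + norm p) ^ (DIM('a) + m))) <= measure lborel (cball (0::'a) 1) * (real DIM('a) / real m) / r ^ m"
proof -
 let ?A = "DIM('a) + m"
 have le: "1 / (1 + norm p) ^ ?A <= 1 / norm p ^ ?A" if "p \<noteq> 0" for p :: 'a
  using that by (intro divide_left_mono power_mono mult_pos_pos zero_less_power add_pos_nonneg) auto
 have t: "integrable lborel (%p::'a. indicator {1..} (norm p) / norm p ^ ?A)"
  using nn_integral_power_tail[OF zero_less_one m, where 'a='a] by (intro integrableI_bounded) (auto simp: abs_mult)
 let ?B = "%p. 1 / (1 + norm p) ^ ?A"
 show "integrable lborel (%p::'a. 1 / (1 + norm p) ^ ?A)"
 proof (rule integrable_bound[OF integrable_add[OF integrable_indicator_ball[of 1] t]])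
  show "AE p::'a in lborel. norm (?B p) <= norm (indicator (cball 0 1) p + indicator {1..} (norm p) / norm p ^ ?A)"
  proof (rule AE_I2)
   fix p :: 'a
   show "norm (?B p) <= norm (indicator (cball 0 1) p + indicator {1..} (norm p) / norm p ^ ?A :: real)"
   proof (cases "norm p < 1")
    case True
    have "1 / (1 + norm p) ^ ?A <= 1 / 1" by (intro divide_left_mono one_le_power mult_pos_pos zero_less_power add_pos_nonneg) auto
    thus ?thesis using True by simp
   next
    case False
    hence "p \<noteq> 0" by auto
    hence "1 / (1 + norm p) ^ ?A <= indicator (cball 0 1) p + indicator {1..} (norm p) / norm p ^ ?A"
     using le[of p] False by (simp add: add_increasing)
    thus ?thesis by (simp add: abs_le_iff order_trans[OF _ abs_ge_self])
   qed
  qed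
 qed measurable
 assume r: "r > 0"
 show "(LBINT p. indicator (- cball (0::'a) r) p * ?B p) <= measure lborel (cball (0::'a) 1) * (real DIM('a) / real m) / r ^ m"
 proof (rule integral_real_bounded)
  show "(\<integral>\<^sup>+p. ennreal (indicator (- cball (0::'a) r) p * ?B p) \<partial>lborel) <= ennreal (measure lborel (cball (0::'a) 1) * (real DIM('a) / real m) / r ^ m)"
   unfolding nn_integral_power_tail[OF r m, symmetric]
  proof (intro nn_integral_mono ennreal_leI)
   fix p :: 'a
   show "indicator (- cball 0 r) p * ?B p <= indicator {r..} (norm p) / norm p ^ ?A"
    using le[of p] r by (cases "norm p <= r"; cases "p = 0") (auto simp: indicator_def)
  qed
 qed (use r in auto)
qed

text \<open>The conjugate of k is a pointwise limit of continuous functions off a null set. Testing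
  with truncated versions of these gives, in the limit, that |k|^2 has weighted integral 0.\<close>

lemma AE_zero_of_continuous_tests:
 fixes k :: "'a::euclidean_space => complex"
 assumes [measurable]: "k \<in> mbl" and K: "\<And>x. norm (k x) <= K"
  and z: "\<And>h B. continuous_on UNIV h ==> (\<And>x. norm (h x) <= B) ==> integrable lborel h ==> (LBINT x. h x * k x) = 0"
 shows "AE x in lborel. k x = 0"
proof -
 define G where "G x = exp (- 1 * (x \<bullet> x))" for x :: 'a
 have Gi: "integrable lborel G" unfolding G_def by (rule integrable_gaussian) simp
 have G1: "0 < G x" "G x <= 1" for x by (auto simp: G_def)
 have Gc: "continuous_on UNIV G" unfolding G_def by (intro continuous_intros)
 have [measurable]: "G \<in> mbl" using Gc by (rule borel_measurable_continuous_onI)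
 have K0: "K >= 0" using K[of 0] norm_ge_zero order_trans by blast
 let ?A = "%x. cnj (k x)"
 have "?A \<in> mbl" by (rule measurable_compose[OF _ cnj_borel_measurable]) measurable
 hence "?A \<in> borel_measurable lborel" by simp
 hence "?A \<in> borel_measurable (lebesgue_on UNIV)" unfolding lebesgue_on_UNIV_eq by (rule measurable_completion)
 hence "?A measurable_on UNIV" by (subst measurable_on_iff_borel_measurable) auto
 then obtain N g where N: "negligible N" and g: "\<And>n. continuous_on UNIV (g n)" "\<And>x. x \<notin> N ==> (%n. g n x) \<longlonglongrightarrow> cnj (k x)"
  unfolding measurable_on_def by auto
 \<comment> \<open>The Gaussian makes h integrable and the quotient keeps it below K + 1. As |k| is
   at most K, the truncation is inactive in the limit.\<close>
 define h where "h n x = of_real ((K + 1) / max (K + 1) (norm (g n x)) * G x) * g n x" for n :: nat and x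
 have hb: "norm (h n x) <= (K + 1) * G x" for n x
 proof -
  have "norm (h n x) = (K + 1) * G x * (norm (g n x) / max (K + 1) (norm (g n x)))" using K0 G1[of x] unfolding h_def norm_mult norm_of_real by (simp add: abs_mult)
  also have "... <= (K + 1) * G x * 1" using K0 G1[of x] by (intro mult_left_mono) (auto simp: divide_le_eq_1)
  finally show ?thesis by simp
 qed
 have hc: "continuous_on UNIV (h n)" for n unfolding h_def using K0 by (intro continuous_intros g Gc) (auto simp: max_def)
 have [measurable]: "h n \<in> mbl" for n using hc by (rule borel_measurable_continuous_onI)
 have hi: "integrable lborel (h n)" for n
  by (rule norm_integral_le_AE(1)[where g="%x. (K + 1) * G x"]) (use hb Gi in auto)
 have "norm (h n x) <= K + 1" for n x using order_trans[OF hb[of n x] mult_left_le[of "G x" "K + 1"]] G1[of x] K0 by simp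
 hence z0: "(LBINT x. h n x * k x) = 0" for n by (rule z[OF hc _ hi])
 let ?B = "%x. G x * (norm (k x))^2"
 let ?C = "%x. (K + 1) / max (K + 1) (norm (cnj (k x))) * G x"
 have "(%n. LBINT x. h n x * k x) \<longlonglongrightarrow> (LBINT x. of_real (?B x))"
 proof (rule integral_dominated_convergence[where w="%x. (K + 1) * G x * K"])
  have "AE x in lborel. x \<notin> N" using N unfolding negligible_iff_null_sets by (rule AE_not_in[of _ lebesgue, unfolded AE_completion_iff])
  thus "AE x in lborel. (%n. h n x * k x) \<longlonglongrightarrow> of_real (?B x)"
  proof eventually_elim
   case (elim x)
   have "(%n. h n x * k x) \<longlonglongrightarrow> of_real (?C x) * cnj (k x) * k x"
    unfolding h_def by (intro tendsto_intros g(2) elim) (use K0 in auto)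
   also have "of_real (?C x) * cnj (k x) * k x = of_real (?B x)"
    using K[of x] K0 by (simp add: complex_norm_square max_def mult_ac del: of_real_power)
   finally show ?case .
  qed
  show "AE x in lborel. norm (h n x * k x) <= (K + 1) * G x * K" for n
   unfolding norm_mult using K0 G1 by (intro AE_I2 mult_mono hb K) (auto simp: less_imp_le)
 qed (use Gi in auto)
 hence "(LBINT x. of_real (?B x)) = (0::complex)" unfolding z0 using LIMSEQ_unique tendsto_const by metis
 hence I: "(LBINT x. G x * (norm (k x))^2) = 0" by (simp del: of_real_mult of_real_power)
 have "integrable lborel (%x. G x * (norm (k x))^2)"
 proof (rule norm_integral_le_AE(1)[where g="%x. K^2 * G x"])
  show "AE x in lborel. norm (?B x) <= K^2 * G x"
   using K G1 by (auto simp: less_imp_le abs_mult mult.commute[of "K^2"] intro!: mult_left_mono power_mono)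
 qed (use Gi in auto)
 from integral_nonneg_eq_0_iff_AE[OF this] I have "AE x in lborel. G x * (norm (k x))^2 = 0" using G1 by (simp add: less_imp_le)
 thus ?thesis using G1 by (auto simp: less_le)
qed

lemma fourier_inversion:
 fixes v :: "'a::euclidean_space => complex"
 assumes v: "bcs R v" and i: "integrable lborel (fourier v)"
 shows "AE x in lborel. v x = (LBINT p. exp (- \<i> * of_real (p \<bullet> x)) * fourier v p)"
proof -
 have [measurable]: "v \<in> mbl" using v by (rule bcs_measurable)
 have [measurable]: "fourier v \<in> mbl" using i by (auto dest: borel_measurable_integrable)
 have vi: "integrable lborel v" using v by (rule bcs_integrable)
 define u where "u x = (LBINT p. exp (- \<i> * of_real (p \<bullet> x)) * fourier v p)" for x
 have [measurable]: "u \<in> mbl" unfolding u_def[abs_def]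
  by (rule lborel.borel_measurable_lebesgue_integral[of "%x p. exp (- \<i> * of_real (p \<bullet> x)) * fourier v p" borel, simplified case_prod_unfold]) measurable
 define I where "I = (LBINT p. norm (fourier v p))"
 define M where "M = (2 * pi) ^ DIM('a)"
 have M: "M > 0" "fourier v p = FT v p / of_real M" for p
  by (auto simp: M_def fourier_eq_FT powr_minus powr_realpow divide_inverse mult.commute)
 define ve where "ve e c = (LBINT x. v x * gk (of_real e) (x - c))" for e c
 let ?C = "%p c. - \<i> * of_real (p \<bullet> c)"
 let ?A = "%p c. exp (?C p c) * fourier v p"
 let ?F = "%p. p \<bullet> p"
 have ve: "ve e c = (LBINT p. exp (- of_real (e * ?F p)) * ?A p c)" if e: "e > 0" for e c
 proof -
  have s: "Re (of_real e) > 0" using e by simp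
  define m where "m p = exp (?C p c) * exp (- of_real e * of_real (?F p))" for p :: 'a
  have m: "integrable lborel m"
   using gaussian_inverse_fourier(1)[OF s, of "- c"] unfolding m_def by (simp add: inner_commute)
  have gx: "(LBINT p. m p * iexp (p \<bullet> x)) = of_real M * gk (of_real e) (x - c)" for x
  proof -
   have "m p * iexp (p \<bullet> x) = iexp ((x - c) \<bullet> p) * exp (- of_real e * of_real (?F p))" for p
    unfolding m_def exp_add[symmetric] by (rule arg_cong[where f=exp]) (simp add: inner_diff_left inner_commute algebra_simps)
   thus ?thesis using gaussian_inverse_fourier(2)[OF s, of "x - c"] by (simp add: M_def)
  qed
  have "(LBINT p. m p * FT v p) = of_real M * ve e c"
   unfolding FT_swap[OF v m] gx ve_def integral_mult_right_zero[symmetric] by (simp only: mult_ac)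
  hence "ve e c = (LBINT p. m p * FT v p) / of_real M" using M(1) by simp
  also have "... = (LBINT p. m p * fourier v p)" unfolding M(2) by (simp add: mult.commute)
  finally show ?thesis by (simp add: m_def mult_ac)
 qed
 define e where "e n = 1 / (real n + 1)" for n
 have e: "e n > 0" for n by (simp add: e_def)
 have e0: "e \<longlonglongrightarrow> 0" unfolding e_def by real_asymp
 have eb: "norm (exp (- of_real (t * ?F p)) * ?A p c) <= norm (fourier v p)" if "t >= 0" for t c p
  using that by (simp add: norm_mult mult_left_le_one_le)
 have ub: "norm (u c) <= I" for c unfolding u_def I_def
  by (rule norm_integral_le_AE(2)) (use i in \<open>auto simp: norm_mult\<close>)
 have veb: "norm (ve (e n) c) <= I" for n c unfolding ve[OF e] I_def
  by (rule norm_integral_le_AE(2)) (use i eb e[of n] in \<open>auto simp: less_imp_le\<close>)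
 let ?B = "%e p c. %n. exp (- of_real (e n * ?F p)) * ?A p c"
 have ve_lim: "(%n. ve (e n) c) \<longlonglongrightarrow> u c" for c
  unfolding ve[OF e] u_def
 proof (rule integral_dominated_convergence[where w="%p. norm (fourier v p)"])
  show "AE p in lborel. (?B e p c) \<longlonglongrightarrow> exp (?C p c) * fourier v p"
  proof (rule AE_I2)
   fix p
   have "?B e p c \<longlonglongrightarrow> exp (- of_real (0 * ?F p)) * ?A p c"
    by (intro tendsto_intros e0)
   thus "?B e p c \<longlonglongrightarrow> exp (?C p c) * fourier v p" by simp
  qed
 qed (use i eb e in \<open>auto simp: less_imp_le\<close>)
 obtain B where B: "\<And>x. norm (v x) <= B" using v unfolding bcs_def by blast
 have B0: "B >= 0" using B[of 0] norm_ge_zero order_trans by blast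
 have [measurable]: "ve t \<in> mbl" for t unfolding ve_def[abs_def]
  by (rule lborel.borel_measurable_lebesgue_integral[of "%c x. v x * gk (of_real t) (x - c)" borel, simplified case_prod_unfold]) measurable
 let ?D = "%e n. of_real (e n)"
 have "AE x in lborel. v x - u x = 0"
 proof (rule AE_zero_of_continuous_tests)
  show "norm (v x - u x) <= B + I" for x using norm_triangle_ineq4[of "v x" "u x"] B[of x] ub[of x] by linarith
  fix h :: "'a => complex" and H
  assume h: "continuous_on UNIV h" "\<And>x. norm (h x) <= H" "integrable lborel h"
  have [measurable]: "h \<in> mbl" using h(1) by (rule borel_measurable_continuous_onI)
  have L: "(%n. LBINT c. h c * ve (e n) c) \<longlonglongrightarrow> (LBINT c. h c * u c)"
  proof (rule integral_dominated_convergence[where w="%c. norm (h c) * I"])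
   show "AE c in lborel. norm (h c * ve (e n) c) <= norm (h c) * I" for n unfolding norm_mult by (intro AE_I2 mult_left_mono veb) auto
  qed (use h(3) ve_lim in \<open>auto intro!: AE_I2 tendsto_mult_left\<close>)
  \<comment> \<open>The kernel is even, so the mollification is moved from v onto the continuous h,
    where \<open>gk_approx\<close> applies.\<close>
  have sw: "(LBINT c. h c * ve (e n) c) = (LBINT x. v x * (LBINT c. h c * gk (?D e n) (c - x)))" for n
  proof -
   have gb: "norm (gk (?D e n) z) <= 1 / sqrt (4 * pi * e n) ^ DIM('a)" for z :: 'a
    using e[of n] by (intro order_trans[OF gk_bound[of "e n" _ "e n"] divide_right_mono]) auto
   have "(LBINT c. h c * ve (e n) c) = (LBINT c. LBINT x. h c * (v x * gk (?D e n) (x - c)))" unfolding ve_def by simp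
   also have "... = (LBINT x. LBINT c. h c * (v x * gk (?D e n) (x - c)))"
   proof (rule Fubini_dominated[where u="%c. norm (h c) * (1 / sqrt (4 * pi * e n) ^ DIM('a))" and v="%x. norm (v x)"])
    show "norm (h c * (v x * gk (?D e n) (x - c))) <= norm (h c) * (1 / sqrt (4 * pi * e n) ^ DIM('a)) * norm (v x)" for c x
     using mult_left_mono[OF gb[of "x - c"], of "norm (h c) * norm (v x)"] by (simp add: norm_mult mult_ac)
   qed (use h(3) vi in auto)
   also have "... = (LBINT x. v x * (LBINT c. h c * gk (?D e n) (c - x)))"
    unfolding integral_mult_right_zero[symmetric]
    by (intro integral_cong refl) (simp add: gk_def inner_diff_left inner_diff_right inner_commute mult_ac algebra_simps del: csqrt.sel)
   finally show ?thesis .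
  qed
  have "(%n. LBINT x. v x * (LBINT c. h c * gk (?D e n) (c - x))) \<longlonglongrightarrow> (LBINT x. v x * h x)"
  proof (rule integral_dominated_convergence[where w="%x. norm (v x) * H"])
   show "AE x in lborel. norm (v x * (LBINT c. h c * gk (?D e n) (c - x))) <= norm (v x) * H" for n
    unfolding norm_mult using h(2) by (intro AE_I2 mult_left_mono gk_translate_bound(2) e) auto
   show "(%x. v x * (LBINT c. h c * gk (?D e n) (c - x))) \<in> borel_measurable lborel" for n
   proof -
    have "(%x. LBINT c. h c * gk (?D e n) (c - x)) \<in> mbl"
     by (rule lborel.borel_measurable_lebesgue_integral[of "%x c. h c * gk (?D e n) (c - x)" borel, simplified case_prod_unfold]) measurable
    thus ?thesis by measurable
   qed
  qed (use vi gk_approx[OF h(1,2) e e0] in \<open>auto intro!: AE_I2 tendsto_mult_left\<close>)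
  with L have eq: "(LBINT c. h c * u c) = (LBINT x. v x * h x)" unfolding sw by (rule LIMSEQ_unique)
  have "integrable lborel (%x. h x * u x)"
   by (rule norm_integral_le_AE(1)[where g="%x. norm (h x) * I"]) (use h(3) ub in \<open>auto simp: norm_mult intro!: mult_left_mono\<close>)
  moreover have "integrable lborel (%x. h x * v x)"
   by (rule norm_integral_le_AE(1)[where g="%x. norm (h x) * B"]) (use h(3) B in \<open>auto simp: norm_mult intro!: mult_left_mono\<close>)
  ultimately show "(LBINT x. h x * (v x - u x)) = 0" using eq by (simp add: right_diff_distrib mult.commute)
 qed measurable
 thus ?thesis unfolding u_def by simp
qed

section \<open>Reconstruction\<close>

lemma Zset_borel [measurable]: "Zset y ep \<in> sets (borel :: 'a::euclidean_space measure)"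
proof -
 have "Zset y ep = (\<Union>z. {p. \<bar>p \<bullet> y - pi * of_int z\<bar> < ep})" by (auto simp: Zset_def)
 also have "open ..." by (intro open_UN ballI open_Collect_less continuous_intros)
 finally show ?thesis by simp
qed

text \<open>A window of length pi meets at most three of the intervals of length 2 ep around the
  multiples of pi; hence 6 ep.\<close>

lemma Zset_line_measure:
 assumes ep: "0 < ep" "ep <= 1"
 shows "(\<integral>\<^sup>+s. indicator {0..pi} s * indicator {s. \<exists>z::int. \<bar>a - s - pi * of_int z\<bar> < ep} s \<partial>lborel) <= ennreal (6 * ep)"
proof -
 define z0 where "z0 = \<lfloor>a / pi\<rfloor>"
 have z0: "pi * of_int z0 <= a" "a < pi * (of_int z0 + 1)"
  using floor_correct[of "a / pi"] unfolding z0_def pos_le_divide_eq[OF pi_gt_zero] pos_divide_less_eq[OF pi_gt_zero] by (simp_all add: mult.commute[of pi])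
 let ?A = "%s. \<Sum>z\<in>{z0-1, z0, z0+1}. indicator {a - pi * of_int z - ep <..< a - pi * of_int z + ep} s"
 have "(\<integral>\<^sup>+s. indicator {0..pi} s * indicator {s. \<exists>z::int. \<bar>a - s - pi * of_int z\<bar> < ep} s \<partial>lborel)
  <= (\<integral>\<^sup>+s. (?A s) \<partial>lborel)"
 proof (rule nn_integral_mono)
  fix s :: real
  show "indicator {0..pi} s * indicator {s. \<exists>z::int. \<bar>a - s - pi * of_int z\<bar> < ep} s <= (?A s :: ennreal)"
  proof (cases "s \<in> {0..pi} \<and> (\<exists>z::int. \<bar>a - s - pi * of_int z\<bar> < ep)")
   case True
   then obtain z :: int where z: "\<bar>a - s - pi * of_int z\<bar> < ep" and s: "0 <= s" "s <= pi" by auto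
   have "pi * of_int z < pi * (of_int z0 + 2)" using z s z0 ep pi_gt3 by (simp add: algebra_simps)
   hence "z < z0 + 2" by (simp add: mult_less_cancel_left_pos)
   moreover have "pi * (of_int z0 - 2) < pi * of_int z" using z s z0 ep pi_gt3 by (simp add: algebra_simps)
   hence "z0 - 2 < z" by (simp add: mult_less_cancel_left_pos)
   ultimately have zi: "z \<in> {z0-1, z0, z0+1}" by auto
   have "indicator {a - pi * of_int z - ep <..< a - pi * of_int z + ep} s <= (?A s :: ennreal)"
    by (rule member_le_sum[OF zi]) auto
   moreover have "s \<in> {a - pi * of_int z - ep <..< a - pi * of_int z + ep}" using z by auto
   ultimately show ?thesis using True by simp
  qed auto
 qed
 also have "... = (\<Sum>z\<in>{z0-1, z0, z0+1}. ennreal (2 * ep))"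
  using ep by (subst nn_integral_sum) (auto intro!: sum.cong)
 also have "... = ennreal (6 * ep)" using ep by (subst sum_ennreal) auto
 finally show ?thesis .
qed

text \<open>Averaging over shifts by s \<open>et\<close>, with s between 0 and pi, which move p.y by
  s. The polynomial weight changes by a bounded factor L, and for each p the shifts that land in the
  strips have measure at most 6 ep.\<close>

lemma strip_decay:
 fixes y :: "'a::euclidean_space"
 assumes y: "y \<noteq> 0" and m: "m > 0"
 shows "\<exists>C. \<forall>ep. 0 < ep \<and> ep <= 1 \<longrightarrow> (LBINT p. indicator (Zset y ep) p * (1 / (1 + norm p) ^ (DIM('a) + m))) <= C * ep"
proof -
 define N where "N = DIM('a) + m"
 define et where "et = (1 / (y \<bullet> y)) *\<^sub>R y"
 have et: "et \<bullet> y = 1" using y by (simp add: et_def)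
 define ph where "ph p = 1 / (1 + norm p) ^ N" for p :: 'a
 have ph0: "ph p >= 0" for p by (simp add: ph_def)
 have [measurable]: "ph \<in> mbl" unfolding ph_def[abs_def] by measurable
 define L where "L = (1 + pi * norm et) ^ N"
 have L0: "L >= 0" by (simp add: L_def)
 let ?A = "%p s et. p + s *\<^sub>R et"
 have sh: "ph p <= L * ph (?A p s et)" if "s \<in> {0..pi}" for p s
 proof -
  have "norm (?A p s et) <= norm p + pi * norm et" using that by (intro order_trans[OF norm_triangle_ineq]) (auto intro!: mult_right_mono)
  also have "... <= norm p + pi * norm et * (1 + norm p)" using mult_left_mono[of 1 "1 + norm p" "pi * norm et"] by simp
  finally have "1 + norm (?A p s et) <= (1 + pi * norm et) * (1 + norm p)" by (simp add: algebra_simps)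
  hence "(1 + norm (?A p s et)) ^ N <= ((1 + pi * norm et) * (1 + norm p)) ^ N" by (intro power_mono) auto
  hence "(1 + norm (?A p s et)) ^ N <= L * (1 + norm p) ^ N" by (simp only: L_def power_mult_distrib)
  moreover have "(1 + norm p) ^ N > 0" "(1 + norm (?A p s et)) ^ N > 0" by (auto intro!: zero_less_power add_pos_nonneg)
  ultimately show ?thesis unfolding ph_def by (simp add: field_simps)
 qed
 define I where "I = (LBINT p. ph p)"
 have I: "integrable lborel ph" unfolding ph_def N_def by (rule integrable_power_decay(1)[OF m])
 have In: "(\<integral>\<^sup>+p. ennreal (ph p) \<partial>lborel) = ennreal I" unfolding I_def using I ph0 by (intro nn_integral_eq_integral) auto
 have I0: "I >= 0" unfolding I_def using ph0 by (intro integral_nonneg_AE) auto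
 let ?B = "L * 6 * I / pi"
 have "(LBINT p. indicator (Zset y ep) p * ph p) <= ?B * ep" if ep: "0 < ep" "ep <= 1" for ep
 proof (rule integral_real_bounded)
  let ?Z = "Zset y ep"
  have "ennreal pi * (\<integral>\<^sup>+p. ennreal (indicator ?Z p * ph p) \<partial>lborel) = (\<integral>\<^sup>+s. indicator {0..pi} s * (\<integral>\<^sup>+p. ennreal (indicator ?Z p * ph p) \<partial>lborel) \<partial>lborel)"
   by (subst nn_integral_multc) (auto simp: ennreal_indicator)
  also have "... <= (\<integral>\<^sup>+s. indicator {0..pi} s * (\<integral>\<^sup>+p. ennreal L * (indicator ?Z p * ennreal (ph (?A p s et))) \<partial>lborel) \<partial>lborel)"
  proof (rule nn_integral_mono)
   fix s :: real
   show "indicator {0..pi} s * (\<integral>\<^sup>+p. ennreal (indicator ?Z p * ph p) \<partial>lborel) <= indicator {0..pi} s * (\<integral>\<^sup>+p. ennreal L * (indicator ?Z p * ennreal (ph (?A p s et))) \<partial>lborel)"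
   proof (cases "s \<in> {0..pi}")
    case True
    have "ennreal (indicator ?Z p * ph p) <= ennreal L * (indicator ?Z p * ennreal (ph (?A p s et)))" for p
     using sh[OF True, of p] L0 ph0 by (auto simp: indicator_def ennreal_mult'[symmetric] intro!: ennreal_leI)
    thus ?thesis by (intro mult_left_mono nn_integral_mono) auto
   qed auto
  qed
  also have "... = (\<integral>\<^sup>+s. (\<integral>\<^sup>+p. ennreal L * (ennreal (ph p) * (indicator {0..pi} s * indicator {s. \<exists>z::int. \<bar>p \<bullet> y - s - pi * of_int z\<bar> < ep} s)) \<partial>lborel) \<partial>lborel)"
  proof (rule nn_integral_cong)
   fix s :: real
   have iz: "indicator ?Z (p - s *\<^sub>R et) = (indicator {s. \<exists>z::int. \<bar>p \<bullet> y - s - pi * of_int z\<bar> < ep} s :: ennreal)" for p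
    using et by (simp add: Zset_def indicator_def inner_diff_left)
   have "(\<integral>\<^sup>+p. ennreal L * (indicator ?Z p * ennreal (ph (?A p s et))) \<partial>lborel) = (\<integral>\<^sup>+p. ennreal L * (indicator ?Z (p - s *\<^sub>R et) * ennreal (ph p)) \<partial>lborel)"
    using nn_integral_lborel_affine[of "%p. ennreal L * (indicator ?Z p * ennreal (ph (?A p s et)))" 1 "- s *\<^sub>R et"] by simp
   note this[unfolded iz]
   thus "indicator {0..pi} s * (\<integral>\<^sup>+p. ennreal L * (indicator ?Z p * ennreal (ph (?A p s et))) \<partial>lborel)
    = (\<integral>\<^sup>+p. ennreal L * (ennreal (ph p) * (indicator {0..pi} s * indicator {s. \<exists>z::int. \<bar>p \<bullet> y - s - pi * of_int z\<bar> < ep} s)) \<partial>lborel)"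
    by (cases "s \<in> {0..pi}") (auto simp: mult_ac)
  qed
  also have "... = (\<integral>\<^sup>+p. (\<integral>\<^sup>+s. ennreal L * (ennreal (ph p) * (indicator {0..pi} s * indicator {s. \<exists>z::int. \<bar>p \<bullet> y - s - pi * of_int z\<bar> < ep} s)) \<partial>lborel) \<partial>lborel)"
   by (rule lborel_pair.Fubini') measurable
  also have "... = (\<integral>\<^sup>+p. ennreal L * (ennreal (ph p) * (\<integral>\<^sup>+s. indicator {0..pi} s * indicator {s. \<exists>z::int. \<bar>p \<bullet> y - s - pi * of_int z\<bar> < ep} s \<partial>lborel)) \<partial>lborel)"
   by (subst nn_integral_cmult, measurable, subst nn_integral_cmult, measurable)
  also have "... <= (\<integral>\<^sup>+p. ennreal L * (ennreal (ph p) * ennreal (6 * ep)) \<partial>lborel)"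
   by (intro nn_integral_mono mult_left_mono Zset_line_measure ep) auto
  also have "... = ennreal (L * 6 * ep) * ennreal I"
   unfolding In[symmetric] using L0 ep by (subst nn_integral_cmult[symmetric]) (auto simp: ennreal_mult' mult_ac)
  also have "... = ennreal pi * ennreal (?B * ep)" using L0 I0 ep by (simp add: ennreal_mult'[symmetric] mult_ac)
  finally show "(\<integral>\<^sup>+p. ennreal (indicator ?Z p * ph p) \<partial>lborel) <= ennreal (?B * ep)"
   by (subst (asm) ennreal_mult_le_mult_iff) auto
 qed (use L0 I0 that in auto)
 thus ?thesis unfolding ph_def N_def by blast
qed

text \<open>With u = t + ln s the left side is at most exp(nu u - exp(u)/2), a function of u alone
  that decays exponentially in both directions. After a translation its integral is therefore
  bounded uniformly in s.\<close>

lemma bessel_integrand_bound: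
 fixes nu :: real
 assumes nu: "nu > 0"
 defines "mu \<equiv> min nu 1"
 shows "\<exists>C\<ge>0. \<forall>s>0. \<forall>t\<ge>0. s powr nu * (exp (- s * cosh t) * cosh (nu * t)) <= C * exp (- mu * \<bar>t + ln s\<bar>)"
proof -
 define k where "k = nat \<lceil>nu\<rceil> + 1"
 have k: "nu + 1 <= real k" unfolding k_def using real_nat_ceiling_ge[of nu] by simp
 \<comment> \<open>The first summand turns the double exponential into exp(-k u) for u >= 0; the
   extra 1 ensures that C is at least 1 for u < 0.\<close>
 define C :: real where "C = 2 ^ k * fact k + 1"
 let ?A = "%u. - exp u / 2"
 have "s powr nu * (exp (- s * cosh t) * cosh (nu * t)) <= C * exp (- mu * \<bar>t + ln s\<bar>)" if s: "s > 0" and t: "t >= 0" for s t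
 proof -
  define u where "u = t + ln s"
  have x: "exp u = s * exp t" using s by (simp add: u_def exp_add mult.commute)
  have "cosh (nu * t) <= exp (nu * t)" using nu t by (simp add: cosh_def field_simps)
  moreover have "s * exp t / 2 <= s * cosh t" using s by (simp add: cosh_def)
  hence "exp (- s * cosh t) <= exp (?A u)" by (simp add: x)
  ultimately have "s powr nu * (exp (- s * cosh t) * cosh (nu * t)) <= s powr nu * (exp (?A u) * exp (nu * t))" by (intro mult_left_mono mult_mono) auto
  also have "... = exp (nu * u) * exp (?A u)" using s by (simp add: powr_def u_def exp_add[symmetric] algebra_simps)
  also have "... <= C * exp (- mu * \<bar>u\<bar>)"
  proof (cases "u >= 0")
   case True
   have "(exp u / 2) ^ k <= fact k * exp (exp u / 2)" by (rule power_le_fact_exp) simp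
   hence "exp (real k * u) * exp (?A u) <= 2 ^ k * fact k" by (simp add: power_divide exp_of_nat_mult[symmetric] exp_minus field_simps)
   moreover have "exp (nu * u) * exp (mu * u) <= exp (real k * u)"
    unfolding exp_add[symmetric] distrib_right[symmetric] using True k by (auto simp: mu_def intro!: mult_right_mono)
   hence "exp (nu * u) * exp (mu * u) * exp (?A u) <= exp (real k * u) * exp (?A u)" by (rule mult_right_mono) simp
   ultimately have "exp (nu * u) * exp (mu * u) * exp (?A u) <= C" unfolding C_def by linarith
   thus ?thesis using True by (simp add: exp_minus field_simps)
  next
   case False
   have "exp (nu * u) * exp (?A u) <= exp (mu * u) * 1"
    using False by (intro mult_mono) (auto simp: mu_def intro!: mult_right_mono_neg)
   also have "... <= C * exp (- mu * \<bar>u\<bar>)" using False by (simp add: C_def)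
   finally show ?thesis .
  qed
  finally show ?thesis by (simp add: u_def)
 qed
 thus ?thesis by (intro exI[of _ C]) (auto simp: C_def)
qed

text \<open>The high-energy estimates need bounded measurable potentials. The Bessel factor is
  bounded uniformly in |x|, and the convolution of q with itself is bounded because q is integrable
  and essentially bounded.\<close>

lemma w_fun_bounded:
 fixes q :: "'a::euclidean_space => real"
 assumes nu: "nu > 0" and q [measurable]: "q \<in> mbl" and qb: "AE x in lborel. \<bar>q x\<bar> <= C" and qs: "\<forall>x. norm x > r \<longrightarrow> q x = 0"
 shows "w_fun nu q \<in> mbl" and "\<exists>B. \<forall>x. \<bar>w_fun nu q x\<bar> <= B"
proof -
 have [measurable]: "besselK nu \<in> mbl" unfolding besselK_def[abs_def] set_lebesgue_integral_def cosh_def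
  by (rule lborel.borel_measurable_lebesgue_integral[of "%z t. indicator {0..} t *\<^sub>R (exp (- z * ((exp t + exp (- t)) /\<^sub>R 2)) * ((exp (nu * t) + exp (- (nu * t))) /\<^sub>R 2))" borel, simplified case_prod_unfold]) measurable
 have [measurable]: "(%x. LBINT y'. q (x - y') * q y') \<in> mbl"
  by (rule lborel.borel_measurable_lebesgue_integral[of "%x y'. q (x - y') * q y'" borel, simplified case_prod_unfold]) measurable
 show "w_fun nu q \<in> mbl" unfolding w_fun_def[abs_def] by measurable
 obtain K where K: "K >= 0" "\<And>s t. s > 0 ==> t >= 0 ==> s powr nu * (exp (- s * cosh t) * cosh (nu * t)) <= K * exp (- min nu 1 * \<bar>t + ln s\<bar>)"
  using bessel_integrand_bound[OF nu] by blast
 define mu where "mu = min nu 1"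
 have mu: "mu > 0" using nu by (simp add: mu_def)
 define J where "J = (LBINT t. K * exp (- \<bar>t\<bar>)) / mu"
 let ?A = "%t s. indicator {0..} t *\<^sub>R (exp (- s * cosh t) * cosh (nu * t))"
 let ?B = "%s t. - \<bar>mu * ln s + mu * t\<bar>"
 have Bb: "\<bar>s powr nu * besselK nu s\<bar> <= J" if s: "s > 0" for s
 proof -
  have i: "integrable lborel (%t. K * exp (?B s t))"
   using lborel_integrable_real_affine[OF integrable_exp_neg_abs, of mu "mu * ln s"] mu by (intro integrable_mult_right) simp
  have "norm (LBINT t. s powr nu * ?A t s) <= (LBINT t. K * exp (?B s t))"
  proof (rule norm_integral_le_AE(2)[OF _ i])
   show "AE t in lborel. norm (s powr nu * ?A t s) <= K * exp (?B s t)"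
   proof (rule AE_I2)
    fix t
    have "mu * \<bar>t + ln s\<bar> = \<bar>mu * ln s + mu * t\<bar>" using mu abs_mult[of mu "t + ln s"] by (simp add: algebra_simps)
    thus "norm (s powr nu * ?A t s) <= K * exp (?B s t)"
     using K(1) K(2)[OF s, of t] by (cases "t >= 0") (auto simp: abs_mult mu_def)
   qed
  qed (simp add: cosh_def)
  also have "... = J" unfolding J_def
   using lborel_integral_real_affine[of mu "%t. K * exp (- \<bar>t\<bar>)" "mu * ln s"] mu by (auto simp: field_simps)
  finally show ?thesis by (simp add: besselK_def set_lebesgue_integral_def)
 qed
 have qi: "integrable lborel q"
 proof (rule norm_integral_le_AE(1)[where g="%x. \<bar>C\<bar> * indicator (cball 0 r) x"])
  show "AE x in lborel. norm (q x) <= \<bar>C\<bar> * indicator (cball 0 r) x"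
   using qb by eventually_elim (use qs in \<open>auto simp: indicator_def not_le\<close>)
 qed (auto intro: integrable_mult_right integrable_indicator_ball)
 define Q where "Q = (LBINT y. \<bar>C\<bar> * \<bar>q y\<bar>)"
 have Qb: "\<bar>LBINT y'. q (x - y') * q y'\<bar> <= Q" for x
 proof -
  have "norm (LBINT y'. q (x - y') * q y') <= (LBINT y'. \<bar>C\<bar> * \<bar>q (x - y')\<bar>)"
  proof (rule norm_integral_le_AE(2))
   show "integrable lborel (%y'. \<bar>C\<bar> * \<bar>q (x - y')\<bar>)" using qi by (subst integrable_lborel_reflect) auto
   show "AE y' in lborel. norm (q (x - y') * q y') <= \<bar>C\<bar> * \<bar>q (x - y')\<bar>"
    using qb
   proof eventually_elim
    case (elim y')
    hence "\<bar>q (x - y')\<bar> * \<bar>q y'\<bar> <= \<bar>q (x - y')\<bar> * \<bar>C\<bar>" by (intro mult_left_mono) auto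
    thus ?case by (simp add: abs_mult mult.commute)
   qed
  qed measurable
  also have "... = Q" unfolding Q_def by (rule integral_lborel_reflect[where f="%y. \<bar>C\<bar> * \<bar>q y\<bar>" and t=x])
  finally show ?thesis by simp
 qed
 have "\<bar>w_fun nu q x\<bar> <= max (2 powr (nu - 1) * \<bar>Gamma nu\<bar>) J * Q" for x
  unfolding w_fun_def abs_mult using Bb[of "norm x"] Qb[of x]
  by (intro mult_mono) (auto simp: abs_mult le_max_iff_disj)
 thus "\<exists>B. \<forall>x. \<bar>w_fun nu q x\<bar> <= B" by blast
qed

section \<open>Error of the pointwise inversion and uniformity of the amplitude bound\<close>

lemma norm_square_diff_le:
 fixes F Y :: complex
 assumes "norm (F - Y) <= dl" "norm Y <= M" "dl <= 1"
 shows "\<bar>(norm F)^2 - (norm Y)^2\<bar> <= dl * (2 * M + 1)"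
proof -
 have F: "norm F <= M + 1" "\<bar>norm F - norm Y\<bar> <= dl" using assms norm_triangle_ineq2[of F Y] norm_triangle_ineq3[of F Y] by linarith+
 have "(norm F)^2 - (norm Y)^2 = (norm F - norm Y) * (norm F + norm Y)" by (simp add: power2_eq_square algebra_simps)
 hence "\<bar>(norm F)^2 - (norm Y)^2\<bar> = \<bar>norm F - norm Y\<bar> * (norm F + norm Y)" by (simp add: abs_mult)
 also have "... <= dl * (2 * M + 1)" using F assms by (intro mult_mono) auto
 finally show ?thesis .
qed

text \<open>The system has determinant Om^2 sin(p.(T2 - T1)) and coefficients of size Om, so the
  errors of the right-hand sides are amplified by 1/(Om |sin|). Each right-hand side is off by at
  most 4 (M + \<Omega> + 1) dl, and the two components of the solution double this.\<close>

lemma U_rec_error: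
 fixes p :: "'a::euclidean_space"
 assumes e: "norm (amp_at F ga E p - X) <= dl" "norm (amp_at F1 ga E p - (X + W1 p)) <= dl" "norm (amp_at F2 ga E p - (X + W2 p)) <= dl"
  and W: "W1 p = iexp (p \<bullet> T1) * of_real Om" "W2 p = iexp (p \<bullet> T2) * of_real Om"
  and b: "0 < Om" "Om <= \<Omega>" "norm X <= M" "dl <= 1" and s: "sin (p \<bullet> (T2 - T1)) \<noteq> 0"
 shows "norm (U_rec W1 W2 F F1 F2 ga E p - X) <= 8 * (M + \<Omega> + 1) * dl / (Om * \<bar>sin (p \<bullet> (T2 - T1))\<bar>)"
proof -
 define ze where "ze = Re (W1 p) * Im (W2 p) - Im (W1 p) * Re (W2 p)"
 have ze: "ze = Om^2 * sin (p \<bullet> (T2 - T1))"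
  by (simp add: ze_def W Re_exp Im_exp inner_diff_right sin_diff power2_eq_square algebra_simps)
 have ze0: "ze \<noteq> 0" using b s by (simp add: ze)
 have nW: "norm (W1 p) = Om" "norm (W2 p) = Om" using b by (auto simp: W norm_mult)
 let ?A = "cmod (amp_at F ga E p)"
 define err where "err F' W = (cmod (amp_at F' ga E p))^2 - ?A^2 - (cmod W)^2 - 2 * (Re X * Re W + Im X * Im W)" for F' W
 let ?F = "M + \<Omega> + 1"
 have err: "\<bar>err F' W\<bar> <= 4 * ?F * dl" if "norm (amp_at F' ga E p - (X + W)) <= dl" "norm W = Om" for F' W
 proof -
  have "(cmod (X + W))^2 = (cmod X)^2 + (cmod W)^2 + 2 * (Re X * Re W + Im X * Im W)" unfolding cmod_power2 by (simp add: power2_eq_square algebra_simps)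
  hence "err F' W = ((cmod (amp_at F' ga E p))^2 - (cmod (X + W))^2) - (?A^2 - (cmod X)^2)" by (simp add: err_def)
  moreover have "norm (X + W) <= M + \<Omega>" using norm_triangle_ineq[of X W] b that by linarith
  moreover have "dl >= 0" using e(1) norm_ge_zero order_trans by blast
  ultimately have "\<bar>err F' W\<bar> <= dl * (2 * (M + \<Omega>) + 1) + dl * (2 * M + 1)"
   using norm_square_diff_le[OF that(1) _ b(4), of "M + \<Omega>"] norm_square_diff_le[OF e(1) b(3,4)] by linarith
  also have "... <= 4 * ?F * dl" using b \<open>dl >= 0\<close> mult_left_mono[of 0 \<Omega> dl] by (simp add: algebra_simps)
  finally show ?thesis .
 qed
 define a b where "a = err F1 (W1 p)" and "b = err F2 (W2 p)"
 define c where "c = 4 * ?F * dl"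
 have ab: "\<bar>a\<bar> <= c" "\<bar>b\<bar> <= c" unfolding a_def b_def c_def by (intro err e nW)+
 have c0: "c >= 0" using ab(1) by linarith
 let ?C = "(- Re (W2 p) * a + Re (W1 p) * b) / (2 * ze)"
 let ?D = "(Im (W2 p) * a - Im (W1 p) * b) / (2 * ze)"
 have eq: "U_rec W1 W2 F F1 F2 ga E p - X = Complex ?D ?C"
 proof -
  have A: "(cmod (amp_at F1 ga E p))^2 - ?A^2 - (cmod (W1 p))^2 = 2 * (Re X * Re (W1 p) + Im X * Im (W1 p)) + a"
   "(cmod (amp_at F2 ga E p))^2 - ?A^2 - (cmod (W2 p))^2 = 2 * (Re X * Re (W2 p) + Im X * Im (W2 p)) + b"
   by (simp_all add: a_def b_def err_def)
  show ?thesis unfolding U_rec_def Let_def A ze_def[symmetric]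
   using ze0 by (simp add: complex_eq_iff field_simps) (simp add: ze_def algebra_simps)
 qed
 have half: "\<bar>(s * a' + t * b') / (2 * ze)\<bar> <= Om * c / \<bar>ze\<bar>" if "\<bar>s\<bar> <= Om" "\<bar>t\<bar> <= Om" "\<bar>a'\<bar> <= c" "\<bar>b'\<bar> <= c" for s t a' b'
 proof -
  have "\<bar>s * a' + t * b'\<bar> <= \<bar>s\<bar> * \<bar>a'\<bar> + \<bar>t\<bar> * \<bar>b'\<bar>" by (metis abs_mult abs_triangle_ineq)
  also have "... <= Om * c + Om * c" using that b(1) c0 assms(6) by (intro add_mono mult_mono) auto
  finally have "\<bar>s * a' + t * b'\<bar> / (2 * \<bar>ze\<bar>) <= (Om * c + Om * c) / (2 * \<bar>ze\<bar>)" by (rule divide_right_mono) simp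
  thus ?thesis by (simp add: abs_mult)
 qed
 let ?B = "Om * \<bar>sin (p \<bullet> (T2 - T1))\<bar>"
 have "norm (U_rec W1 W2 F F1 F2 ga E p - X) <= Om * c / \<bar>ze\<bar> + Om * c / \<bar>ze\<bar>"
  unfolding eq using cmod_le[of "Complex ?D ?C"]
   half[of "Im (W2 p)" "- Im (W1 p)" a b] half[of "- Re (W2 p)" "Re (W1 p)" a b] abs_Re_le_cmod[of "W1 p"] abs_Im_le_cmod[of "W1 p"] abs_Re_le_cmod[of "W2 p"] abs_Im_le_cmod[of "W2 p"] ab
  unfolding nW by simp
 also have "... = 8 * ?F * dl / ?B"
 proof -
  have "Om * c / \<bar>ze\<bar> = c / ?B" using assms(6) by (simp add: ze abs_mult power2_eq_square)
  thus ?thesis by (simp add: c_def)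
 qed
 finally show ?thesis .
qed

lemma kE_lE:
 assumes "norm (ga p) = 1" "ga p \<bullet> p = 0" "norm p <= 2 * ka"
 shows "norm (kE ga (ka^2) p) = ka" "norm (lE ga (ka^2) p) = ka" "kE ga (ka^2) p - lE ga (ka^2) p = p"
proof -
 have k0: "ka >= 0" using assms(3) norm_ge_zero[of p] by linarith
 have "(norm p)^2 <= (2 * ka)^2" by (rule power_mono[OF assms(3)]) simp
 hence s: "(sqrt (ka^2 - (p \<bullet> p) / 4))^2 = ka^2 - (p \<bullet> p) / 4" by (simp add: dot_square_norm)
 have g: "ga p \<bullet> ga p = 1" using assms(1) by (simp add: dot_square_norm)
 let ?A = "ka^2"
 have "kE ga ?A p \<bullet> kE ga ?A p = ka^2" "lE ga ?A p \<bullet> lE ga ?A p = ka^2"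
  using s assms(2) g unfolding kE_def lE_def
  by (auto simp: inner_add_left inner_add_right inner_commute[of p "ga p"] power2_eq_square algebra_simps)
 thus "norm (kE ga ?A p) = ka" "norm (lE ga ?A p) = ka" using k0 by (auto simp: norm_eq_sqrt_inner)
 show "kE ga ?A p - lE ga ?A p = p" by (simp add: kE_def lE_def scaleR_2[symmetric] flip: scaleR_add_left)
qed

text \<open>The amplitude is only determined on the energy shell, hence the cut-off.\<close>

definition good_amp :: "real => real => ('a::euclidean_space => complex) => ('a => 'a => complex) => bool" where
 "good_amp C ka \<Phi> F \<longleftrightarrow> (\<forall>k l. norm k = ka \<and> norm l = ka \<longrightarrow> norm (F k l - \<Phi> (k - l)) <= C / ka) \<and>
   (%(k, l). indicator (sphere 0 ka \<times> sphere 0 ka) (k, l) *\<^sub>R F k l) \<in> mbl"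

text \<open>C and ka0 depend only on CV, rh and the dimension, so one pair serves all three
  potentials. Measurability on the shell comes from continuity there, that is, from the Lipschitz
  part of \<open>amp_approx\<close>.\<close>

lemma scat_amp_uniform:
 assumes dim: "DIM('a::euclidean_space) >= 2" and rh: "rh >= 0"
 shows "\<exists>C ka0. C >= 0 \<and> (\<forall>(V :: 'a => complex) F ka. V \<in> mbl \<and> (\<forall>x. norm (V x) <= CV) \<and> (\<forall>x. norm x > rh \<longrightarrow> V x = 0)
  \<and> ka >= ka0 \<and> is_scat_amp V (ka^2) F \<longrightarrow> good_amp C ka (fourier V) F)"
proof -
 define A0 where "A0 = (13 + real DIM('a)) * exp (rh^2)"
 define C where "C = (CV + CV * (4 * (A0 * CV)^2) + 4 * CV * rh^2 + 5 * CV * rh) * measure lborel (cball (0::'a) rh) + 1"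
 define ka0 where "ka0 = 2 * \<bar>A0 * CV\<bar> + 1"
 let ?A = "%z' z. norm (fst z' - fst z) + norm (snd z' - snd z)"
 have "good_amp \<bar>C\<bar> ka (fourier V) F" if V: "V \<in> mbl" "\<forall>x. norm (V x) <= CV" "\<forall>x. norm x > rh \<longrightarrow> V x = 0"
  and ka: "ka >= ka0" and amp: "is_scat_amp V (ka^2) F" for V :: "'a => complex" and F ka
 proof -
  have "(2 * \<bar>A0 * CV\<bar>)^2 <= ka^2" using ka by (intro power_mono) (auto simp: ka0_def)
  hence sm: "4 * (A0 * CV)^2 <= ka^2" by (simp add: power_mult_distrib)
  have ka1: "ka >= 1" using ka by (auto simp: ka0_def)
  interpret scatterer V F CV rh ka
   by unfold_locales (use dim V rh ka1 amp sm in \<open>auto simp: A0_def\<close>)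
  have ac: "amp_const <= \<bar>C\<bar>" unfolding amp_const_def C_def bvol_def A_def A0_def by (rule abs_ge_self)
  have "continuous_on (sphere 0 ka \<times> sphere 0 ka) (%(k, l). F k l)"
   unfolding continuous_on_iff case_prod_unfold
  proof (intro ballI allI impI)
   fix z :: "'a \<times> 'a" and e :: real assume z: "z \<in> sphere 0 ka \<times> sphere 0 ka" and e: "e > 0"
   define d where "d = e / (2 * (\<bar>C\<bar> + 1))"
   have d: "d > 0" using e by (simp add: d_def add_nonneg_pos)
   have "dist (F (fst z') (snd z')) (F (fst z) (snd z)) < e" if z': "z' \<in> sphere 0 ka \<times> sphere 0 ka" "dist z' z < d" for z'
   proof -
    have "norm (fst z' - fst z) < d" "norm (snd z' - snd z) < d"
     using z'(2) dist_fst_le[of z' z] dist_snd_le[of z' z] by (auto simp: dist_norm)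
    moreover have "norm (F (fst z') (snd z') - F (fst z) (snd z)) <= amp_const * ?A z' z"
     using z z' by (intro amp_approx(2)) (auto simp: mem_Times_iff)
    moreover have "... <= \<bar>C\<bar> * ?A z' z" using ac by (intro mult_right_mono) auto
    moreover have "\<bar>C\<bar> * ?A z' z <= \<bar>C\<bar> * (2 * d)" using calculation(1,2) by (intro mult_left_mono) auto
    moreover have "\<bar>C\<bar> * (2 * d) < e" using e unfolding d_def by (simp add: field_simps)
    ultimately show ?thesis by (simp add: dist_norm)
   qed
   thus "\<exists>d>0. \<forall>z'\<in>sphere 0 ka \<times> sphere 0 ka. dist z' z < d \<longrightarrow> dist (F (fst z') (snd z')) (F (fst z) (snd z)) < e"
    using d by (intro exI[of _ d]) auto
  qed
  note cont = this
  have "sphere 0 ka \<times> sphere 0 ka \<in> sets (borel :: ('a \<times> 'a) measure)" by (intro borel_closed closed_Times closed_sphere)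
  from borel_measurable_continuous_on_indicator[OF this cont]
  have "(%(k, l). indicator (sphere 0 ka \<times> sphere 0 ka) (k, l) *\<^sub>R F k l) \<in> mbl"
   by (simp add: case_prod_unfold)
  moreover have "norm (F k l - fourier V (k - l)) <= \<bar>C\<bar> / ka" if "norm k = ka" "norm l = ka" for k l
   using amp_approx(1)[OF that] divide_right_mono[OF ac, of ka] ka1 by linarith
  ultimately show ?thesis unfolding good_amp_def by blast
 qed
 thus ?thesis by (intro exI[of _ "\<bar>C\<bar>"] exI[of _ ka0]) auto
qed

section \<open>Geometry of the strips\<close>

lemma sin_ge_half:
 fixes x :: real
 assumes x: "0 < x" "x <= 1"
 shows "x / 2 <= sin x"
proof -
 obtain z where z: "0 < z" "z < x" "sin x - sin 0 = (x - 0) * cos z" using MVT2[OF x(1) DERIV_sin] by blast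
 have "cos (pi / 3) <= cos z" using z x pi_gt3 by (intro cos_monotone_0_pi_le) auto
 hence "x * (1/2) <= x * cos z" using x by (intro mult_left_mono) (auto simp: cos_60)
 thus ?thesis using z by simp
qed

lemma abs_sin_add_pi_int: "\<bar>sin (x + pi * of_int z)\<bar> = \<bar>sin x\<bar>"
proof -
 have "sin (of_int z * pi) = 0" by (simp add: sin_times_pi_eq_0)
 thus ?thesis using sin_zero_abs_cos_one[of "of_int z * pi"] by (simp add: sin_add mult.commute[of pi] abs_mult)
qed

text \<open>Subtracting the nearest multiple of pi does not change |sin| and leaves a remainder
  between ep and pi/2 in modulus, where sin is monotone.\<close>

lemma sin_off_strip:
 assumes "p \<notin> Zset y ep" "0 < ep" "ep <= 1"
 shows "\<bar>sin (p \<bullet> y)\<bar> >= ep / 2"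
proof -
 let ?A = "p \<bullet> y"
 define z where "z = \<lfloor>?A / pi + 1/2\<rfloor>"
 define t where "t = p \<bullet> y - pi * of_int z"
 have "of_int z <= ?A / pi + 1/2" "?A / pi + 1/2 < of_int z + 1" unfolding z_def by linarith+
 hence "pi * of_int z <= pi * (?A / pi + 1/2)" "pi * (?A / pi + 1/2) <= pi * (of_int z + 1)" by (intro mult_left_mono; simp)+
 hence "pi * of_int z <= p \<bullet> y + pi / 2" "p \<bullet> y + pi / 2 <= pi + pi * of_int z" by (simp_all add: algebra_simps)
 hence t: "\<bar>t\<bar> <= pi / 2" unfolding t_def by linarith
 have "ep <= \<bar>t\<bar>" using assms(1) by (auto simp: Zset_def t_def not_less)
 hence "sin ep <= sin \<bar>t\<bar>" using t assms pi_gt3 by (intro sin_monotone_2pi_le) auto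
 also have "sin \<bar>t\<bar> <= \<bar>sin t\<bar>" by (cases "t >= 0") auto
 also have "\<bar>sin t\<bar> = \<bar>sin ?A\<bar>" using abs_sin_add_pi_int[of t z] by (simp add: t_def)
 finally show ?thesis using sin_ge_half[OF assms(2,3)] by linarith
qed

text \<open>Since ep is at most 1, which is below pi/2, the intervals are disjoint and the integer
  is the nearest one. The closed form with floor, unlike the description by \<open>THE\<close>, is
  visibly measurable.\<close>

lemma zint_eq:
 assumes ep: "0 < ep" "ep <= 1" and p: "p \<in> Zset y ep"
 shows "zint y ep p = \<lfloor>(p \<bullet> y) / pi + 1/2\<rfloor>" and "\<bar>p \<bullet> y - pi * of_int (zint y ep p)\<bar> < ep"
proof -
 let ?A = "p \<bullet> y"
 have u: "z = \<lfloor>?A / pi + 1/2\<rfloor>" if "\<bar>p \<bullet> y - pi * of_int z\<bar> < ep" for z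
 proof -
  have "\<bar>p \<bullet> y - pi * of_int z\<bar> < pi * (1/2)" using that ep pi_gt3 by linarith
  moreover have "p \<bullet> y - pi * of_int z = pi * (?A / pi - of_int z)" by (simp add: right_diff_distrib)
  ultimately have "\<bar>?A / pi - of_int z\<bar> < 1/2" by (simp only: abs_mult abs_of_pos[OF pi_gt_zero] mult_less_cancel_left_pos[OF pi_gt_zero])
  thus ?thesis by linarith
 qed
 obtain z :: int where z: "\<bar>p \<bullet> y - pi * of_int z\<bar> < ep" using p by (auto simp: Zset_def)
 have "zint y ep p = z" unfolding zint_def by (rule the_equality[where P="%z. \<bar>p \<bullet> y - pi * of_int z\<bar> < ep", OF z]) (use u z in metis)
 thus "zint y ep p = \<lfloor>?A / pi + 1/2\<rfloor>" "\<bar>p \<bullet> y - pi * of_int (zint y ep p)\<bar> < ep" using u z by auto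
qed

text \<open>Both boundary points at once: s = ep gives \<open>pplus\<close> and s = -ep gives
  \<open>pminus\<close>.\<close>

lemma strip_boundary:
 fixes y :: "'a::euclidean_space"
 assumes y: "y \<noteq> 0" and ep: "0 < ep" "ep <= 1" and p: "p \<in> Zset y ep" and s: "\<bar>s\<bar> = ep"
 defines "q \<equiv> pperp y p + ((pi * of_int (zint y ep p) + s) / (y \<bullet> y)) *\<^sub>R y"
 shows "norm (q - p) <= 2 * ep * norm ((1 / (y \<bullet> y)) *\<^sub>R y)" "\<bar>sin (q \<bullet> y)\<bar> >= ep / 2"
proof -
 let ?z = "pi * of_int (zint y ep p)"
 let ?A = "(1 / (y \<bullet> y)) *\<^sub>R y"
 have "q - p = (?z + s - p \<bullet> y) *\<^sub>R ?A" unfolding q_def pperp_def by (simp add: algebra_simps diff_divide_distrib add_divide_distrib)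
 hence "norm (q - p) = \<bar>?z + s - p \<bullet> y\<bar> * norm ?A" by simp
 also have "... <= 2 * ep * norm ?A" using zint_eq(2)[OF ep p] s by (intro mult_right_mono) auto
 finally show "norm (q - p) <= 2 * ep * norm ?A" .
 have "q \<bullet> y = s + ?z" using y unfolding q_def pperp_def by (simp add: inner_add_left inner_diff_left)
 hence "\<bar>sin (q \<bullet> y)\<bar> = \<bar>sin s\<bar>" using abs_sin_add_pi_int by simp
 also have "... = \<bar>sin ep\<bar>" using s by (cases "s >= 0") auto
 finally show "\<bar>sin (q \<bullet> y)\<bar> >= ep / 2" using sin_ge_half[OF ep] by linarith
qed

lemma piecewise_cont_measurable:
 assumes "piecewise_cont g"
 shows "g \<in> mbl"
proof -
 obtain \<S> where \<S>: "finite \<S>" "\<Union>\<S> = UNIV" "\<And>S. S \<in> \<S> ==> S \<in> sets borel \<and> continuous_on S g"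
  using assms unfolding piecewise_cont_def by blast
 show ?thesis
  by (rule measurable_piecewise_restrict[of \<S>]) (use \<S> in \<open>auto intro: borel_measurable_continuous_on_restrict countable_finite\<close>)
qed

text \<open>The whole argument on the Fourier side, for abstract amplitudes that satisfy the Born
  bound. With S = ka^(2s) the three errors are S^(d+be)/(ka ep), ep^2 and S^(-m); the value of
  \<open>ap\<close> makes all of them ka^(-2 ap).\<close>

lemma reconstruction:
 fixes v W1 W2 :: "'a::euclidean_space => complex"
 assumes n: "n = DIM('a) + m" and m: "m > 0" and sob: "sobolev_W1 n v" and v: "bcs rh v"
  and Wm [measurable]: "W1 \<in> mbl" "W2 \<in> mbl"
  and W: "\<And>p. W1 p = iexp (p \<bullet> T1) * of_real (Om p)" "\<And>p. W2 p = iexp (p \<bullet> T2) * of_real (Om p)"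
  and Om: "c1 > 0" "\<And>p. c1 * (1 + norm p) powr (- be) <= Om p" "\<And>p. Om p <= \<Omega>" and be: "be > 0"
  and y: "T2 - T1 \<noteq> 0" and ta: "0 < ta" "ta <= 1"
  and gam [measurable]: "ga \<in> mbl" and ga: "\<And>p. norm (ga p) = 1" "\<And>p. ga p \<bullet> p = 0" and C: "C >= 0"
 defines "ap \<equiv> real m / (2 * (real n + be + real m / 2))"
 shows "\<exists>ka1\<ge>1. \<exists>A>0. \<forall>ka\<ge>ka1. \<forall>F F1 F2. good_amp C ka (fourier v) F \<and> good_amp C ka (%p. fourier v p + W1 p) F1 \<and> good_amp C ka (%p. fourier v p + W2 p) F2 \<longrightarrow>
  (AE x in lborel. norm (u_rec W1 W2 F F1 F2 ga (T2 - T1) (2 * ta * (ka^2) powr (ap / real m)) ((ka^2) powr (- ap / 2)) (ka^2) x - v x) <= A * (ka^2) powr (- ap))"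
proof -
 let ?y = "T2 - T1" and ?d = "real DIM('a)"
 define X where "X = fourier v"
 have vm [measurable]: "v \<in> mbl" using v by (rule bcs_measurable)
 have vs: "\<And>x. norm x > rh ==> v x = 0" using v by (simp add: bcs_def)
 have [measurable]: "X \<in> mbl" unfolding X_def fourier_eq_FT[abs_def] by measurable
 obtain Cd where Cd: "Cd >= 0" "\<And>p. (1 + norm p) ^ n * norm (X p) <= Cd"
  "\<And>p q. norm (q - p) <= 1 ==> (1 + norm p) ^ n * norm (X q - X p) <= Cd * norm (q - p)"
  unfolding X_def using fourier_decay[OF sob vs] by blast
 have pos: "(1 + norm p) ^ n > 0" "(1 + norm p) ^ n >= 1" for p :: 'a by (auto intro!: zero_less_power add_pos_nonneg one_le_power)
 let ?A = "%p n. 1 / (1 + norm p) ^ n"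
 have Xd: "norm (X p) <= Cd * ?A p n" for p using Cd(2)[of p] pos(1)[of p] by (simp add: field_simps)
 have Xb: "norm (X p) <= Cd" for p using Cd(2)[of p] mult_right_mono[OF pos(2)[of p], of "norm (X p)"] by simp
 have dec: "integrable lborel (%p::'a. 1 / (1 + norm p) ^ n)" unfolding n by (rule integrable_power_decay(1)[OF m])
 have Xi: "integrable lborel X"
  by (rule norm_integral_le_AE(1)[OF _ integrable_mult_right[OF dec, of Cd]]) (use Xd in auto)
 obtain Cz where Cz: "\<And>ep. 0 < ep ==> ep <= 1 ==> (LBINT p. indicator (Zset ?y ep) p * ?A p n) <= Cz * ep"
  unfolding n using strip_decay[OF y m] by blast
 define Vt where "Vt = measure lborel (cball (0::'a) 1) * (?d / real m)"
 have Vt: "(LBINT p. indicator (- cball (0::'a) r) p * ?A p n) <= Vt / r ^ m" if "r > 0" for r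
  unfolding n Vt_def by (rule integrable_power_decay(2)[OF m that])
 \<comment> \<open>The displacement of p per unit change of p.y; boundary points of a strip lie
   within 2 ep h of p.\<close>
 define h where "h = norm ((1 / (?y \<bullet> ?y)) *\<^sub>R ?y)"
 have h0: "h >= 0" by (simp add: h_def)
 define s where "s = ap / real m"
 have den: "2 * (real n + be + real m / 2) > 0" using m be by (intro mult_pos_pos add_pos_pos add_nonneg_pos) auto
 have "s * (real n + be + real m / 2) = 1/2" using m den by (simp add: s_def ap_def)
 moreover have aps1: "ap = real m * s" using m by (simp add: s_def)
 \<comment> \<open>The balance equations: the second is equivalent to 2s(d + be) - 1 + ap = -2 ap,
   because n = d + m and ap = m s.\<close>
 ultimately have aps: "ap = real m * s" "s * (real n + be) + ap / 2 = 1/2" by (auto simp: algebra_simps)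
 have ap: "ap > 0" "s > 0" using m den unfolding s_def ap_def by auto
 have s2: "2 * s < 1"
 proof -
  have "s * 1 <= s * real n" using ap n m by (intro mult_left_mono) auto
  moreover have "s * be > 0" using ap be by simp
  ultimately show ?thesis using aps(2) ap unfolding distrib_left by linarith
 qed
 define K1 where "K1 = 16 * (Cd + \<Omega> + 1) * C / c1"
 have \<Omega>0: "\<Omega> >= 0" using Om(1) Om(2)[of 0] Om(3)[of 0] by simp
 have K1: "K1 >= 0" unfolding K1_def using Cd(1) C Om(1) \<Omega>0 by (intro divide_nonneg_nonneg mult_nonneg_nonneg add_nonneg_nonneg) auto
 define A1 where "A1 = K1 * (3 + 2 * h) powr be * (unit_ball_vol ?d * 2 ^ DIM('a))"
 define A where "A = 2 * A1 + \<bar>Cd * (2 * h) * Cz\<bar> + Cd * Vt / (2 * ta) ^ m + 1"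
 have Vt0: "Vt >= 0" by (simp add: Vt_def)
 have A1: "A1 >= 0" unfolding A1_def using K1 by (intro mult_nonneg_nonneg) auto
 have A: "A > 0" unfolding A_def using A1 Cd(1) Vt0 ta by (intro add_nonneg_pos add_nonneg_nonneg divide_nonneg_nonneg mult_nonneg_nonneg) auto
 let ?C = "- ap"
 have "((%ka. ka powr ?C) \<longlongrightarrow> 0) at_top" by (rule tendsto_neg_powr) (use ap in \<open>auto intro: filterlim_ident\<close>)
 hence ev1: "eventually (%ka. ka powr ?C < 1 / (2 * h + 1)) at_top" using h0 by (intro order_tendstoD) auto
 have "((%ka. ka powr (2 * s - 1)) \<longlongrightarrow> 0) at_top" by (rule tendsto_neg_powr) (use s2 in \<open>auto intro: filterlim_ident\<close>)
 hence ev2: "eventually (%ka. ka powr (2 * s - 1) < 1 / (2 + 2 * h)) at_top" using h0 by (intro order_tendstoD) auto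
 \<comment> \<open>What large energy has to provide: dl = C/ka at most 1, shifts across a strip of
   length at most 1 so that the Lipschitz decay applies, and the ball of radius r + 2h inside the
   ball of radius 2 ka, where the on-shell momenta exist. The last is possible since 2s < 1.\<close>
 obtain ka1 where ka1: "ka1 >= 1" "ka1 >= C" "\<And>ka. ka >= ka1 ==> ka powr ?C < 1 / (2 * h + 1)" "\<And>ka. ka >= ka1 ==> ka powr (2 * s - 1) < 1 / (2 + 2 * h)"
 proof -
  obtain a b where "\<And>ka. ka >= a ==> ka powr ?C < 1 / (2 * h + 1)" "\<And>ka. ka >= b ==> ka powr (2 * s - 1) < 1 / (2 + 2 * h)"
   using ev1 ev2 unfolding eventually_at_top_linorder by blast
  thus ?thesis by (intro that[of "max (max 1 C) (max a b)"]) auto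
 qed
 let ?B = "- 2 * ap"
 let ?D = "%r Z. cball 0 r \<inter> Z"
 let ?F = "%ex x. LBINT p. ex x p * X p"
 have main: "AE x in lborel. norm (u_rec W1 W2 F F1 F2 ga ?y (2 * ta * (ka^2) powr (ap / real m)) ((ka^2) powr (- ap / 2)) (ka^2) x - v x) <= A * (ka^2) powr ?C"
  if ka: "ka >= ka1" and F: "good_amp C ka X F" "good_amp C ka (%p. X p + W1 p) F1" "good_amp C ka (%p. X p + W2 p) F2" for ka F F1 F2
 proof -
  have ka0: "ka >= 1" "ka > 0" "C / ka <= 1" using ka ka1 by auto
  have Ep: "(ka^2) powr e = ka powr (2 * e)" for e
  proof -
   have "ka^2 = ka powr 2" using ka0 by simp
   thus ?thesis by (simp only: powr_powr)
  qed
  define S ep r where "S = ka powr (2 * s)" and "ep = ka powr ?C" and "r = 2 * ta * S"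
  have S: "S >= 1" using ka0 ap by (simp add: S_def ge_one_powr_ge_zero)
  have ep: "0 < ep" "ep * (2 * h + 1) < 1" using ka0 ka1(3)[OF ka] h0 by (auto simp: ep_def pos_less_divide_eq add_nonneg_pos)
  have "0 <= ep * h" "2 * (ep * h) + ep < 1" using ep h0 by (simp_all add: algebra_simps)
  hence ep1: "ep <= 1" "2 * ep * h <= 1" using ep(1) by linarith+
  have r: "0 < r" "r <= 2 * S" using ta S by (auto simp: r_def)
  have "S / ka = ka powr (2 * s - 1)" using ka0 by (simp add: S_def powr_diff)
  hence "S / ka < 1 / (2 + 2 * h)" using ka1(4)[OF ka] by simp
  hence Sk: "S * (2 + 2 * h) <= ka" using ka0 h0 by (simp add: pos_divide_less_eq) (simp add: field_simps)
  \<comment> \<open>Bounds 1 + |q| on the ball enlarged by 2h, which contains the boundary points of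
    the strips that meet the ball of radius r.\<close>
  define L where "L = (3 + 2 * h) * S"
  have big: "1 + norm q <= L \<and> norm q <= 2 * ka" if "norm q <= r + 2 * h" for q :: 'a
  proof -
   have "h <= h * S" using S h0 mult_left_mono[of 1 S h] by simp
   thus ?thesis using that r S Sk h0 unfolding L_def by (simp add: algebra_simps)
  qed
  define U where "U = U_rec W1 W2 F F1 F2 ga (ka^2)"
  \<comment> \<open>The error of \<open>U_rec_error\<close> made uniform on the enlarged ball, with
    |sin| at least ep/2 and the lower bound of Om at radius L.\<close>
  define b where "b = K1 * L powr be / (ka * ep)"
  have Ub: "norm (U q - X q) <= b" if q: "norm q <= r + 2 * h" "\<bar>sin (q \<bullet> ?y)\<bar> >= ep / 2" for q
  proof -
   note k = kE_lE[of ga q ka, OF ga conjunct2[OF big[OF q(1)]]]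
   have om: "Om q > 0" using Om(1) Om(2)[of q] by (smt (verit) mult_pos_pos norm_ge_zero powr_gt_zero)
   have amp: "norm (amp_at F' ga (ka^2) q - \<Phi> q) <= C / ka" if "good_amp C ka \<Phi> F'" for F' \<Phi>
    using that k unfolding good_amp_def amp_at_def by metis
   have Lp: "L > 0" using big[OF q(1)] norm_ge_zero[of q] by linarith
   have sn: "sin (q \<bullet> ?y) \<noteq> 0" using q(2) ep by auto
   have "norm (U q - X q) <= 8 * (Cd + \<Omega> + 1) * (C / ka) / (Om q * \<bar>sin (q \<bullet> ?y)\<bar>)"
    unfolding U_def using amp[OF F(1)] amp[OF F(2)] amp[OF F(3)] W om Om(3) Xb ka0(3) sn by (intro U_rec_error) auto
   also have "... <= 8 * (Cd + \<Omega> + 1) * (C / ka) / (c1 * L powr (- be) * (ep / 2))"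
   proof (intro divide_left_mono mult_mono)
    have "L powr (- be) <= (1 + norm q) powr (- be)" using big[OF q(1)] be by (intro powr_mono2') (auto intro: add_pos_nonneg)
    thus "c1 * L powr (- be) <= Om q" using Om(1) Om(2)[of q] by (meson mult_left_mono less_imp_le order_trans)
    show "0 <= 8 * (Cd + \<Omega> + 1) * (C / ka)" using Cd(1) \<Omega>0 C ka0 by simp
    show "0 < Om q * \<bar>sin (q \<bullet> ?y)\<bar> * (c1 * L powr (- be) * (ep / 2))" using om sn Om(1) ep Lp by (intro mult_pos_pos) auto
   qed (use q(2) om ep Om(1) in auto)
   also have "... = b" using Om(1) ka0 ep by (simp add: b_def K1_def powr_minus field_simps)
   finally show ?thesis .
  qed
  define Z where "Z = Zset ?y ep"
  have [measurable]: "Z \<in> sets borel" "cball (0::'a) r \<in> sets borel" by (simp_all add: Z_def)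
  define av where "av p = (U (pminus ?y ep p) + U (pplus ?y ep p)) / 2" for p
  have d1: "norm (U p - X p) <= b" if "p \<in> cball 0 r - Z" for p
   using that h0 sin_off_strip[of p ?y ep] ep ep1 by (intro Ub) (auto simp: Z_def)
  \<comment> \<open>At both boundary points the inversion error is at most b; the rest is the
    variation of the transform over a distance of at most 2 ep h, with its decay kept so that the
    strip measure can be used.\<close>
  have d2: "norm (av p - X p) <= b + Cd * (2 * h) * ep * ?A p n" if "p \<in> cball 0 r \<inter> Z" for p
  proof -
   define t0 where "t0 = b + Cd * (2 * h) * ep * ?A p n"
   have pZ: "p \<in> Zset ?y ep" using that by (simp add: Z_def)
   have half: "norm (U q - X p) <= t0"
    if q: "norm (q - p) <= 2 * ep * h" "\<bar>sin (q \<bullet> ?y)\<bar> >= ep / 2" for q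
   proof -
    have "2 * ep * h <= 2 * h" using ep1 h0 by (simp add: mult_left_le_one_le ep less_imp_le)
    hence "norm q <= r + 2 * h" using q \<open>p \<in> cball 0 r \<inter> Z\<close> norm_triangle_ineq[of p "q - p"] by simp
    from Ub[OF this q(2)] have 1: "norm (U q - X q) <= b" .
    have "(1 + norm p) ^ n * norm (X q - X p) <= Cd * norm (q - p)" using q(1) ep1 by (intro Cd(3)) auto
    also have "... <= Cd * (2 * ep * h)" using q(1) Cd(1) by (rule mult_left_mono)
    finally have "norm (X q - X p) <= Cd * (2 * h) * ep * ?A p n" using pos(1)[of p] by (simp add: field_simps)
    thus ?thesis using 1 norm_triangle_ineq[of "U q - X q" "X q - X p"] by (simp add: t0_def)
   qed
   have m: "norm (U (pminus ?y ep p) - X p) <= t0"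
    using strip_boundary[OF y ep(1) ep1(1) pZ, of "- ep"] ep unfolding h_def[symmetric] by (intro half) (auto simp: pminus_def)
   have p: "norm (U (pplus ?y ep p) - X p) <= t0"
    using strip_boundary[OF y ep(1) ep1(1) pZ, of ep] ep unfolding h_def[symmetric] by (intro half) (auto simp: pplus_def)
   have av: "av p - X p = ((U (pminus ?y ep p) - X p) + (U (pplus ?y ep p) - X p)) / 2" by (simp add: av_def field_simps)
   have "norm (av p - X p) <= (norm (U (pminus ?y ep p) - X p) + norm (U (pplus ?y ep p) - X p)) / 2"
    unfolding av norm_divide norm_numeral by (intro divide_right_mono norm_triangle_ineq) simp
   also have "... <= (t0 + t0) / 2"
    by (intro divide_right_mono add_mono m p) simp
   finally have "norm (av p - X p) <= t0" by simp
   thus ?thesis unfolding t0_def .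
  qed
  \<comment> \<open>The amplitude times the indicator of the shell is Borel and agrees with the
    amplitude at every momentum pair used for |p| at most r + 2h.\<close>
  define cut where "cut F' k l = indicator (sphere 0 ka \<times> sphere 0 ka) (k, l) *\<^sub>R F' k l" for F' :: "'a => 'a => complex" and k l
  have kEm [measurable]: "kE ga (ka^2) \<in> mbl" "lE ga (ka^2) \<in> mbl"
   unfolding kE_def[abs_def] lE_def[abs_def] by measurable
  have cutm: "(%p. amp_at (cut F') ga (ka^2) p) \<in> mbl" if "good_amp C ka \<Phi> F'" for F' \<Phi>
  proof -
   have "(%p. (kE ga (ka^2) p, lE ga (ka^2) p)) \<in> mbl" by measurable
   from measurable_compose[OF this conjunct2[OF that[unfolded good_amp_def]]]
   show ?thesis by (simp add: amp_at_def cut_def)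
  qed
  note [measurable] = cutm[OF F(1)] cutm[OF F(2)] cutm[OF F(3)]
  define U' where "U' = U_rec W1 W2 (cut F) (cut F1) (cut F2) ga (ka^2)"
  have [measurable]: "U' \<in> mbl" unfolding U'_def U_rec_def[abs_def] Let_def Complex_eq by measurable
  have UU: "U' q = U q" if "norm q <= r + 2 * h" for q
   using kE_lE[of ga q ka, OF ga conjunct2[OF big[OF that]]] by (simp add: U_def U'_def U_rec_def amp_at_def cut_def)
  \<comment> \<open>The boundary point in measurable form, with floor in place of
    \<open>zint\<close>; the two agree inside the strips.\<close>
  define pm where "pm t p = pperp ?y p + ((pi * of_int \<lfloor>(p \<bullet> ?y) / pi + 1/2\<rfloor> + t) / (?y \<bullet> ?y)) *\<^sub>R ?y" for t p
  have [measurable]: "pm t \<in> mbl" for t unfolding pm_def[abs_def] pperp_def by measurable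
  define av' where "av' p = (U' (pm (- ep) p) + U' (pm ep p)) / 2" for p
  have [measurable]: "av' \<in> mbl" unfolding av'_def[abs_def] by measurable
  have avav: "av' p = av p" if "p \<in> cball 0 r \<inter> Z" for p
  proof -
   have pZ: "p \<in> Zset ?y ep" using that by (simp add: Z_def)
   have e: "pm (- ep) p = pminus ?y ep p" "pm ep p = pplus ?y ep p" unfolding pm_def pminus_def pplus_def zint_eq(1)[OF ep(1) ep1(1) pZ] by simp_all
   have q: "norm q <= r + 2 * h" if "norm (q - p) <= 2 * ep * h" for q
   proof -
    have "2 * ep * h <= 2 * h" using ep1 h0 by (simp add: mult_left_le_one_le ep less_imp_le)
    thus ?thesis using that \<open>p \<in> cball 0 r \<inter> Z\<close> norm_triangle_ineq[of p "q - p"] by simp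
   qed
   have "norm (pminus ?y ep p) <= r + 2 * h" "norm (pplus ?y ep p) <= r + 2 * h"
    using strip_boundary(1)[OF y ep(1) ep1(1) pZ, of "- ep"] strip_boundary(1)[OF y ep(1) ep1(1) pZ, of ep] ep
    unfolding h_def[symmetric] by (auto intro!: q simp: pminus_def pplus_def)
   thus ?thesis unfolding av'_def av_def e by (simp add: UU)
  qed
  define ex where "ex x p = exp (- \<i> * of_real (p \<bullet> x))" for x p :: 'a
  have nex: "norm (ex x p) = 1" for x p by (simp add: ex_def)
  have exm [measurable]: "ex x \<in> mbl" for x unfolding ex_def[abs_def] by measurable
  have fm: "(%p. indicator Y p *\<^sub>R (ex x p * g p)) \<in> mbl" if "Y \<in> sets borel" "g \<in> mbl" for Y g x
   using that exm by (intro borel_measurable_scaleR borel_measurable_indicator borel_measurable_times)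
  define vol where "vol = measure lborel (cball (0::'a) r)"
  have bi: "integrable lborel (%p::'a. b * indicator (cball 0 r) p)" by (intro integrable_mult_right integrable_indicator_ball)
  have bI: "(LBINT p. b * indicator (cball (0::'a) r) p) = b * vol" by (simp add: vol_def)
  have L0: "L >= 1" using big[of 0] r h0 by simp
  have b0: "b >= 0" unfolding b_def using K1 ka0 ep by (intro divide_nonneg_nonneg mult_nonneg_nonneg) auto
  have zi: "integrable lborel (%p. Cd * (2 * h) * ep * (indicator Z p * ?A p n))"
   by (intro integrable_mult_right, rule integrable_bound[OF dec]) (auto simp: indicator_def)
  have ti: "integrable lborel (%p::'a. Cd * (indicator (- cball 0 r) p * ?A p n))"
   by (intro integrable_mult_right, rule integrable_bound[OF dec]) (auto simp: indicator_def)
  \<comment> \<open>Three pieces: the ball off the strips, the strips, and the tail of the inverse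
    transform. One factor ep in the second term is the variation across a strip, the other the
    measure of the strips.\<close>
  have bound: "norm (u_rec W1 W2 F F1 F2 ga ?y r ep (ka^2) x - ?F ex x) <= 2 * (b * vol) + \<bar>Cd * (2 * h) * Cz\<bar> * (ep * ep) + Cd * (Vt / r ^ m)" for x
  proof -
   define f1 f2 f3 where "f1 p = indicator (cball 0 r - Z) p *\<^sub>R (ex x p * (U' p - X p))"
    and "f2 p = indicator (?D r Z) p *\<^sub>R (ex x p * (av' p - X p))" and "f3 p = indicator (- cball 0 r) p *\<^sub>R (ex x p * X p)" for p
   have [measurable]: "f1 \<in> mbl" "f2 \<in> mbl" "f3 \<in> mbl"
    unfolding f1_def[abs_def] f2_def[abs_def] f3_def[abs_def] by (intro fm sets.Diff sets.Int borel_comp borel_measurable_diff; measurable)+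
   have n1: "AE p in lborel. norm (f1 p) <= b * indicator (cball 0 r) p"
   proof (rule AE_I2)
    fix p show "norm (f1 p) <= b * indicator (cball 0 r) p"
     using d1[of p] UU[of p] h0 b0 by (cases "p \<in> cball 0 r - Z") (auto simp: f1_def norm_mult nex)
   qed
   have n2: "AE p in lborel. norm (f2 p) <= b * indicator (cball 0 r) p + Cd * (2 * h) * ep * (indicator Z p * ?A p n)"
   proof (rule AE_I2)
    fix p show "norm (f2 p) <= b * indicator (cball 0 r) p + Cd * (2 * h) * ep * (indicator Z p * ?A p n)"
    proof (cases "p \<in> cball 0 r \<inter> Z")
     case True
     thus ?thesis using d2[OF True] avav[OF True] by (auto simp: f2_def norm_mult nex)
    next
     case False
     hence "f2 p = 0" by (simp add: f2_def)
     thus ?thesis using b0 Cd(1) h0 ep by (auto intro!: add_nonneg_nonneg mult_nonneg_nonneg divide_nonneg_nonneg)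
    qed
   qed
   have n3: "AE p in lborel. norm (f3 p) <= Cd * (indicator (- cball 0 r) p * ?A p n)"
    using Xd by (auto simp: f3_def norm_mult nex indicator_def)
   have i1: "integrable lborel f1" by (rule norm_integral_le_AE(1)[OF _ bi n1]) simp
   have i2: "integrable lborel f2" by (rule norm_integral_le_AE(1)[OF _ integrable_add[OF bi zi] n2]) simp
   have exX: "integrable lborel (%p. indicator Y p *\<^sub>R (ex x p * X p))" if [measurable]: "Y \<in> sets borel" for Y
    by (rule integrable_bound[OF Xi]) (auto simp: norm_mult nex indicator_def)
   have "u_rec W1 W2 F F1 F2 ga ?y r ep (ka^2) x = (LBINT p. f1 p + indicator (cball 0 r - Z) p *\<^sub>R (ex x p * X p)) + (LBINT p. f2 p + indicator (?D r Z) p *\<^sub>R (ex x p * X p))"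
    unfolding u_rec_def set_lebesgue_integral_def Z_def[symmetric] U_def[symmetric] ex_def[symmetric] av_def[symmetric]
    using UU h0 avav by (intro arg_cong2[where f="(+)"] integral_cong refl) (auto simp: f1_def f2_def indicator_def algebra_simps)
   also have "... = (LBINT p. f1 p) + (LBINT p. indicator (cball 0 r - Z) p *\<^sub>R (ex x p * X p)) + ((LBINT p. f2 p) + (LBINT p. indicator (?D r Z) p *\<^sub>R (ex x p * X p)))"
    by (simp only: integral_add[OF i1 exX] integral_add[OF i2 exX] sets.Diff sets.Int borel_closed[OF closed_cball] \<open>Z \<in> sets borel\<close>)
   finally have e1: "u_rec W1 W2 F F1 F2 ga ?y r ep (ka^2) x = ..." .
   have e2: "?F ex x = (LBINT p. indicator (cball 0 r - Z) p *\<^sub>R (ex x p * X p)) + (LBINT p. indicator (?D r Z) p *\<^sub>R (ex x p * X p)) + (LBINT p. f3 p)"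
   proof -
    have "?F ex x = (LBINT p. (indicator (cball 0 r - Z) p *\<^sub>R (ex x p * X p) + indicator (?D r Z) p *\<^sub>R (ex x p * X p)) + f3 p)"
     by (intro integral_cong refl) (auto simp: f3_def indicator_def)
    thus ?thesis unfolding f3_def by (simp add: exX)
   qed
   have "norm (u_rec W1 W2 F F1 F2 ga ?y r ep (ka^2) x - ?F ex x) <= norm (LBINT p. f1 p) + norm (LBINT p. f2 p) + norm (LBINT p. f3 p)"
    unfolding e1 e2 using norm_triangle_ineq4[of "(LBINT p. f1 p) + (LBINT p. f2 p)" "LBINT p. f3 p"] norm_triangle_ineq[of "LBINT p. f1 p" "LBINT p. f2 p"]
    by (simp add: algebra_simps)
   moreover have "norm (LBINT p. f1 p) <= b * vol" using norm_integral_le_AE(2)[OF _ bi n1] unfolding bI by simp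
   moreover have "norm (LBINT p. f2 p) <= b * vol + \<bar>Cd * (2 * h) * Cz\<bar> * (ep * ep)"
   proof -
    have "norm (LBINT p. f2 p) <= (LBINT p. b * indicator (cball 0 r) p + Cd * (2 * h) * ep * (indicator Z p * ?A p n))"
     by (rule norm_integral_le_AE(2)[OF _ integrable_add[OF bi zi] n2]) simp
    also have "... = b * vol + Cd * (2 * h) * ep * (LBINT p. indicator Z p * ?A p n)"
     unfolding integral_add[OF bi zi] bI unfolding integral_mult_right_zero ..
    also have "... <= b * vol + Cd * (2 * h) * ep * (Cz * ep)"
     unfolding Z_def using Cz[OF ep(1) ep1(1)] Cd(1) h0 ep by (intro add_left_mono mult_left_mono) auto
    also have "Cd * (2 * h) * ep * (Cz * ep) = Cd * (2 * h) * Cz * (ep * ep)" by simp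
    also have "... <= \<bar>Cd * (2 * h) * Cz\<bar> * (ep * ep)" by (intro mult_right_mono) auto
    finally show ?thesis by simp
   qed
   moreover have "norm (LBINT p. f3 p) <= Cd * (Vt / r ^ m)"
   proof -
    have "norm (LBINT p. f3 p) <= (LBINT p. Cd * (indicator (- cball (0::'a) r) p * ?A p n))" by (rule norm_integral_le_AE(2)[OF _ ti n3]) simp
    also have "... <= Cd * (Vt / r ^ m)" unfolding integral_mult_right_zero by (rule mult_left_mono[OF Vt[OF r(1)] Cd(1)])
    finally show ?thesis .
   qed
   ultimately show ?thesis by linarith
  qed
  have small: "2 * (b * vol) + \<bar>Cd * (2 * h) * Cz\<bar> * (ep * ep) + Cd * (Vt / r ^ m) <= A * ka powr ?B"
  proof -
   have Sn: "S ^ k = ka powr (2 * s * real k)" for k using ka0 by (simp add: S_def powr_power mult.commute)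
   have "vol = unit_ball_vol ?d * r ^ DIM('a)" using r by (simp add: vol_def content_cball)
   also have "... <= unit_ball_vol ?d * (2 * S) ^ DIM('a)" using r by (intro mult_left_mono power_mono) auto
   finally have "b * vol <= b * (unit_ball_vol ?d * (2 * S) ^ DIM('a))" using b0 by (rule mult_left_mono)
   also have "... = A1 * (S powr be * S ^ DIM('a) / (ka * ep))"
    using S h0 by (simp add: b_def A1_def L_def powr_mult power_mult_distrib)
   also have "S powr be * S ^ DIM('a) / (ka * ep) = ka powr (2 * s * be + 2 * s * ?d - 1 + ap)"
    unfolding Sn using ka0 by (simp add: S_def ep_def powr_powr powr_add powr_diff powr_minus field_simps)
   \<comment> \<open>Here the choice of \<open>ap\<close> enters: the growth of the inversion error
     over the ball is brought to the order of the other two terms.\<close>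
   also have "2 * s * be + 2 * s * ?d - 1 + ap = - 2 * ap" using aps n by (simp add: algebra_simps)
   finally have 1: "b * vol <= A1 * ka powr ?B" .
   have 2: "ep * ep = ka powr ?B" unfolding ep_def powr_add[symmetric] by simp
   have "Vt / r ^ m = Vt / (2 * ta) ^ m * (1 / S ^ m)" by (simp add: r_def power_mult_distrib)
   also have "1 / S ^ m = ka powr ?B" unfolding Sn aps(1) by (simp add: powr_minus_divide mult_ac)
   finally have 3: "Cd * (Vt / r ^ m) = Cd * Vt / (2 * ta) ^ m * ka powr ?B" by simp
   show ?thesis using 1 powr_ge_zero[of ka "- 2 * ap"] unfolding 2 3 A_def distrib_right by linarith
  qed
  have inv: "AE x in lborel. v x = ?F ex x"
   using fourier_inversion[OF v] Xi unfolding X_def ex_def by blast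
  have par: "2 * ta * (ka^2) powr (ap / real m) = r" "(ka^2) powr (- ap / 2) = ep" "(ka^2) powr ?C = ka powr ?B"
   unfolding Ep r_def S_def s_def ep_def by simp_all
  from inv show ?thesis unfolding par
  proof eventually_elim
   case (elim x)
   thus ?case using order_trans[OF bound[of x] small] by simp
  qed
 qed
 show ?thesis using ka1(1) A main unfolding X_def by blast
qed

section \<open>Invariance under changes on null sets, and translations\<close>

lemma test_fun_measurable:
 assumes "test_fun ph" "set bs \<subseteq> Basis"
 shows "pdiffs bs ph \<in> mbl"
proof -
 have "Ck (length bs) ph" using assms(1) by (simp add: test_fun_def)
 thus ?thesis using assms(2) by (intro borel_measurable_continuous_onI) (simp add: Ck_def)
qed

lemma sobolev_W1_cong_AE:
 fixes u u' :: "'a::euclidean_space => complex"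
 assumes m [measurable]: "u \<in> mbl" "u' \<in> mbl" and ae: "AE x in lborel. u x = u' x" and S: "sobolev_W1 n u"
 shows "sobolev_W1 n u'"
proof -
 have i: "integrable lborel u'" using S m by (subst integrable_cong_AE[OF _ _ ae, symmetric]) (auto simp: sobolev_W1_def)
 have eq: "(LBINT x. u x * of_real (pdiffs bs ph x)) = (LBINT x. u' x * of_real (pdiffs bs ph x))" if "test_fun ph" "set bs \<subseteq> Basis" for ph bs
 proof -
  note [measurable] = test_fun_measurable[OF that]
  show ?thesis by (rule integral_cong_AE) (use ae in auto)
 qed
 show ?thesis unfolding sobolev_W1_def
 proof (intro conjI i allI impI)
  fix bs :: "'a list" assume bs: "set bs \<subseteq> Basis \<and> length bs <= n"
  then obtain g where "integrable lborel g" "\<And>ph. test_fun ph ==> (LBINT x. g x * of_real (ph x)) = (-1) ^ length bs * (LBINT x. u x * of_real (pdiffs bs ph x))"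
   using S unfolding sobolev_W1_def by blast
  thus "\<exists>g. integrable lborel g \<and> (\<forall>ph. test_fun ph \<longrightarrow> (LBINT x. g x * of_real (ph x)) = (-1) ^ length bs * (LBINT x. u' x * of_real (pdiffs bs ph x)))"
   using eq bs by (intro exI[of _ g]) auto
 qed
qed

text \<open>The potential enters only through integrals against continuous fields and test
  functions, so the same fields witness the amplitude of any representative.\<close>

lemma is_scat_amp_cong_AE:
 fixes V V' :: "'a::euclidean_space => complex"
 assumes [measurable]: "V \<in> mbl" "V' \<in> mbl" and ae: "AE x in lborel. V x = V' x" and S: "is_scat_amp V E F"
 shows "is_scat_amp V' E F"
proof -
 let ?A = "%ps ph. LBINT x. ps x * (of_real (- laplacian ph x) + (V' x - of_real E) * of_real (ph x))"
 have "weak_schroedinger_sol V' E ps" if w: "weak_schroedinger_sol V E ps" and c: "continuous_on UNIV ps" for ps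
  unfolding weak_schroedinger_sol_def
 proof (intro allI impI)
  fix ph :: "'a => real" assume t: "test_fun ph"
  have [measurable]: "ps \<in> mbl" using c by (rule borel_measurable_continuous_onI)
  have [measurable]: "ph \<in> mbl" using test_fun_measurable[OF t, of "[]"] by simp
  have [measurable]: "laplacian ph \<in> mbl" unfolding laplacian_def[abs_def]
   by (intro borel_measurable_sum test_fun_measurable t) auto
  have "?A ps ph = (LBINT x. ps x * (of_real (- laplacian ph x) + (V x - of_real E) * of_real (ph x)))"
   by (rule integral_cong_AE) (use ae in auto)
  thus "?A ps ph = 0"
   using w t unfolding weak_schroedinger_sol_def by simp
 qed
 note * = this
 have L: "\<forall>k. Q k \<longrightarrow> (\<exists>ps. a ps \<and> b' ps \<and> c k ps)" if "\<forall>k. Q k \<longrightarrow> (\<exists>ps. a ps \<and> b ps \<and> c k ps)" "\<And>ps. b ps ==> a ps ==> b' ps"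
  for Q :: "'a => bool" and a b b' :: "('a => complex) => bool" and c using that by blast
 show ?thesis unfolding is_scat_amp_def by (rule L[OF S[unfolded is_scat_amp_def] *])
qed

lemma fourier_translate:
 fixes u :: "'a::euclidean_space => complex"
 shows "fourier (%x. u (x - T)) p = iexp (p \<bullet> T) * fourier u p"
proof -
 let ?A = "p \<bullet> T"
 have "(LBINT x. iexp (p \<bullet> x) * u (x - T)) = (LBINT x. iexp ?A * (iexp (p \<bullet> (x - T)) * u (x - T)))"
  by (intro integral_cong refl) (simp add: inner_diff_right mult_exp_exp right_diff_distrib flip: mult.assoc)
 also have "... = (LBINT x. iexp ?A * (iexp (p \<bullet> x) * u x))"
  by (rule integral_lborel_translate[of "%x. iexp ?A * (iexp (p \<bullet> x) * u x)" T])
 finally show ?thesis by (simp add: fourier_def)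
qed

lemma bcsI: "f \<in> mbl ==> (\<And>x. norm (f x) <= B) ==> (\<And>x. norm x > rh ==> f x = 0) ==> bcs rh f"
 unfolding bcs_def by blast

lemma support_in_ball:
 assumes "closure {x. u x \<noteq> 0} \<subseteq> S" "bounded S"
 shows "\<exists>R. \<forall>x. norm x > R \<longrightarrow> u x = (0::complex)"
proof -
 obtain R where "\<And>x. x \<in> S ==> norm x <= R" using assms(2) unfolding bounded_iff by blast
 thus ?thesis using assms(1) closure_subset[of "{x. u x \<noteq> 0}"] by (intro exI[of _ R]) (meson CollectI not_less subsetD)
qed

theorem theorem2:
  fixes v :: "'a::euclidean_space \<Rightarrow> complex"
    and D \<Omega>1 \<Omega>2 :: "'a set"
    and n :: nat
    and \<nu> r \<tau> :: real
    and q :: "'a \<Rightarrow> real"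
    and T1 T2 :: 'a
    and \<gamma> :: "'a \<Rightarrow> 'a"
  defines "w \<equiv> (\<lambda>x. complex_of_real (w_fun \<nu> q x))"
  defines "w1 \<equiv> (\<lambda>x. w (x - T1))"
    and "w2 \<equiv> (\<lambda>x. w (x - T2))"
  defines "y \<equiv> T2 - T1"
    and "\<beta> \<equiv> real DIM('a) + 2 * \<nu>"
  defines "\<alpha>2 \<equiv> (real n - real DIM('a)) / (2 * (real n + \<beta> + (real n - real DIM('a)) / 2))"
  defines "r2 \<equiv> (\<lambda>E::real. 2 * \<tau> * E powr (\<alpha>2 / (real n - real DIM('a))))"
    and "\<epsilon>2 \<equiv> (\<lambda>E::real. E powr (- \<alpha>2 / 2))"
  assumes dim: "DIM('a) \<ge> 2"
    and D: "open D" "bounded D" "connected D"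
    and v_Linf: "Linf v"
    and v_supp: "closure {x. v x \<noteq> 0} \<subseteq> D"
    and n: "n > DIM('a)"
    and v_sob: "sobolev_W1 n v"
    and nu: "\<nu> > 0"
    and r: "r > 0"
    and q_meas: "q \<in> borel_measurable lborel"
    and q_bdd: "\<exists>C. AE x in lborel. \<bar>q x\<bar> \<le> C"
    and q_nz: "\<not> (AE x in lborel. q x = 0)"
    and q_supp: "\<forall>x. norm x > r \<longrightarrow> q x = 0"
    and q_even: "\<forall>x. q x = q (- x)"
    and w_hat: "\<exists>c1>0. \<forall>p. fourier w p \<in> \<real> \<and> Re (fourier w p) \<ge> c1 * (1 + norm p) powr (- \<beta>)"
    and y: "y \<noteq> 0"
    and \<Omega>1: "open \<Omega>1" "bounded \<Omega>1" "connected \<Omega>1"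
    and \<Omega>2: "open \<Omega>2" "bounded \<Omega>2" "connected \<Omega>2"
    and w1_supp: "closure {x. w1 x \<noteq> 0} \<subseteq> \<Omega>1"
    and w2_supp: "closure {x. w2 x \<noteq> 0} \<subseteq> \<Omega>2"
    and disj: "\<Omega>1 \<inter> D = {}" "\<Omega>2 \<inter> D = {}"
    and tau: "0 < \<tau>" "\<tau> \<le> 1"
    and gamma: "piecewise_cont \<gamma>" "\<forall>p. norm (\<gamma> p) = 1 \<and> \<gamma> p \<bullet> p = 0"
  shows "\<exists>\<rho>2 \<ge> 1. \<exists>A2 > 0. \<forall>E. sqrt E \<ge> \<rho>2 \<longrightarrow>
           (\<forall>f f1 f2. is_scat_amp v E f \<and> is_scat_amp (\<lambda>x. v x + w1 x) E f1
                      \<and> is_scat_amp (\<lambda>x. v x + w2 x) E f2 \<longrightarrow>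
              (AE x in lborel. x \<in> D \<longrightarrow>
                 cmod (u_rec (fourier w1) (fourier w2) f f1 f2 \<gamma> y (r2 E) (\<epsilon>2 E) E x - v x)
                   \<le> A2 * E powr (- \<alpha>2)))"
proof -
 define m where "m = n - DIM('a)"
 have m: "n = DIM('a) + m" "m > 0" and mr: "real n - real DIM('a) = real m" using n by (auto simp: m_def)
 obtain Cv where vm [measurable]: "v \<in> mbl" and Cv: "AE x in lborel. norm (v x) <= Cv" using v_Linf unfolding Linf_def by auto
 \<comment> \<open>A representative bounded everywhere, as the estimates for a single potential are
   pointwise. Setting it to 0 on the exceptional set also preserves its support.\<close>
 define v0 where "v0 x = (if norm (v x) <= Cv then v x else 0)" for x
 have [measurable]: "v0 \<in> mbl" unfolding v0_def[abs_def] by measurable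
 have v0: "AE x in lborel. v x = v0 x" using Cv by eventually_elim (simp add: v0_def)
 have v0b: "norm (v0 x) <= \<bar>Cv\<bar>" for x using abs_ge_self[of Cv] by (auto simp: v0_def simp del: abs_ge_self)
 obtain Rv where Rv: "\<And>x. norm x > Rv ==> v x = 0" using support_in_ball[OF v_supp D(2)] by blast
 obtain R1 where R1: "\<And>x. norm x > R1 ==> w1 x = 0" using support_in_ball[OF w1_supp \<Omega>1(2)] by blast
 obtain R2 where R2: "\<And>x. norm x > R2 ==> w2 x = 0" using support_in_ball[OF w2_supp \<Omega>2(2)] by blast
 obtain Cq where "AE x in lborel. \<bar>q x\<bar> <= Cq" using q_bdd by blast
 note wb = w_fun_bounded[OF nu q_meas[simplified] this q_supp]
 obtain B where B: "\<And>x. \<bar>w_fun \<nu> q x\<bar> <= B" using wb(2) by blast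
 have [measurable]: "w \<in> mbl" unfolding w_def using wb(1) by measurable
 have [measurable]: "w1 \<in> mbl" "w2 \<in> mbl" unfolding w1_def w2_def by measurable
 have wB: "norm (w x) <= B" "norm (w1 x) <= B" "norm (w2 x) <= B" for x unfolding w1_def w2_def w_def using B by simp_all
 \<comment> \<open>One radius for all three potentials; the entry 0 ensures that it is
   nonnegative.\<close>
 define \<rho> where "\<rho> = Max {0, Rv, R1, R2}"
 have \<rho>: "\<rho> >= 0" "Rv <= \<rho>" "R1 <= \<rho>" "R2 <= \<rho>" by (auto simp: \<rho>_def)
 have bcs: "bcs \<rho> v0" "bcs \<rho> w1" "bcs \<rho> w2"
  using Rv R1 R2 \<rho> by (auto intro!: bcsI[OF _ v0b] bcsI[OF _ wB(2)] bcsI[OF _ wB(3)]) (auto simp: v0_def)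
 \<comment> \<open>The bound |Cv| + B covers v0 and both sums v0 + w1 and v0 + w2, so a single C
   results.\<close>
 obtain C \<kappa>0 where C: "C >= 0" and amp: "\<And>(V :: 'a => complex) F \<kappa>. V \<in> mbl ==> (\<And>x. norm (V x) <= \<bar>Cv\<bar> + B) ==> (\<And>x. norm x > \<rho> ==> V x = 0) ==>
   \<kappa> >= \<kappa>0 ==> is_scat_amp V (\<kappa>^2) F ==> good_amp C \<kappa> (fourier V) F"
  using scat_amp_uniform[OF dim \<rho>(1), of "\<bar>Cv\<bar> + B"] by blast
 define \<omega> where "\<omega> p = Re (fourier w p)" for p
 obtain c1 where c1: "c1 > 0" "\<And>p. fourier w p \<in> \<real>" "\<And>p. c1 * (1 + norm p) powr (- \<beta>) <= \<omega> p" using w_hat unfolding \<omega>_def by blast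
 have W: "fourier w1 p = iexp (p \<bullet> T1) * of_real (\<omega> p)" "fourier w2 p = iexp (p \<bullet> T2) * of_real (\<omega> p)" for p
  using c1(2)[of p] unfolding w1_def w2_def fourier_translate \<omega>_def by (auto elim: Reals_cases)
 have \<Omega>: "\<omega> p <= (LBINT x. norm (w1 x))" for p
 proof -
  have "\<omega> p <= norm (fourier w1 p)" unfolding W by (simp add: norm_mult)
  also have "... <= norm (FT w1 p)" by (rule norm_fourier_le)
  also have "... <= (LBINT x. norm (iexp (p \<bullet> x) * w1 x))" unfolding FT_def by (rule integral_norm_bound)
  finally show ?thesis by (simp add: norm_mult)
 qed
 have [measurable]: "fourier u \<in> mbl" if [measurable]: "u \<in> mbl" for u :: "'a => complex"
  unfolding fourier_eq_FT[abs_def] by measurable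
 have \<beta>: "\<beta> > 0" using nu by (simp add: \<beta>_def)
 have \<alpha>: "\<alpha>2 = real m / (2 * (real n + \<beta> + real m / 2))" by (simp only: \<alpha>2_def mr)
 have \<gamma>: "\<gamma> \<in> mbl" by (rule piecewise_cont_measurable[OF gamma(1)])
 have y': "T2 - T1 \<noteq> 0" using y by (simp add: y_def)
 have sob: "sobolev_W1 n v0" by (rule sobolev_W1_cong_AE[OF _ _ v0 v_sob]) measurable
 obtain \<kappa>1 A where \<kappa>1: "\<kappa>1 >= 1" "A > 0" and main: "\<And>\<kappa> F F1 F2. \<kappa> >= \<kappa>1 ==> good_amp C \<kappa> (fourier v0) F ==> good_amp C \<kappa> (%p. fourier v0 p + fourier w1 p) F1 ==>
   good_amp C \<kappa> (%p. fourier v0 p + fourier w2 p) F2 ==>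
   (AE x in lborel. norm (u_rec (fourier w1) (fourier w2) F F1 F2 \<gamma> (T2 - T1) (2 * \<tau> * (\<kappa>^2) powr (\<alpha>2 / real m)) ((\<kappa>^2) powr (- \<alpha>2 / 2)) (\<kappa>^2) x - v0 x) <= A * (\<kappa>^2) powr (- \<alpha>2))"
  using reconstruction[OF m sob bcs(1) _ _ W c1(1,3) \<Omega> \<beta> y' tau \<gamma> conjunct1[OF gamma(2)[rule_format]] conjunct2[OF gamma(2)[rule_format]] C] unfolding \<alpha>[symmetric] by auto
 have sum: "fourier (%x. v0 x + u x) = (%p. fourier v0 p + fourier u p)" if u: "bcs \<rho> u" for u
 proof
  fix p :: 'a
  have "integrable lborel (%x. iexp (p \<bullet> x) * h x)" if "bcs \<rho> h" for h
   using bcs_integrable[OF bcs_mult[OF that, of "%x. iexp (p \<bullet> x)" 1]] by (simp add: mult.commute)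
  thus "fourier (%x. v0 x + u x) p = fourier v0 p + fourier u p"
   using bcs(1) u by (simp add: fourier_def distrib_left)
 qed
 have final: "AE x in lborel. x \<in> D \<longrightarrow> cmod (u_rec (fourier w1) (fourier w2) f f1 f2 \<gamma> y (r2 E) (\<epsilon>2 E) E x - v x) <= A * E powr (- \<alpha>2)"
  if E: "sqrt E >= max \<kappa>0 \<kappa>1" and f: "is_scat_amp v E f" "is_scat_amp (%x. v x + w1 x) E f1" "is_scat_amp (%x. v x + w2 x) E f2" for E f f1 f2
 proof -
  define \<kappa> where "\<kappa> = sqrt E"
  \<comment> \<open>As \<kappa>1 is at least 1, so is sqrt E; this excludes negative energies and
    makes the square of \<kappa> equal to E.\<close>
  have \<kappa>: "\<kappa> >= \<kappa>0" "\<kappa> >= \<kappa>1" "\<kappa>^2 = E"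
   using E \<kappa>1(1) order_trans[of 1 \<kappa>1 "sqrt E"] real_sqrt_ge_1_iff[of E] by (auto simp: \<kappa>_def)
  have B0: "B >= 0" using wB(1)[of 0] norm_ge_zero order_trans by blast
  have a0: "is_scat_amp v0 (\<kappa>^2) f" unfolding \<kappa>(3) by (rule is_scat_amp_cong_AE[OF _ _ v0 f(1)]) measurable
  have a1: "is_scat_amp (%x. v0 x + w1 x) (\<kappa>^2) f1" unfolding \<kappa>(3) by (rule is_scat_amp_cong_AE[OF _ _ _ f(2)]) (use v0 in auto)
  have a2: "is_scat_amp (%x. v0 x + w2 x) (\<kappa>^2) f2" unfolding \<kappa>(3) by (rule is_scat_amp_cong_AE[OF _ _ _ f(3)]) (use v0 in auto)
  have g0: "good_amp C \<kappa> (fourier v0) f"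
   by (rule amp[OF _ _ _ \<kappa>(1) a0]) (use v0b B0 bcs in \<open>auto simp: bcs_def intro: order_trans[OF v0b]\<close>)
  have g1: "good_amp C \<kappa> (%p. fourier v0 p + fourier w1 p) f1" unfolding sum[OF bcs(2), symmetric]
   by (rule amp[OF _ _ _ \<kappa>(1) a1]) (use bcs in \<open>auto simp: bcs_def intro!: order_trans[OF norm_triangle_ineq add_mono[OF v0b wB(2)]]\<close>)
  have g2: "good_amp C \<kappa> (%p. fourier v0 p + fourier w2 p) f2" unfolding sum[OF bcs(3), symmetric]
   by (rule amp[OF _ _ _ \<kappa>(1) a2]) (use bcs in \<open>auto simp: bcs_def intro!: order_trans[OF norm_triangle_ineq add_mono[OF v0b wB(3)]]\<close>)
  from main[OF \<kappa>(2) g0 g1 g2] v0 show ?thesis unfolding \<kappa>(3)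
   by eventually_elim (simp add: r2_def \<epsilon>2_def y_def mr)
 qed
 show ?thesis using \<kappa>1 final by (intro exI[of _ "max \<kappa>0 \<kappa>1"] exI[of _ A] conjI) auto
qed

end
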